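(* Let $\lambda$ be a partition with at most $n$ parts. (a) Let $m$ be a positive integer such that for each $T\in\mathsf{KN}(\lambda,n)$ the $m$-dilatation map gives $\theta_m(T)=K(\sigma_1\lambda)\otimes\cdots\otimes K(\sigma_m\lambda)$ for some $\sigma_1\ge\cdots\ge\sigma_m$ in $B_n^\lambda$. Then, for every $T\in\mathsf{KN}(\lambda,n)$, with $\sigma_1\ge\cdots\ge\sigma_m$ the elements of $B_n^\lambda$ such that $\theta_m(T)=K(\sigma_1\lambda)\otimes\cdots\otimes K(\sigma_m\lambda)$, $$\theta_m(E(T))=E(\theta_m(T))=E(K(\sigma_1\lambda))\otimes\cdots\otimes E(K(\sigma_m\lambda))=K(\tilde\sigma_1\lambda^A)\otimes\cdots\otimes K(\tilde\sigma_m\lambda^A),$$ where $E(K(\sigma_i\lambda))=K(\tilde\sigma_i\lambda^A)\in O_{B_n^A}(\lambda^A)$ for $1\le i\le m$. (b) $E(K^+(T))=K^+(E(T))$ and $E(K^-(T))=K^-(E(T))$ for all $T\in\mathsf{KN}(\lambda,n)$.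
   Context: **Type $C_n$.** The alphabet is $[\pm n]=\{1<\dots<n<\overline n<\dots<\overline1\}$, $\overline i=-i$. A column (strictly increasing from top to bottom) $C$ is admissible if, with $I=\{z_1>\dots>z_r\}$ the set of unbarred $z$ with $z,\overline z\in C$, there are $t_1>\dots>t_r$ in $[n]$ such that $t_1$ is the greatest letter of $[n]$ with $t_1<z_1$, $t_1,\overline{t_1}\notin C$, and for $i\ge2$, $t_i$ is the greatest with $t_i<\min(t_{i-1},z_i)$, $t_i,\overline{t_i}\notin C$; then $rC$ (resp. $\ell C$) is obtained by replacing each $\overline{z_i}$ by $\overline{t_i}$ (resp. each $z_i$ by $t_i$) and reordering. $\mathsf{KN}(\lambda,n)$ is the set of semistandard tableaux of shape $\lambda$ on $[\pm n]$ with admissible columns $C_1,\dots,C_k$ such that the tableau with columns $\ell C_1,rC_1,\dots,\ell C_k,rC_k$ is semistandard. The weight is the vector whose $i$-th entry is (number of $i$'s) minus (number of $\overline i$'s). Crystal operators $f_i$, $i\in[n]$: read columns right to left, each top to bottom; mark letters $i,\overline{i+1}$ by $+$ and $i+1,\overline i$ by $-$ (for $i=n$: $n$ by $+$, $\overline n$ by $-$), successively cancel pairs $+-$ to leave $-^a+^b$; $\varepsilon_i=a$, $\varphi_i=b$; $f_i$ changes the letter of the leftmost remaining $+$ ($i\mapsto i+1$, $\overline{i+1}\mapsto\overline i$; $n\mapsto\overline n$ when $i=n$), and $f_i=0$ if $b=0$. $K(\lambda)$ (row $i$ filled with $i$) is the highest weight element and generates $\mathsf{KN}(\lambda,n)$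 under the $f_i$. **Type $A_{2n-1}$.** $\mathsf{SSYT}(\mu,2n)$ is the crystal of semistandard tableaux of shape $\mu$ on $[2n]$ with operators $f_i^A$, $1\le i\le 2n-1$, given by the same rule with $i\mapsto+$, $i+1\mapsto-$, and highest weight element $K(\mu)$. **Tensor products** (both types): $f_i(u\otimes v)=f_i(u)\otimes v$ if $\varphi_i(u)>\varepsilon_i(v)$, and $u\otimes f_i(v)$ otherwise. **Groups, keys.** $B_n=\langle s_1,\dots,s_n\rangle$ acts on $\mathbb Z^n$ ($s_i$, $i<n$, swaps coordinates $i,i+1$; $s_n$ changes the sign of the $n$-th). $\mathfrak S_{2n}=\langle s_1^A,\dots,s_{2n-1}^A\rangle$ acts on $\mathbb Z^{2n}$. $\tilde s_i=s_i^As_{2n-i}^A$ for $i<n$, $\tilde s_n=s_n^A$, and $B_n^A=\langle\tilde s_1,\dots,\tilde s_n\rangle\simeq B_n$; for $\sigma=s_{i_r}\cdots s_{i_1}\in B_n$ put $\tilde\sigma=\tilde s_{i_r}\cdots\tilde s_{i_1}$. $B_n^\lambda$ is the set of minimal length representatives of cosets of $B_n$ modulo the stabilizer of $\lambda$, with Bruhat order. A key tableau has columns nested as sets (each contained in the one to its left) and does not contain both $i$ and $\overline i$; for $u\in B_n\lambda$ (resp. $u\in\mathfrak S_{2n}\mu$) $K(u)$ is the unique key tableau in $\mathsf{KN}(\lambda,n)$ (resp. $\mathsf{SSYT}(\mu,2n)$) of weight $u$. $O_{B_n^A}(\lambda^A)=\{K(u):u\in B_n^A\lambda^A\}$. **Baker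 embedding.** For $\lambda=\Lambda_{m_1}+\cdots+\Lambda_{m_k}$ ($1\le m_1\le\dots\le m_k\le n$, $\Lambda_j=\mathbf e_1+\dots+\mathbf e_j$), put $\lambda^A=\sum_{i=1}^k(\Lambda^A_{m_i}+\Lambda^A_{2n-m_i})\in\mathbb Z^{2n}$, $\Lambda^A_j=\mathbf e_1+\dots+\mathbf e_j$. Let $f_i^E=f_i^Af_{2n-i}^A=f_{2n-i}^Af_i^A$ for $i<n$, $f_n^E=(f_n^A)^2$. $E:\mathsf{KN}(\lambda,n)\hookrightarrow\mathsf{SSYT}(\lambda^A,2n)$ is the injection with $E(f_{i_1}\cdots f_{i_l}K(\lambda))=f^E_{i_1}\cdots f^E_{i_l}K(\lambda^A)$. **Dilatation.** In either type, with $\mathfrak B(\mu)$ the crystal with highest weight element $K(\mu)$, $\theta_m:\mathfrak B(\mu)\hookrightarrow\mathfrak B(\mu)^{\otimes m}$ is the unique injection with $\theta_m(f_{i_1}\cdots f_{i_l}K(\mu))=f_{i_1}^m\cdots f_{i_l}^m(K(\mu)^{\otimes m})$. The component of $\mathsf{KN}(\lambda,n)^{\otimes m}$ generated by $K(\lambda)^{\otimes m}$ is identified with $\mathsf{KN}(m\lambda,n)$, that of $\mathsf{SSYT}(\lambda^A,2n)^{\otimes m}$ generated by $K(\lambda^A)^{\otimes m}$ with $\mathsf{SSYT}(m\lambda^A,2n)$, and $E$ on the former is the corresponding Baker embedding $E(f_{i_1}\cdots f_{i_l}K(\lambda)^{\otimes m})=f^E_{i_1}\cdots f^E_{i_l}(K(\lambda^A)^{\otimes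 m})$. **Right and left keys.** In either type, when $m$ has sufficiently many factors (e.g. the least common multiple of the maximal string lengths), $\theta_m(b)$ is, for each $b$, a tensor product of $m$ keys whose first and last factors do not depend on $m$; $K^+(b)$ (right key) is the first factor and $K^-(b)$ (left key) the last factor. *)

theory Defs
  imports Main
begin

section \<open>Weights, partitions and tableaux\<close>

text \<open>
  A vector of \<open>Z^N\<close> is a function \<open>nat \<Rightarrow> int\<close> that vanishes outside the coordinates \<open>1, \<dots>, N\<close>.
  A tableau is the list of its columns from left to right, and a column is the list of its letters
  from top to bottom. Letters are integers: \<open>1, \<dots>, N\<close> in type A, and in type C a barred letter
  is the negative of the unbarred one.
\<close>

type_synonym weight = "nat \<Rightarrow> int"
type_synonym column = "int list"
type_synonym tableau = "column list"

definition is_partition :: "nat \<Rightarrow> weight \<Rightarrow> bool" where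
  "is_partition N \<mu> \<longleftrightarrow>
     (\<forall>i. i \<notin> {1..N} \<longrightarrow> \<mu> i = 0) \<and> (\<forall>i. 0 \<le> \<mu> i) \<and>
     (\<forall>i j. 1 \<le> i \<and> i \<le> j \<and> j \<le> N \<longrightarrow> \<mu> j \<le> \<mu> i)"

definition col_heights :: "weight \<Rightarrow> nat list" where
  "col_heights \<mu> = map (\<lambda>c. card {i. int c \<le> \<mu> i}) [1..<Suc (nat (\<mu> 1))]"

definition semistandard :: "(int \<Rightarrow> int \<Rightarrow> bool) \<Rightarrow> tableau \<Rightarrow> bool" where
  "semistandard lt T \<longleftrightarrow>
     (\<forall>C \<in> set T. sorted_wrt lt C) \<and>
     (\<forall>j. Suc j < length T \<longrightarrow>
        length (T ! Suc j) \<le> length (T ! j) \<and>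
        (\<forall>i < length (T ! Suc j).
           lt (T ! j ! i) (T ! Suc j ! i) \<or> T ! j ! i = T ! Suc j ! i))"

definition highest :: "weight \<Rightarrow> tableau" where
  "highest \<mu> = map (\<lambda>h. map int [1..<Suc h]) (col_heights \<mu>)"

definition is_key :: "tableau \<Rightarrow> bool" where
  "is_key T \<longleftrightarrow>
     (\<forall>j. Suc j < length T \<longrightarrow> set (T ! Suc j) \<subseteq> set (T ! j)) \<and>
     (\<forall>x. \<not> (x \<in> set (concat T) \<and> - x \<in> set (concat T)))"


section \<open>Semistandard tableaux of type A\<close>

definition SSYT :: "nat \<Rightarrow> weight \<Rightarrow> tableau set" where
  "SSYT N \<mu> = {T. map length T = col_heights \<mu> \<and> set (concat T) \<subseteq> {1..int N} \<and>
                 semistandard (<) T}"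

definition wt_A :: "nat \<Rightarrow> tableau \<Rightarrow> weight" where
  "wt_A N T = (\<lambda>i. if i \<in> {1..N} then int (count_list (concat T) (int i)) else 0)"


section \<open>Kashiwara--Nakashima tableaux of type C\<close>

text \<open>The order \<open>1 < \<dots> < n < -n < \<dots> < -1\<close>; it does not depend on \<open>n\<close>.\<close>

definition letter_less :: "int \<Rightarrow> int \<Rightarrow> bool" where
  "letter_less x y \<longleftrightarrow> (0 < x \<and> y < 0) \<or> (0 < x \<and> x < y) \<or> (x < y \<and> y < 0)"

definition letters_C :: "nat \<Rightarrow> int set" where
  "letters_C n = {x. x \<noteq> 0 \<and> \<bar>x\<bar> \<le> int n}"

definition col_of_set :: "int set \<Rightarrow> column" where
  "col_of_set A = sorted_list_of_set (A \<inter> {0<..}) @ sorted_list_of_set (A \<inter> {..<0})"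

definition paired :: "column \<Rightarrow> int set" where
  "paired C = {z. 0 < z \<and> z \<in> set C \<and> - z \<in> set C}"

text \<open>The sequence \<open>z\<^sub>1 > \<dots> > z\<^sub>r\<close>, and the sequence \<open>t\<^sub>1 > \<dots> > t\<^sub>r\<close> that must exist for the column to be
  admissible (each \<open>t\<close> is below some \<open>z\<close>, so \<open>t \<le> n\<close> is automatic).\<close>

definition z_seq :: "column \<Rightarrow> int list" where
  "z_seq C = rev (sorted_list_of_set (paired C))"

definition is_t_seq :: "column \<Rightarrow> int list \<Rightarrow> bool" where
  "is_t_seq C ts \<longleftrightarrow> length ts = length (z_seq C) \<and>
     (\<forall>i < length ts.
        let S = {t. 1 \<le> t \<and> t < z_seq C ! i \<and> (0 < i \<longrightarrow> t < ts ! (i - 1)) \<and>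
                    t \<notin> set C \<and> - t \<notin> set C}
        in ts ! i \<in> S \<and> (\<forall>t \<in> S. t \<le> ts ! i))"

definition admissible :: "column \<Rightarrow> bool" where
  "admissible C \<longleftrightarrow> (\<exists>ts. is_t_seq C ts)"

definition t_seq :: "column \<Rightarrow> int list" where
  "t_seq C = (THE ts. is_t_seq C ts)"

definition r_col :: "column \<Rightarrow> column" where
  "r_col C = col_of_set ((set C - uminus ` paired C) \<union> uminus ` set (t_seq C))"

definition l_col :: "column \<Rightarrow> column" where
  "l_col C = col_of_set ((set C - paired C) \<union> set (t_seq C))"

definition KN :: "nat \<Rightarrow> weight \<Rightarrow> tableau set" where
  "KN n \<mu> = {T. map length T = col_heights \<mu> \<and> set (concat T) \<subseteq> letters_C n \<and>
               semistandard letter_less T \<and> (\<forall>C \<in> set T. admissible C) \<and>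
               semistandard letter_less (concat (map (\<lambda>C. [l_col C, r_col C]) T))}"

definition wt_C :: "nat \<Rightarrow> tableau \<Rightarrow> weight" where
  "wt_C n T = (\<lambda>i. if i \<in> {1..n}
                   then int (count_list (concat T) (int i)) - int (count_list (concat T) (- int i))
                   else 0)"


section \<open>The signature rule\<close>

datatype sign = Plus | Minus

text \<open>Cancellation of adjacent pairs \<open>+ -\<close>, scanning from left to right; every sign carries its
  position in the word, and the accumulator is kept in reverse order.\<close>

fun cancel_step :: "sign \<times> nat \<Rightarrow> (sign \<times> nat) list \<Rightarrow> (sign \<times> nat) list" where
  "cancel_step (Minus, q) ((Plus, p) # acc) = acc"
| "cancel_step x acc = x # acc"

definition reduced_signature :: "(int \<Rightarrow> sign option) \<Rightarrow> int list \<Rightarrow> (sign \<times> nat) list" where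
  "reduced_signature mark w =
     rev (fold cancel_step
           (concat (map (\<lambda>p. case mark (w ! p) of None \<Rightarrow> [] | Some s \<Rightarrow> [(s, p)]) [0..<length w]))
           [])"

definition word_eps :: "(int \<Rightarrow> sign option) \<Rightarrow> int list \<Rightarrow> nat" where
  "word_eps mark w = length (filter (\<lambda>(s, p). s = Minus) (reduced_signature mark w))"

definition word_phi :: "(int \<Rightarrow> sign option) \<Rightarrow> int list \<Rightarrow> nat" where
  "word_phi mark w = length (filter (\<lambda>(s, p). s = Plus) (reduced_signature mark w))"

text \<open>\<open>None\<close> plays the role of \<open>0\<close>.\<close>

definition word_f :: "(int \<Rightarrow> sign option) \<Rightarrow> (int \<Rightarrow> int) \<Rightarrow> int list \<Rightarrow> int list option" where
  "word_f mark act w =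
     (case filter (\<lambda>(s, p). s = Plus) (reduced_signature mark w) of
        [] \<Rightarrow> None
      | (s, p) # _ \<Rightarrow> Some (w[p := act (w ! p)]))"

definition reading :: "tableau \<Rightarrow> int list" where
  "reading T = concat (rev T)"

fun chop :: "nat list \<Rightarrow> 'a list \<Rightarrow> 'a list list" where
  "chop [] w = []"
| "chop (k # ks) w = take k w # chop ks (drop k w)"

definition unread :: "nat list \<Rightarrow> int list \<Rightarrow> tableau" where
  "unread hs w = rev (chop (rev hs) w)"

definition tab_f :: "(int \<Rightarrow> sign option) \<Rightarrow> (int \<Rightarrow> int) \<Rightarrow> tableau \<Rightarrow> tableau option" where
  "tab_f mark act T = map_option (unread (map length T)) (word_f mark act (reading T))"


section \<open>Crystals, tensor powers, and maps defined along lowering paths\<close>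

record 'b crystal =
  cr_index :: "nat set"
  cr_f :: "nat \<Rightarrow> 'b \<Rightarrow> 'b option"
  cr_eps :: "nat \<Rightarrow> 'b \<Rightarrow> nat"
  cr_phi :: "nat \<Rightarrow> 'b \<Rightarrow> nat"

definition mark_A :: "nat \<Rightarrow> int \<Rightarrow> sign option" where
  "mark_A i x = (if x = int i then Some Plus else if x = int i + 1 then Some Minus else None)"

definition crystal_A :: "nat \<Rightarrow> tableau crystal" where
  "crystal_A N = \<lparr>cr_index = {1..N - 1},
                  cr_f = (\<lambda>i. tab_f (mark_A i) (\<lambda>x. x + 1)),
                  cr_eps = (\<lambda>i T. word_eps (mark_A i) (reading T)),
                  cr_phi = (\<lambda>i T. word_phi (mark_A i) (reading T))\<rparr>"

definition mark_C :: "nat \<Rightarrow> nat \<Rightarrow> int \<Rightarrow> sign option" where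
  "mark_C n i x =
     (if i < n then
        if x = int i \<or> x = - (int i + 1) then Some Plus
        else if x = int i + 1 \<or> x = - int i then Some Minus
        else None
      else
        if x = int n then Some Plus else if x = - int n then Some Minus else None)"

text \<open>For \<open>i < n\<close>, both \<open>i\<close> to \<open>i + 1\<close> and \<open>-(i + 1)\<close> to \<open>-i\<close> are the map \<open>x\<close> to \<open>x + 1\<close>.\<close>

definition act_C :: "nat \<Rightarrow> nat \<Rightarrow> int \<Rightarrow> int" where
  "act_C n i x = (if i < n then x + 1 else - x)"

definition crystal_C :: "nat \<Rightarrow> tableau crystal" where
  "crystal_C n = \<lparr>cr_index = {1..n},
                  cr_f = (\<lambda>i. tab_f (mark_C n i) (act_C n i)),
                  cr_eps = (\<lambda>i T. word_eps (mark_C n i) (reading T)),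
                  cr_phi = (\<lambda>i T. word_phi (mark_C n i) (reading T))\<rparr>"

text \<open>A tensor \<open>b\<^sub>1 \<otimes> \<dots> \<otimes> b\<^sub>m\<close> is the list of its factors. The string lengths of a tensor product
  follow the usual rule belonging to the convention for \<open>f\<close>, namely
  \<open>\<epsilon>(u \<otimes> v) = \<epsilon>(u) + max 0 (\<epsilon>(v) - \<phi>(u))\<close> and \<open>\<phi>(u \<otimes> v) = \<phi>(v) + max 0 (\<phi>(u) - \<epsilon>(v))\<close>;
  the maxima are the truncated subtraction of \<open>nat\<close>.\<close>

fun tensor_eps :: "'b crystal \<Rightarrow> nat \<Rightarrow> 'b list \<Rightarrow> nat" where
  "tensor_eps B i [] = 0"
| "tensor_eps B i (u # v) = cr_eps B i u + (tensor_eps B i v - cr_phi B i u)"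

fun tensor_phi :: "'b crystal \<Rightarrow> nat \<Rightarrow> 'b list \<Rightarrow> nat" where
  "tensor_phi B i [] = 0"
| "tensor_phi B i (u # v) = tensor_phi B i v + (cr_phi B i u - tensor_eps B i v)"

fun tensor_f :: "'b crystal \<Rightarrow> nat \<Rightarrow> 'b list \<Rightarrow> 'b list option" where
  "tensor_f B i [] = None"
| "tensor_f B i (u # v) =
     (if cr_phi B i u > tensor_eps B i v then map_option (\<lambda>u'. u' # v) (cr_f B i u)
      else map_option (\<lambda>v'. u # v') (tensor_f B i v))"

definition tensor_crystal :: "'b crystal \<Rightarrow> 'b list crystal" where
  "tensor_crystal B = \<lparr>cr_index = cr_index B, cr_f = tensor_f B,
                       cr_eps = tensor_eps B, cr_phi = tensor_phi B\<rparr>"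

text \<open>\<open>f_path g [i\<^sub>1, \<dots>, i\<^sub>l] b = g\<^bsub>i\<^sub>1\<^esub> (\<dots> (g\<^bsub>i\<^sub>l\<^esub> b))\<close>.\<close>

fun f_path :: "(nat \<Rightarrow> 'b \<Rightarrow> 'b option) \<Rightarrow> nat list \<Rightarrow> 'b \<Rightarrow> 'b option" where
  "f_path g [] b = Some b"
| "f_path g (i # is) b = Option.bind (f_path g is b) (g i)"

text \<open>The value at \<open>b\<close> of the map sending \<open>g\<^bsub>i\<^sub>1\<^esub> \<dots> g\<^bsub>i\<^sub>l\<^esub> h\<close> to \<open>g'\<^bsub>i\<^sub>1\<^esub> \<dots> g'\<^bsub>i\<^sub>l\<^esub> h'\<close>. The embedding \<open>E\<close> and the
  dilatations are both prescribed in this way on the component generated by \<open>h\<close>.\<close>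

definition path_map ::
  "nat set \<Rightarrow> (nat \<Rightarrow> 'b \<Rightarrow> 'b option) \<Rightarrow> 'b \<Rightarrow> (nat \<Rightarrow> 'c \<Rightarrow> 'c option) \<Rightarrow> 'c \<Rightarrow> 'b \<Rightarrow> 'c" where
  "path_map I g h g' h' b =
     (THE c. \<exists>is. set is \<subseteq> I \<and> f_path g is h = Some b \<and> f_path g' is h' = Some c)"

definition dilatation :: "'b crystal \<Rightarrow> 'b \<Rightarrow> nat \<Rightarrow> 'b \<Rightarrow> 'b list" where
  "dilatation B h m =
     path_map (cr_index B) (cr_f B) h
       (\<lambda>i. f_path (cr_f (tensor_crystal B)) (replicate m i)) (replicate m h)"


section \<open>The Baker embedding\<close>

definition Lam :: "nat \<Rightarrow> weight" where
  "Lam j = (\<lambda>i. if i \<in> {1..j} then 1 else 0)"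

text \<open>The \<open>m\<^sub>1, \<dots>, m\<^sub>k\<close> with \<open>\<lambda> = \<Lambda>\<^bsub>m\<^sub>1\<^esub> + \<dots> + \<Lambda>\<^bsub>m\<^sub>k\<^esub>\<close> are the column heights of \<open>\<lambda>\<close>.\<close>

definition lift_A :: "nat \<Rightarrow> weight \<Rightarrow> weight" where
  "lift_A n \<mu> = (\<lambda>i. \<Sum>h \<leftarrow> col_heights \<mu>. Lam h i + Lam (2 * n - h) i)"

definition f_E :: "nat \<Rightarrow> (nat \<Rightarrow> 'b \<Rightarrow> 'b option) \<Rightarrow> nat \<Rightarrow> 'b \<Rightarrow> 'b option" where
  "f_E n fA i = (if i < n then f_path fA [i, 2 * n - i] else f_path fA [n, n])"

definition baker :: "nat \<Rightarrow> weight \<Rightarrow> tableau \<Rightarrow> tableau" where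
  "baker n \<mu> =
     path_map {1..n} (cr_f (crystal_C n)) (highest \<mu>)
       (f_E n (cr_f (crystal_A (2 * n)))) (highest (lift_A n \<mu>))"

definition baker_tensor :: "nat \<Rightarrow> weight \<Rightarrow> nat \<Rightarrow> tableau list \<Rightarrow> tableau list" where
  "baker_tensor n \<mu> m =
     path_map {1..n} (cr_f (tensor_crystal (crystal_C n))) (replicate m (highest \<mu>))
       (f_E n (cr_f (tensor_crystal (crystal_A (2 * n))))) (replicate m (highest (lift_A n \<mu>)))"

abbreviation theta_C :: "nat \<Rightarrow> weight \<Rightarrow> nat \<Rightarrow> tableau \<Rightarrow> tableau list" where
  "theta_C n \<mu> \<equiv> dilatation (crystal_C n) (highest \<mu>)"

abbreviation theta_A :: "nat \<Rightarrow> weight \<Rightarrow> nat \<Rightarrow> tableau \<Rightarrow> tableau list" where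
  "theta_A N \<mu> \<equiv> dilatation (crystal_A N) (highest \<mu>)"


section \<open>Weyl groups\<close>

text \<open>Group elements are the transformations of the weight lattice that they induce (the actions
  are faithful), so the product is composition. The group generated by \<open>s 1, \<dots>, s r\<close>:\<close>

definition word_prod :: "(nat \<Rightarrow> weight \<Rightarrow> weight) \<Rightarrow> nat list \<Rightarrow> weight \<Rightarrow> weight" where
  "word_prod s is = foldr (\<lambda>i g. s i \<circ> g) is id"

definition gen_group :: "(nat \<Rightarrow> weight \<Rightarrow> weight) \<Rightarrow> nat \<Rightarrow> (weight \<Rightarrow> weight) set" where
  "gen_group s r = {word_prod s is | is. set is \<subseteq> {1..r}}"

definition cox_length :: "(nat \<Rightarrow> weight \<Rightarrow> weight) \<Rightarrow> nat \<Rightarrow> (weight \<Rightarrow> weight) \<Rightarrow> nat" where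
  "cox_length s r \<sigma> =
     (LEAST k. \<exists>is. set is \<subseteq> {1..r} \<and> length is = k \<and> word_prod s is = \<sigma>)"

definition reflections :: "(nat \<Rightarrow> weight \<Rightarrow> weight) \<Rightarrow> nat \<Rightarrow> (weight \<Rightarrow> weight) set" where
  "reflections s r = {\<tau> \<circ> s j \<circ> inv \<tau> | \<tau> j. \<tau> \<in> gen_group s r \<and> j \<in> {1..r}}"

definition bruhat_le ::
  "(nat \<Rightarrow> weight \<Rightarrow> weight) \<Rightarrow> nat \<Rightarrow> (weight \<Rightarrow> weight) \<Rightarrow> (weight \<Rightarrow> weight) \<Rightarrow> bool" where
  "bruhat_le s r =
     (\<lambda>\<sigma> \<tau>. (\<exists>t \<in> reflections s r. \<tau> = t \<circ> \<sigma>) \<and> cox_length s r \<sigma> < cox_length s r \<tau>)\<^sup>*\<^sup>*"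

definition s_A :: "nat \<Rightarrow> weight \<Rightarrow> weight" where
  "s_A i v = v(i := v (Suc i), Suc i := v i)"

definition s_C :: "nat \<Rightarrow> nat \<Rightarrow> weight \<Rightarrow> weight" where
  "s_C n i v = (if i < n then v(i := v (Suc i), Suc i := v i) else v(n := - v n))"

definition s_tilde :: "nat \<Rightarrow> nat \<Rightarrow> weight \<Rightarrow> weight" where
  "s_tilde n i = (if i < n then s_A i \<circ> s_A (2 * n - i) else s_A n)"

definition weyl_A :: "nat \<Rightarrow> (weight \<Rightarrow> weight) set" where
  "weyl_A N = gen_group s_A (N - 1)"

definition weyl_C :: "nat \<Rightarrow> (weight \<Rightarrow> weight) set" where
  "weyl_C n = gen_group (s_C n) n"

definition weyl_CA :: "nat \<Rightarrow> (weight \<Rightarrow> weight) set" where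
  "weyl_CA n = gen_group (s_tilde n) n"

definition tilde :: "nat \<Rightarrow> (weight \<Rightarrow> weight) \<Rightarrow> weight \<Rightarrow> weight" where
  "tilde n \<sigma> = (THE \<tau>. \<exists>is. set is \<subseteq> {1..n} \<and> \<sigma> = word_prod (s_C n) is \<and>
                            \<tau> = word_prod (s_tilde n) is)"

definition min_reps :: "nat \<Rightarrow> weight \<Rightarrow> (weight \<Rightarrow> weight) set" where
  "min_reps n \<mu> =
     {\<sigma> \<in> weyl_C n. \<forall>\<tau> \<in> weyl_C n. \<tau> \<mu> = \<mu> \<longrightarrow>
        cox_length (s_C n) n \<sigma> \<le> cox_length (s_C n) n (\<sigma> \<circ> \<tau>)}"


section \<open>Keys\<close>

definition key_C :: "nat \<Rightarrow> weight \<Rightarrow> weight \<Rightarrow> tableau" where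
  "key_C n \<mu> u = (THE T. T \<in> KN n \<mu> \<and> is_key T \<and> wt_C n T = u)"

definition key_A :: "nat \<Rightarrow> weight \<Rightarrow> weight \<Rightarrow> tableau" where
  "key_A N \<mu> u = (THE T. T \<in> SSYT N \<mu> \<and> is_key T \<and> wt_A N T = u)"

definition keys_C :: "nat \<Rightarrow> weight \<Rightarrow> tableau set" where
  "keys_C n \<mu> = {key_C n \<mu> (\<sigma> \<mu>) | \<sigma>. \<sigma> \<in> weyl_C n}"

definition keys_A :: "nat \<Rightarrow> weight \<Rightarrow> tableau set" where
  "keys_A N \<mu> = {key_A N \<mu> (\<sigma> \<mu>) | \<sigma>. \<sigma> \<in> weyl_A N}"

definition orbit_CA :: "nat \<Rightarrow> weight \<Rightarrow> tableau set" where
  "orbit_CA n \<mu> = {key_A (2 * n) (lift_A n \<mu>) (\<tau> (lift_A n \<mu>)) | \<tau>. \<tau> \<in> weyl_CA n}"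

text \<open>\<open>\<theta>\<close> is a family of dilatations indexed by \<open>m\<close>. ``\<open>m\<close> has sufficiently many factors'' is read
  as: \<open>m\<close> is a positive multiple of some fixed \<open>M > 0\<close>.\<close>

definition right_key ::
  "tableau set \<Rightarrow> (nat \<Rightarrow> tableau \<Rightarrow> tableau list) \<Rightarrow> tableau \<Rightarrow> tableau" where
  "right_key keys \<theta> b =
     (THE k. \<exists>M > 0. \<forall>m > 0. M dvd m \<longrightarrow>
        length (\<theta> m b) = m \<and> set (\<theta> m b) \<subseteq> keys \<and> hd (\<theta> m b) = k)"

definition left_key ::
  "tableau set \<Rightarrow> (nat \<Rightarrow> tableau \<Rightarrow> tableau list) \<Rightarrow> tableau \<Rightarrow> tableau" where
  "left_key keys \<theta> b =
     (THE k. \<exists>M > 0. \<forall>m > 0. M dvd m \<longrightarrow>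
        length (\<theta> m b) = m \<and> set (\<theta> m b) \<subseteq> keys \<and> last (\<theta> m b) = k)"

definition right_key_C :: "nat \<Rightarrow> weight \<Rightarrow> tableau \<Rightarrow> tableau" where
  "right_key_C n \<mu> = right_key (keys_C n \<mu>) (theta_C n \<mu>)"

definition left_key_C :: "nat \<Rightarrow> weight \<Rightarrow> tableau \<Rightarrow> tableau" where
  "left_key_C n \<mu> = left_key (keys_C n \<mu>) (theta_C n \<mu>)"

definition right_key_A :: "nat \<Rightarrow> weight \<Rightarrow> tableau \<Rightarrow> tableau" where
  "right_key_A N \<mu> = right_key (keys_A N \<mu>) (theta_A N \<mu>)"

definition left_key_A :: "nat \<Rightarrow> weight \<Rightarrow> tableau \<Rightarrow> tableau" where
  "left_key_A N \<mu> = left_key (keys_A N \<mu>) (theta_A N \<mu>)"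

definition dilates_to :: "nat \<Rightarrow> weight \<Rightarrow> nat \<Rightarrow> tableau \<Rightarrow> (weight \<Rightarrow> weight) list \<Rightarrow> bool" where
  "dilates_to n \<mu> m T \<sigma>s \<longleftrightarrow>
     length \<sigma>s = m \<and> set \<sigma>s \<subseteq> min_reps n \<mu> \<and>
     sorted_wrt (\<lambda>\<sigma> \<tau>. bruhat_le (s_C n) n \<tau> \<sigma>) \<sigma>s \<and>
     theta_C n \<mu> m T = map (\<lambda>\<sigma>. key_C n \<mu> (\<sigma> \<mu>)) \<sigma>s"

end

theory Submission
  imports Defs
begin

text \<open>
  Letter by letter, type C words embed into type A words: a letter \<open>x\<close> goes to \<open>x\<close> followed by the column
  \<open>{1..2n} - {-x}\<close> (with \<open>-i\<close> read as \<open>2n + 1 - i\<close>), and dilatation repeats every letter. These maps are explicit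
  and intertwine the operators, but they land in a different realisation of the component that is wanted.
  Knuth moves are bijections commuting with the operators, and any two lattice words of equal content are joined by
  Knuth moves; hence components of type A words with the same highest weight are isomorphic. This makes the Baker
  embedding and all dilatations well defined and compatible, and gives \<open>\<theta> \<circ> E = E \<circ> \<theta>\<close> factor by factor.
  A key tableau is the only filling with strict columns of its shape whose weight is extremal, so the Baker embedding
  sends keys to keys. Every dilatation consists of keys once \<open>m\<close> is divisible enough, by induction along a lowering
  path: divisibility makes the operators exhaust complete strings of keys.
  That every Kashiwara--Nakashima tableau lies on such a path follows from closure under the raising operators,
  which can be read off from the two columns \<open>l_col\<close> and \<open>r_col\<close>.
\<close>

section \<open>Seminormal crystals and tensor products\<close>

text \<open>The embedding and the dilatations are given by definite descriptions over lowering
  paths, so nothing is known about them until any two paths to the same tableau are shown to have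
  the same image. Each map is therefore captured by a single-valued relation that contains the pair
  of starting elements and is preserved by parallel steps. An explicit letter substitution yields
  the right crystal in the wrong shape: the image of the highest weight tableau is a lattice word,
  but not the reading of the wanted tableau. The contents differ by full columns
  \<open>1, ..., 2n\<close>, whose string lengths are all zero; after padding both sides with such
  columns, equal content is enough. For type C no analogue of Knuth moves is introduced: words are
  compared after \<open>E_word\<close>, which is injective on words of equal length. What survives
  the passage to tensor products is alignment, the multiplication of all string lengths by a fixed
  factor for each index, because the tensor rule only compares string lengths. The crystals carry no
  raising operators; raising is expressed by finding a preimage under the lowering operator.\<close>

definition seminormal :: "'b crystal \<Rightarrow> bool" where
  "seminormal B \<longleftrightarrow> (\<forall>i\<in>cr_index B. \<forall>b.
     (cr_f B i b = None \<longleftrightarrow> cr_phi B i b = 0) \<and>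
     (\<forall>b'. cr_f B i b = Some b' \<longrightarrow>
        cr_eps B i b' = Suc (cr_eps B i b) \<and> cr_phi B i b = Suc (cr_phi B i b')))"

definition indep :: "'b crystal \<Rightarrow> nat \<Rightarrow> nat \<Rightarrow> bool" where
  "indep B i j \<longleftrightarrow> (\<forall>b b'. cr_f B i b = Some b' \<longrightarrow>
     cr_eps B j b' = cr_eps B j b \<and> cr_phi B j b' = cr_phi B j b)"

lemma seminormalD:
  assumes "seminormal B" "i \<in> cr_index B"
  shows "cr_f B i b = None \<longleftrightarrow> cr_phi B i b = 0"
    and "cr_f B i b = Some b' \<Longrightarrow> cr_eps B i b' = Suc (cr_eps B i b)"
    and "cr_f B i b = Some b' \<Longrightarrow> cr_phi B i b = Suc (cr_phi B i b')"
  using assms unfolding seminormal_def by blast+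

lemma indepD:
  assumes "indep B i j" "cr_f B i b = Some b'"
  shows "cr_eps B j b' = cr_eps B j b" "cr_phi B j b' = cr_phi B j b"
  using assms unfolding indep_def by blast+

lemma tensor_crystal_simps [simp]:
  "cr_index (tensor_crystal B) = cr_index B"
  "cr_f (tensor_crystal B) = tensor_f B"
  "cr_eps (tensor_crystal B) = tensor_eps B"
  "cr_phi (tensor_crystal B) = tensor_phi B"
  by (simp_all add: tensor_crystal_def)

text \<open>Associativity of the tensor rule for string lengths. The two equations go together
  because \<open>tensor_phi\<close> of a list refers to \<open>tensor_eps\<close> of its
  tail.\<close>

lemma tensor_eps_phi_append:
  "tensor_eps B i (u @ v) = tensor_eps B i u + (tensor_eps B i v - tensor_phi B i u) \<and>
   tensor_phi B i (u @ v) = tensor_phi B i v + (tensor_phi B i u - tensor_eps B i v)"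
  by (induction u) auto

lemmas tensor_eps_append = tensor_eps_phi_append[THEN conjunct1]
lemmas tensor_phi_append = tensor_eps_phi_append[THEN conjunct2]

lemma tensor_f_append:
  "tensor_f B i (u @ v) =
     (if tensor_phi B i u > tensor_eps B i v then map_option (\<lambda>u'. u' @ v) (tensor_f B i u)
      else map_option (\<lambda>v'. u @ v') (tensor_f B i v))"
proof (induction u)
  case Nil
  show ?case by (cases "tensor_f B i v") auto
next
  case (Cons a u)
  then show ?case
    by (auto simp: tensor_eps_append option.map_comp comp_def)
qed

lemma tensor_f_singleton: "tensor_f B i [x] = map_option (\<lambda>y. [y]) (cr_f B i x)"
  if "seminormal B" "i \<in> cr_index B"
  using seminormalD(1)[OF that, of x] by auto

lemma seminormal_tensor:
  assumes "seminormal B"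
  shows "seminormal (tensor_crystal B)"
proof -
  have "(tensor_f B i b = None \<longleftrightarrow> tensor_phi B i b = 0) \<and>
     (\<forall>b'. tensor_f B i b = Some b' \<longrightarrow>
        tensor_eps B i b' = Suc (tensor_eps B i b) \<and> tensor_phi B i b = Suc (tensor_phi B i b'))"
    if i: "i \<in> cr_index B" for i b
  proof (induction b)
    case (Cons a b)
    show ?case
    proof (cases "cr_phi B i a > tensor_eps B i b")
      case True
      then obtain a' where a': "cr_f B i a = Some a'"
        using seminormalD(1)[OF assms i, of a] by (cases "cr_f B i a") auto
      then show ?thesis
        using True seminormalD(2,3)[OF assms i a'] by auto
    next
      case False
      then show ?thesis using Cons by auto
    qed
  qed simp
  then show ?thesis by (simp add: seminormal_def)
qed

lemma indep_tensor:
  assumes "indep B i j"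
  shows "indep (tensor_crystal B) i j"
proof -
  have "tensor_eps B j b' = tensor_eps B j b \<and> tensor_phi B j b' = tensor_phi B j b"
    if "tensor_f B i b = Some b'" for b b'
    using that
  proof (induction b arbitrary: b')
    case (Cons a b)
    then show ?case
      by (auto split: if_splits) (metis indepD[OF assms])+
  qed simp
  then show ?thesis by (simp add: indep_def)
qed

definition commuting :: "'b crystal \<Rightarrow> nat \<Rightarrow> nat \<Rightarrow> bool" where
  "commuting B i j \<longleftrightarrow> (\<forall>b. Option.bind (cr_f B i b) (cr_f B j) = Option.bind (cr_f B j b) (cr_f B i))"

text \<open>The factor on which one operator acts is selected by string lengths that the other
  operator does not change, so both orders hit the same factors; when these coincide, commutation
  inside a single factor applies.\<close>

lemma commuting_tensor:
  assumes "indep B i j" "indep B j i" "commuting B i j"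
  shows "commuting (tensor_crystal B) i j"
proof -
  have ind: "indep (tensor_crystal B) i j" "indep (tensor_crystal B) j i"
    using assms indep_tensor by blast+
  have "Option.bind (tensor_f B i b) (tensor_f B j) = Option.bind (tensor_f B j b) (tensor_f B i)"
    for b
  proof (induction b)
    case (Cons a b)
    have c: "Option.bind (cr_f B i a) (cr_f B j) = Option.bind (cr_f B j a) (cr_f B i)"
      using assms(3) by (simp add: commuting_def)
    note d = indepD[OF ind(1), simplified] indepD[OF ind(2), simplified]
      indepD[OF assms(1)] indepD[OF assms(2)]
    show ?case
      using Cons c
      by (cases "cr_f B i a"; cases "cr_f B j a"; cases "tensor_f B i b"; cases "tensor_f B j b")
        (auto simp: d split: if_splits)
  qed simp
  then show ?thesis by (simp add: commuting_def)
qed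

section \<open>Lowering paths on tensor products\<close>

lemma f_path_append: "f_path g (is @ js) b = Option.bind (f_path g js b) (f_path g is)"
  by (induction "is") (auto simp: Option.bind_assoc split: option.splits)

lemma f_path_concat:
  "f_path (\<lambda>i. f_path g (J i)) is b = f_path g (concat (map J is)) b"
  by (induction "is" arbitrary: b) (auto simp: f_path_append fun_eq_iff)

lemma f_path_eps_phi:
  assumes "seminormal B" "set J \<subseteq> cr_index B"
    and "\<And>j j'. j \<in> set J \<Longrightarrow> j' \<in> set J \<Longrightarrow> j \<noteq> j' \<Longrightarrow> indep B j j'"
    and "f_path (cr_f B) J b = Some b'"
    and "j \<in> set J \<or> (j \<in> cr_index B \<and> (\<forall>j'\<in>set J. indep B j' j))"
  shows "cr_eps B j b' = cr_eps B j b + count_list J j \<and>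
         cr_phi B j b = cr_phi B j b' + count_list J j"
  using assms(2-)
proof (induction J arbitrary: b')
  case (Cons k J)
  obtain b1 where b1: "f_path (cr_f B) J b = Some b1" "cr_f B k b1 = Some b'"
    using Cons.prems(3) by (auto simp: bind_eq_Some_conv)
  have kI: "k \<in> cr_index B" using Cons.prems(1) by simp
  have IH: "cr_eps B j b1 = cr_eps B j b + count_list J j \<and>
         cr_phi B j b = cr_phi B j b1 + count_list J j"
  proof (rule Cons.IH)
    show "set J \<subseteq> cr_index B" using Cons.prems by simp
    show "j \<in> set J \<or> (j \<in> cr_index B \<and> (\<forall>j'\<in>set J. indep B j' j))"
      using Cons.prems(1,2,4) by (metis list.set_intros set_ConsD subsetD)
  qed (use Cons.prems b1 in auto)
  show ?case
  proof (cases "j = k")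
    case True
    then show ?thesis using IH seminormalD(2,3)[OF assms(1) kI b1(2)] by simp
  next
    case False
    then have "indep B k j" using Cons.prems by auto
    then show ?thesis using IH indepD[OF _ b1(2)] False by auto
  qed
qed auto

text \<open>Each step at \<open>j\<close> lowers \<open>tensor_phi\<close> of the left part by one,
  so a surplus of \<open>count_list J j\<close> keeps the entire path on the left. Steps on the
  right only increase its \<open>tensor_eps\<close>, so a path that starts on the right stays there.
  Distinct indices of \<open>J\<close> do not interfere because they are independent.\<close>

lemma f_path_tensor_append:
  assumes "seminormal B" "set J \<subseteq> cr_index B"
    and "\<And>j j'. j \<in> set J \<Longrightarrow> j' \<in> set J \<Longrightarrow> j \<noteq> j' \<Longrightarrow> indep B j j'"
  shows "(\<forall>j\<in>set J. tensor_phi B j u \<ge> tensor_eps B j v + count_list J j) \<Longrightarrow>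
      f_path (tensor_f B) J (u @ v) = map_option (\<lambda>u'. u' @ v) (f_path (tensor_f B) J u)"
    and "(\<forall>j\<in>set J. tensor_phi B j u \<le> tensor_eps B j v) \<Longrightarrow>
      f_path (tensor_f B) J (u @ v) = map_option (\<lambda>v'. u @ v') (f_path (tensor_f B) J v)"
proof -
  have sn: "seminormal (tensor_crystal B)" by (rule seminormal_tensor[OF assms(1)])
  have key: "tensor_eps B j b' = tensor_eps B j b + count_list K j \<and>
         tensor_phi B j b = tensor_phi B j b' + count_list K j"
    if "f_path (tensor_f B) K b = Some b'" "j \<in> set J" "set K \<subseteq> set J" for j K b b'
  proof -
    have "indep (tensor_crystal B) k k'" if "k \<in> set J" "k' \<in> set J" "k \<noteq> k'" for k k'
      using assms(3) that by (intro indep_tensor)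
    moreover have "j \<in> cr_index B" using that assms(2) by blast
    ultimately show ?thesis
      using f_path_eps_phi[OF sn, of K b b' j] that assms(2) by (auto simp: subset_iff)
  qed
  show "f_path (tensor_f B) J (u @ v) = map_option (\<lambda>u'. u' @ v) (f_path (tensor_f B) J u)"
    if h: "\<forall>j\<in>set J. tensor_phi B j u \<ge> tensor_eps B j v + count_list J j"
  proof -
    have "f_path (tensor_f B) K (u @ v) = map_option (\<lambda>u'. u' @ v) (f_path (tensor_f B) K u)"
      if "set K \<subseteq> set J" "\<forall>j\<in>set J. tensor_phi B j u \<ge> tensor_eps B j v + count_list K j" for K
      using that
    proof (induction K)
      case (Cons k K)
      then have IH: "f_path (tensor_f B) K (u @ v) = map_option (\<lambda>u'. u' @ v) (f_path (tensor_f B) K u)"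
        by (auto split: if_splits) (metis Suc_leD add_Suc_right)
      have k: "k \<in> set J" using Cons.prems by simp
      show ?case
      proof (cases "f_path (tensor_f B) K u")
        case (Some u')
        from Cons.prems(2) k have "tensor_phi B k u \<ge> tensor_eps B k v + Suc (count_list K k)"
          by fastforce
        with key[OF Some k] Cons.prems(1) have "tensor_phi B k u' > tensor_eps B k v" by auto
        then show ?thesis using IH Some by (simp add: tensor_f_append)
      qed (use IH in simp)
    qed simp
    from this[of J] h show ?thesis by simp
  qed
  show "f_path (tensor_f B) J (u @ v) = map_option (\<lambda>v'. u @ v') (f_path (tensor_f B) J v)"
    if h: "\<forall>j\<in>set J. tensor_phi B j u \<le> tensor_eps B j v"
  proof -
    have "f_path (tensor_f B) K (u @ v) = map_option (\<lambda>v'. u @ v') (f_path (tensor_f B) K v)"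
      if "set K \<subseteq> set J" for K
      using that
    proof (induction K)
      case (Cons k K)
      then have IH: "f_path (tensor_f B) K (u @ v) = map_option (\<lambda>v'. u @ v') (f_path (tensor_f B) K v)"
        by auto
      have k: "k \<in> set J" using Cons.prems by simp
      show ?case
      proof (cases "f_path (tensor_f B) K v")
        case (Some v')
        have "tensor_phi B k u \<le> tensor_eps B k v" using h k by blast
        also have "\<dots> \<le> tensor_eps B k v'" using key[OF Some k] Cons.prems(1) by simp
        finally have "\<not> tensor_phi B k u > tensor_eps B k v'" by simp
        then show ?thesis using IH Some by (simp add: tensor_f_append)
      qed (use IH in simp)
    qed simp
    from this[of J] show ?thesis by simp
  qed
qed

section \<open>Aligned maps\<close>

text \<open>One operator \<open>f_i\<close> is simulated by the path \<open>J i\<close>, in which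
  every index that occurs does so exactly \<open>c i\<close> times. The instances are
  \<open>replicate m i\<close> with factor \<open>m\<close> for dilatations, and
  \<open>[i, 2n - i]\<close> with factor 1 and \<open>[n, n]\<close> with factor 2 for the Baker
  embedding.\<close>

definition virtual_indices :: "'c crystal \<Rightarrow> (nat \<Rightarrow> nat list) \<Rightarrow> (nat \<Rightarrow> nat) \<Rightarrow> nat \<Rightarrow> bool" where
  "virtual_indices B' J c i \<longleftrightarrow> J i \<noteq> [] \<and> set (J i) \<subseteq> cr_index B' \<and>
     (\<forall>j\<in>set (J i). count_list (J i) j = c i) \<and>
     (\<forall>j\<in>set (J i). \<forall>j'\<in>set (J i). j \<noteq> j' \<longrightarrow> indep B' j j')"

text \<open>The alignment condition of virtual crystals: string lengths are scaled by
  \<open>c i\<close>, uniformly over the indices in \<open>J i\<close>. Values are lists, that is,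
  tensors over \<open>B'\<close>; \<open>D\<close> is a set stable under the operators on which the
  condition is known.\<close>

definition aligned ::
  "'b crystal \<Rightarrow> 'c crystal \<Rightarrow> (nat \<Rightarrow> nat list) \<Rightarrow> (nat \<Rightarrow> nat) \<Rightarrow> 'b set \<Rightarrow> ('b \<Rightarrow> 'c list) \<Rightarrow> bool"
  where
  "aligned B B' J c D \<psi> \<longleftrightarrow> (\<forall>i\<in>cr_index B. \<forall>b\<in>D.
     (\<forall>j\<in>set (J i). tensor_eps B' j (\<psi> b) = c i * cr_eps B i b \<and>
                    tensor_phi B' j (\<psi> b) = c i * cr_phi B i b) \<and>
     (\<forall>b'. cr_f B i b = Some b' \<longrightarrow>
        b' \<in> D \<and> f_path (tensor_f B') (J i) (\<psi> b) = Some (\<psi> b')))"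

lemma alignedD:
  assumes "aligned B B' J c D \<psi>" "i \<in> cr_index B" "b \<in> D"
  shows "j \<in> set (J i) \<Longrightarrow> tensor_eps B' j (\<psi> b) = c i * cr_eps B i b"
    and "j \<in> set (J i) \<Longrightarrow> tensor_phi B' j (\<psi> b) = c i * cr_phi B i b"
    and "cr_f B i b = Some b' \<Longrightarrow> b' \<in> D"
    and "cr_f B i b = Some b' \<Longrightarrow> f_path (tensor_f B') (J i) (\<psi> b) = Some (\<psi> b')"
  using assms unfolding aligned_def by blast+

text \<open>Scaling by \<open>c i\<close> preserves the comparison that selects the factor. A strict
  inequality even becomes a gap of at least \<open>c i\<close>, which is exactly what all of
  \<open>J i\<close> consumes, so the whole simulated step stays in the factor selected by the
  original one.\<close>

lemma aligned_tensor:
  assumes al: "aligned B B' J c D \<psi>" and sn: "seminormal B'"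
    and vi: "\<And>i. i \<in> cr_index B \<Longrightarrow> virtual_indices B' J c i"
  shows "aligned (tensor_crystal B) B' J c (lists D) (\<lambda>bs. concat (map \<psi> bs))"
proof -
  have "(\<forall>j\<in>set (J i). tensor_eps B' j (concat (map \<psi> bs)) = c i * tensor_eps B i bs \<and>
                    tensor_phi B' j (concat (map \<psi> bs)) = c i * tensor_phi B i bs) \<and>
     (\<forall>bs'. tensor_f B i bs = Some bs' \<longrightarrow>
        bs' \<in> lists D \<and> f_path (tensor_f B') (J i) (concat (map \<psi> bs)) = Some (concat (map \<psi> bs')))"
    if i: "i \<in> cr_index B" and "bs \<in> lists D" for i bs
    using that(2)
  proof (induction bs)
    case (Cons b bs)
    then have b: "b \<in> D" and bs: "bs \<in> lists D" by auto
    note A = alignedD[OF al i b]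
    note V = vi[OF i, unfolded virtual_indices_def]
    have ind: "indep B' j j'" if "j \<in> set (J i)" "j' \<in> set (J i)" "j \<noteq> j'" for j j'
      using V that by blast
    have sub: "set (J i) \<subseteq> cr_index B'" using V by blast
    note P = f_path_tensor_append[OF sn sub ind, where u = "\<psi> b" and v = "concat (map \<psi> bs)"]
    show ?case
    proof (intro conjI ballI allI impI)
      fix j assume j: "j \<in> set (J i)"
      show "tensor_eps B' j (concat (map \<psi> (b # bs))) = c i * tensor_eps B i (b # bs)"
        and "tensor_phi B' j (concat (map \<psi> (b # bs))) = c i * tensor_phi B i (b # bs)"
        using Cons.IH A(1,2)[OF j] j
        by (simp_all add: tensor_eps_append tensor_phi_append algebra_simps diff_mult_distrib2)
    next
      fix bs' assume f: "tensor_f B i (b # bs) = Some bs'"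
      have "bs' \<in> lists D \<and> f_path (tensor_f B') (J i) (concat (map \<psi> (b # bs))) = Some (concat (map \<psi> bs'))"
      proof (cases "cr_phi B i b > tensor_eps B i bs")
        case True
        then obtain b' where b': "cr_f B i b = Some b'" "bs' = b' # bs" using f by auto
        have "tensor_phi B' j (\<psi> b) \<ge> tensor_eps B' j (concat (map \<psi> bs)) + count_list (J i) j"
          if j: "j \<in> set (J i)" for j
        proof -
          have "c i * cr_phi B i b \<ge> c i * Suc (tensor_eps B i bs)"
            using True by (intro mult_le_mono2) simp
          then show ?thesis using Cons.IH A(1,2)[OF j] j V by simp
        qed
        then show ?thesis using P(1) A(3,4)[OF b'(1)] b'(2) bs by simp
      next
        case False
        then obtain bs2 where b': "tensor_f B i bs = Some bs2" "bs' = b # bs2" using f by auto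
        have "tensor_phi B' j (\<psi> b) \<le> tensor_eps B' j (concat (map \<psi> bs))"
          if j: "j \<in> set (J i)" for j
          using Cons.IH A(1,2)[OF j] j False by simp
        then show ?thesis using P(2) Cons.IH b' b by simp
      qed
      then show "bs' \<in> lists D"
        and "f_path (tensor_f B') (J i) (concat (map \<psi> (b # bs))) = Some (concat (map \<psi> bs'))"
        by auto
    qed
  qed simp
  then show ?thesis by (simp add: aligned_def)
qed

lemma aligned_path:
  assumes "aligned B B' J c D \<psi>" "b \<in> D" "set is \<subseteq> cr_index B" "f_path (cr_f B) is b = Some b'"
  shows "b' \<in> D \<and> f_path (tensor_f B') (concat (map J is)) (\<psi> b) = Some (\<psi> b')"
  using assms(3,4)
proof (induction "is" arbitrary: b')
  case (Cons i "is")
  then obtain b1 where b1: "f_path (cr_f B) is b = Some b1" "cr_f B i b1 = Some b'"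
    by (auto simp: bind_eq_Some_conv)
  with Cons have "b1 \<in> D" "f_path (tensor_f B') (concat (map J is)) (\<psi> b) = Some (\<psi> b1)" by auto
  then show ?case using alignedD(3,4)[OF assms(1) _ _ b1(2)] Cons.prems by (simp add: f_path_append)
qed (use assms(2) in simp)

text \<open>Every path from \<open>h\<close> to \<open>b\<close> drags \<open>h'\<close> to a
  partner of \<open>b\<close> under \<open>R\<close>, and single-valuedness makes all these partners
  equal, so the description in \<open>path_map\<close> has a unique solution. Well-definedness of
  the Baker embedding and of dilatations is thereby reduced to finding such an
  \<open>R\<close>.\<close>

lemma path_map_rel:
  assumes sv: "single_valued R" and h: "(h, h') \<in> R"
    and step: "\<And>i b c b'. i \<in> I \<Longrightarrow> (b, c) \<in> R \<Longrightarrow> g i b = Some b' \<Longrightarrow> \<exists>c'. g' i c = Some c' \<and> (b', c') \<in> R"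
    and is': "set is \<subseteq> I" "f_path g is h = Some b"
  shows "(b, path_map I g h g' h' b) \<in> R"
    and "f_path g' is h' = Some (path_map I g h g' h' b)"
proof -
  have key: "\<exists>c. f_path g' js h' = Some c \<and> (x, c) \<in> R" if "set js \<subseteq> I" "f_path g js h = Some x" for js x
    using that
  proof (induction js arbitrary: x)
    case (Cons j js)
    then obtain x1 where x1: "f_path g js h = Some x1" "g j x1 = Some x" by (auto simp: bind_eq_Some_conv)
    with Cons obtain c where "f_path g' js h' = Some c" "(x1, c) \<in> R" by auto
    then show ?case using step[OF _ _ x1(2)] Cons.prems by fastforce
  qed (use h in simp)
  from key[OF is'] obtain c where c: "f_path g' is h' = Some c" "(b, c) \<in> R" by auto
  have "path_map I g h g' h' b = c"
    unfolding path_map_def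
  proof (rule the_equality)
    show "\<exists>is. set is \<subseteq> I \<and> f_path g is h = Some b \<and> f_path g' is h' = Some c" using is' c by blast
    show "c' = c" if "\<exists>is. set is \<subseteq> I \<and> f_path g is h = Some b \<and> f_path g' is h' = Some c'" for c'
      using key that c(2) sv unfolding single_valued_def by (metis option.inject)
  qed
  then show "(b, path_map I g h g' h' b) \<in> R" "f_path g' is h' = Some (path_map I g h g' h' b)"
    using c by auto
qed

section \<open>Words and tableaux\<close>

definition letter_crystal ::
  "nat set \<Rightarrow> (nat \<Rightarrow> int \<Rightarrow> sign option) \<Rightarrow> (nat \<Rightarrow> int \<Rightarrow> int) \<Rightarrow> int crystal" where
  "letter_crystal I mark act = \<lparr>cr_index = I,
     cr_f = (\<lambda>i x. if mark i x = Some Plus then Some (act i x) else None),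
     cr_eps = (\<lambda>i x. if mark i x = Some Minus then 1 else 0),
     cr_phi = (\<lambda>i x. if mark i x = Some Plus then 1 else 0)\<rparr>"

lemma letter_crystal_simps [simp]:
  "cr_index (letter_crystal I mark act) = I"
  "cr_f (letter_crystal I mark act) i x = (if mark i x = Some Plus then Some (act i x) else None)"
  "cr_eps (letter_crystal I mark act) i x = (if mark i x = Some Minus then 1 else 0)"
  "cr_phi (letter_crystal I mark act) i x = (if mark i x = Some Plus then 1 else 0)"
  by (simp_all add: letter_crystal_def)

definition tableau_crystal ::
  "nat set \<Rightarrow> (nat \<Rightarrow> int \<Rightarrow> sign option) \<Rightarrow> (nat \<Rightarrow> int \<Rightarrow> int) \<Rightarrow> tableau crystal" where
  "tableau_crystal I mark act = \<lparr>cr_index = I,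
     cr_f = (\<lambda>i. tab_f (mark i) (act i)),
     cr_eps = (\<lambda>i T. word_eps (mark i) (reading T)),
     cr_phi = (\<lambda>i T. word_phi (mark i) (reading T))\<rparr>"

definition word_A :: "nat \<Rightarrow> int crystal" where
  "word_A N = letter_crystal {1..N - 1} mark_A (\<lambda>_ x. x + 1)"

definition word_C :: "nat \<Rightarrow> int crystal" where
  "word_C n = letter_crystal {1..n} (mark_C n) (act_C n)"

lemma word_A_simps [simp]:
  "cr_index (word_A N) = {1..N - 1}"
  "cr_f (word_A N) i x = (if mark_A i x = Some Plus then Some (x + 1) else None)"
  "cr_eps (word_A N) i x = (if mark_A i x = Some Minus then 1 else 0)"
  "cr_phi (word_A N) i x = (if mark_A i x = Some Plus then 1 else 0)"
  by (simp_all add: word_A_def)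

lemma word_C_simps [simp]:
  "cr_index (word_C n) = {1..n}"
  "cr_f (word_C n) i x = (if mark_C n i x = Some Plus then Some (act_C n i x) else None)"
  "cr_eps (word_C n) i x = (if mark_C n i x = Some Minus then 1 else 0)"
  "cr_phi (word_C n) i x = (if mark_C n i x = Some Plus then 1 else 0)"
  by (simp_all add: word_C_def)

lemma crystal_A_eq: "crystal_A N = tableau_crystal {1..N - 1} mark_A (\<lambda>_ x. x + 1)"
  by (simp add: crystal_A_def tableau_crystal_def)

lemma crystal_C_eq: "crystal_C n = tableau_crystal {1..n} (mark_C n) (act_C n)"
  by (simp add: crystal_C_def tableau_crystal_def)

lemma seminormal_A: "seminormal (word_A N)"
  by (auto simp: seminormal_def mark_A_def)

lemma seminormal_C: "seminormal (word_C n)"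
  by (auto simp: seminormal_def mark_C_def act_C_def)

lemma indep_A: "i + 2 \<le> j \<or> j + 2 \<le> i \<Longrightarrow> indep (word_A N) i j"
  by (auto simp: indep_def mark_A_def split: if_splits)

lemma commuting_A: "i + 2 \<le> j \<or> j + 2 \<le> i \<Longrightarrow> commuting (word_A N) i j"
  by (auto simp: commuting_def mark_A_def split: if_splits)


section \<open>The signature rule as an iterated tensor rule\<close>

lemma reduced_signature_snoc:
  "reduced_signature mark (w @ [x]) =
     (case mark x of None \<Rightarrow> reduced_signature mark w
      | Some s \<Rightarrow> rev (cancel_step (s, length w) (rev (reduced_signature mark w))))"
proof -
  have *: "map (\<lambda>p. case mark ((w @ [x]) ! p) of None \<Rightarrow> [] | Some s \<Rightarrow> [(s, p)]) [0..<length w] =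
        map (\<lambda>p. case mark (w ! p) of None \<Rightarrow> [] | Some s \<Rightarrow> [(s, p)]) [0..<length w]"
    by (auto simp: nth_append)
  have "map (\<lambda>p. case mark ((w @ [x]) ! p) of None \<Rightarrow> [] | Some s \<Rightarrow> [(s, p)]) [0..<length (w @ [x])] =
        map (\<lambda>p. case mark (w ! p) of None \<Rightarrow> [] | Some s \<Rightarrow> [(s, p)]) [0..<length w] @
        [case mark x of None \<Rightarrow> [] | Some s \<Rightarrow> [(s, length w)]]"
    using * by (simp del: map_eq_conv)
  then show ?thesis
    unfolding reduced_signature_def by (simp del: map_eq_conv upt_Suc split: option.splits)
qed

text \<open>Induction from the right end, because the cancellation scans the word from left to
  right. The positions \<open>ps\<close> are carried along to locate the leftmost surviving plus,
  which is the letter that the tensor rule picks.\<close>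

lemma reduced_signature_tensor:
  fixes I mark act i w
  defines "L \<equiv> letter_crystal I mark act"
  shows "\<exists>qs ps. reduced_signature (mark i) w = map (Pair Minus) qs @ map (Pair Plus) ps \<and>
     length qs = tensor_eps L i w \<and> length ps = tensor_phi L i w \<and> (\<forall>p\<in>set ps. p < length w) \<and>
     tensor_f L i w = (if ps = [] then None else Some (w[hd ps := act i (w ! hd ps)]))"
proof (induction w rule: rev_induct)
  case Nil
  then show ?case by (simp add: reduced_signature_def L_def)
next
  case (snoc x w)
  then obtain qs ps where IH: "reduced_signature (mark i) w = map (Pair Minus) qs @ map (Pair Plus) ps"
     "length qs = tensor_eps L i w" "length ps = tensor_phi L i w" "\<forall>p\<in>set ps. p < length w"
     "tensor_f L i w = (if ps = [] then None else Some (w[hd ps := act i (w ! hd ps)]))" by blast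
  note E = tensor_eps_append[of L i w "[x]"] tensor_phi_append[of L i w "[x]"] tensor_f_append[of L i w "[x]"]
  have hd: "ps \<noteq> [] \<Longrightarrow> hd ps < length w" using IH(4) by simp
  show ?case
  proof (cases "mark i x")
    case None
    then show ?thesis
      using IH hd E by - (rule exI[of _ qs], rule exI[of _ ps],
            auto simp: reduced_signature_snoc L_def nth_append list_update_append)
  next
    case (Some s)
    show ?thesis
    proof (cases s)
      case Plus
      show ?thesis
        using IH hd E Some Plus
        by - (rule exI[of _ qs], rule exI[of _ "ps @ [length w]"],
            auto simp: reduced_signature_snoc L_def nth_append list_update_append hd_append)
    next
      case Minus
      show ?thesis
      proof (cases ps rule: rev_cases)
        case Nil
        have "rev (cancel_step (Minus, length w) (map (Pair Minus) (rev qs))) =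
           map (Pair Minus) (qs @ [length w])"
          by (cases "rev qs") (auto simp: rev_map[symmetric] simp flip: rev_map)
        then show ?thesis
          using IH E Some Minus Nil
          by - (rule exI[of _ "qs @ [length w]"], rule exI[of _ "[]"],
            auto simp: reduced_signature_snoc L_def rev_map)
      next
        case (snoc ps' p)
        \<comment> \<open>The new minus cancels the last surviving plus, so the leftmost one
          persists exactly when there were at least two.\<close>
        then have "ps' \<noteq> [] \<longleftrightarrow> Suc 0 < tensor_phi L i w" using IH(3) by (cases ps') auto
        then show ?thesis
          using snoc IH E Some Minus hd
          by - (rule exI[of _ qs], rule exI[of _ ps'],
            auto simp: reduced_signature_snoc L_def rev_map hd_append list_update_append nth_append)
      qed
    qed
  qed
qed

lemma word_tensor:
  "word_eps (mark i) w = tensor_eps (letter_crystal I mark act) i w"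
  "word_phi (mark i) w = tensor_phi (letter_crystal I mark act) i w"
  "word_f (mark i) (act i) w = tensor_f (letter_crystal I mark act) i w"
proof -
  obtain qs ps where *: "reduced_signature (mark i) w = map (Pair Minus) qs @ map (Pair Plus) ps"
     "length qs = tensor_eps (letter_crystal I mark act) i w"
     "length ps = tensor_phi (letter_crystal I mark act) i w"
     "tensor_f (letter_crystal I mark act) i w =
        (if ps = [] then None else Some (w[hd ps := act i (w ! hd ps)]))"
    using reduced_signature_tensor[of mark i w I act] by blast
  have f: "filter (\<lambda>(s, p). s = Minus) (map (Pair Minus) qs @ map (Pair Plus) ps) = map (Pair Minus) qs"
    "filter (\<lambda>(s, p). s = Plus) (map (Pair Minus) qs @ map (Pair Plus) ps) = map (Pair Plus) ps"
    by (simp_all add: filter_map comp_def)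
  show "word_eps (mark i) w = tensor_eps (letter_crystal I mark act) i w"
    "word_phi (mark i) w = tensor_phi (letter_crystal I mark act) i w"
    "word_f (mark i) (act i) w = tensor_f (letter_crystal I mark act) i w"
    unfolding word_eps_def word_phi_def word_f_def *(1) f using *
    by (auto split: list.splits)
qed

lemma tensor_f_length:
  "tensor_f (letter_crystal I mark act) i w = Some w' \<Longrightarrow> length w' = length w"
  by (induction w arbitrary: w') (auto split: if_splits)

lemma chop: "length w = sum_list ks \<Longrightarrow> map length (chop ks w) = ks \<and> concat (chop ks w) = w"
  by (induction ks arbitrary: w) auto

lemma unread:
  assumes "length w = sum_list hs"
  shows "map length (unread hs w) = hs" "reading (unread hs w) = w"
  using chop[of w "rev hs"] assms
  by (simp_all add: unread_def reading_def flip: rev_map)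

lemma length_reading: "length (reading T) = sum_list (map length T)"
  by (simp add: reading_def length_concat flip: rev_map)

lemma reading_inj:
  assumes "map length T = map length T'" "reading T = reading T'"
  shows "T = T'"
proof -
  have "concat (rev T) = concat (rev T')" using assms(2) by (simp add: reading_def)
  moreover have "map length (rev T) = map length (rev T')" using assms(1) by (simp flip: rev_map)
  then have "length (rev T) = length (rev T')"
    "\<forall>(x, y)\<in>set (zip (rev T) (rev T')). length x = length y"
    by (metis length_map, auto simp: set_zip) (metis length_map length_rev nth_map)
  ultimately have "rev T = rev T'" by (rule concat_injective)
  then show ?thesis by simp
qed

lemma tableau_crystal_simps:
  fixes I mark act
  defines "L \<equiv> letter_crystal I mark act" and "B \<equiv> tableau_crystal I mark act"
  shows "cr_index B = I"
    and "cr_eps B i T = tensor_eps L i (reading T)"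
    and "cr_phi B i T = tensor_phi L i (reading T)"
    and "cr_f B i T = map_option (unread (map length T)) (tensor_f L i (reading T))"
  by (simp_all add: L_def B_def tableau_crystal_def tab_f_def word_tensor(1)[of mark _ _ I act] word_tensor(2)[of mark _ _ I act]
      word_tensor(3)[of mark _ act _ I])

lemma tableau_f_Some_iff:
  fixes I mark act
  defines "L \<equiv> letter_crystal I mark act" and "B \<equiv> tableau_crystal I mark act"
  shows "cr_f B i T = Some T' \<longleftrightarrow>
     map length T' = map length T \<and> tensor_f L i (reading T) = Some (reading T')"
proof -
  have *: "map length (unread (map length T) w) = map length T" "reading (unread (map length T) w) = w"
    if "tensor_f L i (reading T) = Some w" for w
    using unread[of w "map length T"] tensor_f_length[OF that[unfolded L_def]] by (simp_all add: length_reading)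
  show ?thesis
    unfolding B_def tableau_crystal_simps(4) L_def[symmetric]
    using * reading_inj[of T'] by (auto intro!: reading_inj)
qed

lemma seminormal_tableau:
  assumes "seminormal (letter_crystal I mark act)"
  shows "seminormal (tableau_crystal I mark act)"
proof -
  let ?L = "letter_crystal I mark act" and ?B = "tableau_crystal I mark act"
  note S = seminormalD[OF seminormal_tensor[OF assms], simplified]
  have "(cr_f ?B i b = None \<longleftrightarrow> cr_phi ?B i b = 0) \<and> (\<forall>b'. cr_f ?B i b = Some b' \<longrightarrow>
        cr_eps ?B i b' = Suc (cr_eps ?B i b) \<and> cr_phi ?B i b = Suc (cr_phi ?B i b'))"
    if "i \<in> I" for i b
  proof (intro conjI allI impI)
    show "cr_f ?B i b = None \<longleftrightarrow> cr_phi ?B i b = 0"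
      using S(1)[OF that] by (simp add: tableau_crystal_simps)
    fix b' assume "cr_f ?B i b = Some b'"
    then have "tensor_f ?L i (reading b) = Some (reading b')" by (simp add: tableau_f_Some_iff)
    from S(2,3)[OF that this]
    show "cr_eps ?B i b' = Suc (cr_eps ?B i b)" "cr_phi ?B i b = Suc (cr_phi ?B i b')"
      by (simp_all add: tableau_crystal_simps)
  qed
  then show ?thesis by (simp add: seminormal_def tableau_crystal_simps(1))
qed

section \<open>Tensors of tableaux as single words\<close>

definition flat :: "tableau list \<Rightarrow> int list" where
  "flat Ts = concat (map reading Ts)"

lemma flat_simps [simp]: "flat [] = []" "flat (T # Ts) = reading T @ flat Ts" "flat (Ts @ Ts') = flat Ts @ flat Ts'"
  by (simp_all add: flat_def)

text \<open>A tableau carries the tensor rule of its letters in reading order, so by associativity a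
  tensor of tableaux behaves like one long word; only the column lengths have to be remembered
  separately.\<close>

lemma flat_tensor:
  "tensor_eps (tableau_crystal I mark act) i Ts = tensor_eps (letter_crystal I mark act) i (flat Ts) \<and>
   tensor_phi (tableau_crystal I mark act) i Ts = tensor_phi (letter_crystal I mark act) i (flat Ts)"
  by (induction Ts) (auto simp: tensor_eps_append tensor_phi_append tableau_crystal_simps)

lemma flat_f:
  "tensor_f (tableau_crystal I mark act) i Ts = Some Ts' \<Longrightarrow>
   tensor_f (letter_crystal I mark act) i (flat Ts) = Some (flat Ts') \<and>
   map (map length) Ts' = map (map length) Ts"
  by (induction Ts arbitrary: Ts')
    (auto simp: tensor_f_append tableau_crystal_simps(3) flat_tensor tableau_f_Some_iff split: if_splits)

text \<open>Whether an operator is defined is visible from \<open>tensor_phi\<close>, which agrees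
  on both sides; hence steps on words lift back to steps on tableaux.\<close>

lemma flat_f_ex:
  assumes sn: "seminormal (letter_crystal I mark act)" and i: "i \<in> I"
    and f: "tensor_f (letter_crystal I mark act) i (flat Ts) = Some w"
  shows "\<exists>Ts'. tensor_f (tableau_crystal I mark act) i Ts = Some Ts' \<and> flat Ts' = w \<and>
     map (map length) Ts' = map (map length) Ts"
proof -
  let ?L = "letter_crystal I mark act" let ?B = "tableau_crystal I mark act"
  have "tensor_phi ?L i (flat Ts) \<noteq> 0"
    using seminormalD(1)[OF seminormal_tensor[OF sn], of i "flat Ts"] i f by simp
  then have "tensor_phi ?B i Ts \<noteq> 0" by (simp add: flat_tensor)
  then obtain Ts' where "tensor_f ?B i Ts = Some Ts'"
    using seminormalD(1)[OF seminormal_tensor[OF seminormal_tableau[OF sn]], of i Ts] i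
    by (cases "tensor_f ?B i Ts") (auto simp: tableau_crystal_simps)
  with flat_f[OF this] f show ?thesis by auto
qed

lemma flat_path:
  "f_path (tensor_f (tableau_crystal I mark act)) is Ts = Some Ts' \<Longrightarrow>
   f_path (tensor_f (letter_crystal I mark act)) is (flat Ts) = Some (flat Ts') \<and>
   map (map length) Ts' = map (map length) Ts"
proof (induction "is" arbitrary: Ts')
  case (Cons i "is")
  then show ?case using flat_f by (fastforce simp: bind_eq_Some_conv)
qed simp

lemma flat_path_ex:
  assumes sn: "seminormal (letter_crystal I mark act)"
  shows "set is \<subseteq> I \<Longrightarrow> f_path (tensor_f (letter_crystal I mark act)) is (flat Ts) = Some w \<Longrightarrow>
   \<exists>Ts'. f_path (tensor_f (tableau_crystal I mark act)) is Ts = Some Ts' \<and> flat Ts' = w \<and>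
     map (map length) Ts' = map (map length) Ts"
proof (induction "is" arbitrary: w)
  case (Cons i "is")
  then obtain w1 where w1: "f_path (tensor_f (letter_crystal I mark act)) is (flat Ts) = Some w1"
     "tensor_f (letter_crystal I mark act) i w1 = Some w" by (auto simp: bind_eq_Some_conv)
  then obtain Ts1 where "f_path (tensor_f (tableau_crystal I mark act)) is Ts = Some Ts1" "flat Ts1 = w1"
    "map (map length) Ts1 = map (map length) Ts" using Cons by auto
  moreover obtain Ts' where "tensor_f (tableau_crystal I mark act) i Ts1 = Some Ts'" "flat Ts' = w"
    "map (map length) Ts' = map (map length) Ts1"
    using flat_f_ex[OF sn, of i Ts1 w] w1 Cons.prems calculation by auto
  ultimately show ?case by (auto simp: bind_eq_Some_conv)
qed auto

lemma flat_inj: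
  assumes "map (map length) Ts = map (map length) Ts'" "flat Ts = flat Ts'"
  shows "Ts = Ts'"
proof -
  have len: "length Ts = length Ts'" using assms(1) by (metis length_map)
  have sh: "map length (Ts ! k) = map length (Ts' ! k)" if "k < length Ts" for k
    using assms(1) that len by (metis nth_map)
  have "map reading Ts = map reading Ts'"
    using assms(2) unfolding flat_def
    by (rule concat_injective) (use len sh in \<open>auto simp: set_zip length_reading\<close>)
  then have "reading (Ts ! k) = reading (Ts' ! k)" if "k < length Ts" for k
    using that len by (metis nth_map)
  with len sh show ?thesis by (metis nth_equalityI reading_inj)
qed

text \<open>Strictness could fail only if the letter after the changed \<open>x\<close> were already
  \<open>act i x\<close>; but this letter is a minus and would have cancelled the plus of
  \<open>x\<close>. The second conjunct, that every new letter is at least some old one, keeps the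
  letters in front of the changed one below the rest during the induction.\<close>

lemma tensor_f_sorted:
  assumes tr: "transp lt"
    and cover: "\<And>x. mark i x = Some Plus \<Longrightarrow> lt x (act i x) \<and> mark i (act i x) = Some Minus"
    and next_gt: "\<And>x y. mark i x = Some Plus \<Longrightarrow> lt x y \<Longrightarrow> y \<in> A \<Longrightarrow> y = act i x \<or> lt (act i x) y"
    and f: "tensor_f (letter_crystal I mark act) i w = Some w'"
    and w: "sorted_wrt lt w" "set w \<subseteq> A"
  shows "sorted_wrt lt w' \<and> (\<forall>y\<in>set w'. \<exists>x\<in>set w. y = x \<or> lt x y)"
  using f w
proof (induction w arbitrary: w')
  case (Cons x w)
  let ?L = "letter_crystal I mark act"
  show ?case
  proof (cases "cr_phi ?L i x > tensor_eps ?L i w")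
    case True
    then have x: "mark i x = Some Plus" and e: "tensor_eps ?L i w = 0" and w': "w' = act i x # w"
      using Cons.prems by (auto split: if_splits)
    have "lt (act i x) y" if y: "y \<in> set w" for y
    proof (cases w)
      case (Cons z v)
      have z: "lt x z" "z \<in> A" using Cons.prems(2,3) Cons by auto
      have "z \<noteq> act i x" using e cover[OF x] Cons by auto
      then have "lt (act i x) z" using next_gt[OF x z] by auto
      moreover have "y = z \<or> lt z y" using y Cons Cons.prems(2) by auto
      ultimately show ?thesis using tr by (auto dest: transpD)
    qed (use y in simp)
    then show ?thesis using w' Cons.prems cover[OF x] by auto
  next
    case False
    then obtain v where v: "tensor_f ?L i w = Some v" "w' = x # v" using Cons.prems by auto
    with Cons have "sorted_wrt lt v" "\<forall>y\<in>set v. \<exists>x\<in>set w. y = x \<or> lt x y" by auto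
    then show ?thesis using v Cons.prems(2) tr by (auto dest: transpD)
  qed
qed simp

lemma tensor_f_concat:
  assumes "tensor_f B i (concat Cs) = Some w"
  shows "\<exists>Xs C Ys C'. Cs = Xs @ [C] @ Ys \<and> tensor_f B i C = Some C' \<and> w = concat (Xs @ [C'] @ Ys)"
  using assms
proof (induction Cs arbitrary: w)
  case (Cons C Cs)
  show ?case
  proof (cases "tensor_phi B i C > tensor_eps B i (concat Cs)")
    case True
    then obtain C' where "tensor_f B i C = Some C'" "w = C' @ concat Cs"
      using Cons.prems by (auto simp: tensor_f_append)
    then show ?thesis by - (rule exI[of _ "[]"], rule exI[of _ C], rule exI[of _ Cs], rule exI[of _ C'], auto)
  next
    case False
    then obtain v where v: "tensor_f B i (concat Cs) = Some v" "w = C @ v"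
      using Cons.prems by (auto simp: tensor_f_append)
    from Cons.IH[OF v(1)] obtain Xs D Ys D' where
      "Cs = Xs @ [D] @ Ys" "tensor_f B i D = Some D'" "v = concat (Xs @ [D'] @ Ys)" by blast
    then show ?thesis using v by - (rule exI[of _ "C # Xs"], rule exI[of _ D], rule exI[of _ Ys], rule exI[of _ D'], auto)
  qed
qed simp

lemma tableau_f_column:
  assumes "cr_f (tableau_crystal I mark act) i T = Some T'"
  shows "\<exists>Xs C Ys C'. T = Xs @ [C] @ Ys \<and> tensor_f (letter_crystal I mark act) i C = Some C' \<and>
     T' = Xs @ [C'] @ Ys"
proof -
  let ?L = "letter_crystal I mark act"
  have T': "map length T' = map length T" "tensor_f ?L i (reading T) = Some (reading T')"
    using assms by (simp_all add: tableau_f_Some_iff)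
  obtain Xs C Ys C' where *: "rev T = Xs @ [C] @ Ys" "tensor_f ?L i C = Some C'"
    "reading T' = concat (Xs @ [C'] @ Ys)"
    using tensor_f_concat[of ?L i "rev T"] T'(2) unfolding reading_def by blast
  have T: "T = rev Ys @ [C] @ rev Xs" using arg_cong[OF *(1), of rev] by simp
  have "T' = rev Ys @ [C'] @ rev Xs"
    by (rule reading_inj) (use T' T * tensor_f_length[OF *(2)] in \<open>auto simp: reading_def\<close>)
  with T *(2) show ?thesis by blast
qed

section \<open>Isomorphic components of type A words\<close>

text \<open>A partial isomorphism between components of words, kept as a relation so that Knuth
  moves, converses and composites can be used directly. Steps are only required to transfer from the
  first word to the second; the other direction follows from equal \<open>tensor_phi\<close>.
  Content is included because keys are later recognised by their weight.\<close>

definition word_iso :: "nat \<Rightarrow> (int list \<times> int list) set \<Rightarrow> bool" where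
  "word_iso N R \<longleftrightarrow> single_valued R \<and> single_valued (R\<inverse>) \<and>
     (\<forall>u v. (u, v) \<in> R \<longrightarrow> count_list u = count_list v \<and>
        (\<forall>i\<in>{1..N - 1}.
           tensor_eps (word_A N) i u = tensor_eps (word_A N) i v \<and>
           tensor_phi (word_A N) i u = tensor_phi (word_A N) i v \<and>
           (\<forall>u'. tensor_f (word_A N) i u = Some u' \<longrightarrow>
              (\<exists>v'. tensor_f (word_A N) i v = Some v' \<and> (u', v') \<in> R))))"

definition linked :: "nat \<Rightarrow> int list \<Rightarrow> int list \<Rightarrow> bool" where
  "linked N u v \<longleftrightarrow> (\<exists>R. word_iso N R \<and> (u, v) \<in> R)"

lemma word_isoD:
  assumes "word_iso N R" "(u, v) \<in> R"
  shows "count_list u = count_list v"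
    and "i \<in> {1..N - 1} \<Longrightarrow> tensor_eps (word_A N) i u = tensor_eps (word_A N) i v"
    and "i \<in> {1..N - 1} \<Longrightarrow> tensor_phi (word_A N) i u = tensor_phi (word_A N) i v"
    and "i \<in> {1..N - 1} \<Longrightarrow> tensor_f (word_A N) i u = Some u' \<Longrightarrow>
           \<exists>v'. tensor_f (word_A N) i v = Some v' \<and> (u', v') \<in> R"
  using assms unfolding word_iso_def by blast+

lemma word_iso_path:
  assumes "word_iso N R" "(u, v) \<in> R" "set is \<subseteq> {1..N - 1}"
    "f_path (tensor_f (word_A N)) is u = Some u'"
  shows "\<exists>v'. f_path (tensor_f (word_A N)) is v = Some v' \<and> (u', v') \<in> R"
  using assms(3,4)
proof (induction "is" arbitrary: u')
  case (Cons i "is")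
  then obtain u1 where "f_path (tensor_f (word_A N)) is u = Some u1" "tensor_f (word_A N) i u1 = Some u'"
    by (auto simp: bind_eq_Some_conv)
  with Cons word_isoD(4)[OF assms(1)] show ?case by fastforce
qed (use assms(2) in simp)

lemma linked_refl: "linked N u u"
  unfolding linked_def by (rule exI[of _ Id]) (auto simp: word_iso_def single_valued_def)

lemma linked_sym: "linked N u v \<Longrightarrow> linked N v u"
proof -
  assume "linked N u v"
  then obtain R where R: "word_iso N R" "(u, v) \<in> R" by (auto simp: linked_def)
  have "\<exists>a'. tensor_f (word_A N) i a = Some a' \<and> (b', a') \<in> R\<inverse>"
    if ab: "(b, a) \<in> R\<inverse>" "i \<in> {1..N - 1}" "tensor_f (word_A N) i b = Some b'" for a b b' i
  proof -
    have S: "tensor_f (word_A N) i x = None \<longleftrightarrow> tensor_phi (word_A N) i x = 0" for x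
      using seminormalD(1)[OF seminormal_tensor[OF seminormal_A]] ab(2) by simp
    have "tensor_phi (word_A N) i a \<noteq> 0"
      using S[of b] ab word_isoD(3)[OF R(1), of a b i] by simp
    then obtain a' where a': "tensor_f (word_A N) i a = Some a'"
      using S[of a] by (cases "tensor_f (word_A N) i a") auto
    with word_isoD(4)[OF R(1), of a b i a'] ab show ?thesis by auto
  qed
  then have "word_iso N (R\<inverse>)"
    using R(1) unfolding word_iso_def by (auto simp: single_valued_def)
  with R(2) show ?thesis by (auto simp: linked_def)
qed

lemma linked_trans: "linked N u v \<Longrightarrow> linked N v w \<Longrightarrow> linked N u w"
proof -
  assume "linked N u v" "linked N v w"
  then obtain R S where R: "word_iso N R" "(u, v) \<in> R" and S: "word_iso N S" "(v, w) \<in> S"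
    by (auto simp: linked_def)
  have "word_iso N (R O S)"
    unfolding word_iso_def
  proof (intro conjI allI impI ballI)
    show "single_valued (R O S)" "single_valued ((R O S)\<inverse>)"
      using R(1) S(1) by (auto simp: word_iso_def converse_relcomp intro!: single_valued_relcomp)
  next
    fix a c assume "(a, c) \<in> R O S"
    then obtain b where b: "(a, b) \<in> R" "(b, c) \<in> S" by auto
    note D = word_isoD[OF R(1) b(1)] word_isoD[OF S(1) b(2)]
    show "count_list a = count_list c" using D(1,5) by simp
    fix i assume i: "i \<in> {1..N - 1}"
    show "tensor_eps (word_A N) i a = tensor_eps (word_A N) i c"
      "tensor_phi (word_A N) i a = tensor_phi (word_A N) i c"
      using D(2,3,6,7)[OF i] by simp_all
    fix a' assume "tensor_f (word_A N) i a = Some a'"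
    then show "\<exists>c'. tensor_f (word_A N) i c = Some c' \<and> (a', c') \<in> R O S"
      using D(4)[OF i] D(8)[OF i] by blast
  qed
  with R(2) S(2) show ?thesis by (auto simp: linked_def)
qed

lemma linked_append_right: "linked N u v \<Longrightarrow> linked N (u @ w) (v @ w)"
proof -
  assume "linked N u v"
  then obtain R where R: "word_iso N R" "(u, v) \<in> R" by (auto simp: linked_def)
  \<comment> \<open>The length of \<open>x\<close> is fixed so that a word determines its splitting
    and the relation stays single-valued.\<close>
  let ?S = "{(a @ x, b @ x) | a b x. (a, b) \<in> R \<and> length x = length w}"
  have "word_iso N ?S"
    unfolding word_iso_def
  proof (intro conjI allI impI ballI)
    show "single_valued ?S" "single_valued (?S\<inverse>)"
      using R(1) by (auto simp: word_iso_def single_valued_def)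
  next
    fix p q assume "(p, q) \<in> ?S"
    then obtain a b x where x: "p = a @ x" "q = b @ x" "(a, b) \<in> R" "length x = length w" by auto
    note D = word_isoD[OF R(1) x(3)]
    show "count_list p = count_list q" using D(1) x by (simp add: fun_eq_iff)
    fix i assume i: "i \<in> {1..N - 1}"
    show "tensor_eps (word_A N) i p = tensor_eps (word_A N) i q"
      "tensor_phi (word_A N) i p = tensor_phi (word_A N) i q"
      using D(2,3)[OF i] x by (simp_all add: tensor_eps_append tensor_phi_append)
    fix p' assume f: "tensor_f (word_A N) i p = Some p'"
    show "\<exists>q'. tensor_f (word_A N) i q = Some q' \<and> (p', q') \<in> ?S"
    proof (cases "tensor_phi (word_A N) i a > tensor_eps (word_A N) i x")
      case True
      then obtain a' where "tensor_f (word_A N) i a = Some a'" "p' = a' @ x"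
        using f x by (auto simp: tensor_f_append)
      with D(3,4)[OF i] True x show ?thesis by (fastforce simp: tensor_f_append)
    next
      case False
      then obtain x' where x': "tensor_f (word_A N) i x = Some x'" "p' = a @ x'"
        using f x by (auto simp: tensor_f_append)
      with D(3)[OF i] False x tensor_f_length[OF x'(1)[unfolded word_A_def]] show ?thesis
        by (fastforce simp: tensor_f_append)
    qed
  qed
  with R(2) show ?thesis unfolding linked_def by blast
qed

lemma linked_append_left: "linked N u v \<Longrightarrow> linked N (w @ u) (w @ v)"
proof -
  assume "linked N u v"
  then obtain R where R: "word_iso N R" "(u, v) \<in> R" by (auto simp: linked_def)
  let ?S = "{(x @ a, x @ b) | a b x. (a, b) \<in> R \<and> length x = length w}"
  have "word_iso N ?S"
    unfolding word_iso_def
  proof (intro conjI allI impI ballI)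
    show "single_valued ?S" "single_valued (?S\<inverse>)"
      using R(1) by (auto simp: word_iso_def single_valued_def)
  next
    fix p q assume "(p, q) \<in> ?S"
    then obtain a b x where x: "p = x @ a" "q = x @ b" "(a, b) \<in> R" "length x = length w" by auto
    note D = word_isoD[OF R(1) x(3)]
    show "count_list p = count_list q" using D(1) x by (simp add: fun_eq_iff)
    fix i assume i: "i \<in> {1..N - 1}"
    show "tensor_eps (word_A N) i p = tensor_eps (word_A N) i q"
      "tensor_phi (word_A N) i p = tensor_phi (word_A N) i q"
      using D(2,3)[OF i] x by (simp_all add: tensor_eps_append tensor_phi_append)
    fix p' assume f: "tensor_f (word_A N) i p = Some p'"
    show "\<exists>q'. tensor_f (word_A N) i q = Some q' \<and> (p', q') \<in> ?S"
    proof (cases "tensor_phi (word_A N) i x > tensor_eps (word_A N) i a")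
      case True
      then obtain x' where x': "tensor_f (word_A N) i x = Some x'" "p' = x' @ a"
        using f x by (auto simp: tensor_f_append)
      with D(2)[OF i] True x tensor_f_length[OF x'(1)[unfolded word_A_def]] show ?thesis
        by (fastforce simp: tensor_f_append)
    next
      case False
      then obtain a' where "tensor_f (word_A N) i a = Some a'" "p' = x @ a'"
        using f x by (auto simp: tensor_f_append)
      with D(2,4)[OF i] False x show ?thesis by (fastforce simp: tensor_f_append)
    qed
  qed
  with R(2) show ?thesis unfolding linked_def by blast
qed

text \<open>The plactic relations for reversed words, since columns are read from right to left and
  top to bottom. Each family is stored in both directions, so the relation is its own converse; a
  word of three letters admits at most one move.\<close>

definition knuth :: "(int list \<times> int list) set" where
  "knuth = {([a, b, e], [a, e, b]) | a b e. b \<le> a \<and> a < e \<or> e \<le> a \<and> a < b} \<union>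
           {([a, b, e], [b, a, e]) | a b e. a < e \<and> e \<le> b \<or> b < e \<and> e \<le> a}"

lemma letter_cases_A:
  obtains "x = int i" "mark_A i x = Some Plus" | "x = int i + 1" "mark_A i x = Some Minus"
  | "x \<noteq> int i" "x \<noteq> int i + 1" "mark_A i x = None"
  by (auto simp: mark_A_def)

text \<open>The operator of index \<open>i\<close> only distinguishes the letters \<open>i\<close>,
  \<open>i + 1\<close> and all others, which leaves a finite check on three letters.\<close>

lemma word_iso_knuth: "word_iso N knuth"
  unfolding word_iso_def
proof (intro conjI allI impI)
  show "single_valued knuth" "single_valued (knuth\<inverse>)"
    by (auto simp: single_valued_def knuth_def)
next
  fix p q assume pq: "(p, q) \<in> knuth"
  then show "count_list p = count_list q" by (auto simp: knuth_def fun_eq_iff)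
  \<comment> \<open>A step can carry a pair from one family to the other: \<open>i, i, i+1\<close>
    and \<open>i, i+1, i\<close> become \<open>i+1, i, i+1\<close> and \<open>i, i+1, i+1\<close>.
    Hence both introduction rules are offered in every case.\<close>
  have K: "([x, y, z], [x, z, y]) \<in> knuth" if "y \<le> x \<and> x < z \<or> z \<le> x \<and> x < y" for x y z
    using that by (auto simp: knuth_def)
  have K': "([x, y, z], [y, x, z]) \<in> knuth" if "x < z \<and> z \<le> y \<or> y < z \<and> z \<le> x" for x y z
    using that by (auto simp: knuth_def)
  let ?compat = "\<lambda>i. tensor_eps (word_A N) i p = tensor_eps (word_A N) i q \<and>
    tensor_phi (word_A N) i p = tensor_phi (word_A N) i q \<and>
    (\<forall>p'. tensor_f (word_A N) i p = Some p' \<longrightarrow>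
      (\<exists>q'. tensor_f (word_A N) i q = Some q' \<and> (p', q') \<in> knuth))"
  show "\<forall>i\<in>{1..N - 1}. ?compat i"
  proof
    fix i
    from pq consider a b e where "p = [a, b, e]" "q = [a, e, b]" "b \<le> a \<and> a < e \<or> e \<le> a \<and> a < b"
      | a b e where "p = [a, b, e]" "q = [b, a, e]" "a < e \<and> e \<le> b \<or> b < e \<and> e \<le> a"
      unfolding knuth_def by blast
    then show "?compat i"
    proof cases
      case 1
      show ?thesis unfolding 1(1,2)
        by (rule letter_cases_A[of a i]; rule letter_cases_A[of b i]; rule letter_cases_A[of e i])
          (use 1(3) in \<open>auto intro!: K K'\<close>)
    next
      case 2
      show ?thesis unfolding 2(1,2)
        by (rule letter_cases_A[of a i]; rule letter_cases_A[of b i]; rule letter_cases_A[of e i])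
          (use 2(3) in \<open>auto intro!: K K'\<close>)
    qed
  qed
qed

lemma linked_knuth: "(u, v) \<in> knuth \<Longrightarrow> linked N u v"
  using word_iso_knuth unfolding linked_def by blast

section \<open>Lattice words, the highest weight words of type A\<close>

definition lattice :: "nat \<Rightarrow> int list \<Rightarrow> bool" where
  "lattice N w \<longleftrightarrow> set w \<subseteq> {1..int N} \<and> (\<forall>i\<in>{1..N - 1}. tensor_eps (word_A N) i w = 0)"

definition dominant :: "nat \<Rightarrow> (int \<Rightarrow> nat) \<Rightarrow> bool" where
  "dominant N \<nu> \<longleftrightarrow> (\<forall>x. x \<notin> {1..int N} \<longrightarrow> \<nu> x = 0) \<and> (\<forall>x. 1 \<le> x \<longrightarrow> \<nu> (x + 1) \<le> \<nu> x)"

text \<open>The difference of the two string lengths is the pairing of the weight with a simple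
  coroot, arranged as a sum to avoid truncated subtraction.\<close>

lemma phi_minus_eps_A:
  "tensor_phi (word_A N) i w + count_list w (int i + 1) =
   tensor_eps (word_A N) i w + count_list w (int i)"
  by (induction w) (auto simp: mark_A_def)

lemma lattice_snoc:
  "lattice N (w @ [c]) \<longleftrightarrow>
     lattice N w \<and> 1 \<le> c \<and> c \<le> int N \<and> (c = 1 \<or> count_list w c < count_list w (c - 1))"
proof -
  have *: "tensor_eps (word_A N) i (w @ [c]) = 0 \<longleftrightarrow>
      tensor_eps (word_A N) i w = 0 \<and> (c = int i + 1 \<longrightarrow> count_list w c < count_list w (c - 1))" for i
    using phi_minus_eps_A[of N i w] by (auto simp: tensor_eps_append mark_A_def)
  have "(\<forall>i\<in>{1..N - 1}. c = int i + 1 \<longrightarrow> P) \<longleftrightarrow> c = 1 \<or> P" if "1 \<le> c" "c \<le> int N" for P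
  proof (cases "c = 1")
    case False
    then have "nat (c - 1) \<in> {1..N - 1}" "c = int (nat (c - 1)) + 1" using that by auto
    then show ?thesis using False by blast
  qed auto
  from this[of "count_list w c < count_list w (c - 1)"] show ?thesis
    unfolding lattice_def * ball_conj_distrib by auto
qed

lemma lattice_dominant:
  assumes "lattice N w"
  shows "dominant N (count_list w)"
proof -
  have "count_list w (x + 1) \<le> count_list w x" if x: "1 \<le> x" for x
  proof (cases "x < int N")
    case True
    then have "nat x \<in> {1..N - 1}" using x by auto
    then show ?thesis using phi_minus_eps_A[of N "nat x" w] assms x by (auto simp: lattice_def)
  next
    case False
    then have "x + 1 \<notin> set w" using assms by (auto simp: lattice_def)
    then show ?thesis by (simp add: count_list_0_iff)
  qed
  moreover have "count_list w x = 0" if "x \<notin> {1..int N}" for x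
    using that assms by (auto simp: lattice_def count_list_0_iff)
  ultimately show ?thesis by (simp add: dominant_def)
qed

lemma lattice_add_corner:
  assumes "dominant N \<nu>" "lattice N w" "count_list w = \<nu>(c := \<nu> c - 1)" "1 \<le> c" "0 < \<nu> c"
  shows "lattice N (w @ [c])" "count_list (w @ [c]) = \<nu>"
proof -
  have "c \<le> int N" using assms(1,5) by (force simp: dominant_def)
  moreover have "\<nu> c \<le> \<nu> (c - 1)" if "c \<noteq> 1"
  proof -
    have "1 \<le> c - 1" using assms(4) that by simp
    then have "\<nu> (c - 1 + 1) \<le> \<nu> (c - 1)" using assms(1) unfolding dominant_def by blast
    then show ?thesis by simp
  qed
  ultimately show "lattice N (w @ [c])"
    using assms(2,4,5) unfolding lattice_snoc assms(3) by (cases "c = 1") auto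
  show "count_list (w @ [c]) = \<nu>" using assms(3,5) by (auto simp: fun_eq_iff)
qed

lemma dominant_remove_corner:
  assumes "dominant N \<nu>" "\<nu> (c + 1) < \<nu> c"
  shows "dominant N (\<nu>(c := \<nu> c - 1))"
  using assms by (auto simp: dominant_def le_diff_conv intro: le_trans[OF diff_le_self])

text \<open>Induction on the size: the lowest nonempty row of the partition ends in a corner, and a
  word for the partition without this corner is extended by the letter of that row.\<close>

lemma lattice_exists:
  assumes "dominant N \<nu>"
  shows "\<exists>w. lattice N w \<and> count_list w = \<nu>"
  using assms
proof (induction "\<Sum>x\<in>{1..int N}. \<nu> x" arbitrary: \<nu>)
  case 0
  then have "\<nu> = count_list []" by (auto simp: dominant_def fun_eq_iff)
  then show ?case by (intro exI[of _ "[]"]) (simp add: lattice_def)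
next
  case (Suc k)
  let ?A = "{x \<in> {1..int N}. \<nu> x > 0}"
  have "?A \<noteq> {}"
  proof
    assume "?A = {}"
    then have "(\<Sum>x\<in>{1..int N}. \<nu> x) = 0" by auto
    with Suc.hyps(2) show False by simp
  qed
  moreover have fin: "finite ?A" by (rule finite_subset[of _ "{1..int N}"]) auto
  moreover define c where "c = Max ?A"
  ultimately have c: "c \<in> ?A" "\<And>x. x \<in> ?A \<Longrightarrow> x \<le> c"
    using Max_in[of ?A] Max_ge[OF fin] by simp_all
  have "c + 1 \<notin> ?A" using c(2)[of "c + 1"] by linarith
  then have "\<nu> (c + 1) = 0" using Suc.prems c(1) unfolding dominant_def by auto
  then have c1: "\<nu> (c + 1) < \<nu> c" using c by simp
  let ?\<nu> = "\<nu>(c := \<nu> c - 1)"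
  have "(\<Sum>x\<in>{1..int N}. \<nu> x) = \<nu> c + (\<Sum>x\<in>{1..int N} - {c}. \<nu> x)"
    "(\<Sum>x\<in>{1..int N}. ?\<nu> x) = ?\<nu> c + (\<Sum>x\<in>{1..int N} - {c}. ?\<nu> x)"
    using c(1) by (blast intro: sum.remove[OF finite_atLeastAtMost_int])+
  moreover have "(\<Sum>x\<in>{1..int N} - {c}. ?\<nu> x) = (\<Sum>x\<in>{1..int N} - {c}. \<nu> x)"
    by (intro sum.cong) auto
  moreover have "?\<nu> c = \<nu> c - 1" "0 < \<nu> c" using c by auto
  ultimately have "k = (\<Sum>x\<in>{1..int N}. ?\<nu> x)" using Suc.hyps(2) by linarith
  then obtain w where w: "lattice N w" "count_list w = ?\<nu>"
    using Suc.hyps(1) dominant_remove_corner[OF Suc.prems c1] by blast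
  have "1 \<le> c" "0 < \<nu> c" using c(1) by auto
  from lattice_add_corner[OF Suc.prems w this] show ?case by (intro exI[of _ "w @ [c]"] conjI)
qed

lemma strict_drop:
  fixes \<nu> :: "int \<Rightarrow> nat"
  assumes "c < d" "\<nu> d < \<nu> c"
  shows "\<exists>y. c \<le> y \<and> y < d \<and> \<nu> (y + 1) < \<nu> y"
proof (rule ccontr)
  assume "\<not> ?thesis"
  then have *: "\<nu> y \<le> \<nu> (y + 1)" if "c \<le> y" "y < d" for y using that not_less by blast
  have "\<nu> c \<le> \<nu> (c + int k)" if "c + int k \<le> d" for k
    using that
  proof (induction k)
    case (Suc k)
    have "c + int k < d" using Suc.prems by simp
    then have "\<nu> (c + int k) \<le> \<nu> (c + int k + 1)" by (intro *) simp_all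
    with Suc show ?case by (simp add: algebra_simps)
  qed simp
  from this[of "nat (d - c)"] assms show False by simp
qed

text \<open>Two lattice words ending in different letters \<open>c < d\<close> are connected through words ending in
  \<open>y d c\<close> and \<open>y c d\<close> for a suitable \<open>y\<close> with \<open>c \<le> y < d\<close>, which differ by a Knuth move.\<close>

lemma lattice_linked:
  assumes "lattice N u" "lattice N v" "count_list u = count_list v"
  shows "linked N u v"
  using assms
proof (induction "length u" arbitrary: u v)
  case 0
  then have "u = []" by simp
  moreover from this have "v = []" using 0(4) by (cases v) (auto dest: fun_cong[of _ _ "hd v"])
  ultimately show ?case by (simp add: linked_refl)
next
  case (Suc l)
  have len: "length x = length y" if "count_list x = count_list y" for x y :: "int list"
    using sum_count_set[of x "set x \<union> set y"] sum_count_set[of y "set x \<union> set y"] that by simp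
  have goal: "linked N (x @ [c]) (y @ [d])"
    if xy: "lattice N (x @ [c])" "lattice N (y @ [d])" "count_list (x @ [c]) = count_list (y @ [d])"
      "length x = l" "c \<le> d" for x y c d
  proof (cases "c = d")
    case True
    have "count_list x = count_list y" using xy(3) True by (auto simp: fun_eq_iff)
    then have "linked N x y" using Suc.hyps(1)[of x y] xy lattice_snoc by auto
    then show ?thesis using True linked_append_right by blast
  next
    case False
    then have cd: "c < d" using xy by simp
    define \<kappa> where "\<kappa> = count_list (x @ [c])"
    have \<kappa>: "dominant N \<kappa>" using lattice_dominant xy(1) \<kappa>_def by simp
    have cx: "count_list x = \<kappa>(c := \<kappa> c - 1)" and cy: "count_list y = \<kappa>(d := \<kappa> d - 1)"
      using xy(3) by (auto simp: \<kappa>_def fun_eq_iff)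
    have dx: "dominant N (count_list x)" and dy: "dominant N (count_list y)"
      using lattice_dominant xy(1,2) lattice_snoc by auto
    have c1: "1 \<le> c" "1 \<le> d" "d \<le> int N" using xy(1,2) lattice_snoc by auto
    have pos: "\<kappa> c > 0" "\<kappa> d > 0" using fun_cong[OF xy(3), of d] by (simp_all add: \<kappa>_def)
    have dc: "\<kappa> (c + 1) < \<kappa> c"
    proof -
      have "count_list x (c + 1) \<le> count_list x c" using dx c1 by (simp add: dominant_def)
      then show ?thesis using pos by (simp add: cx)
    qed
    have dd: "\<kappa> (d + 1) < \<kappa> d"
    proof -
      have "count_list y (d + 1) \<le> count_list y d" using dy c1 by (simp add: dominant_def)
      then show ?thesis using pos by (simp add: cy)
    qed
    define \<nu> where "\<nu> = \<kappa>(c := \<kappa> c - 1, d := \<kappa> d - 1)"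
    have xd: "count_list x (d + 1) < count_list x d" using dd cd by (simp add: cx)
    have yc: "count_list y (c + 1) < count_list y c" using dc cd pos by (auto simp: cy)
    have \<nu>x: "\<nu> = (count_list x)(d := count_list x d - 1)" using cd by (auto simp: \<nu>_def cx)
    have \<nu>y: "\<nu> = (count_list y)(c := count_list y c - 1)" using cd by (auto simp: \<nu>_def cy)
    have \<nu>: "dominant N \<nu>" unfolding \<nu>x by (rule dominant_remove_corner[OF dx xd])
    \<comment> \<open>Dominance between \<open>c + 1\<close> and \<open>d\<close>, together with the
      corner at \<open>c\<close>, shows that \<open>\<nu>\<close> drops strictly somewhere from
      \<open>c\<close> to \<open>d\<close>. Such a drop is a corner of \<open>\<nu>\<close> and
      supplies the letter \<open>z\<close>.\<close>
    have mono: "\<kappa> d \<le> \<kappa> (c + 1)"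
    proof -
      have "\<kappa> (c + 1 + int k) \<le> \<kappa> (c + 1)" for k
      proof (induction k)
        case (Suc k)
        have "\<kappa> (c + 1 + int k + 1) \<le> \<kappa> (c + 1 + int k)"
          by (rule \<kappa>[unfolded dominant_def, THEN conjunct2, rule_format]) (use c1 in simp)
        with Suc show ?case by (simp add: algebra_simps)
      qed simp
      from this[of "nat (d - c - 1)"] cd show ?thesis by simp
    qed
    have "\<nu> d < \<nu> c" using mono dc pos cd by (simp add: \<nu>_def)
    then obtain z where z: "c \<le> z" "z < d" "\<nu> (z + 1) < \<nu> z" using strict_drop cd by blast
    obtain a where a: "lattice N a" "count_list a = \<nu>(z := \<nu> z - 1)"
      using lattice_exists dominant_remove_corner[OF \<nu> z(3)] by blast
    have az: "lattice N (a @ [z])" "count_list (a @ [z]) = \<nu>"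
      using lattice_add_corner[OF \<nu> a] z c1 by auto
    have azd: "lattice N ((a @ [z]) @ [d])" "count_list ((a @ [z]) @ [d]) = count_list x"
      using lattice_add_corner[OF dx az(1)] az(2) \<nu>x c1 xd by auto
    have azc: "lattice N ((a @ [z]) @ [c])" "count_list ((a @ [z]) @ [c]) = count_list y"
      using lattice_add_corner[OF dy az(1)] az(2) \<nu>y c1 yc by auto
    have "linked N x ((a @ [z]) @ [d])"
      using Suc.hyps(1)[of x] xy azd lattice_snoc by auto
    then have 1: "linked N (x @ [c]) (a @ [z, d, c])" using linked_append_right by fastforce
    have "length y = l" using len[OF xy(3)] xy(4) by simp
    then have "linked N y ((a @ [z]) @ [c])"
      using Suc.hyps(1)[of y] xy azc lattice_snoc by auto
    then have 2: "linked N (y @ [d]) (a @ [z, c, d])" using linked_append_right by fastforce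
    have "([z, d, c], [z, c, d]) \<in> knuth" using z by (auto simp: knuth_def)
    then have "linked N (a @ [z, d, c]) (a @ [z, c, d])"
      by (intro linked_append_left linked_knuth)
    with 1 2 show ?thesis by (meson linked_sym linked_trans)
  qed
  obtain x c where u: "u = x @ [c]" using Suc.hyps(2) by (cases u rule: rev_cases) auto
  obtain y d where v: "v = y @ [d]"
    using Suc.hyps(2) len[OF Suc.prems(3)] by (cases v rule: rev_cases) auto
  show ?case
  proof (cases "c \<le> d")
    case True
    then show ?thesis using goal[of x c y d] Suc.prems Suc.hyps(2) by (simp add: u v)
  next
    case False
    then have "linked N (y @ [d]) (x @ [c])"
      using goal[of y d x c] Suc.prems Suc.hyps(2) len[OF Suc.prems(3)] by (simp add: u v)
    then show ?thesis unfolding u v by (rule linked_sym)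
  qed
qed

section \<open>Strings, padding and stretching\<close>

lemma count_list_replicate: "count_list (replicate k x) y = (if x = y then k else 0)"
  by (induction k) auto

lemma count_list_distinct: "distinct w \<Longrightarrow> count_list w x = (if x \<in> set w then 1 else 0)"
  by (induction w) auto

lemma f_path_singleton:
  assumes "seminormal B" "set J \<subseteq> cr_index B"
  shows "f_path (tensor_f B) J [b] = map_option (\<lambda>x. [x]) (f_path (cr_f B) J b)"
  using assms(2)
proof (induction J)
  case (Cons j J)
  then show ?case
    using tensor_f_singleton[OF assms(1), of j] by (cases "f_path (cr_f B) J b") auto
qed simp

lemma f_path_pad:
  assumes sn: "seminormal B" and J: "set J \<subseteq> cr_index B"
    and P: "\<And>j. j \<in> cr_index B \<Longrightarrow> tensor_eps B j P = 0"
      "\<And>j. j \<in> cr_index B \<Longrightarrow> tensor_phi B j P = 0"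
  shows "f_path (tensor_f B) J (w @ P) = map_option (\<lambda>w. w @ P) (f_path (tensor_f B) J w)"
  using J
proof (induction J)
  case (Cons j J)
  then have j: "j \<in> cr_index B" by simp
  note S = seminormalD(1)[OF seminormal_tensor[OF sn], simplified, OF j]
  have "tensor_f B j (v @ P) = map_option (\<lambda>w. w @ P) (tensor_f B j v)" for v
    using P[OF j] S[of v] S[of P] by (simp add: tensor_f_append)
  then show ?case using Cons by (cases "f_path (tensor_f B) J w") auto
qed simp

lemma string_exists:
  assumes sn: "seminormal B" and i: "i \<in> cr_index B"
  shows "k \<le> cr_phi B i b \<Longrightarrow> \<exists>b'. f_path (cr_f B) (replicate k i) b = Some b'"
proof (induction k)
  case (Suc k)
  then obtain b1 where b1: "f_path (cr_f B) (replicate k i) b = Some b1" by auto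
  have "cr_phi B i b = cr_phi B i b1 + k"
  proof (cases "k = 0")
    case False
    then show ?thesis using f_path_eps_phi[OF sn _ _ b1, of i] i by (simp add: count_list_replicate)
  qed (use b1 in simp)
  then show ?case using Suc.prems seminormalD(1)[OF sn i, of b1] b1 by (cases "cr_f B i b1") auto
qed simp

lemma tensor_replicate_phi_0:
  "cr_phi B i b = 0 \<Longrightarrow> tensor_phi B i (replicate k b) = 0 \<and> tensor_eps B i (replicate k b) = k * cr_eps B i b"
  by (induction k) auto

lemma tensor_replicate_eps_0:
  "cr_eps B i b = 0 \<Longrightarrow> tensor_eps B i (replicate k b) = 0 \<and> tensor_phi B i (replicate k b) = k * cr_phi B i b"
  by (induction k) auto

text \<open>With \<open>cr_eps\<close> zero, the copies further right contribute no minus, so the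
  leftmost untouched copy absorbs its complete string; once exhausted it has \<open>cr_phi\<close>
  zero and passes the next operators on. Lowerings are counted in whole strings of length
  \<open>cr_phi B i b\<close>.\<close>

lemma full_string_replicate:
  assumes sn: "seminormal B" and i: "i \<in> cr_index B"
    and e: "cr_eps B i b = 0" and f: "f_path (cr_f B) (replicate (cr_phi B i b) i) b = Some b'"
    and q: "q \<le> k"
  shows "f_path (tensor_f B) (replicate (cr_phi B i b * q) i) (replicate k b) =
     Some (replicate q b' @ replicate (k - q) b)"
  using q
proof (induction q)
  case (Suc q)
  let ?d = "cr_phi B i b" and ?J = "replicate (cr_phi B i b) i"
  have J: "set ?J \<subseteq> cr_index B" using i by auto
  have ind: "indep B j j'" if "j \<in> set ?J" "j' \<in> set ?J" "j \<noteq> j'" for j j'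
    using that by simp
  have phi': "cr_phi B i b' = 0"
  proof (cases "?d = 0")
    case False
    then show ?thesis using f_path_eps_phi[OF sn J ind f, of i] by (simp add: count_list_replicate)
  qed (use f in simp)
  have "f_path (tensor_f B) (replicate (?d * Suc q) i) (replicate k b) =
    Option.bind (f_path (tensor_f B) (replicate (?d * q) i) (replicate k b)) (f_path (tensor_f B) ?J)"
    by (simp add: replicate_add f_path_append)
  also have "\<dots> = f_path (tensor_f B) ?J (replicate q b' @ ([b] @ replicate (k - Suc q) b))"
    using Suc by (simp add: Suc_diff_Suc flip: replicate_Suc)
  also have "\<dots> = map_option ((@) (replicate q b')) (f_path (tensor_f B) ?J ([b] @ replicate (k - Suc q) b))"
    by (rule f_path_tensor_append(2)[OF sn J ind]) (use phi' in \<open>simp_all add: tensor_replicate_phi_0\<close>)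
  also have "f_path (tensor_f B) ?J ([b] @ replicate (k - Suc q) b) =
      map_option (\<lambda>u. u @ replicate (k - Suc q) b) (f_path (tensor_f B) ?J [b])"
    by (rule f_path_tensor_append(1)[OF sn J ind])
      (use e in \<open>simp_all add: tensor_replicate_eps_0 count_list_replicate\<close>)
  also have "f_path (tensor_f B) ?J [b] = Some [b']"
    using f_path_singleton[OF sn J] f by simp
  finally show ?case by (simp add: replicate_append_same)
qed simp

definition stretch :: "nat \<Rightarrow> 'a list \<Rightarrow> 'a list" where
  "stretch m w = concat (map (replicate m) w)"

lemma virtual_indices_replicate:
  "m > 0 \<Longrightarrow> i \<in> cr_index B \<Longrightarrow> virtual_indices B (replicate m) (\<lambda>_. m) i"
  by (simp add: virtual_indices_def count_list_replicate)

text \<open>Strings of letters have length at most one, so \<open>m\<close> lowerings of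
  \<open>m\<close> equal letters turn all of them.\<close>

lemma aligned_stretch_letter:
  assumes sn: "seminormal (letter_crystal I mark act)" and m: "m > 0"
  shows "aligned (letter_crystal I mark act) (letter_crystal I mark act) (replicate m) (\<lambda>_. m) UNIV (replicate m)"
proof -
  let ?L = "letter_crystal I mark act"
  have "tensor_eps ?L i (replicate m x) = m * cr_eps ?L i x \<and>
     tensor_phi ?L i (replicate m x) = m * cr_phi ?L i x" for i x
    by (cases "mark i x = Some Plus")
      (simp_all add: tensor_replicate_phi_0 tensor_replicate_eps_0)
  moreover have "f_path (tensor_f ?L) (replicate m i) (replicate m x) = Some (replicate m (act i x))"
    if "i \<in> I" "mark i x = Some Plus" for i x
    using full_string_replicate[OF sn, of i x "act i x" m m] that by simp
  ultimately show ?thesis using m by (auto simp: aligned_def)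
qed

lemma aligned_stretch:
  assumes sn: "seminormal (letter_crystal I mark act)" and m: "m > 0"
  shows "aligned (tensor_crystal (letter_crystal I mark act)) (letter_crystal I mark act)
    (replicate m) (\<lambda>_. m) UNIV (stretch m)"
proof -
  have "aligned (tensor_crystal (letter_crystal I mark act)) (letter_crystal I mark act)
    (replicate m) (\<lambda>_. m) (lists UNIV) (\<lambda>bs. concat (map (replicate m) bs))"
    by (rule aligned_tensor[OF aligned_stretch_letter[OF assms] sn])
      (use m in \<open>auto intro: virtual_indices_replicate\<close>)
  then show ?thesis by (simp add: stretch_def[abs_def])
qed

lemma count_list_concat: "count_list (concat xss) x = sum_list (map (\<lambda>xs. count_list xs x) xss)"
  by (induction xss) auto

lemma count_list_stretch: "count_list (stretch m w) x = m * count_list w x"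
  by (induction w) (auto simp: stretch_def count_list_replicate)

lemma count_list_flat_replicate: "count_list (flat (replicate m T)) x = m * count_list (reading T) x"
  by (induction m) auto

lemma set_stretch: "set (stretch m w) \<subseteq> set w"
  by (auto simp: stretch_def)

section \<open>The embedding on letters\<close>

text \<open>The order isomorphism from the type C alphabet onto \<open>1, ..., 2n\<close>.\<close>

definition hat :: "nat \<Rightarrow> int \<Rightarrow> int" where
  "hat n x = (if 0 < x then x else 2 * int n + 1 + x)"

definition cocol :: "nat \<Rightarrow> int \<Rightarrow> int list" where
  "cocol N c = filter (\<lambda>y. y \<noteq> c) [1..int N]"

text \<open>The reading of a two-column tableau of heights \<open>2n - 1\<close> and 1: the short
  column stands on the right and is read first.\<close>

definition E_letter :: "nat \<Rightarrow> int \<Rightarrow> int list" where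
  "E_letter n x = hat n x # cocol (2 * n) (hat n (- x))"

definition E_word :: "nat \<Rightarrow> int list \<Rightarrow> int list" where
  "E_word n w = concat (map (E_letter n) w)"

definition E_index :: "nat \<Rightarrow> nat \<Rightarrow> nat list" where
  "E_index n i = (if i < n then [i, 2 * n - i] else [n, n])"

definition E_mult :: "nat \<Rightarrow> nat \<Rightarrow> nat" where
  "E_mult n i = (if i < n then 1 else 2)"

lemma f_E_path: "f_E n g i = f_path g (E_index n i)"
  by (simp add: f_E_def E_index_def fun_eq_iff)

lemma no_marks:
  "(\<And>x. x \<in> set w \<Longrightarrow> mark i x = None) \<Longrightarrow>
     tensor_eps (letter_crystal I mark act) i w = 0 \<and> tensor_phi (letter_crystal I mark act) i w = 0
     \<and> tensor_f (letter_crystal I mark act) i w = None"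
  by (induction w) auto

lemma upto_split:
  assumes "1 \<le> i" "i \<le> N - 1"
  shows "[1..int N] = [1..int i - 1] @ [int i, int i + 1] @ [int i + 2..int N]"
proof -
  have "[1..int N] = [1..int i - 1] @ [int i..int N]" using assms by (intro upto_split1) auto
  also have "[int i..int N] = int i # (int i + 1) # [int i + 2..int N]"
    using assms upto_rec1[of "int i" "int N"] upto_rec1[of "int i + 1" "int N"]
    by (simp add: add.commute[of 2])
  finally show ?thesis by simp
qed

text \<open>If the omitted letter is neither \<open>i\<close> nor \<open>i + 1\<close>, both occur
  and cancel; omitting \<open>i\<close> leaves a minus, omitting \<open>i + 1\<close> a plus, and
  lowering moves the gap from \<open>i + 1\<close> to \<open>i\<close>.\<close>

lemma cocol:
  assumes i: "i \<in> {1..N - 1}"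
  shows "tensor_eps (word_A N) i (cocol N c) = (if c = int i then 1 else 0)"
    and "tensor_phi (word_A N) i (cocol N c) = (if c = int i + 1 then 1 else 0)"
    and "tensor_f (word_A N) i (cocol N (int i + 1)) = Some (cocol N (int i))"
proof -
  define A where "A = (\<lambda>c. filter (\<lambda>y. y \<noteq> c) [1..int i - 1])"
  define B where "B = (\<lambda>c. filter (\<lambda>y. y \<noteq> c) [int i + 2..int N])"
  have split: "cocol N c = A c @ filter (\<lambda>y. y \<noteq> c) [int i, int i + 1] @ B c" for c
    unfolding cocol_def A_def B_def filter_append[symmetric] using upto_split[of i N] i by simp
  have 0: "tensor_eps (word_A N) i (A c) = 0 \<and> tensor_phi (word_A N) i (A c) = 0 \<and> tensor_f (word_A N) i (A c) = None"
    "tensor_eps (word_A N) i (B c) = 0 \<and> tensor_phi (word_A N) i (B c) = 0 \<and> tensor_f (word_A N) i (B c) = None" for c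
    unfolding word_A_def by (rule no_marks; auto simp: A_def B_def mark_A_def)+
  show "tensor_eps (word_A N) i (cocol N c) = (if c = int i then 1 else 0)"
    "tensor_phi (word_A N) i (cocol N c) = (if c = int i + 1 then 1 else 0)"
    by (simp_all add: split tensor_eps_append tensor_phi_append 0 mark_A_def)
  have "A (int i) = A (int i + 1)" "B (int i) = B (int i + 1)"
    by (auto simp: A_def B_def intro!: filter_cong)
  then show "tensor_f (word_A N) i (cocol N (int i + 1)) = Some (cocol N (int i))"
    by (simp add: split tensor_f_append tensor_eps_append tensor_phi_append 0 mark_A_def)
qed

lemma virtual_indices_E:
  assumes "1 \<le> i" "i \<le> n"
  shows "virtual_indices (word_A (2 * n)) (E_index n) (E_mult n) i"
  using assms by (auto simp: virtual_indices_def E_index_def E_mult_def intro!: indep_A)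

text \<open>For \<open>i < n\<close> one of the two operators changes the single letter and the
  other moves the gap of the long column; which does which depends on the sign of \<open>x\<close>.
  For \<open>i = n\<close> both pluses belong to the same index, one from the letter and one from
  the column, whence the factor 2.\<close>

lemma aligned_E_letter:
  "aligned (word_C n) (word_A (2 * n)) (E_index n) (E_mult n) (letters_C n) (E_letter n)"
proof -
  have "(\<forall>j\<in>set (E_index n i).
       tensor_eps (word_A (2 * n)) j (E_letter n x) = E_mult n i * cr_eps (word_C n) i x \<and>
       tensor_phi (word_A (2 * n)) j (E_letter n x) = E_mult n i * cr_phi (word_C n) i x) \<and>
     (mark_C n i x = Some Plus \<longrightarrow> act_C n i x \<in> letters_C n \<and>
       f_path (tensor_f (word_A (2 * n))) (E_index n i) (E_letter n x) = Some (E_letter n (act_C n i x)))"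
    if i: "1 \<le> i" "i \<le> n" and x: "x \<in> letters_C n" for i x
  proof (cases "i < n")
    case True
    have j: "i \<in> {1..2 * n - 1}" "2 * n - i \<in> {1..2 * n - 1}" using i by auto
    have x': "x \<noteq> 0" "- int n \<le> x" "x \<le> int n" using x by (auto simp: letters_C_def)
    have r: "int (2 * n - i) = 2 * int n - int i" using i by simp
    have "f_path (tensor_f (word_A (2 * n))) (E_index n i) (E_letter n x) = Some (E_letter n (act_C n i x))"
      if "mark_C n i x = Some Plus"
    proof -
      from that True consider "x = int i" | "x = - (int i + 1)"
        by (auto simp: mark_C_def split: if_splits)
      then show ?thesis
      proof cases
        case 1
        have c: "cocol (2 * n) (2 * int n + 1 - int i) = cocol (2 * n) (int (2 * n - i) + 1)"
          unfolding r by (simp add: algebra_simps)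
        show ?thesis using 1 True i cocol[OF j(1)] cocol[OF j(2)]
          by (simp add: E_index_def E_letter_def hat_def act_C_def mark_A_def c r algebra_simps)
      next
        case 2
        have h: "hat n x = int (2 * n - i)" "hat n (- x) = int i + 1"
          "hat n (act_C n i x) = int (2 * n - i) + 1" "hat n (- act_C n i x) = int i"
          using 2 True i by (auto simp: hat_def act_C_def)
        show ?thesis using True i cocol[OF j(1)] cocol[OF j(2)]
          by (simp add: E_index_def E_letter_def h mark_A_def)
      qed
    qed
    moreover have "act_C n i x \<in> letters_C n" if "mark_C n i x = Some Plus"
      using that True i by (auto simp: mark_C_def act_C_def letters_C_def split: if_splits)
    ultimately show ?thesis
      using True i x' cocol(1,2)[OF j(1)] cocol(1,2)[OF j(2)]
      by (auto simp: E_index_def E_mult_def E_letter_def hat_def mark_A_def mark_C_def r)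
  next
    case False
    then have [simp]: "i = n" using i by simp
    have j: "n \<in> {1..2 * n - 1}" using i by auto
    have x': "x \<noteq> 0" "- int n \<le> x" "x \<le> int n" using x by (auto simp: letters_C_def)
    have c: "cocol (2 * n) (1 + int n) = cocol (2 * n) (int n + 1)" by (simp add: algebra_simps)
    show ?thesis
      using x' cocol[OF j] i
      by (auto simp: E_index_def E_mult_def E_letter_def hat_def mark_A_def mark_C_def act_C_def letters_C_def c)
  qed
  then show ?thesis by (auto simp: aligned_def)
qed

lemma aligned_E_word:
  "aligned (tensor_crystal (word_C n)) (word_A (2 * n)) (E_index n) (E_mult n) (lists (letters_C n)) (E_word n)"
  unfolding E_word_def[abs_def]
  by (rule aligned_tensor[OF aligned_E_letter seminormal_A]) (auto intro!: virtual_indices_E)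

lemma E_letter_inj:
  assumes "x \<in> letters_C n" "y \<in> letters_C n" "E_letter n x = E_letter n y"
  shows "x = y"
  using assms by (auto simp: E_letter_def hat_def letters_C_def split: if_splits)

lemma length_E_letter:
  assumes "x \<in> letters_C n"
  shows "length (E_letter n x) = 2 * n"
proof -
  have hx: "hat n (- x) \<in> {1..2 * int n}" using assms by (auto simp: letters_C_def hat_def)
  have "length (filter (\<lambda>y. y \<noteq> hat n (- x)) [1..2 * int n]) = 2 * n - 1"
  proof -
    let ?w = "filter (\<lambda>y. y \<noteq> hat n (- x)) [1..2 * int n]"
    have "length ?w = card (set ?w)" by (intro distinct_card[symmetric] distinct_filter) simp
    also have "set ?w = {1..2 * int n} - {hat n (- x)}" by auto
    finally show ?thesis using hx by simp
  qed
  then show ?thesis using assms by (auto simp: E_letter_def cocol_def letters_C_def)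
qed

lemma E_word_inj:
  assumes "set u \<subseteq> letters_C n" "set v \<subseteq> letters_C n" "length u = length v" "E_word n u = E_word n v"
  shows "u = v"
  using assms(3,1,2,4)
  by (induction u v rule: list_induct2) (auto simp: E_word_def length_E_letter dest: E_letter_inj)

text \<open>Among \<open>1, ..., 2n\<close> the letter \<open>hat n x\<close> occurs twice,
  \<open>hat n (- x)\<close> never and every other letter once; the equation is additive to stay
  within the naturals.\<close>

lemma count_E_letter:
  assumes "x \<in> letters_C n" "y \<in> {1..2 * int n}"
  shows "count_list (E_letter n x) y + (if hat n (- x) = y then 1 else 0) = (if hat n x = y then 1 else 0) + 1"
proof -
  have "count_list (filter P xs) z = (if P z then count_list xs z else 0)" for P xs and z :: int
    by (induction xs) auto
  moreover have "count_list [1..2 * int n] y = 1" using assms(2) by (simp add: count_list_distinct)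
  ultimately show ?thesis by (auto simp: E_letter_def cocol_def)
qed

section \<open>Highest weight tableaux\<close>

definition col_height :: "weight \<Rightarrow> nat \<Rightarrow> nat" where
  "col_height \<mu> c = card {i. int c \<le> \<mu> i}"

lemma col_heights_eq: "col_heights \<mu> = map (col_height \<mu>) [1..<Suc (nat (\<mu> 1))]"
  by (simp add: col_heights_def col_height_def[abs_def])

text \<open>The rows that reach column \<open>c\<close> form an initial segment, so conjugating the
  partition turns conditions on entries into conditions on heights.\<close>

lemma le_col_height_iff:
  assumes "is_partition N \<mu>" "1 \<le> c"
  shows "int c \<le> \<mu> i \<longleftrightarrow> 1 \<le> i \<and> i \<le> col_height \<mu> c"
proof -
  let ?S = "{i. int c \<le> \<mu> i}"
  have sub: "?S \<subseteq> {1..N}"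
  proof
    fix i assume "i \<in> ?S"
    then have "\<mu> i \<noteq> 0" using assms(2) by auto
    then show "i \<in> {1..N}" using assms(1) unfolding is_partition_def by blast
  qed
  then have fin: "finite ?S" using finite_subset by blast
  have down: "j \<in> ?S" if "i \<in> ?S" "1 \<le> j" "j \<le> i" for i j
  proof -
    have "\<mu> i \<le> \<mu> j" using that sub assms(1) unfolding is_partition_def by (metis atLeastAtMost_iff subsetD)
    then show ?thesis using that by simp
  qed
  have S: "?S = {1..card ?S}"
  proof (cases "?S = {}")
    case False
    have "?S = {1..Max ?S}"
    proof (intro equalityI subsetI)
      fix i assume i: "i \<in> ?S"
      then show "i \<in> {1..Max ?S}" using Max_ge[OF fin i] subsetD[OF sub i] by simp
    next
      fix i assume "i \<in> {1..Max ?S}"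
      then show "i \<in> ?S" by (intro down[OF Max_in[OF fin False]]) simp_all
    qed
    then have "card ?S = Max ?S" using card_atLeastAtMost[of 1 "Max ?S"] by simp
    with \<open>?S = {1..Max ?S}\<close> show ?thesis by simp
  qed simp
  have "i \<in> ?S \<longleftrightarrow> i \<in> {1..col_height \<mu> c}" using S unfolding col_height_def by metis
  then show ?thesis by simp
qed

lemma partition_nonneg: "is_partition N \<mu> \<Longrightarrow> 0 \<le> \<mu> i"
  by (simp add: is_partition_def)

lemma partition_le_first:
  assumes "is_partition N \<mu>"
  shows "\<mu> i \<le> \<mu> 1"
proof (cases "i \<in> {1..N}")
  case True
  then show ?thesis using assms unfolding is_partition_def by (metis atLeastAtMost_iff le_refl)
next
  case False
  then have "\<mu> i = 0" using assms unfolding is_partition_def by blast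
  then show ?thesis using partition_nonneg[OF assms] by simp
qed

lemma partition_outside: "is_partition N \<mu> \<Longrightarrow> i \<notin> {1..N} \<Longrightarrow> \<mu> i = 0"
  unfolding is_partition_def by blast

lemma col_height_le:
  assumes "is_partition N \<mu>" "1 \<le> c"
  shows "col_height \<mu> c \<le> N"
proof (rule ccontr)
  assume *: "\<not> ?thesis"
  then have "int c \<le> \<mu> (col_height \<mu> c)" using le_col_height_iff[OF assms] by simp
  then have "\<mu> (col_height \<mu> c) \<noteq> 0" using assms(2) by auto
  then show False using partition_outside[OF assms(1), of "col_height \<mu> c"] * by auto
qed

lemma highest_eq: "highest \<mu> = map (\<lambda>c. map int [1..<Suc (col_height \<mu> c)]) [1..<Suc (nat (\<mu> 1))]"
  by (simp add: highest_def col_heights_eq)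

lemma map_length_highest: "map length (highest \<mu>) = col_heights \<mu>"
  by (simp add: highest_def comp_def del: upt_Suc)

lemma count_list_column: "count_list (map int [1..<Suc h]) x = (if 1 \<le> x \<and> x \<le> int h then 1 else 0)"
proof -
  have "x \<in> int ` {1..<Suc h} \<longleftrightarrow> 1 \<le> x \<and> x \<le> int h"
    by (auto intro!: image_eqI[of _ _ "nat x"])
  then show ?thesis by (subst count_list_distinct) (auto simp: distinct_map simp del: upt_Suc)
qed

lemma sum_list_threshold:
  "sum_list (map (\<lambda>c. if int c \<le> k then 1 else 0) [1..<Suc M]) = min (nat k) M"
  for k :: int
  by (induction M) auto

lemma count_list_highest:
  assumes "is_partition N \<mu>"
  shows "count_list (reading (highest \<mu>)) x = (if 0 \<le> x then nat (\<mu> (nat x)) else 0)"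
proof -
  have "count_list (reading (highest \<mu>)) x =
      sum_list (map (\<lambda>c. if 1 \<le> x \<and> x \<le> int (col_height \<mu> c) then 1 else 0) [1..<Suc (nat (\<mu> 1))])"
    unfolding reading_def count_list_concat highest_eq rev_map[symmetric] sum_list_rev map_map comp_def
      count_list_column by (rule refl)
  also have "\<dots> = sum_list (map (\<lambda>c. if 0 \<le> x \<and> int c \<le> \<mu> (nat x) then 1 else 0) [1..<Suc (nat (\<mu> 1))])"
  proof (intro arg_cong[of _ _ sum_list] map_cong refl if_cong)
    fix c assume "c \<in> set [1..<Suc (nat (\<mu> 1))]"
    then have "1 \<le> c" by (simp only: set_upt atLeastLessThan_iff)
    from le_col_height_iff[OF assms this, of "nat x"]
    show "(1 \<le> x \<and> x \<le> int (col_height \<mu> c)) = (0 \<le> x \<and> int c \<le> \<mu> (nat x))"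
      by (cases "1 \<le> x") (auto simp: nat_le_iff)
  qed
  also have "\<dots> = (if 0 \<le> x then nat (\<mu> (nat x)) else 0)"
    using sum_list_threshold[of "\<mu> (nat x)" "nat (\<mu> 1)"] partition_le_first[OF assms, of "nat x"]
    by (simp add: min_absorb1 nat_mono del: upt_Suc)
  finally show ?thesis .
qed

lemma lattice_column: "h \<le> N \<Longrightarrow> lattice N (map int [1..<Suc h])"
proof (induction h)
  case (Suc h)
  have "map int [1..<Suc (Suc h)] = map int [1..<Suc h] @ [int (Suc h)]" by simp
  then show ?case
    using Suc count_list_column[of h] by (auto simp: lattice_snoc simp del: upt_Suc)
qed (simp add: lattice_def)

lemma tensor_eps_concat_0:
  "(\<And>w. w \<in> set ws \<Longrightarrow> tensor_eps B i w = 0) \<Longrightarrow> tensor_eps B i (concat ws) = 0"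
  by (induction ws) (auto simp: tensor_eps_append)

lemma lattice_concat: "(\<And>w. w \<in> set ws \<Longrightarrow> lattice N w) \<Longrightarrow> lattice N (concat ws)"
  unfolding lattice_def by (auto intro!: tensor_eps_concat_0)

lemma lattice_append: "lattice N u \<Longrightarrow> lattice N v \<Longrightarrow> lattice N (u @ v)"
  using lattice_concat[of "[u, v]" N] by auto

lemma lattice_highest:
  assumes "is_partition N \<mu>"
  shows "lattice N (reading (highest \<mu>))"
  unfolding reading_def
proof (rule lattice_concat)
  fix w assume "w \<in> set (rev (highest \<mu>))"
  then obtain c where c: "w = map int [1..<Suc (col_height \<mu> c)]" "c \<in> set [1..<Suc (nat (\<mu> 1))]"
    by (auto simp only: highest_eq set_rev set_map)
  then have "1 \<le> c" by (simp only: set_upt atLeastLessThan_iff)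
  then show "lattice N w" unfolding c(1) by (intro lattice_column col_height_le[OF assms])
qed

lemma tensor_eps_phi_cong:
  assumes "\<And>x. x \<in> set w \<Longrightarrow> cr_eps B i x = cr_eps B' j x \<and> cr_phi B i x = cr_phi B' j x"
  shows "tensor_eps B i w = tensor_eps B' j w \<and> tensor_phi B i w = tensor_phi B' j w"
  using assms by (induction w) auto

text \<open>Without barred letters the type C signature for \<open>i < n\<close> is the type A one,
  and for \<open>i = n\<close> there is no minus at all.\<close>

lemma highest_C:
  assumes "is_partition n \<mu>"
  shows "set (reading (highest \<mu>)) \<subseteq> {1..int n}"
    and "i \<in> {1..n} \<Longrightarrow> tensor_eps (word_C n) i (reading (highest \<mu>)) = 0"
proof -
  let ?w = "reading (highest \<mu>)"
  show sub: "set ?w \<subseteq> {1..int n}" using lattice_highest[OF assms] by (simp add: lattice_def)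
  assume i: "i \<in> {1..n}"
  show "tensor_eps (word_C n) i ?w = 0"
  proof (cases "i < n")
    case True
    have "tensor_eps (word_C n) i ?w = tensor_eps (word_A n) i ?w"
      by (rule tensor_eps_phi_cong[THEN conjunct1]) (use sub True i in \<open>auto simp: mark_C_def mark_A_def\<close>)
    then show ?thesis using lattice_highest[OF assms] True i by (simp add: lattice_def)
  next
    case False
    have *: "mark_C n i x \<noteq> Some Minus" if "x \<in> set ?w" for x
      using False sub that by (auto simp: mark_C_def)
    have "tensor_eps (word_C n) i v = 0" if "set v \<subseteq> set ?w" for v
      using that * by (induction v) auto
    then show ?thesis by simp
  qed
qed

section \<open>The lifted partition\<close>

text \<open>A pair of columns of heights \<open>h\<close> and \<open>2n - h\<close> with
  \<open>h \<le> n\<close> meets row \<open>i \<le> n\<close> once, and once more if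
  \<open>i \<le> h\<close>; it meets row \<open>2n + 1 - i\<close> once unless
  \<open>i \<le> h\<close>. Summation over the \<open>\<mu> 1\<close> columns gives
  \<open>\<mu> 1\<close> plus or minus an entry of \<open>\<mu>\<close>.\<close>

lemma lift_A_eq:
  assumes "is_partition n \<mu>"
  shows "i \<in> {1..n} \<Longrightarrow> lift_A n \<mu> i = \<mu> 1 + \<mu> i"
    and "i \<in> {n + 1..2 * n} \<Longrightarrow> lift_A n \<mu> i = \<mu> 1 - \<mu> (2 * n + 1 - i)"
    and "i \<notin> {1..2 * n} \<Longrightarrow> lift_A n \<mu> i = 0"
proof -
  have hn: "col_height \<mu> c \<le> n" if "1 \<le> c" for c using col_height_le[OF assms that] .
  have sum: "sum_list (map (\<lambda>c. if int c \<le> k then 1 else 0) [1..<Suc M]) = min (max 0 k) (int M)"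
    for k :: int and M by (induction M) auto
  have mu1: "int (nat (\<mu> 1)) = \<mu> 1" using partition_nonneg[OF assms] by simp
  have eq: "lift_A n \<mu> i = sum_list (map (\<lambda>c. Lam (col_height \<mu> c) i + Lam (2 * n - col_height \<mu> c) i) [1..<Suc (nat (\<mu> 1))])" for i
    by (simp add: lift_A_def col_heights_eq comp_def del: upt_Suc)
  have ge: "1 \<le> i \<and> i \<le> col_height \<mu> c \<longleftrightarrow> int c \<le> \<mu> i" if "1 \<le> c" for c i
    using le_col_height_iff[OF assms that] by simp
  show "lift_A n \<mu> i = \<mu> 1 + \<mu> i" if i: "i \<in> {1..n}"
  proof -
    have "lift_A n \<mu> i = sum_list (map (\<lambda>c. (if int c \<le> \<mu> i then 1 else 0) + 1) [1..<Suc (nat (\<mu> 1))])"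
      unfolding eq
    proof (intro arg_cong[of _ _ sum_list] map_cong refl)
      fix c assume "c \<in> set [1..<Suc (nat (\<mu> 1))]"
      then have "1 \<le> c" by (simp only: set_upt atLeastLessThan_iff)
      then show "Lam (col_height \<mu> c) i + Lam (2 * n - col_height \<mu> c) i = (if int c \<le> \<mu> i then 1 else 0) + 1"
        using hn[of c] ge[of c i] i by (auto simp: Lam_def)
    qed
    also have "\<dots> = min (max 0 (\<mu> i)) (int (nat (\<mu> 1))) + \<mu> 1"
      unfolding sum_list_addf sum using mu1 by (simp add: sum_list_triv del: upt_Suc)
    finally show ?thesis
      using mu1 partition_nonneg[OF assms, of i] partition_le_first[OF assms, of i] by simp
  qed
  show "lift_A n \<mu> i = \<mu> 1 - \<mu> (2 * n + 1 - i)" if i: "i \<in> {n + 1..2 * n}"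
  proof -
    let ?i = "2 * n + 1 - i"
    have "lift_A n \<mu> i = sum_list (map (\<lambda>c. 1 - (if int c \<le> \<mu> ?i then 1 else 0)) [1..<Suc (nat (\<mu> 1))])"
      unfolding eq
    proof (intro arg_cong[of _ _ sum_list] map_cong refl)
      fix c assume "c \<in> set [1..<Suc (nat (\<mu> 1))]"
      then have "1 \<le> c" by (simp only: set_upt atLeastLessThan_iff)
      then show "Lam (col_height \<mu> c) i + Lam (2 * n - col_height \<mu> c) i = 1 - (if int c \<le> \<mu> ?i then 1 else 0)"
        using hn[of c] ge[of c ?i] i by (auto simp: Lam_def)
    qed
    also have "\<dots> = \<mu> 1 - min (max 0 (\<mu> ?i)) (int (nat (\<mu> 1)))"
      unfolding sum_list_subtractf sum using mu1 by (simp add: sum_list_triv del: upt_Suc)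
    finally show ?thesis
      using mu1 partition_nonneg[OF assms, of ?i] partition_le_first[OF assms, of ?i] by simp
  qed
  show "lift_A n \<mu> i = 0" if i: "i \<notin> {1..2 * n}"
  proof -
    have "Lam (col_height \<mu> c) i + Lam (2 * n - col_height \<mu> c) i = 0" if "1 \<le> c" for c
      using hn[OF that] i by (auto simp: Lam_def)
    then have "lift_A n \<mu> i = sum_list (map (\<lambda>c. 0) [1..<Suc (nat (\<mu> 1))])"
      unfolding eq by (intro arg_cong[of _ _ sum_list] map_cong refl) (simp only: set_upt atLeastLessThan_iff)
    then show ?thesis by (simp add: sum_list_triv del: upt_Suc)
  qed
qed

lemma partition_lift_A:
  assumes "is_partition n \<mu>"
  shows "is_partition (2 * n) (lift_A n \<mu>)"
  unfolding is_partition_def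
proof (intro conjI allI impI)
  note le = partition_le_first[OF assms] and nn = partition_nonneg[OF assms]
  have mono: "\<mu> j \<le> \<mu> i" if "1 \<le> i" "i \<le> j" "j \<le> n" for i j
    using assms that unfolding is_partition_def by blast
  show "lift_A n \<mu> i = 0" if "i \<notin> {1..2 * n}" for i using lift_A_eq(3)[OF assms that] .
  have cases: "i \<in> {1..n} \<or> i \<in> {n + 1..2 * n} \<or> i \<notin> {1..2 * n}" for i by auto
  show "0 \<le> lift_A n \<mu> i" for i
    using cases[of i]
  proof (elim disjE)
    assume "i \<in> {1..n}"
    then show ?thesis using lift_A_eq(1)[OF assms] nn[of i] nn[of 1] by simp
  next
    assume "i \<in> {n + 1..2 * n}"
    then show ?thesis using lift_A_eq(2)[OF assms] le[of "2 * n + 1 - i"] by simp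
  next
    assume "i \<notin> {1..2 * n}"
    then show ?thesis using lift_A_eq(3)[OF assms] by simp
  qed
  fix i j assume ij: "1 \<le> i \<and> i \<le> j \<and> j \<le> 2 * n"
  consider "j \<le> n" | "i \<le> n" "n < j" | "n < i" by linarith
  then show "lift_A n \<mu> j \<le> lift_A n \<mu> i"
  proof cases
    case 1
    then show ?thesis using ij mono[of i j] lift_A_eq(1)[OF assms] by simp
  next
    case 2
    then show ?thesis
      using ij lift_A_eq(1)[OF assms, of i] lift_A_eq(2)[OF assms, of j] nn[of i] nn[of "2 * n + 1 - j"] by simp
  next
    case 3
    then show ?thesis
      using ij lift_A_eq(2)[OF assms, of i] lift_A_eq(2)[OF assms, of j] mono[of "2 * n + 1 - j" "2 * n + 1 - i"]
      by (auto simp: Suc_diff_le)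
  qed
qed

text \<open>Full columns form a trivial crystal of type A. They compensate the difference in size
  between an explicit image and the tableau that it should match.\<close>

definition pad :: "nat \<Rightarrow> nat \<Rightarrow> int list" where
  "pad N q = concat (replicate q [1..int N])"

lemma pad_eps_phi:
  assumes "j \<in> {1..N - 1}"
  shows "tensor_eps (word_A N) j (pad N q) = 0" "tensor_phi (word_A N) j (pad N q) = 0"
proof -
  have "tensor_eps (word_A N) j [1..int N] = 0 \<and> tensor_phi (word_A N) j [1..int N] = 0"
    using cocol(1,2)[OF assms, of 0] assms by (simp add: cocol_def filter_id_conv)
  then have "tensor_eps (word_A N) j (pad N q) = 0 \<and> tensor_phi (word_A N) j (pad N q) = 0"
    unfolding pad_def by (induction q) (auto simp: tensor_eps_append tensor_phi_append)
  then show "tensor_eps (word_A N) j (pad N q) = 0" "tensor_phi (word_A N) j (pad N q) = 0" by auto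
qed

lemma lattice_pad: "lattice N (pad N q)"
  unfolding lattice_def using pad_eps_phi(1) by (auto simp: pad_def)

lemma count_list_pad: "count_list (pad N q) x = (if x \<in> {1..int N} then q else 0)"
  by (auto simp: pad_def count_list_concat count_list_distinct sum_list_replicate)

lemma f_path_pad_A:
  "set J \<subseteq> {1..N - 1} \<Longrightarrow>
   f_path (tensor_f (word_A N)) J (w @ pad N q) =
     map_option (\<lambda>w. w @ pad N q) (f_path (tensor_f (word_A N)) J w)"
  by (rule f_path_pad[OF seminormal_A]) (simp_all add: pad_eps_phi)

lemma E_letter_range:
  assumes "x \<in> letters_C n"
  shows "set (E_letter n x) \<subseteq> {1..2 * int n}"
  using assms by (auto simp: E_letter_def letters_C_def hat_def cocol_def)

lemma E_word_range: "set w \<subseteq> letters_C n \<Longrightarrow> set (E_word n w) \<subseteq> {1..2 * int n}"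
  using E_letter_range by (fastforce simp: E_word_def)

text \<open>Folding the type A diagram at its middle node puts every node \<open>j\<close> into some
  \<open>E_index n i\<close>, so alignment transfers all the conditions.\<close>

lemma lattice_E_word:
  assumes "set w \<subseteq> letters_C n" "\<And>i. i \<in> {1..n} \<Longrightarrow> tensor_eps (word_C n) i w = 0"
  shows "lattice (2 * n) (E_word n w)"
  unfolding lattice_def
proof
  show "set (E_word n w) \<subseteq> {1..int (2 * n)}" using E_word_range[OF assms(1)] by simp
  show "\<forall>j\<in>{1..2 * n - 1}. tensor_eps (word_A (2 * n)) j (E_word n w) = 0"
  proof
    fix j assume j: "j \<in> {1..2 * n - 1}"
    obtain i where i: "i \<in> {1..n}" "j \<in> set (E_index n i)"
    proof (cases "j \<le> n")
      case True
      then show ?thesis using that[of j] j by (auto simp: E_index_def)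
    next
      case False
      then have "2 * n - j < n" "2 * n - (2 * n - j) = j" "1 \<le> 2 * n - j" using j by auto
      then show ?thesis using that[of "2 * n - j"] by (simp add: E_index_def)
    qed
    have "w \<in> lists (letters_C n)" using assms(1) by auto
    from alignedD(1)[OF aligned_E_word _ this i(2)] i(1) assms(2)
    show "tensor_eps (word_A (2 * n)) j (E_word n w) = 0" by simp
  qed
qed

text \<open>The weight of the image is the type C weight, with opposite sign on barred letters, plus
  \<open>length w\<close> in every coordinate. This constant shift is what padding absorbs.\<close>

lemma count_E_word:
  assumes "set w \<subseteq> letters_C n" "u \<in> letters_C n"
  shows "count_list (E_word n w) (hat n u) + count_list w (- u) = count_list w u + length w"
  using assms(1)
proof (induction w)
  case (Cons x w)
  have x: "x \<in> letters_C n" using Cons.prems by simp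
  have h: "hat n u \<in> {1..2 * int n}" using assms(2) by (auto simp: letters_C_def hat_def)
  have inj: "hat n y = hat n u \<longleftrightarrow> y = u" if "y \<in> letters_C n" for y
    using that assms(2) by (auto simp: letters_C_def hat_def split: if_splits)
  have "- x \<in> letters_C n" using x by (simp add: letters_C_def)
  then show ?case
    using Cons count_E_letter[OF x h] inj[OF x] inj[of "- x"]
    by (auto simp: E_word_def minus_equation_iff split: if_splits)
qed (simp add: E_word_def)

lemma hat_surj:
  assumes "y \<in> {1..2 * int n}"
  obtains u where "u \<in> letters_C n" "y = hat n u"
proof (cases "y \<le> int n")
  case True
  then show ?thesis using that[of y] assms by (auto simp: letters_C_def hat_def)
next
  case False
  then show ?thesis using that[of "y - 2 * int n - 1"] assms by (auto simp: letters_C_def hat_def)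
qed

lemma count_E_word_cong:
  assumes "set v \<subseteq> letters_C n" "set w \<subseteq> letters_C n" "count_list v = count_list w"
  shows "count_list (E_word n v) = count_list (E_word n w)"
proof
  fix y
  have len: "length v = length w"
    using sum_count_set[of v "set v \<union> set w"] sum_count_set[of w "set v \<union> set w"] assms(3) by simp
  show "count_list (E_word n v) y = count_list (E_word n w) y"
  proof (cases "y \<in> {1..2 * int n}")
    case True
    then obtain u where u: "u \<in> letters_C n" "y = hat n u" by (rule hat_surj)
    show ?thesis
      using count_E_word[OF assms(1) u(1)] count_E_word[OF assms(2) u(1)] len assms(3) u(2) by simp
  next
    case False
    then have "y \<notin> set (E_word n v)" "y \<notin> set (E_word n w)" using E_word_range assms by blast+
    then show ?thesis by (simp add: count_list_0_iff)
  qed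
qed

section \<open>The embedding and the dilatations\<close>

definition reachable :: "'b crystal \<Rightarrow> 'b \<Rightarrow> 'b set" where
  "reachable B h = {b. \<exists>is. set is \<subseteq> cr_index B \<and> f_path (cr_f B) is h = Some b}"

lemma reachable_refl: "h \<in> reachable B h"
  unfolding reachable_def by (intro CollectI exI[of _ "[]"]) simp

lemma reachable_step:
  assumes "b \<in> reachable B h" "i \<in> cr_index B" "cr_f B i b = Some b'"
  shows "b' \<in> reachable B h"
proof -
  obtain "is" where "set is \<subseteq> cr_index B" "f_path (cr_f B) is h = Some b"
    using assms(1) by (auto simp: reachable_def)
  then show ?thesis unfolding reachable_def using assms(2,3) by (intro CollectI exI[of _ "i # is"]) simp
qed

lemma reachable_path:
  assumes "b \<in> reachable B h" "set is \<subseteq> cr_index B" "f_path (cr_f B) is b = Some b'"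
  shows "b' \<in> reachable B h"
  using assms(2,3)
proof (induction "is" arbitrary: b')
  case (Cons i "is")
  then show ?case using reachable_step by (fastforce simp: bind_eq_Some_conv)
qed (use assms(1) in simp)

lemma tableau_path:
  assumes sn: "seminormal (letter_crystal I mark act)" and sub: "set is \<subseteq> I"
  shows "f_path (cr_f (tableau_crystal I mark act)) is T = Some T' \<longleftrightarrow>
     map length T' = map length T \<and>
     f_path (tensor_f (letter_crystal I mark act)) is (reading T) = Some (reading T')"
proof
  note S = f_path_singleton[OF seminormal_tableau[OF sn], of "is" T]
  show "map length T' = map length T \<and>
     f_path (tensor_f (letter_crystal I mark act)) is (reading T) = Some (reading T')"
    if "f_path (cr_f (tableau_crystal I mark act)) is T = Some T'"
    using flat_path[of I mark act "is" "[T]" "[T']"] S sub that by (simp add: tableau_crystal_simps(1))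
  show "f_path (cr_f (tableau_crystal I mark act)) is T = Some T'"
    if *: "map length T' = map length T \<and>
     f_path (tensor_f (letter_crystal I mark act)) is (reading T) = Some (reading T')"
  proof -
    obtain Ts' where "f_path (tensor_f (tableau_crystal I mark act)) is [T] = Some Ts'"
      "flat Ts' = reading T'" "map (map length) Ts' = map (map length) [T]"
      using flat_path_ex[OF sn sub, of "[T]"] * by auto
    moreover from this obtain T'' where T'': "Ts' = [T'']" by (cases Ts') auto
    ultimately have "f_path (cr_f (tableau_crystal I mark act)) is T = Some T''"
      "reading T'' = reading T'" "map length T'' = map length T'"
      using S sub * by (auto simp: tableau_crystal_simps(1))
    then show ?thesis using reading_inj[of T'' T'] by simp
  qed
qed

lemma E_index_range: "i \<in> {1..n} \<Longrightarrow> set (E_index n i) \<subseteq> {1..2 * n - 1}"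
  by (auto simp: E_index_def)

section \<open>The Baker embedding for a fixed partition\<close>

locale baker_setup =
  fixes n :: nat and \<mu> :: weight
  assumes n1: "1 \<le> n" and part: "is_partition n \<mu>"
begin

abbreviation "\<mu>A \<equiv> lift_A n \<mu>"
abbreviation "hC \<equiv> highest \<mu>"
abbreviation "hA \<equiv> highest \<mu>A"
abbreviation "BC \<equiv> crystal_C n"
abbreviation "BA \<equiv> crystal_A (2 * n)"
abbreviation "RC \<equiv> reachable BC hC"

lemma partA: "is_partition (2 * n) \<mu>A" by (rule partition_lift_A[OF part])

lemma BC_index [simp]: "cr_index BC = {1..n}" by (simp add: crystal_C_def)
lemma BA_index [simp]: "cr_index BA = {1..2 * n - 1}" by (simp add: crystal_A_def)

lemma BC_sem: "seminormal BC"
  unfolding crystal_C_eq by (rule seminormal_tableau[OF seminormal_C[unfolded word_C_def]])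
lemma BA_sem: "seminormal BA"
  unfolding crystal_A_eq by (rule seminormal_tableau[OF seminormal_A[unfolded word_A_def]])

lemma BC_eps: "cr_eps BC i T = tensor_eps (word_C n) i (reading T)"
  and BC_phi: "cr_phi BC i T = tensor_phi (word_C n) i (reading T)"
  unfolding crystal_C_eq word_C_def by (simp_all add: tableau_crystal_simps)
lemma BA_eps: "cr_eps BA i T = tensor_eps (word_A (2 * n)) i (reading T)"
  and BA_phi: "cr_phi BA i T = tensor_phi (word_A (2 * n)) i (reading T)"
  unfolding crystal_A_eq word_A_def by (simp_all add: tableau_crystal_simps)

lemma BC_f: "cr_f BC i T = Some T' \<longleftrightarrow>
     map length T' = map length T \<and> tensor_f (word_C n) i (reading T) = Some (reading T')"
  unfolding crystal_C_eq word_C_def by (rule tableau_f_Some_iff)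

lemma BA_path: "set is \<subseteq> {1..2 * n - 1} \<Longrightarrow> f_path (cr_f BA) is T = Some T' \<longleftrightarrow>
     map length T' = map length T \<and> f_path (tensor_f (word_A (2 * n))) is (reading T) = Some (reading T')"
  unfolding crystal_A_eq word_A_def by (rule tableau_path[OF seminormal_A[unfolded word_A_def]])

lemma flat_tensor_C:
  "tensor_eps BC i Ts = tensor_eps (word_C n) i (flat Ts)"
  "tensor_phi BC i Ts = tensor_phi (word_C n) i (flat Ts)"
  unfolding crystal_C_eq word_C_def by (simp_all add: flat_tensor)

lemma flat_path_C_ex: "set is \<subseteq> {1..n} \<Longrightarrow> f_path (tensor_f (word_C n)) is (flat Ts) = Some w \<Longrightarrow>
   \<exists>Ts'. f_path (tensor_f BC) is Ts = Some Ts' \<and> flat Ts' = w \<and>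
     map (map length) Ts' = map (map length) Ts"
  unfolding crystal_C_eq word_C_def by (rule flat_path_ex[OF seminormal_C[unfolded word_C_def]])

lemma flat_path_A_ex: "set is \<subseteq> {1..2 * n - 1} \<Longrightarrow> f_path (tensor_f (word_A (2 * n))) is (flat Ts) = Some w \<Longrightarrow>
   \<exists>Ts'. f_path (tensor_f BA) is Ts = Some Ts' \<and> flat Ts' = w \<and>
     map (map length) Ts' = map (map length) Ts"
  unfolding crystal_A_eq word_A_def by (rule flat_path_ex[OF seminormal_A[unfolded word_A_def]])

lemma hC_letters: "set (reading hC) \<subseteq> letters_C n"
  using highest_C(1)[OF part] by (auto simp: letters_C_def)

lemma f_letters_C:
  assumes "set w \<subseteq> letters_C n" "i \<in> {1..n}" "tensor_f (word_C n) i w = Some w'"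
  shows "set w' \<subseteq> letters_C n"
  using alignedD(3)[OF aligned_E_word, of i n w w'] assms by auto

lemma E_word_f:
  assumes "set w \<subseteq> letters_C n" "i \<in> {1..n}" "tensor_f (word_C n) i w = Some w'"
  shows "f_path (tensor_f (word_A (2 * n))) (E_index n i) (E_word n w) = Some (E_word n w')"
  using alignedD(4)[OF aligned_E_word, of i n w w'] assms by auto

lemma path_letters_C:
  assumes "set w \<subseteq> letters_C n" "set is \<subseteq> {1..n}" "f_path (tensor_f (word_C n)) is w = Some w'"
  shows "set w' \<subseteq> letters_C n"
    and "f_path (tensor_f (word_A (2 * n))) (concat (map (E_index n) is)) (E_word n w) = Some (E_word n w')"
  using aligned_path[OF aligned_E_word, of w n "is" w'] assms by auto

text \<open>Both words are lattice words. The image word exceeds the weight of \<open>\<mu>\<close>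
  by \<open>length (reading hC)\<close> in every coordinate, and \<open>\<mu>A\<close> exceeds it by
  \<open>\<mu> 1\<close>; padding each side with the excess of the other makes the contents
  agree.\<close>

lemma baker_linked:
  "\<exists>R. word_iso (2 * n) R \<and>
     (E_word n (reading hC) @ pad (2 * n) (nat (\<mu> 1)), reading hA @ pad (2 * n) (length (reading hC))) \<in> R"
proof -
  let ?u = "E_word n (reading hC) @ pad (2 * n) (nat (\<mu> 1))"
  let ?v = "reading hA @ pad (2 * n) (length (reading hC))"
  have lu: "lattice (2 * n) ?u"
    using lattice_E_word[OF hC_letters highest_C(2)[OF part]] by (intro lattice_append lattice_pad)
  have lv: "lattice (2 * n) ?v" by (intro lattice_append lattice_pad lattice_highest partA)
  have "count_list ?u y = count_list ?v y" for y
  proof (cases "y \<in> {1..2 * int n}")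
    case True
    then obtain u where u: "u \<in> letters_C n" "y = hat n u" by (rule hat_surj)
    note c = count_E_word[OF hC_letters u(1)] count_list_highest[OF part]
      count_list_highest[OF partA] count_list_pad
    have nn: "0 \<le> \<mu> i" "\<mu> i \<le> \<mu> 1" for i
      using partition_nonneg[OF part] partition_le_first[OF part] by auto
    show ?thesis
    proof (cases "0 < u")
      case True
      then have "nat u \<in> {1..n}" "y = u" using u by (auto simp: letters_C_def hat_def)
      then have "nat (\<mu>A (nat y)) = nat (\<mu> 1) + nat (\<mu> (nat u))"
        using lift_A_eq(1)[OF part, of "nat u"] nn by (simp add: nat_add_distrib)
      moreover have "\<mu> 0 = 0" using partition_outside[OF part, of 0] by simp
      ultimately show ?thesis
        using c True u \<open>y \<in> {1..2 * int n}\<close> by (auto simp: hat_def)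
    next
      case False
      then have y: "nat y \<in> {n + 1..2 * n}" "u < 0" "2 * n + 1 - nat y = nat (- u)"
        using u by (auto simp: letters_C_def hat_def)
      then have "\<mu>A (nat y) = \<mu> 1 - \<mu> (nat (- u))"
        using lift_A_eq(2)[OF part y(1)] by simp
      moreover have "0 \<le> y" using \<open>y \<in> {1..2 * int n}\<close> by simp
      ultimately have r: "count_list (reading hA) y = nat (\<mu> 1) - nat (\<mu> (nat (- u)))"
        using c(3)[of y] nn[of "nat (- u)"] by (simp add: nat_diff_distrib)
      have l: "count_list (E_word n (reading hC)) y + nat (\<mu> (nat (- u))) = length (reading hC)"
        using c(1) c(2)[of u] c(2)[of "- u"] y(2) u(2) by simp
      have p: "count_list (pad (2 * n) q) y = q" for q
        using c(4)[of "2 * n" q y] \<open>y \<in> {1..2 * int n}\<close> by simp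
      have "nat (\<mu> (nat (- u))) \<le> nat (\<mu> 1)" using nn(2) by (rule nat_mono)
      with r l show ?thesis unfolding count_list_append p by linarith
    qed
  next
    case False
    then have "y \<notin> set ?u" "y \<notin> set ?v"
      using lu lv by (auto simp: lattice_def simp del: set_append)
    then show ?thesis by (simp add: count_list_0_iff)
  qed
  then have "linked (2 * n) ?u ?v" using lattice_linked[OF lu lv] by blast
  then show ?thesis by (simp add: linked_def)
qed

text \<open>Linkage only asserts that some isomorphism exists; one is fixed here so that all
  tableaux are compared through the same relation.\<close>

definition baker_iso :: "(int list \<times> int list) set" where
  "baker_iso = (SOME R. word_iso (2 * n) R \<and>
     (E_word n (reading hC) @ pad (2 * n) (nat (\<mu> 1)), reading hA @ pad (2 * n) (length (reading hC))) \<in> R)"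

lemma baker_iso:
  "word_iso (2 * n) baker_iso"
  "(E_word n (reading hC) @ pad (2 * n) (nat (\<mu> 1)), reading hA @ pad (2 * n) (length (reading hC))) \<in> baker_iso"
  using someI_ex[OF baker_linked] by (simp_all add: baker_iso_def)

text \<open>The shape of \<open>c\<close> is prescribed because a reading alone does not determine
  its division into columns.\<close>

definition baker_rel :: "(tableau \<times> tableau) set" where
  "baker_rel = {(b, c). set (reading b) \<subseteq> letters_C n \<and> map length c = map length hA \<and>
     (E_word n (reading b) @ pad (2 * n) (nat (\<mu> 1)), reading c @ pad (2 * n) (length (reading hC))) \<in> baker_iso}"

lemma baker_path:
  assumes "set is \<subseteq> {1..n}" "f_path (cr_f BC) is hC = Some b"
  shows "(b, baker n \<mu> b) \<in> baker_rel"
    and "f_path (f_E n (cr_f BA)) is hA = Some (baker n \<mu> b)"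
proof -
  have sv: "single_valued baker_rel"
    using baker_iso(1) unfolding word_iso_def single_valued_def baker_rel_def
    by (auto intro!: reading_inj)
  have h: "(hC, hA) \<in> baker_rel" using baker_iso(2) hC_letters by (simp add: baker_rel_def)
  have step: "\<exists>c'. f_E n (cr_f BA) i c = Some c' \<and> (b', c') \<in> baker_rel"
    if i: "i \<in> {1..n}" and bc: "(b, c) \<in> baker_rel" and f: "cr_f BC i b = Some b'" for i b c b'
  proof -
    let ?J = "E_index n i" let ?P = "pad (2 * n) (nat (\<mu> 1))" and ?Q = "pad (2 * n) (length (reading hC))"
    have J: "set ?J \<subseteq> {1..2 * n - 1}" by (rule E_index_range[OF i])
    have bw: "tensor_f (word_C n) i (reading b) = Some (reading b')" using f BC_f by simp
    have bl: "set (reading b) \<subseteq> letters_C n" and cs: "map length c = map length hA"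
      and R: "(E_word n (reading b) @ ?P, reading c @ ?Q) \<in> baker_iso"
      using bc by (auto simp: baker_rel_def)
    \<comment> \<open>The simulated step is performed on the explicit image, carried across
      \<open>baker_iso\<close>, freed from the padding, and the resulting word is cut into columns
      of the shape of \<open>c\<close>.\<close>
    have "f_path (tensor_f (word_A (2 * n))) ?J (E_word n (reading b) @ ?P) = Some (E_word n (reading b') @ ?P)"
      using E_word_f[OF bl i bw] f_path_pad_A[OF J] by simp
    from word_iso_path[OF baker_iso(1) R J this]
    obtain v where v: "f_path (tensor_f (word_A (2 * n))) ?J (reading c @ ?Q) = Some v"
      "(E_word n (reading b') @ ?P, v) \<in> baker_iso" by blast
    then obtain w where w: "f_path (tensor_f (word_A (2 * n))) ?J (reading c) = Some w" "v = w @ ?Q"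
      using f_path_pad_A[OF J] by auto
    obtain Ts where "flat Ts = w" "map (map length) Ts = map (map length) [c]"
      using flat_path_A_ex[OF J, of "[c]" w] w(1) by (metis append_Nil2 flat_simps(1,2))
    then obtain c' where c': "reading c' = w" "map length c' = map length c" by (cases Ts) auto
    then have "f_path (cr_f BA) ?J c = Some c'" using BA_path[OF J] w by simp
    then show ?thesis
      using c' cs v w f_letters_C[OF bl i bw] by (auto simp: f_E_path baker_rel_def)
  qed
  show "(b, baker n \<mu> b) \<in> baker_rel" "f_path (f_E n (cr_f BA)) is hA = Some (baker n \<mu> b)"
    unfolding baker_def using path_map_rel[OF sv h step assms] by auto
qed

lemma baker_reachable:
  assumes "b \<in> RC"
  shows "(b, baker n \<mu> b) \<in> baker_rel"
  using assms baker_path(1) by (auto simp: reachable_def)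

lemma baker_eps_phi:
  assumes b: "b \<in> RC" and i: "i \<in> {1..n}" and j: "j \<in> set (E_index n i)"
  shows "cr_eps BA j (baker n \<mu> b) = E_mult n i * cr_eps BC i b"
    and "cr_phi BA j (baker n \<mu> b) = E_mult n i * cr_phi BC i b"
proof -
  have j': "j \<in> {1..2 * n - 1}" using E_index_range[OF i] j by blast
  have R: "(E_word n (reading b) @ pad (2 * n) (nat (\<mu> 1)),
      reading (baker n \<mu> b) @ pad (2 * n) (length (reading hC))) \<in> baker_iso"
    and l: "reading b \<in> lists (letters_C n)"
    using baker_reachable[OF b] by (auto simp: baker_rel_def)
  have "i \<in> cr_index (tensor_crystal (word_C n))" using i by simp
  note A = alignedD(1,2)[OF aligned_E_word this l j, simplified]
  show "cr_eps BA j (baker n \<mu> b) = E_mult n i * cr_eps BC i b"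
    "cr_phi BA j (baker n \<mu> b) = E_mult n i * cr_phi BC i b"
    using word_isoD(2,3)[OF baker_iso(1) R j'] pad_eps_phi[OF j'] A
    by (simp_all add: tensor_eps_append tensor_phi_append BC_eps BC_phi BA_eps BA_phi)
qed

lemma baker_f:
  assumes b: "b \<in> RC" and i: "i \<in> {1..n}" and f: "cr_f BC i b = Some b'"
  shows "f_path (cr_f BA) (E_index n i) (baker n \<mu> b) = Some (baker n \<mu> b')"
proof -
  obtain "is" where is': "set is \<subseteq> {1..n}" "f_path (cr_f BC) is hC = Some b"
    using b by (auto simp: reachable_def)
  then have "f_path (cr_f BC) (i # is) hC = Some b'" "set (i # is) \<subseteq> {1..n}" using f i by auto
  from baker_path(2)[OF this(2,1)] baker_path(2)[OF is'] show ?thesis by (simp add: f_E_path)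
qed

lemma baker_highest: "baker n \<mu> hC = hA"
  using baker_path(2)[of "[]" hC] by simp

lemma E_index_indep:
  assumes "i \<in> {1..n}"
  shows "virtual_indices BA (E_index n) (E_mult n) i"
proof -
  have "indep BA j j'" if "j \<in> set (E_index n i)" "j' \<in> set (E_index n i)" "j \<noteq> j'" for j j'
  proof -
    have "indep (word_A (2 * n)) j j'" using virtual_indices_E[of i n] assms that
      unfolding virtual_indices_def by auto
    from indep_tensor[OF this] show ?thesis
      unfolding indep_def crystal_A_eq tableau_f_Some_iff by (auto simp: tableau_crystal_simps word_A_def)
  qed
  then show ?thesis using assms virtual_indices_E[of i n] unfolding virtual_indices_def by simp
qed

lemma aligned_baker: "aligned BC BA (E_index n) (E_mult n) RC (\<lambda>b. [baker n \<mu> b])"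
  unfolding aligned_def
proof (intro ballI conjI allI impI)
  fix i b assume i: "i \<in> cr_index BC" and b: "b \<in> RC"
  then have i': "i \<in> {1..n}" by simp
  fix j assume j: "j \<in> set (E_index n i)"
  show "tensor_eps BA j [baker n \<mu> b] = E_mult n i * cr_eps BC i b"
    "tensor_phi BA j [baker n \<mu> b] = E_mult n i * cr_phi BC i b"
    using baker_eps_phi[OF b i' j] by simp_all
next
  fix i b b' assume i: "i \<in> cr_index BC" and b: "b \<in> RC" and f: "cr_f BC i b = Some b'"
  then have i': "i \<in> {1..n}" by simp
  show "b' \<in> RC" by (rule reachable_step[OF b i f])
  show "f_path (tensor_f BA) (E_index n i) [baker n \<mu> b] = Some [baker n \<mu> b']"
    using f_path_singleton[OF BA_sem] E_index_range[OF i'] baker_f[OF b i' f] by simp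
qed

lemma aligned_baker_tensor:
  "aligned (tensor_crystal BC) BA (E_index n) (E_mult n) (lists RC) (map (baker n \<mu>))"
  using aligned_tensor[OF aligned_baker BA_sem] E_index_indep by simp

text \<open>Applying the embedding to each factor is again aligned and sends the starting tensor to
  the starting tensor, so it coincides with the path-defined map on the component.\<close>

lemma baker_tensor_path:
  assumes "set is \<subseteq> {1..n}" "f_path (tensor_f BC) is (replicate m hC) = Some bs"
  shows "baker_tensor n \<mu> m bs = map (baker n \<mu>) bs"
    and "f_path (tensor_f BA) (concat (map (E_index n) is)) (replicate m hA) = Some (map (baker n \<mu>) bs)"
proof -
  let ?R = "{(bs, map (baker n \<mu>) bs) | bs. bs \<in> lists RC}"
  have sv: "single_valued ?R" by (auto simp: single_valued_def)
  have h: "(replicate m hC, replicate m hA) \<in> ?R"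
    using reachable_refl[of hC BC] by (auto simp: baker_highest in_lists_conv_set map_replicate)
  have step: "\<exists>c'. f_E n (tensor_f BA) i c = Some c' \<and> (b', c') \<in> ?R"
    if "i \<in> {1..n}" "(b, c) \<in> ?R" "tensor_f BC i b = Some b'" for i b c b'
    using alignedD(3,4)[OF aligned_baker_tensor, of i b b'] that by (auto simp: f_E_path)
  show *: "baker_tensor n \<mu> m bs = map (baker n \<mu>) bs"
    unfolding baker_tensor_def using path_map_rel(1)[where g' = "f_E n (tensor_f BA)", OF sv h step assms] by simp
  show "f_path (tensor_f BA) (concat (map (E_index n) is)) (replicate m hA) = Some (map (baker n \<mu>) bs)"
    using path_map_rel(2)[where g' = "f_E n (tensor_f BA)", OF sv h step assms] * unfolding baker_tensor_def
    by (simp add: f_path_concat f_E_path[abs_def])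
qed

section \<open>Dilatations in types C and A\<close>

lemma theta_linked:
  assumes "lattice N (stretch m (reading h))" "lattice N (flat (replicate m h))"
  shows "linked N (stretch m (reading h)) (flat (replicate m h))"
  by (rule lattice_linked[OF assms]) (simp add: fun_eq_iff count_list_stretch count_list_flat_replicate)

lemma lattice_flat_replicate: "lattice N (reading h) \<Longrightarrow> lattice N (flat (replicate m h))"
  unfolding flat_def by (rule lattice_concat) auto

text \<open>Repeating the letters and repeating the tableau give two realisations of the same
  dilated component. In type C they are compared through \<open>E_word\<close>, where equal content
  of two lattice words is enough.\<close>

lemma theta_C_linked:
  "linked (2 * n) (E_word n (stretch m (reading hC))) (E_word n (flat (replicate m hC)))"
proof -
  have 1: "set (stretch m (reading hC)) \<subseteq> letters_C n"
    using set_stretch[of m "reading hC"] hC_letters by blast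
  have 2: "set (flat (replicate m hC)) \<subseteq> letters_C n"
    using hC_letters by (auto simp: flat_def)
  have e: "tensor_eps (word_C n) i (reading hC) = 0" if "i \<in> {1..n}" for i
    using highest_C(2)[OF part that] .
  have e1: "tensor_eps (word_C n) i (stretch m (reading hC)) = 0" if "i \<in> {1..n}" for i
  proof (cases "m = 0")
    case False
    then have "i \<in> set (replicate m i)" by simp
    from alignedD(1)[OF aligned_stretch[OF seminormal_C[unfolded word_C_def], of m] _ _ this]
    show ?thesis using e[OF that] that False by (simp add: word_C_def)
  next
    case True
    then have "stretch m (reading hC) = []" by (auto simp: stretch_def)
    then show ?thesis by simp
  qed
  have e2: "tensor_eps (word_C n) i (flat (replicate m hC)) = 0" if "i \<in> {1..n}" for i
    unfolding flat_def using e[OF that] by (intro tensor_eps_concat_0) auto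
  show ?thesis
    by (intro lattice_linked lattice_E_word count_E_word_cong 1 2 e1 e2)
      (simp_all add: fun_eq_iff count_list_stretch count_list_flat_replicate)
qed

definition theta_iso :: "nat \<Rightarrow> (int list \<times> int list) set" where
  "theta_iso m = (SOME R. word_iso (2 * n) R \<and>
     (E_word n (stretch m (reading hC)), E_word n (flat (replicate m hC))) \<in> R)"

lemma theta_iso:
  "word_iso (2 * n) (theta_iso m)"
  "(E_word n (stretch m (reading hC)), E_word n (flat (replicate m hC))) \<in> theta_iso m"
  using someI_ex[OF theta_C_linked[unfolded linked_def], of m] by (simp_all add: theta_iso_def)

definition theta_rel :: "nat \<Rightarrow> (tableau \<times> tableau list) set" where
  "theta_rel m = {(b, cs). set (reading b) \<subseteq> letters_C n \<and> set (flat cs) \<subseteq> letters_C n \<and>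
     map (map length) cs = replicate m (map length hC) \<and>
     (E_word n (stretch m (reading b)), E_word n (flat cs)) \<in> theta_iso m}"

lemma length_flat: "length (flat cs) = sum_list (map (sum_list \<circ> map length) cs)"
  by (simp add: flat_def length_concat comp_def length_reading)

text \<open>Both words are viewed in type A, where \<open>theta_iso\<close> equates their string
  lengths; the common factor \<open>E_mult n i\<close> is positive and cancels.\<close>

lemma theta_rel_eps_phi:
  assumes m: "m > 0" and r: "(b, cs) \<in> theta_rel m" and i: "i \<in> {1..n}"
  shows "tensor_eps (word_C n) i (flat cs) = m * tensor_eps (word_C n) i (reading b) \<and>
     tensor_phi (word_C n) i (flat cs) = m * tensor_phi (word_C n) i (reading b)"
proof -
  have rel: "set (reading b) \<subseteq> letters_C n" "set (flat cs) \<subseteq> letters_C n"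
    "(E_word n (stretch m (reading b)), E_word n (flat cs)) \<in> theta_iso m"
    using r by (auto simp: theta_rel_def)
  have sl: "stretch m (reading b) \<in> lists (letters_C n)" "flat cs \<in> lists (letters_C n)"
    using rel set_stretch[of m "reading b"] by auto
  obtain l where l: "l \<in> set (E_index n i)" by (cases "E_index n i") (auto simp: E_index_def split: if_splits)
  have l': "l \<in> {1..2 * n - 1}" using l E_index_range[OF i] by blast
  have ii: "i \<in> cr_index (tensor_crystal (word_C n))" using i by simp
  have im: "i \<in> set (replicate m i)" using m by simp
  note E1 = alignedD(1,2)[OF aligned_E_word ii sl(1) l] and E2 = alignedD(1,2)[OF aligned_E_word ii sl(2) l]
  note S = alignedD(1,2)[OF aligned_stretch[OF seminormal_C[unfolded word_C_def] m], folded word_C_def, OF ii UNIV_I im]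
  note W = word_isoD(2,3)[OF theta_iso(1) rel(3) l']
  show ?thesis using E1 E2 W S[of "reading b"] by (simp add: E_mult_def split: if_splits)
qed

lemma theta_C_path:
  assumes m: "m > 0" and "set is \<subseteq> {1..n}" "f_path (cr_f BC) is hC = Some b"
  shows "(b, theta_C n \<mu> m b) \<in> theta_rel m"
    and "f_path (tensor_f BC) (concat (map (replicate m) is)) (replicate m hC) = Some (theta_C n \<mu> m b)"
proof -
  have sv: "single_valued (theta_rel m)"
  proof -
    have "cs = cs'" if r: "(b, cs) \<in> theta_rel m" "(b, cs') \<in> theta_rel m" for b cs cs'
    proof (rule flat_inj)
      show sh: "map (map length) cs = map (map length) cs'" using r by (simp add: theta_rel_def)
      then have "length (flat cs) = length (flat cs')"
        unfolding length_flat by (metis map_map)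
      \<comment> \<open>The isomorphism only identifies the type A images; equal length, known from
        the shapes, allows \<open>E_word\<close> to be inverted.\<close>
      moreover have "E_word n (flat cs) = E_word n (flat cs')"
        using r theta_iso(1)[of m] unfolding theta_rel_def word_iso_def single_valued_def by blast
      ultimately show "flat cs = flat cs'" using r E_word_inj by (auto simp: theta_rel_def)
    qed
    then show ?thesis by (simp add: single_valued_def)
  qed
  have h: "(hC, replicate m hC) \<in> theta_rel m"
    using theta_iso(2) hC_letters by (auto simp: theta_rel_def flat_def map_replicate)
  have step: "\<exists>c'. f_path (tensor_f BC) (replicate m i) c = Some c' \<and> (b', c') \<in> theta_rel m"
    if i: "i \<in> {1..n}" and bc: "(b, c) \<in> theta_rel m" and f: "cr_f BC i b = Some b'" for i b c b'
  proof -
    let ?I = "replicate m i" let ?J = "concat (map (E_index n) ?I)"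
    have I: "set ?I \<subseteq> {1..n}" using i by auto
    have J: "set ?J \<subseteq> {1..2 * n - 1}" using E_index_range[OF i] by auto
    have bw: "tensor_f (word_C n) i (reading b) = Some (reading b')" using f BC_f by simp
    have bl: "set (reading b) \<subseteq> letters_C n" and cl: "set (flat c) \<subseteq> letters_C n"
      and cs: "map (map length) c = replicate m (map length hC)"
      and R: "(E_word n (stretch m (reading b)), E_word n (flat c)) \<in> theta_iso m"
      using bc by (auto simp: theta_rel_def)
    have sl: "set (stretch m (reading b)) \<subseteq> letters_C n" using bl set_stretch[of m "reading b"] by blast
    have "f_path (tensor_f (word_C n)) ?I (stretch m (reading b)) = Some (stretch m (reading b'))"
      using alignedD(4)[OF aligned_stretch[OF seminormal_C[unfolded word_C_def] m], of i n "reading b" "reading b'"] bw i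
      by (simp add: word_C_def)
    from path_letters_C(2)[OF sl I this]
    have "f_path (tensor_f (word_A (2 * n))) ?J (E_word n (stretch m (reading b))) =
      Some (E_word n (stretch m (reading b')))" .
    from word_iso_path[OF theta_iso(1) R J this]
    obtain v where v: "f_path (tensor_f (word_A (2 * n))) ?J (E_word n (flat c)) = Some v"
      "(E_word n (stretch m (reading b')), v) \<in> theta_iso m" by blast
    \<comment> \<open>A type A path on the image need not by itself come from a type C path. The
      scaled string length guarantees that \<open>m\<close> lowerings exist in type C, and alignment
      then identifies their image with \<open>v\<close>.\<close>
    have "tensor_phi (word_C n) i (flat c) = m * tensor_phi (word_C n) i (reading b)"
      using theta_rel_eps_phi[OF m bc i] by simp
    also have "\<dots> \<ge> m"
      using seminormalD(3)[OF seminormal_tensor[OF seminormal_C], of i n "reading b" "reading b'"] i bw by simp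
    finally obtain w where w: "f_path (tensor_f (word_C n)) ?I (flat c) = Some w"
      using string_exists[OF seminormal_tensor[OF seminormal_C], of i n m "flat c"] i by auto
    obtain c' where c': "f_path (tensor_f BC) ?I c = Some c'" "flat c' = w"
      "map (map length) c' = map (map length) c"
      using flat_path_C_ex[OF I w] by blast
    have "v = E_word n w" using path_letters_C(2)[OF cl I w] v(1) by simp
    moreover have "set w \<subseteq> letters_C n" by (rule path_letters_C(1)[OF cl I w])
    ultimately show ?thesis
      using c' cs v f_letters_C[OF bl i bw] by (auto simp: theta_rel_def)
  qed
  note P = path_map_rel[where g' = "\<lambda>i. f_path (tensor_f BC) (replicate m i)", OF sv h step assms(2,3)]
  show "(b, theta_C n \<mu> m b) \<in> theta_rel m"
    "f_path (tensor_f BC) (concat (map (replicate m) is)) (replicate m hC) = Some (theta_C n \<mu> m b)"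
    using P by (simp_all add: dilatation_def f_path_concat)
qed

lemma theta_A_path:
  assumes m: "m > 0" and "set is \<subseteq> {1..2 * n - 1}" "f_path (cr_f BA) is hA = Some b"
  shows "f_path (tensor_f BA) (concat (map (replicate m) is)) (replicate m hA) =
    Some (theta_A (2 * n) \<mu>A m b)"
proof -
  have l: "lattice (2 * n) (reading hA)" by (rule lattice_highest[OF partA])
  note al = aligned_stretch[OF seminormal_A[unfolded word_A_def] m, folded word_A_def]
  have "lattice (2 * n) (stretch m (reading hA))"
    unfolding lattice_def
  proof (intro conjI ballI)
    show "set (stretch m (reading hA)) \<subseteq> {1..int (2 * n)}"
      using l set_stretch[of m "reading hA"] unfolding lattice_def by blast
    fix j assume j: "j \<in> {1..2 * n - 1}"
    have "j \<in> set (replicate m j)" using m by simp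
    from alignedD(1)[OF al _ _ this, of "2 * n" "reading hA"] j l
    show "tensor_eps (word_A (2 * n)) j (stretch m (reading hA)) = 0" by (simp add: lattice_def)
  qed
  from theta_linked[OF this lattice_flat_replicate[OF l]]
  obtain R where R: "word_iso (2 * n) R" "(stretch m (reading hA), flat (replicate m hA)) \<in> R"
    by (auto simp: linked_def)
  let ?S = "{(b, cs). map (map length) cs = replicate m (map length hA) \<and> (stretch m (reading b), flat cs) \<in> R}"
  have sv: "single_valued ?S"
    using R(1) unfolding word_iso_def single_valued_def by (auto intro!: flat_inj)
  have h: "(hA, replicate m hA) \<in> ?S" using R(2) by (simp add: map_replicate)
  have step: "\<exists>c'. f_path (tensor_f BA) (replicate m i) c = Some c' \<and> (b', c') \<in> ?S"
    if i: "i \<in> {1..2 * n - 1}" and bc: "(b, c) \<in> ?S" and f: "cr_f BA i b = Some b'" for i b c b'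
  proof -
    let ?I = "replicate m i"
    have I: "set ?I \<subseteq> {1..2 * n - 1}" using i by auto
    have "tensor_f (word_A (2 * n)) i (reading b) = Some (reading b')"
      using BA_path[of "[i]" b b'] f i by simp
    then have "f_path (tensor_f (word_A (2 * n))) ?I (stretch m (reading b)) = Some (stretch m (reading b'))"
      using alignedD(4)[OF al, of i "2 * n" "reading b" "reading b'"] i by simp
    then obtain v where v: "f_path (tensor_f (word_A (2 * n))) ?I (flat c) = Some v"
      "(stretch m (reading b'), v) \<in> R" using word_iso_path[OF R(1) _ I] bc by blast
    then show ?thesis using flat_path_A_ex[OF I v(1)] bc by auto
  qed
  let ?g' = "\<lambda>i. f_path (tensor_f BA) (replicate m i)"
  have "f_path ?g' is (replicate m hA) =
      Some (path_map {1..2 * n - 1} (cr_f BA) hA ?g' (replicate m hA) b)"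
    by (rule path_map_rel(2)[OF sv h _ assms(2,3)]) (rule step)
  then show ?thesis by (simp add: dilatation_def f_path_concat)
qed

section \<open>Exchanging dilatation and embedding\<close>

lemma f_path_replicate_commute:
  assumes "commuting B i j"
  shows "f_path (cr_f B) (concat (replicate m [i, j])) b = f_path (cr_f B) (replicate m i @ replicate m j) b"
proof -
  have c: "Option.bind (cr_f B i b) (cr_f B j) = Option.bind (cr_f B j b) (cr_f B i)" for b
    using assms by (simp add: commuting_def)
  have one: "f_path (cr_f B) (j # replicate k i) b = f_path (cr_f B) (replicate k i @ [j]) b" for k b
  proof (induction k)
    case (Suc k)
    have "f_path (cr_f B) (j # replicate (Suc k) i) b =
      Option.bind (f_path (cr_f B) (replicate k i) b) (\<lambda>x. Option.bind (cr_f B i x) (cr_f B j))"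
      by (simp add: Option.bind_assoc)
    also have "\<dots> = Option.bind (f_path (cr_f B) (j # replicate k i) b) (cr_f B i)"
      by (simp add: c Option.bind_assoc)
    also have "\<dots> = f_path (cr_f B) (replicate (Suc k) i @ [j]) b" using Suc by simp
    finally show ?case .
  qed simp
  show ?thesis
  proof (induction m arbitrary: b)
    case (Suc m)
    have two: "f_path (cr_f B) [i, j] = (\<lambda>x. Option.bind (cr_f B j x) (cr_f B i))"
      by (rule ext) simp
    have "f_path (cr_f B) (concat (replicate (Suc m) [i, j])) b =
      Option.bind (f_path (cr_f B) (replicate m i @ replicate m j) b) (f_path (cr_f B) [i, j])"
      using Suc by (simp add: f_path_append[of _ "[i, j]", simplified])
    also have "\<dots> = Option.bind (f_path (cr_f B) (replicate m j) b)
        (\<lambda>x. Option.bind (f_path (cr_f B) (j # replicate m i) x) (cr_f B i))"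
      unfolding two by (simp add: f_path_append Option.bind_assoc)
    also have "\<dots> = Option.bind (f_path (cr_f B) (replicate m j) b)
        (\<lambda>x. Option.bind (f_path (cr_f B) (replicate m i @ [j]) x) (cr_f B i))"
      unfolding one ..
    also have "\<dots> = f_path (cr_f B) (replicate (Suc m) i @ replicate (Suc m) j) b"
      by (simp add: f_path_append Option.bind_assoc)
    finally show ?case .
  qed simp
qed

text \<open>Dilating the embedded tableau lowers \<open>m\<close> times by one index of a folded
  pair and \<open>m\<close> times by the other, whereas embedding the dilatation alternates between
  them. The two operators commute, so both paths end in the same tensor. At the middle node both are
  \<open>2m\<close> lowerings by \<open>n\<close>.\<close>

lemma theta_A_baker:
  assumes m: "m > 0" and T: "T \<in> RC"
  shows "theta_A (2 * n) \<mu>A m (baker n \<mu> T) = map (baker n \<mu>) (theta_C n \<mu> m T)"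
    and "baker_tensor n \<mu> m (theta_C n \<mu> m T) = map (baker n \<mu>) (theta_C n \<mu> m T)"
proof -
  obtain "is" where is': "set is \<subseteq> {1..n}" "f_path (cr_f BC) is hC = Some T"
    using T by (auto simp: reachable_def)
  let ?ms = "concat (map (replicate m) is)" let ?js = "concat (map (E_index n) is)"
  have ms: "set ?ms \<subseteq> {1..n}" using is'(1) by auto
  note C = baker_tensor_path[OF ms theta_C_path(2)[OF m is']]
  show "baker_tensor n \<mu> m (theta_C n \<mu> m T) = map (baker n \<mu>) (theta_C n \<mu> m T)" by (rule C(1))
  have js: "set ?js \<subseteq> {1..2 * n - 1}" using subsetD[OF is'(1)] subsetD[OF E_index_range]
    unfolding set_concat set_map by blast
  have "f_path (cr_f BA) ?js hA = Some (baker n \<mu> T)"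
    using baker_path(2)[OF is'] by (simp add: f_path_concat f_E_path[abs_def])
  note A = theta_A_path[OF m js this]
  have com: "f_path (tensor_f BA) (concat (map (replicate m) (E_index n i))) b =
      f_path (tensor_f BA) (concat (map (E_index n) (replicate m i))) b" if i: "i \<in> {1..n}" for i b
  proof (cases "i < n")
    case True
    have d: "i + 2 \<le> 2 * n - i" using True by simp
    have w: "commuting (tensor_crystal (word_A (2 * n))) i (2 * n - i)"
      using d by (intro commuting_tensor indep_A commuting_A) auto
    have "f_path (cr_f BA) [i, 2 * n - i] T = f_path (cr_f BA) [2 * n - i, i] T" for T
    proof -
      have I: "set [i, 2 * n - i] \<subseteq> {1..2 * n - 1}" "set [2 * n - i, i] \<subseteq> {1..2 * n - 1}" using True i by auto
      have eq: "f_path (tensor_f (word_A (2 * n))) [i, 2 * n - i] (reading T) =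
        f_path (tensor_f (word_A (2 * n))) [2 * n - i, i] (reading T)"
        using w by (simp add: commuting_def)
      have iff: "f_path (cr_f BA) [i, 2 * n - i] T = Some T' \<longleftrightarrow> f_path (cr_f BA) [2 * n - i, i] T = Some T'" for T'
        unfolding BA_path[OF I(1)] BA_path[OF I(2)] eq ..
      have "x = z" if "\<And>y. x = Some y \<longleftrightarrow> z = Some y" for x z :: "tableau option"
        using that by (metis option.exhaust)
      from this[OF iff] show ?thesis .
    qed
    then have cBA: "commuting BA i (2 * n - i)" by (simp add: commuting_def)
    have iBA: "indep BA i (2 * n - i)" "indep BA (2 * n - i) i"
      using E_index_indep[OF i] True d unfolding virtual_indices_def E_index_def by auto
    show ?thesis
      using f_path_replicate_commute[OF commuting_tensor[OF iBA cBA], of m b] True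
      by (simp add: E_index_def)
  next
    case False
    have "replicate m n @ replicate m n = concat (replicate m [n, n])"
      by (induction m) (auto simp: replicate_app_Cons_same)
    then show ?thesis using False by (simp add: E_index_def)
  qed
  have "f_path (tensor_f BA) (concat (map (replicate m) ?js)) b = f_path (tensor_f BA) (concat (map (E_index n) ?ms)) b" for b
    using is'(1)
  proof (induction "is" arbitrary: b)
    case (Cons i "is")
    then have i: "i \<in> {1..n}" by simp
    have "f_path (tensor_f BA) (concat (map (replicate m) (E_index n i))) =
      f_path (tensor_f BA) (concat (map (E_index n) (replicate m i)))" using com[OF i] by (rule ext)
    then show ?case using Cons by (simp add: f_path_append)
  qed simp
  with A C(2) show "theta_A (2 * n) \<mu>A m (baker n \<mu> T) = map (baker n \<mu>) (theta_C n \<mu> m T)" by simp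
qed

end

section \<open>Columns\<close>

lemma letter_less_trans: "transp letter_less"
  unfolding transp_def letter_less_def by auto

lemma letter_less_hat:
  "x \<in> letters_C n \<Longrightarrow> y \<in> letters_C n \<Longrightarrow> letter_less x y \<longleftrightarrow> hat n x < hat n y"
  by (auto simp: letters_C_def letter_less_def hat_def)

lemma finite_letters_C: "finite (letters_C n)"
  by (rule finite_subset[of _ "{- int n..int n}"]) (auto simp: letters_C_def)

lemma hat_inj: "inj_on (hat n) (letters_C n)"
  by (auto simp: inj_on_def letters_C_def hat_def split: if_splits)

lemma sorted_hat:
  assumes "set C \<subseteq> letters_C n"
  shows "sorted_wrt letter_less C \<longleftrightarrow> sorted_wrt (<) (map (hat n) C)"
  using assms
proof (induction C)
  case (Cons a C)
  then have "letter_less a x \<longleftrightarrow> hat n a < hat n x" if "x \<in> set C" for x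
    using that by (intro letter_less_hat) auto
  then show ?case using Cons by simp
qed simp

lemma sorted_letters_unique:
  assumes "sorted_wrt letter_less C" "sorted_wrt letter_less D" "set C = set D" "0 \<notin> set C"
  shows "C = D"
proof -
  \<comment> \<open>Any bound on the absolute values serves as the size of an alphabet, so that
    \<open>hat\<close> turns the order into that of the integers.\<close>
  obtain n where n: "set C \<subseteq> letters_C n"
  proof -
    have "x \<in> letters_C (nat (Max (abs ` set C)))" if "x \<in> set C" for x
    proof -
      have "\<bar>x\<bar> \<le> Max (abs ` set C)" using that by (intro Max_ge) auto
      moreover have "x \<noteq> 0" using that assms(4) by auto
      ultimately show ?thesis unfolding letters_C_def mem_Collect_eq by linarith
    qed
    then show ?thesis using that by blast
  qed
  have "map (hat n) C = map (hat n) D"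
    using assms n sorted_hat[of C n] sorted_hat[of D n] by (intro strict_sorted_equal) auto
  then show ?thesis
    by (rule map_inj_on) (use n assms(3) in \<open>auto intro: inj_on_subset[OF hat_inj]\<close>)
qed

lemma set_col_of_set: "finite S \<Longrightarrow> 0 \<notin> S \<Longrightarrow> set (col_of_set S) = S"
proof -
  assume "finite S" "0 \<notin> S"
  then have "S \<inter> {0<..} \<union> S \<inter> {..<0} = S" by (auto simp: set_eq_iff) (metis linorder_neqE)
  then show ?thesis using \<open>finite S\<close> by (simp add: col_of_set_def)
qed

lemma sorted_col_of_set: "finite S \<Longrightarrow> sorted_wrt letter_less (col_of_set S)"
proof -
  assume "finite S"
  have "sorted_wrt letter_less (sorted_list_of_set (S \<inter> {0<..}))"
    by (rule sorted_wrt_mono_rel[of _ "(<)"]) (use \<open>finite S\<close> in \<open>auto simp: letter_less_def\<close>)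
  moreover have "sorted_wrt letter_less (sorted_list_of_set (S \<inter> {..<0}))"
    by (rule sorted_wrt_mono_rel[of _ "(<)"]) (use \<open>finite S\<close> in \<open>auto simp: letter_less_def\<close>)
  ultimately show ?thesis
    using \<open>finite S\<close> by (auto simp: col_of_set_def sorted_wrt_append letter_less_def)
qed

lemma distinct_sorted_letters: "sorted_wrt letter_less C \<Longrightarrow> distinct C"
  by (induction C) (auto simp: letter_less_def)

lemma length_col_of_set: "finite S \<Longrightarrow> 0 \<notin> S \<Longrightarrow> length (col_of_set S) = card S"
  using distinct_card[OF distinct_sorted_letters[OF sorted_col_of_set]] set_col_of_set by metis

lemma col_of_set_set: "sorted_wrt letter_less C \<Longrightarrow> 0 \<notin> set C \<Longrightarrow> col_of_set (set C) = C"
  by (intro sorted_letters_unique sorted_col_of_set) (auto simp: set_col_of_set)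

lemma sorted_nth_le_iff:
  fixes xs :: "int list"
  assumes "sorted_wrt (<) xs" "i < length xs"
  shows "xs ! i \<le> x \<longleftrightarrow> i < card {y \<in> set xs. y \<le> x}"
  using assms
proof (induction xs arbitrary: i)
  case (Cons a xs)
  have fin: "finite {y \<in> set xs. y \<le> x}" by simp
  show ?case
  proof (cases "a \<le> x")
    case True
    have "{y \<in> set (a # xs). y \<le> x} = insert a {y \<in> set xs. y \<le> x}" using True by auto
    moreover have "a \<notin> set xs" using Cons.prems by auto
    ultimately have "card {y \<in> set (a # xs). y \<le> x} = Suc (card {y \<in> set xs. y \<le> x})" by simp
    then show ?thesis using Cons True by (cases i) auto
  next
    case False
    then have "{y \<in> set (a # xs). y \<le> x} = {}" using Cons.prems by force
    moreover have "\<not> (a # xs) ! i \<le> x"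
      using Cons.prems False nth_mem[of i "a # xs"] by fastforce
    ultimately show ?thesis by (metis card.empty not_less_zero)
  qed
qed simp

text \<open>The entry with index \<open>i\<close> of a strict column is at most \<open>x\<close>
  exactly when more than \<open>i\<close> entries are, so comparing columns row by row amounts to
  comparing counting functions. Columns can thus be handled as sets.\<close>

lemma sorted_rows_le_iff:
  fixes A B :: "int list"
  assumes "sorted_wrt (<) A" "sorted_wrt (<) B" "length B \<le> length A"
  shows "(\<forall>i<length B. A ! i \<le> B ! i) \<longleftrightarrow>
         (\<forall>x. card {y \<in> set B. y \<le> x} \<le> card {y \<in> set A. y \<le> x})"
proof
  assume *: "\<forall>i<length B. A ! i \<le> B ! i"
  show "\<forall>x. card {y \<in> set B. y \<le> x} \<le> card {y \<in> set A. y \<le> x}"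
  proof (rule ccontr)
    assume "\<not> ?thesis"
    then obtain x where x: "card {y \<in> set A. y \<le> x} < card {y \<in> set B. y \<le> x}" by (auto simp: not_le)
    let ?i = "card {y \<in> set A. y \<le> x}"
    have "card {y \<in> set B. y \<le> x} \<le> length B"
      by (rule le_trans[OF card_mono card_length]) auto
    then have i: "?i < length B" using x by simp
    then have "B ! ?i \<le> x" using sorted_nth_le_iff[OF assms(2) i] x by simp
    then have "A ! ?i \<le> x" using * i by force
    then show False using sorted_nth_le_iff[OF assms(1), of ?i x] i assms(3) by simp
  qed
next
  assume *: "\<forall>x. card {y \<in> set B. y \<le> x} \<le> card {y \<in> set A. y \<le> x}"
  show "\<forall>i<length B. A ! i \<le> B ! i"
  proof (intro allI impI)
    fix i assume i: "i < length B"
    have "i < card {y \<in> set B. y \<le> B ! i}" using sorted_nth_le_iff[OF assms(2) i, of "B ! i"] by simp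
    also have "\<dots> \<le> card {y \<in> set A. y \<le> B ! i}" using * by simp
    finally show "A ! i \<le> B ! i" using sorted_nth_le_iff[OF assms(1), of i "B ! i"] i assms(3) by simp
  qed
qed

definition col_le :: "(int \<Rightarrow> int \<Rightarrow> bool) \<Rightarrow> column \<Rightarrow> column \<Rightarrow> bool" where
  "col_le lt A B \<longleftrightarrow> length B \<le> length A \<and> (\<forall>i<length B. lt (A ! i) (B ! i) \<or> A ! i = B ! i)"

lemma semistandard_iff:
  "semistandard lt T \<longleftrightarrow> (\<forall>C\<in>set T. sorted_wrt lt C) \<and> successively (col_le lt) T"
  unfolding semistandard_def successively_conv_nth col_le_def by blast

definition rank_le :: "nat \<Rightarrow> int set \<Rightarrow> int \<Rightarrow> nat" where
  "rank_le n S x = card {y \<in> S. hat n y \<le> x}"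

lemma col_le_letter_iff:
  assumes "sorted_wrt letter_less A" "sorted_wrt letter_less B"
    and A: "set A \<subseteq> letters_C n" and B: "set B \<subseteq> letters_C n"
  shows "col_le letter_less A B \<longleftrightarrow>
     length B \<le> length A \<and> (\<forall>x. rank_le n (set B) x \<le> rank_le n (set A) x)"
proof -
  have c: "card {y \<in> set (map (hat n) C). y \<le> x} = rank_le n (set C) x" if "set C \<subseteq> letters_C n" for C x
  proof -
    have "{y \<in> set (map (hat n) C). y \<le> x} = hat n ` {y \<in> set C. hat n y \<le> x}" by auto
    moreover have "inj_on (hat n) {y \<in> set C. hat n y \<le> x}"
      by (rule inj_on_subset[OF hat_inj]) (use that in auto)
    ultimately show ?thesis by (simp add: rank_le_def card_image)
  qed
  have "letter_less (A ! i) (B ! i) \<or> A ! i = B ! i \<longleftrightarrow> map (hat n) A ! i \<le> map (hat n) B ! i"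
    if "i < length B" "length B \<le> length A" for i
  proof -
    have "A ! i \<in> letters_C n" "B ! i \<in> letters_C n" using that A B by auto
    then show ?thesis
      using that letter_less_hat hat_inj[THEN inj_onD] by (auto simp: order_le_less)
  qed
  then have "(\<forall>i<length B. letter_less (A ! i) (B ! i) \<or> A ! i = B ! i) \<longleftrightarrow>
      (\<forall>i<length B. map (hat n) A ! i \<le> map (hat n) B ! i)" if "length B \<le> length A"
    using that by blast
  then have "col_le letter_less A B \<longleftrightarrow> length B \<le> length A \<and>
      (\<forall>i<length (map (hat n) B). map (hat n) A ! i \<le> map (hat n) B ! i)"
    unfolding col_le_def length_map by blast
  also have "\<dots> \<longleftrightarrow> length B \<le> length A \<and> (\<forall>x. rank_le n (set B) x \<le> rank_le n (set A) x)"
    using sorted_rows_le_iff[of "map (hat n) A" "map (hat n) B"] assms sorted_hat c by auto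
  finally show ?thesis .
qed

section \<open>Extremal weights and key tableaux\<close>

text \<open>A weight extended to barred letters with the opposite sign, so that swaps and sign
  changes of coordinates both become permutations of letters.\<close>

definition signed :: "weight \<Rightarrow> int \<Rightarrow> int" where
  "signed u x = (if 0 \<le> x then u (nat x) else - u (nat (- x)))"

definition net_count :: "int list \<Rightarrow> int \<Rightarrow> int" where
  "net_count w x = int (count_list w x) - int (count_list w (- x))"

text \<open>Membership in the orbit of \<open>\<mu>\<close> under signed permutations, expressed by
  the sizes of the level sets of the absolute values, hence by the conjugate partition.\<close>

definition rearranges :: "nat \<Rightarrow> weight \<Rightarrow> weight \<Rightarrow> bool" where
  "rearranges N \<mu> u \<longleftrightarrow> (\<forall>i. i \<notin> {1..N} \<longrightarrow> u i = 0) \<and>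
     (\<forall>c\<ge>1. card {i. int c \<le> \<bar>u i\<bar>} = col_height \<mu> c)"

text \<open>Column \<open>c\<close> of the key of weight \<open>u\<close>. The level sets are
  nested, and for \<open>c \<ge> 1\<close> they contain no opposite pair because
  \<open>signed u\<close> changes sign with the letter.\<close>

definition key_set :: "weight \<Rightarrow> nat \<Rightarrow> int set" where
  "key_set u c = {x. int c \<le> signed u x}"

definition key_tab :: "weight \<Rightarrow> weight \<Rightarrow> tableau" where
  "key_tab \<mu> u = map (\<lambda>c. col_of_set (key_set u c)) [1..<Suc (nat (\<mu> 1))]"

lemma net_count_append: "net_count (u @ v) x = net_count u x + net_count v x"
  by (simp add: net_count_def)

lemma net_count_concat: "net_count (concat ws) x = sum_list (map (\<lambda>w. net_count w x) ws)"
  by (induction ws) (simp_all add: net_count_append, simp add: net_count_def)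

lemma signed_minus: "u 0 = 0 \<Longrightarrow> signed u (- x) = - signed u x"
  by (auto simp: signed_def)

context
  fixes N :: nat and \<mu> u :: weight
  assumes part: "is_partition N \<mu>" and u: "rearranges N \<mu> u"
begin

lemma u0: "i \<notin> {1..N} \<Longrightarrow> u i = 0"
  using u unfolding rearranges_def by blast

lemma key_set_sub: "1 \<le> c \<Longrightarrow> key_set u c \<subseteq> letters_C N"
proof
  fix x assume c: "1 \<le> c" and "x \<in> key_set u c"
  then have "signed u x \<noteq> 0" by (auto simp: key_set_def)
  then have "nat \<bar>x\<bar> \<in> {1..N}" using u0 by (auto simp: signed_def split: if_splits)
  then show "x \<in> letters_C N" by (auto simp: letters_C_def)
qed

lemma finite_key_set: "1 \<le> c \<Longrightarrow> finite (key_set u c)"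
  using key_set_sub finite_letters_C finite_subset by blast

lemma zero_key_set: "1 \<le> c \<Longrightarrow> 0 \<notin> key_set u c"
  using key_set_sub by (auto simp: letters_C_def)

text \<open>A coordinate of absolute value at least \<open>c\<close> contributes exactly one of its
  two letters, the one with the sign of the coordinate.\<close>

lemma card_key_set:
  assumes c: "1 \<le> c"
  shows "card (key_set u c) = col_height \<mu> c"
proof -
  have "bij_betw (\<lambda>x. nat \<bar>x\<bar>) (key_set u c) {i. int c \<le> \<bar>u i\<bar>}"
  proof (rule bij_betw_byWitness[where f' = "\<lambda>i. if 0 \<le> u i then int i else - int i"])
    show "(\<lambda>x. nat \<bar>x\<bar>) ` key_set u c \<subseteq> {i. int c \<le> \<bar>u i\<bar>}"
      by (auto simp: key_set_def signed_def abs_if)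
    show "(\<lambda>i. if 0 \<le> u i then int i else - int i) ` {i. int c \<le> \<bar>u i\<bar>} \<subseteq> key_set u c"
      using c u0[of 0] by (auto simp: key_set_def signed_def)
    show "\<forall>x\<in>key_set u c. (if 0 \<le> u (nat \<bar>x\<bar>) then int (nat \<bar>x\<bar>) else - int (nat \<bar>x\<bar>)) = x"
      using c by (auto simp: key_set_def signed_def split: if_splits)
    show "\<forall>i\<in>{i. int c \<le> \<bar>u i\<bar>}. nat \<bar>if 0 \<le> u i then int i else - int i\<bar> = i" by simp
  qed
  then show ?thesis using u c by (simp add: bij_betw_same_card rearranges_def)
qed

lemma key_set_opposite: "1 \<le> c \<Longrightarrow> 1 \<le> c' \<Longrightarrow> x \<in> key_set u c \<Longrightarrow> - x \<notin> key_set u c'"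
  using signed_minus[of u x] u0[of 0] by (auto simp: key_set_def)

lemma key_set_mono: "c \<le> c' \<Longrightarrow> key_set u c' \<subseteq> key_set u c"
  by (auto simp: key_set_def)

lemma signed_le: "signed u x \<le> \<mu> 1"
proof -
  \<comment> \<open>The first level above \<open>\<mu> 1\<close> is empty for \<open>\<mu>\<close>
    and therefore for \<open>u\<close>.\<close>
  let ?c = "Suc (nat (\<mu> 1))"
  have "col_height \<mu> ?c = 0"
  proof -
    have "\<not> int ?c \<le> \<mu> i" for i using partition_le_first[OF part, of i] by linarith
    then show ?thesis by (simp add: col_height_def del: of_nat_Suc)
  qed
  then have "key_set u ?c = {}" using card_key_set[of ?c] finite_key_set[of ?c] by simp
  then have "x \<notin> key_set u ?c" by simp
  then show ?thesis using partition_nonneg[OF part, of 1] by (simp add: key_set_def)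
qed

lemma key_col_facts:
  assumes "1 \<le> c"
  shows "set (col_of_set (key_set u c)) = key_set u c"
    and "sorted_wrt letter_less (col_of_set (key_set u c))"
    and "length (col_of_set (key_set u c)) = col_height \<mu> c"
    and "distinct (col_of_set (key_set u c))"
  using assms set_col_of_set sorted_col_of_set length_col_of_set card_key_set finite_key_set zero_key_set
    distinct_sorted_letters by simp_all

lemma map_length_key_tab: "map length (key_tab \<mu> u) = col_heights \<mu>"
  unfolding key_tab_def col_heights_eq map_map comp_def
  by (rule map_cong) (auto intro!: key_col_facts(3) simp del: upt_Suc)

lemma key_tab_col:
  assumes "C \<in> set (key_tab \<mu> u)"
  obtains c where "1 \<le> c" "C = col_of_set (key_set u c)"
  using assms unfolding key_tab_def by (auto simp del: upt_Suc)

lemma net_count_key_tab: "net_count (concat (key_tab \<mu> u)) x = signed u x"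
proof -
  have cnt: "count_list (concat (key_tab \<mu> u)) y = nat (signed u y)" for y
  proof -
    have "count_list (concat (key_tab \<mu> u)) y =
        sum_list (map (\<lambda>c. if int c \<le> signed u y then 1 else 0) [1..<Suc (nat (\<mu> 1))])"
      unfolding count_list_concat key_tab_def map_map comp_def
    proof (intro arg_cong[of _ _ sum_list] map_cong refl)
      fix c assume "c \<in> set [1..<Suc (nat (\<mu> 1))]"
      then have "1 \<le> c" by (simp only: set_upt atLeastLessThan_iff)
      from key_col_facts(1,4)[OF this]
      show "count_list (col_of_set (key_set u c)) y = (if int c \<le> signed u y then 1 else 0)"
        by (simp add: count_list_distinct) (simp add: key_set_def)
    qed
    then show ?thesis using sum_list_threshold signed_le[of y] by (simp add: min_absorb1 nat_mono)
  qed
  have "signed u (- x) = - signed u x" using u0[of 0] by (intro signed_minus) simp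
  then show ?thesis unfolding net_count_def cnt by simp
qed

text \<open>Summed over all columns, the net number of letters of \<open>U = key_set u c\<close> depends only on the
  weight, while a single column of height \<open>h\<close> contributes at most \<open>min h (card U)\<close>. The key columns
  attain this bound, hence so does every other filling of the same weight.\<close>

lemma extremal_columns:
  assumes len: "map length Ys = map length Xs"
    and X: "\<And>X. X \<in> set Xs \<Longrightarrow> \<exists>c\<ge>1. X = col_of_set (key_set u c)"
    and Y: "\<And>Y. Y \<in> set Ys \<Longrightarrow> distinct Y"
    and wt: "net_count (concat Ys) = net_count (concat Xs)"
    and j: "j < length Xs"
  shows "set (Ys ! j) = set (Xs ! j)"
proof -
  have len': "length Ys = length Xs" "\<And>k. k < length Xs \<Longrightarrow> length (Ys ! k) = length (Xs ! k)"
    using len by (metis length_map, metis len length_map nth_map)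
  obtain c where c: "1 \<le> c" "Xs ! j = col_of_set (key_set u c)" using X[of "Xs ! j"] j by auto
  let ?U = "key_set u c"
  have fin: "finite ?U" using finite_key_set[OF c(1)] .
  define F where "F = (\<lambda>D. \<Sum>x\<in>?U. net_count D x)"
  have F_concat: "(\<Sum>k<length Zs. F (Zs ! k)) = (\<Sum>x\<in>?U. net_count (concat Zs) x)" for Zs
    unfolding F_def by (subst sum.swap) (simp add: net_count_concat sum_list_sum_nth atLeast0LessThan)
  have count: "(\<Sum>x\<in>?U. int (count_list D x)) = int (card (set D \<inter> ?U))" if "distinct D" for D
  proof -
    have "(\<Sum>x\<in>?U. int (count_list D x)) = (\<Sum>x\<in>?U. if x \<in> set D then 1 else 0)"
      using that by (intro sum.cong) (auto simp: count_list_distinct)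
    also have "\<dots> = int (card (set D \<inter> ?U))"
      using fin by (simp add: sum.If_cases Int_commute)
    finally show ?thesis .
  qed
  have le: "F D \<le> int (card (set D \<inter> ?U))" if "distinct D" for D
    unfolding count[OF that, symmetric] F_def net_count_def by (intro sum_mono) simp
  have eq: "F (Xs ! k) = int (min (length (Xs ! k)) (card ?U))" if k: "k < length Xs" for k
  proof -
    obtain c' where c': "1 \<le> c'" "Xs ! k = col_of_set (key_set u c')" using X[of "Xs ! k"] k by auto
    note K = key_col_facts[OF c'(1)]
    have "count_list (Xs ! k) (- x) = 0" if "x \<in> ?U" for x
      using key_set_opposite[OF c(1) c'(1) that] K(1) c'(2) by (simp add: count_list_0_iff)
    then have "F (Xs ! k) = (\<Sum>x\<in>?U. int (count_list (Xs ! k) x))"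
      unfolding F_def net_count_def by (intro sum.cong) simp_all
    also have "\<dots> = int (card (key_set u c' \<inter> ?U))" using count K c'(2) by simp
    \<comment> \<open>The key sets form a chain, so the smaller of the two is the
      intersection.\<close>
    also have "card (key_set u c' \<inter> ?U) = min (length (Xs ! k)) (card ?U)"
    proof (cases "c \<le> c'")
      case True
      then have "key_set u c' \<subseteq> ?U" by (rule key_set_mono)
      then have "card (key_set u c') \<le> card ?U" "key_set u c' \<inter> ?U = key_set u c'"
        using fin by (auto intro: card_mono)
      then show ?thesis using K(3) c'(2) card_key_set[OF c'(1)] by simp
    next
      case False
      then have "?U \<subseteq> key_set u c'" by (intro key_set_mono) simp
      then have "card ?U \<le> card (key_set u c')" "key_set u c' \<inter> ?U = ?U"
        using finite_key_set[OF c'(1)] by (auto intro: card_mono)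
      then show ?thesis using K(3) c'(2) card_key_set[OF c'(1)] by simp
    qed
    finally show ?thesis .
  qed
  have mono: "F (Ys ! k) \<le> F (Xs ! k)" if k: "k < length Xs" for k
  proof -
    have d: "distinct (Ys ! k)" using Y k len'(1) by simp
    have "card (set (Ys ! k) \<inter> ?U) \<le> min (length (Ys ! k)) (card ?U)"
      using fin card_length[of "Ys ! k"] card_mono[of "set (Ys ! k)" "set (Ys ! k) \<inter> ?U"]
        card_mono[of ?U "set (Ys ! k) \<inter> ?U"] by simp
    then have "int (card (set (Ys ! k) \<inter> ?U)) \<le> int (min (length (Xs ! k)) (card ?U))"
      using len'(2)[OF k] by simp
    then show ?thesis using le[OF d] unfolding eq[OF k] by (rule order_trans[rotated])
  qed
  have "(\<Sum>k<length Xs. F (Ys ! k)) = (\<Sum>k<length Xs. F (Xs ! k))"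
    using F_concat[of Ys] F_concat[of Xs] wt len'(1) by simp
  \<comment> \<open>Equal sums with termwise inequalities force termwise equality. In column
    \<open>j\<close> the bound equals both the height and \<open>card ?U\<close>, so the column
    fills \<open>?U\<close> completely.\<close>
  then have "F (Ys ! j) = F (Xs ! j)" using j mono sum_mono_inv[of "\<lambda>k. F (Ys ! k)" "{..<length Xs}" "\<lambda>k. F (Xs ! k)" j] by auto
  moreover have d: "distinct (Ys ! j)" using Y j len'(1) by simp
  moreover have "length (Xs ! j) = card ?U" using c key_col_facts(3)[OF c(1)] card_key_set by simp
  ultimately have ge: "card ?U \<le> card (set (Ys ! j) \<inter> ?U)" using le[OF d] eq[OF j] by simp
  then have "set (Ys ! j) \<inter> ?U = ?U" using fin by (intro card_seteq) auto
  moreover have "card (set (Ys ! j)) = card ?U"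
    using d len'(2)[OF j] \<open>length (Xs ! j) = card ?U\<close> by (simp add: distinct_card)
  ultimately have "set (Ys ! j) = ?U" using fin card_subset_eq[of "set (Ys ! j)" ?U] by auto
  then show ?thesis using c key_col_facts(1)[OF c(1)] by simp
qed

text \<open>Stated for \<open>k\<close> tableaux at once: of the dilatation of a key only the
  shapes, the strictness of columns and the total weight are known, and these already pin down every
  factor.\<close>

lemma extremal_tableaux:
  assumes sh: "map (map length) Ts = replicate k (col_heights \<mu>)"
    and sorted: "\<And>T C. T \<in> set Ts \<Longrightarrow> C \<in> set T \<Longrightarrow> sorted_wrt letter_less C"
    and wt: "\<And>x. net_count (concat (concat Ts)) x = int k * signed u x"
  shows "Ts = replicate k (key_tab \<mu> u)"
proof -
  let ?K = "key_tab \<mu> u"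
  let ?Xs = "concat (replicate k ?K)"
  have sh': "map (map length) Ts = map (map length) (replicate k ?K)"
    using sh map_length_key_tab by (simp add: map_replicate)
  have len: "map length (concat Ts) = map length ?Xs" using sh' by (metis map_concat)
  have X: "\<exists>c\<ge>1. X = col_of_set (key_set u c)" if "X \<in> set ?Xs" for X
    using that key_tab_col by (auto split: if_splits)
  have "net_count (concat ?Xs) x = int k * signed u x" for x
    by (induction k) (auto simp: net_count_append net_count_key_tab algebra_simps, simp add: net_count_def)
  then have wt': "net_count (concat (concat Ts)) = net_count (concat ?Xs)" using wt by (simp add: fun_eq_iff)
  have d: "distinct Y" if "Y \<in> set (concat Ts)" for Y using that sorted distinct_sorted_letters by auto
  have "concat Ts = ?Xs"
  proof (rule nth_equalityI)
    show l: "length (concat Ts) = length ?Xs" using len by (metis length_map)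
    fix j assume j: "j < length (concat Ts)"
    then have j': "j < length ?Xs" using l by simp
    note S = extremal_columns[OF len X d wt' j']
    obtain c where c: "1 \<le> c" "?Xs ! j = col_of_set (key_set u c)" using X[of "?Xs ! j"] j' nth_mem by blast
    have "concat Ts ! j \<in> set (concat Ts)" using j nth_mem by blast
    then have "sorted_wrt letter_less (concat Ts ! j)" using sorted by auto
    then show "concat Ts ! j = ?Xs ! j"
      using S c key_col_facts[OF c(1)] zero_key_set[OF c(1)] by (intro sorted_letters_unique) auto
  qed
  then show ?thesis
  proof (rule concat_injective)
    show l: "length Ts = length (replicate k ?K)" using sh' by (metis length_map)
    show "\<forall>(x, y)\<in>set (zip Ts (replicate k ?K)). length x = length y"
    proof (clarsimp simp: set_zip)
      fix i assume i: "i < length Ts" "i < k"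
      have "map length (Ts ! i) = col_heights \<mu>"
        using arg_cong[OF sh, of "\<lambda>z. z ! i"] i by simp
      then show "length (Ts ! i) = length ?K" using map_length_key_tab by (metis length_map)
    qed
  qed
qed

lemma extremal_tableau:
  assumes "map length T = col_heights \<mu>" "\<And>C. C \<in> set T \<Longrightarrow> sorted_wrt letter_less C"
    "\<And>x. net_count (concat T) x = signed u x"
  shows "T = key_tab \<mu> u"
  using extremal_tableaux[of "[T]" 1] assms by simp

lemma is_key_key_tab: "is_key (key_tab \<mu> u)"
  unfolding is_key_def
proof (intro conjI allI impI notI)
  fix j assume j: "Suc j < length (key_tab \<mu> u)"
  have "set (key_tab \<mu> u ! k) = key_set u (Suc k)" if "k < length (key_tab \<mu> u)" for k
    using that key_col_facts(1)[of "Suc k"] by (simp add: key_tab_def del: upt_Suc)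
  then show "set (key_tab \<mu> u ! Suc j) \<subseteq> set (key_tab \<mu> u ! j)"
    using j key_set_mono[of "Suc j" "Suc (Suc j)"] by simp
next
  fix x assume x: "x \<in> set (concat (key_tab \<mu> u)) \<and> - x \<in> set (concat (key_tab \<mu> u))"
  then obtain C C' where "C \<in> set (key_tab \<mu> u)" "x \<in> set C" "C' \<in> set (key_tab \<mu> u)" "- x \<in> set C'" by auto
  then obtain c c' where "1 \<le> c" "1 \<le> c'" "x \<in> key_set u c" "- x \<in> key_set u c'"
    using key_col_facts(1) by (metis key_tab_col)
  then show False using key_set_opposite by blast
qed

lemma semistandard_key:
  assumes "set cs \<subseteq> {1..}" "sorted cs"
  shows "semistandard letter_less (map (\<lambda>c. col_of_set (key_set u c)) cs)"
  unfolding semistandard_iff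
proof
  show "\<forall>C\<in>set (map (\<lambda>c. col_of_set (key_set u c)) cs). sorted_wrt letter_less C"
    using assms(1) key_col_facts(2) by auto
  have le: "col_le letter_less (col_of_set (key_set u c)) (col_of_set (key_set u c'))"
    if "1 \<le> c" "c \<le> c'" for c c'
  proof -
    have c': "1 \<le> c'" using that by simp
    note K = key_col_facts[OF that(1)] and K' = key_col_facts[OF c']
    have sub: "key_set u c' \<subseteq> key_set u c" by (rule key_set_mono[OF that(2)])
    have "rank_le N (key_set u c') x \<le> rank_le N (key_set u c) x" for x
      unfolding rank_le_def using sub finite_key_set[OF that(1)] by (intro card_mono) auto
    moreover have "card (key_set u c') \<le> card (key_set u c)"
      using sub finite_key_set[OF that(1)] by (intro card_mono)
    ultimately show ?thesis
      using col_le_letter_iff[OF K(2) K'(2), of N] key_set_sub[OF that(1)] key_set_sub[OF c']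
        card_key_set[OF that(1)] card_key_set[OF c'] unfolding K(1,3) K'(1,3) by simp
  qed
  show "successively (col_le letter_less) (map (\<lambda>c. col_of_set (key_set u c)) cs)"
    using assms
  proof (induction cs)
    case (Cons c cs)
    then show ?case using le by (cases cs) auto
  qed simp
qed

end

section \<open>Admissible columns\<close>

text \<open>Scanning \<open>n, n - 1, \<dots>, j\<close>, a letter \<open>k\<close> with \<open>k, -k \<in> S\<close> opens a bracket and one with
  \<open>k, -k \<notin> S\<close> closes the bracket if one is open; \<open>pending n S j\<close> is the number of brackets still open. The
  sequence \<open>t\<close> consists of the letters that close a bracket.\<close>

definition pending :: "nat \<Rightarrow> int set \<Rightarrow> int \<Rightarrow> nat" where
  "pending n S j = foldr (\<lambda>k p. if k \<in> S \<and> - k \<in> S then Suc p else if k \<notin> S \<and> - k \<notin> S then p - 1 else p)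
     [j..int n] 0"

definition closers :: "nat \<Rightarrow> int set \<Rightarrow> int set" where
  "closers n S = {t. 1 \<le> t \<and> t \<le> int n \<and> t \<notin> S \<and> - t \<notin> S \<and> 0 < pending n S (t + 1)}"

definition openers :: "int set \<Rightarrow> int set" where
  "openers S = {z. 0 < z \<and> z \<in> S \<and> - z \<in> S}"

lemma pending_rec:
  "j \<le> int n \<Longrightarrow> pending n S j =
     (if j \<in> S \<and> - j \<in> S then Suc (pending n S (j + 1))
      else if j \<notin> S \<and> - j \<notin> S then pending n S (j + 1) - 1 else pending n S (j + 1))"
  by (simp add: pending_def upto_rec1)

lemma pending_beyond: "int n < j \<Longrightarrow> pending n S j = 0"
  by (simp add: pending_def)

lemma pending_cong:
  assumes "\<And>k. j \<le> k \<Longrightarrow> k \<le> int n \<Longrightarrow> (k \<in> S \<longleftrightarrow> k \<in> S') \<and> (- k \<in> S \<longleftrightarrow> - k \<in> S')"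
  shows "pending n S j = pending n S' j"
  unfolding pending_def by (rule foldr_cong) (use assms in auto)

text \<open>The scan runs downwards, so the state at \<open>i\<close> and the letters below
  \<open>i\<close> determine everything further down.\<close>

lemma pending_cong_below:
  assumes "\<And>k. 1 \<le> k \<Longrightarrow> k < i \<Longrightarrow> (k \<in> S \<longleftrightarrow> k \<in> S') \<and> (- k \<in> S \<longleftrightarrow> - k \<in> S')"
    and "pending n S i = pending n S' i" "i \<le> int n + 1" "1 \<le> j" "j \<le> i"
  shows "pending n S j = pending n S' j"
proof -
  have "pending n S (i - int k) = pending n S' (i - int k)" if "1 \<le> i - int k" for k
    using that
  proof (induction k)
    case (Suc k)
    have e: "i - int (Suc k) + 1 = i - int k" by simp
    have l: "i - int (Suc k) \<le> int n" using assms(3) by simp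
    have "i - int (Suc k) < i" by simp
    from assms(1)[OF Suc.prems this] show ?case
      unfolding pending_rec[OF l] e using Suc by simp
  qed (use assms(2) in simp)
  from this[of "nat (i - j)"] assms(4,5) show ?thesis by simp
qed

lemma down_induct:
  assumes "P (int n + 1)" "\<And>j. 1 \<le> j \<Longrightarrow> j \<le> int n \<Longrightarrow> P (j + 1) \<Longrightarrow> P j" "1 \<le> j" "j \<le> int n + 1"
  shows "P j"
proof -
  have "P (int n + 1 - int k)" if "k \<le> n" for k
    using that
  proof (induction k)
    case (Suc k)
    have e: "int n + 1 - int (Suc k) + 1 = int n + 1 - int k" by simp
    show ?case
    proof (rule assms(2))
      show "1 \<le> int n + 1 - int (Suc k)" "int n + 1 - int (Suc k) \<le> int n" using Suc.prems by auto
      show "P (int n + 1 - int (Suc k) + 1)" unfolding e using Suc by simp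
    qed
  qed (use assms(1) in simp)
  from this[of "nat (int n + 1 - j)"] assms(3,4) show ?thesis by simp
qed

lemma card_step:
  fixes A :: "int set"
  assumes "finite A"
  shows "card {x \<in> A. j \<le> x} = card {x \<in> A. j + 1 \<le> x} + (if j \<in> A then 1 else 0)"
proof (cases "j \<in> A")
  case True
  then have "{x \<in> A. j \<le> x} = insert j {x \<in> A. j + 1 \<le> x}" by auto
  then show ?thesis using True assms by simp
next
  case False
  then have "{x \<in> A. j \<le> x} = {x \<in> A. j + 1 \<le> x}" by (auto simp: order_le_less)
  then show ?thesis using False by simp
qed

text \<open>Conservation of brackets: those opened so far are still open or already closed.
  \<open>T\<close> is general because it stands both for \<open>closers\<close> and for the entries
  of a given sequence \<open>ts\<close>; in the latter case the decision at \<open>j\<close> is made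
  with the help of the count above \<open>j\<close>, hence the form of the third assumption.\<close>

lemma pending_count_gen:
  assumes S: "S \<subseteq> letters_C n" and T: "T \<subseteq> {t. 1 \<le> t \<and> t \<le> int n \<and> t \<notin> S \<and> - t \<notin> S}"
    and dec: "\<And>j. 1 \<le> j \<Longrightarrow> j \<le> int n \<Longrightarrow> j \<notin> S \<Longrightarrow> - j \<notin> S \<Longrightarrow>
       card {z \<in> openers S. j + 1 \<le> z} = pending n S (j + 1) + card {t \<in> T. j + 1 \<le> t} \<Longrightarrow>
       j \<in> T \<longleftrightarrow> 0 < pending n S (j + 1)"
    and j: "1 \<le> j" "j \<le> int n + 1"
  shows "card {z \<in> openers S. j \<le> z} = pending n S j + card {t \<in> T. j \<le> t}"
proof (rule down_induct[OF _ _ j])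
  have 1: "{z \<in> openers S. int n + 1 \<le> z} = {}" using S by (auto simp: openers_def letters_C_def)
  have 2: "{t \<in> T. int n + 1 \<le> t} = {}" using T by auto
  show "card {z \<in> openers S. int n + 1 \<le> z} = pending n S (int n + 1) + card {t \<in> T. int n + 1 \<le> t}"
    unfolding 1 2 by (simp add: pending_beyond)
next
  fix j assume j: "1 \<le> j" "j \<le> int n"
    and IH: "card {z \<in> openers S. j + 1 \<le> z} = pending n S (j + 1) + card {t \<in> T. j + 1 \<le> t}"
  have fin: "finite (openers S)" "finite T"
    by (rule finite_subset[OF _ finite_letters_C[of n]], use S in \<open>auto simp: openers_def\<close>)
      (rule finite_subset[OF T], rule finite_subset[of _ "{1..int n}"], auto)
  have o: "j \<in> openers S \<longleftrightarrow> j \<in> S \<and> - j \<in> S" using j by (simp add: openers_def)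
  have t: "j \<in> T \<longleftrightarrow> j \<notin> S \<and> - j \<notin> S \<and> 0 < pending n S (j + 1)"
    using T dec[OF j _ _ IH] by blast
  show "card {z \<in> openers S. j \<le> z} = pending n S j + card {t \<in> T. j \<le> t}"
    unfolding card_step[OF fin(1), of j] card_step[OF fin(2), of j] pending_rec[OF j(2)] IH o t
    by (cases "j \<in> S"; cases "- j \<in> S"; cases "pending n S (j + 1)") simp_all
qed

lemma pending_count:
  assumes "S \<subseteq> letters_C n" "1 \<le> j" "j \<le> int n + 1"
  shows "card {z \<in> openers S. j \<le> z} = pending n S j + card {t \<in> closers n S. j \<le> t}"
  by (rule pending_count_gen[OF assms(1) _ _ assms(2,3)]) (auto simp: closers_def)

lemma finite_closers: "finite (closers n S)"
  by (rule finite_subset[of _ "{1..int n}"]) (auto simp: closers_def)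

lemma finite_openers: "S \<subseteq> letters_C n \<Longrightarrow> finite (openers S)"
  by (rule finite_subset[OF _ finite_letters_C[of n]]) (auto simp: openers_def)

section \<open>The greedy sequence as a bracket matching\<close>

lemma descending_nth_ge_iff:
  fixes xs :: "int list"
  assumes "sorted_wrt (>) xs" "k < length xs"
  shows "j \<le> xs ! k \<longleftrightarrow> k < card {x \<in> set xs. j \<le> x}"
proof -
  have "sorted_wrt (<) (map uminus xs)" using assms(1) by (simp add: sorted_wrt_map)
  then have "map uminus xs ! k \<le> - j \<longleftrightarrow> k < card {y \<in> set (map uminus xs). y \<le> - j}"
    using assms(2) by (intro sorted_nth_le_iff) simp_all
  moreover have "{y \<in> set (map uminus xs). y \<le> - j} = uminus ` {x \<in> set xs. j \<le> x}" by auto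
  then have "card {y \<in> set (map uminus xs). y \<le> - j} = card {x \<in> set xs. j \<le> x}"
    by (simp add: card_image)
  ultimately show ?thesis using assms(2) by simp
qed

lemma z_seq:
  assumes "set C \<subseteq> letters_C n"
  shows "set (z_seq C) = openers (set C)" "sorted_wrt (>) (z_seq C)" "length (z_seq C) = card (openers (set C))"
proof -
  have p: "paired C = openers (set C)" by (simp add: paired_def openers_def)
  have f: "finite (paired C)" using finite_openers[OF assms] p by simp
  show "set (z_seq C) = openers (set C)" "sorted_wrt (>) (z_seq C)" "length (z_seq C) = card (openers (set C))"
    using f by (simp_all add: z_seq_def p sorted_wrt_rev)
qed

text \<open>If \<open>k\<close> entries of \<open>ts\<close> exceed a free letter \<open>j\<close>,
  the greedy rule takes \<open>j\<close> next precisely when the opener with index \<open>k\<close>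
  lies above \<open>j\<close>, that is, when more than \<open>k\<close> openers do; by the bracket
  count this says that a bracket is pending. Equal lengths of the two sequences leave none open at
  the bottom.\<close>

lemma is_t_seqD:
  assumes C: "set C \<subseteq> letters_C n" and ts: "is_t_seq C ts"
  shows "set ts = closers n (set C)" "sorted_wrt (>) ts" "pending n (set C) 1 = 0"
proof -
  let ?S = "set C" let ?zs = "z_seq C"
  note Z = z_seq[OF C]
  have len: "length ts = length ?zs" using ts by (simp add: is_t_seq_def)
  have in_k: "1 \<le> ts ! k \<and> ts ! k < ?zs ! k \<and> (0 < k \<longrightarrow> ts ! k < ts ! (k - 1)) \<and> ts ! k \<notin> ?S \<and> - ts ! k \<notin> ?S"
    and max_k: "\<And>t. 1 \<le> t \<Longrightarrow> t < ?zs ! k \<Longrightarrow> (0 < k \<longrightarrow> t < ts ! (k - 1)) \<Longrightarrow> t \<notin> ?S \<Longrightarrow> - t \<notin> ?S \<Longrightarrow> t \<le> ts ! k"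
    if "k < length ts" for k
    using ts that unfolding is_t_seq_def Let_def by blast+
  have "ts ! Suc k < ts ! k" if "Suc k < length ts" for k using in_k[OF that] by simp
  then show sorted: "sorted_wrt (>) ts"
    by (subst sorted_wrt_iff_nth_Suc_transp) (auto simp: transp_def)
  have zle: "z \<le> int n" if "z \<in> set ?zs" for z using that Z(1) C by (auto simp: openers_def letters_C_def)
  have T: "set ts \<subseteq> {t. 1 \<le> t \<and> t \<le> int n \<and> t \<notin> ?S \<and> - t \<notin> ?S}"
  proof
    fix t assume "t \<in> set ts"
    then obtain k where k: "k < length ts" "t = ts ! k" by (auto simp: in_set_conv_nth)
    then have "?zs ! k \<le> int n" using len by (intro zle) simp
    then show "t \<in> {t. 1 \<le> t \<and> t \<le> int n \<and> t \<notin> ?S \<and> - t \<notin> ?S}" using in_k[OF k(1)] k by simp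
  qed
  have dec: "j \<in> set ts \<longleftrightarrow> 0 < pending n ?S (j + 1)"
    if j: "1 \<le> j" "j \<le> int n" "j \<notin> ?S" "- j \<notin> ?S"
      and c: "card {z \<in> openers ?S. j + 1 \<le> z} = pending n ?S (j + 1) + card {t \<in> set ts. j + 1 \<le> t}" for j
  proof -
    let ?k = "card {t \<in> set ts. j + 1 \<le> t}"
    note dz = descending_nth_ge_iff[OF Z(2), unfolded Z(1), of _ "j + 1"]
    note dt = descending_nth_ge_iff[OF sorted, of _ "j + 1"]
    show ?thesis
    proof
      assume "j \<in> set ts"
      then obtain k where k: "k < length ts" "j = ts ! k" by (auto simp: in_set_conv_nth)
      have "j + 1 \<le> ?zs ! k" "\<not> j + 1 \<le> ts ! k" using in_k[OF k(1)] k(2) by auto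
      then have "k < card {z \<in> openers ?S. j + 1 \<le> z}" "\<not> k < ?k" using dz dt k(1) len by auto
      then show "0 < pending n ?S (j + 1)" using c by simp
    next
      assume "0 < pending n ?S (j + 1)"
      then have lt: "?k < card {z \<in> openers ?S. j + 1 \<le> z}" using c by simp
      also have "\<dots> \<le> card (openers ?S)" using finite_openers[OF C] by (intro card_mono) auto
      finally have k: "?k < length ts" using Z(3) len by simp
      have z: "j + 1 \<le> ?zs ! ?k" using dz lt k len by simp
      have t: "ts ! ?k \<le> j" using dt[of ?k] k by simp
      have "j < ts ! (?k - 1)" if "0 < ?k"
      proof -
        have "?k - 1 < length ts" using k by simp
        from dt[OF this] that show ?thesis by linarith
      qed
      then have "j \<le> ts ! ?k" using max_k[OF k j(1)] z j by simp
      then have "j = ts ! ?k" using t by simp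
      then show "j \<in> set ts" using nth_mem[OF k] by metis
    qed
  qed
  have P: "card {z \<in> openers ?S. j \<le> z} = pending n ?S j + card {t \<in> set ts. j \<le> t}"
    if "1 \<le> j" "j \<le> int n + 1" for j
    by (rule pending_count_gen[OF C T _ that]) (rule dec)
  show eq: "set ts = closers n ?S"
  proof (intro set_eqI)
    fix t
    show "t \<in> set ts \<longleftrightarrow> t \<in> closers n ?S"
    proof (cases "1 \<le> t \<and> t \<le> int n \<and> t \<notin> ?S \<and> - t \<notin> ?S")
      case True
      then have "card {z \<in> openers ?S. t + 1 \<le> z} = pending n ?S (t + 1) + card {x \<in> set ts. t + 1 \<le> x}"
        by (intro P) simp_all
      from dec[OF _ _ _ _ this] have "t \<in> set ts \<longleftrightarrow> 0 < pending n ?S (t + 1)" using True by blast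
      then show ?thesis using True unfolding closers_def mem_Collect_eq by blast
    next
      case False
      then show ?thesis using T by (auto simp: closers_def)
    qed
  qed
  have "{z \<in> openers ?S. 1 \<le> z} = openers ?S" "{t \<in> set ts. 1 \<le> t} = set ts"
    using T by (auto simp: openers_def)
  moreover have "distinct ts" using sorted by (induction ts) auto
  then have "card (set ts) = length ts" by (rule distinct_card)
  ultimately show "pending n ?S 1 = 0" using P[of 1] Z(3) len by simp
qed

lemma is_t_seqI:
  assumes C: "set C \<subseteq> letters_C n" and p: "pending n (set C) 1 = 0"
  shows "is_t_seq C (rev (sorted_list_of_set (closers n (set C))))"
proof -
  let ?S = "set C" let ?zs = "z_seq C" let ?T = "closers n (set C)"
  let ?ts = "rev (sorted_list_of_set ?T)"
  note Z = z_seq[OF C]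
  have ts: "set ?ts = ?T" "sorted_wrt (>) ?ts" "length ?ts = card ?T"
    using finite_closers by (simp_all add: sorted_wrt_rev)
  have "{z \<in> openers ?S. 1 \<le> z} = openers ?S" "{t \<in> ?T. 1 \<le> t} = ?T"
    by (auto simp: openers_def closers_def)
  then have len: "length ?ts = length ?zs"
    using pending_count[OF C, of 1] p Z(3) ts(3) by simp
  note dz = descending_nth_ge_iff[OF Z(2), unfolded Z(1)]
  note dt = descending_nth_ge_iff[OF ts(2), unfolded ts(1)]
  have "1 \<le> ?ts ! k \<and> ?ts ! k < ?zs ! k \<and> (0 < k \<longrightarrow> ?ts ! k < ?ts ! (k - 1)) \<and> ?ts ! k \<notin> ?S \<and> - ?ts ! k \<notin> ?S \<and>
     (\<forall>t. 1 \<le> t \<and> t < ?zs ! k \<and> (0 < k \<longrightarrow> t < ?ts ! (k - 1)) \<and> t \<notin> ?S \<and> - t \<notin> ?S \<longrightarrow> t \<le> ?ts ! k)"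
    if k: "k < length ?ts" for k
  proof (intro conjI allI impI)
    define t where "t = ?ts ! k"
    have tT: "t \<in> ?T" using k ts(1) unfolding t_def by (metis nth_mem)
    then have t: "1 \<le> t" "t \<le> int n" "t \<notin> ?S" "- t \<notin> ?S" "0 < pending n ?S (t + 1)" by (auto simp: closers_def)
    show "1 \<le> ?ts ! k" "?ts ! k \<notin> ?S" "- ?ts ! k \<notin> ?S" using t t_def by auto
    have "\<not> k < card {x \<in> ?T. t + 1 \<le> x}" "k < card {x \<in> ?T. t \<le> x}"
      using dt[OF k, of "t + 1"] dt[OF k, of t] unfolding t_def[symmetric] by simp_all
    \<comment> \<open>Positions start at 0, so \<open>k\<close> is the number of closers above the
      one in position \<open>k\<close>.\<close>
    then have kc: "card {x \<in> ?T. t + 1 \<le> x} = k"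
      using card_step[OF finite_closers, of n ?S t] by (simp split: if_splits)
    then have "k < card {z \<in> openers ?S. t + 1 \<le> z}" using pending_count[OF C, of "t + 1"] t by simp
    then show "?ts ! k < ?zs ! k" using dz[of k "t + 1"] k len t_def by simp
    show "?ts ! k < ?ts ! (k - 1)" if "0 < k"
      using sorted_wrt_nth_less[OF ts(2), of "k - 1" k] that k by simp
    fix e assume e: "1 \<le> e \<and> e < ?zs ! k \<and> (0 < k \<longrightarrow> e < ?ts ! (k - 1)) \<and> e \<notin> ?S \<and> - e \<notin> ?S"
    show "e \<le> ?ts ! k"
    proof (rule ccontr)
      \<comment> \<open>A competitor \<open>e\<close> above \<open>t\<close> has at most
        \<open>k\<close> closers but more than \<open>k\<close> openers above it, so a bracket is
        pending and \<open>e\<close> is itself a closer. Yet the \<open>k\<close> earlier closers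
        lie strictly above \<open>e\<close> and are all the closers above \<open>t\<close>, which
        leaves no place for \<open>e\<close>.\<close>
      assume "\<not> e \<le> ?ts ! k"
      then have te: "t < e" using t_def by simp
      have zk: "k < card {z \<in> openers ?S. e + 1 \<le> z}" using dz[of k "e + 1"] e k len by simp
      have "?zs ! k \<in> openers ?S" using k len Z(1) by (metis nth_mem)
      then have en: "e \<le> int n" using e C by (auto simp: openers_def letters_C_def)
      have "card {x \<in> ?T. e + 1 \<le> x} \<le> card {x \<in> ?T. t + 1 \<le> x}"
        using te finite_closers by (intro card_mono) auto
      then have "0 < pending n ?S (e + 1)" using pending_count[OF C, of "e + 1"] e en zk kc by simp
      then have "e \<in> ?T" using e en by (simp add: closers_def)
      then have "card {x \<in> ?T. e \<le> x} > 0" using finite_closers by (auto simp: card_gt_0_iff)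
      have "card {x \<in> ?T. e \<le> x} \<le> k"
        unfolding kc[symmetric] using te finite_closers by (intro card_mono) auto
      moreover have "card {x \<in> ?T. e \<le> x} \<ge> k"
      proof (cases "k = 0")
        case False
        then have "e + 1 \<le> ?ts ! (k - 1)" using e by simp
        then have "k - 1 < card {x \<in> ?T. e + 1 \<le> x}" using dt[of "k - 1" "e + 1"] k by simp
        then show ?thesis using card_step[OF finite_closers, of n ?S e] \<open>e \<in> ?T\<close> by simp
      qed simp
      ultimately have "card {x \<in> ?T. e \<le> x} = k" by simp
      moreover have "card {x \<in> ?T. e + 1 \<le> x} \<ge> k"
      proof (cases "k = 0")
        case False
        then have "e + 1 \<le> ?ts ! (k - 1)" using e by simp
        then have "k - 1 < card {x \<in> ?T. e + 1 \<le> x}" using dt[of "k - 1" "e + 1"] k by simp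
        then show ?thesis by linarith
      qed simp
      ultimately show False using card_step[OF finite_closers, of n ?S e] \<open>e \<in> ?T\<close> by simp
    qed
  qed
  then show ?thesis unfolding is_t_seq_def Let_def using len by blast
qed

lemma admissible_iff:
  assumes "set C \<subseteq> letters_C n"
  shows "admissible C \<longleftrightarrow> pending n (set C) 1 = 0"
  using is_t_seqD(3)[OF assms] is_t_seqI[OF assms] unfolding admissible_def by blast

lemma t_seq:
  assumes "set C \<subseteq> letters_C n" "admissible C"
  shows "set (t_seq C) = closers n (set C)"
proof -
  obtain ts where ts: "is_t_seq C ts" using assms(2) by (auto simp: admissible_def)
  have "ts' = ts" if "is_t_seq C ts'" for ts'
  proof -
    note D = is_t_seqD[OF assms(1)]
    have "rev ts' = rev ts"
      using D(1,2)[OF ts] D(1,2)[OF that] by (intro strict_sorted_equal) (simp_all add: sorted_wrt_rev)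
    then show ?thesis by simp
  qed
  then have "t_seq C = ts" unfolding t_seq_def using ts by (intro the_equality)
  then show ?thesis using is_t_seqD(1)[OF assms(1) ts] by simp
qed

definition l_set :: "nat \<Rightarrow> int set \<Rightarrow> int set" where
  "l_set n S = (S - openers S) \<union> closers n S"

definition r_set :: "nat \<Rightarrow> int set \<Rightarrow> int set" where
  "r_set n S = (S - uminus ` openers S) \<union> uminus ` closers n S"

lemma l_r_set_sub:
  assumes "S \<subseteq> letters_C n"
  shows "l_set n S \<subseteq> letters_C n" "r_set n S \<subseteq> letters_C n"
  using assms by (auto simp: l_set_def r_set_def closers_def letters_C_def)

lemma lr_set_iff:
  assumes "S \<subseteq> letters_C n" "1 \<le> j" "j \<le> int n"
  shows "j \<in> l_set n S \<longleftrightarrow> (j \<in> S \<and> - j \<notin> S) \<or> (j \<notin> S \<and> - j \<notin> S \<and> 0 < pending n S (j + 1))"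
    and "- j \<in> l_set n S \<longleftrightarrow> - j \<in> S"
    and "j \<in> r_set n S \<longleftrightarrow> j \<in> S"
    and "- j \<in> r_set n S \<longleftrightarrow> (- j \<in> S \<and> j \<notin> S) \<or> (j \<notin> S \<and> - j \<notin> S \<and> 0 < pending n S (j + 1))"
  using assms by (auto simp: l_set_def r_set_def closers_def openers_def image_iff)

lemma l_r_col:
  assumes C: "set C \<subseteq> letters_C n" and a: "admissible C"
  shows "set (l_col C) = l_set n (set C)" "set (r_col C) = r_set n (set C)"
    and "sorted_wrt letter_less (l_col C)" "sorted_wrt letter_less (r_col C)"
proof -
  have p: "paired C = openers (set C)" by (simp add: paired_def openers_def)
  have f: "finite (l_set n (set C))" "finite (r_set n (set C))" "0 \<notin> l_set n (set C)" "0 \<notin> r_set n (set C)"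
    using l_r_set_sub[OF C] finite_letters_C finite_subset by (blast, blast, auto simp: letters_C_def)
  have e: "l_col C = col_of_set (l_set n (set C))" "r_col C = col_of_set (r_set n (set C))"
    unfolding l_col_def r_col_def l_set_def r_set_def p t_seq[OF assms] by simp_all
  show "set (l_col C) = l_set n (set C)" "set (r_col C) = r_set n (set C)"
    "sorted_wrt letter_less (l_col C)" "sorted_wrt letter_less (r_col C)"
    unfolding e using f by (simp_all add: set_col_of_set sorted_col_of_set)
qed

text \<open>From any level upwards there are at least as many openers as closers, and in total
  equally many. Trading openers for closers moves unbarred letters down and raises the ranks; on
  barred letters the same trade moves letters up and lowers them.\<close>

lemma rank_l_r:
  assumes S: "S \<subseteq> letters_C n" and p: "pending n S 1 = 0"
  shows "rank_le n S x \<le> rank_le n (l_set n S) x" "rank_le n (r_set n S) x \<le> rank_le n S x"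
    and "card (l_set n S) = card S" "card (r_set n S) = card S"
proof -
  let ?Z = "openers S" let ?T = "closers n S"
  have finS: "finite S" using S finite_letters_C finite_subset by blast
  have fin: "finite ?Z" "finite ?T" using finite_openers[OF S] finite_closers by auto
  have ZT: "card ?Z = card ?T"
  proof -
    have "{z \<in> ?Z. 1 \<le> z} = ?Z" "{t \<in> ?T. 1 \<le> t} = ?T" by (auto simp: openers_def closers_def)
    then show ?thesis using pending_count[OF S, of 1] p by simp
  qed
  have ge: "card {t \<in> ?T. j \<le> t} \<le> card {z \<in> ?Z. j \<le> z}" for j
  proof -
    consider "j < 1" | "1 \<le> j" "j \<le> int n + 1" | "int n + 1 < j" by linarith
    then show ?thesis
    proof cases
      case 1
      then have "{z \<in> ?Z. j \<le> z} = ?Z" "{t \<in> ?T. j \<le> t} = ?T" by (auto simp: openers_def closers_def)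
      then show ?thesis using ZT by simp
    next
      case 2
      then show ?thesis using pending_count[OF S 2] by simp
    next
      case 3
      then have e: "{t \<in> ?T. j \<le> t} = {}" by (auto simp: closers_def)
      show ?thesis unfolding e by simp
    qed
  qed
  have le: "card {z \<in> ?Z. z \<le> j} \<le> card {t \<in> ?T. t \<le> j}" for j
  proof -
    have split: "card A = card {x \<in> A. x \<le> j} + card {x \<in> A. j + 1 \<le> x}" if "finite A" for A :: "int set"
    proof -
      have "A = {x \<in> A. x \<le> j} \<union> {x \<in> A. j + 1 \<le> x}" by auto
      also have "card \<dots> = card {x \<in> A. x \<le> j} + card {x \<in> A. j + 1 \<le> x}"
        using that by (intro card_Un_disjoint) auto
      finally show ?thesis .
    qed
    show ?thesis using split[OF fin(1)] split[OF fin(2)] ZT ge[of "j + 1"] by linarith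
  qed
  have exch: "card ((A - B) \<union> D) + card B = card A + card D"
    if "finite A" "B \<subseteq> A" "finite D" "D \<inter> A = {}" for A B D :: "int set"
  proof -
    have "card ((A - B) \<union> D) = card (A - B) + card D" using that by (intro card_Un_disjoint) auto
    moreover have "card (A - B) + card B = card A"
      using that card_mono[of A B] finite_subset[of B A] by (simp add: card_Diff_subset)
    ultimately show ?thesis by simp
  qed
  have ZS: "?Z \<subseteq> S" "uminus ` ?Z \<subseteq> S" "?T \<inter> S = {}" "uminus ` ?T \<inter> S = {}"
    by (auto simp: openers_def closers_def)
  show "card (l_set n S) = card S" "card (r_set n S) = card S"
    using exch[OF finS ZS(1) fin(2) ZS(3)] exch[OF finS ZS(2) _ ZS(4)] fin ZT
    by (simp_all add: l_set_def r_set_def card_image)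
  have "{y \<in> l_set n S. hat n y \<le> x} = ({y \<in> S. hat n y \<le> x} - {z \<in> ?Z. z \<le> x}) \<union> {t \<in> ?T. t \<le> x}"
    by (auto simp: l_set_def openers_def closers_def hat_def)
  then have "card {y \<in> l_set n S. hat n y \<le> x} + card {z \<in> ?Z. z \<le> x} = card {y \<in> S. hat n y \<le> x} + card {t \<in> ?T. t \<le> x}"
    by (simp only:) (rule exch, use finS fin in \<open>auto simp: hat_def\<close>, auto simp: openers_def closers_def)
  then show "rank_le n S x \<le> rank_le n (l_set n S) x" using le[of x] unfolding rank_le_def by linarith
  \<comment> \<open>For a positive \<open>z\<close>, the condition
    \<open>hat n (- z) \<le> x\<close> means \<open>z \<ge> 2n + 1 - x\<close>.\<close>
  let ?j = "2 * int n + 1 - x"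
  have "{y \<in> r_set n S. hat n y \<le> x} = ({y \<in> S. hat n y \<le> x} - uminus ` {z \<in> ?Z. ?j \<le> z}) \<union> uminus ` {t \<in> ?T. ?j \<le> t}"
    by (auto simp: r_set_def openers_def closers_def hat_def image_iff)
  then have "card {y \<in> r_set n S. hat n y \<le> x} + card (uminus ` {z \<in> ?Z. ?j \<le> z}) =
      card {y \<in> S. hat n y \<le> x} + card (uminus ` {t \<in> ?T. ?j \<le> t})"
    by (simp only:) (rule exch, use finS fin in \<open>auto simp: hat_def\<close>, auto simp: openers_def closers_def)
  then show "rank_le n (r_set n S) x \<le> rank_le n S x" using ge[of ?j] unfolding rank_le_def by (simp add: card_image)
qed

section \<open>Raising operators on admissible columns\<close>

text \<open>The simple reflection of index \<open>i\<close> acting on letters.\<close>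

definition reflect :: "nat \<Rightarrow> nat \<Rightarrow> int \<Rightarrow> int" where
  "reflect n i x =
     (if i < n then
        if x = int i then int i + 1 else if x = int i + 1 then int i
        else if x = - int i then - (int i + 1) else if x = - (int i + 1) then - int i else x
      else if x = int n \<or> x = - int n then - x else x)"

definition marked :: "nat \<Rightarrow> nat \<Rightarrow> int \<Rightarrow> bool" where
  "marked n i x \<longleftrightarrow> mark_C n i x \<noteq> None"

definition mark_list :: "nat \<Rightarrow> nat \<Rightarrow> int list" where
  "mark_list n i = (if i < n then [int i, int i + 1, - (int i + 1), - int i] else [int n, - int n])"

lemma reflect_involution: "1 \<le> i \<Longrightarrow> reflect n i (reflect n i x) = x"
  by (auto simp: reflect_def)

lemma reflect_letters: "1 \<le> i \<Longrightarrow> i \<le> n \<Longrightarrow> reflect n i x \<in> letters_C n \<longleftrightarrow> x \<in> letters_C n"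
  by (auto simp: reflect_def letters_C_def)

lemma tensor_filter_marked:
  "tensor_eps (word_C n) i (filter (marked n i) w) = tensor_eps (word_C n) i w \<and>
   tensor_phi (word_C n) i (filter (marked n i) w) = tensor_phi (word_C n) i w"
  by (induction w) (auto simp: marked_def)

lemma act_C_marked: "i \<in> {1..n} \<Longrightarrow> mark_C n i x = Some Plus \<Longrightarrow> mark_C n i (act_C n i x) = Some Minus"
  by (auto simp: mark_C_def act_C_def split: if_splits)

lemma tensor_f_filter_marked:
  assumes i: "i \<in> {1..n}"
  shows "tensor_f (word_C n) i (filter (marked n i) w) = Some v \<Longrightarrow>
    \<exists>w'. tensor_f (word_C n) i w = Some w' \<and> filter (marked n i) w' = v \<and>
      filter (\<lambda>x. \<not> marked n i x) w' = filter (\<lambda>x. \<not> marked n i x) w"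
proof (induction w arbitrary: v)
  case (Cons x w)
  show ?case
  proof (cases "marked n i x")
    case True
    show ?thesis
    proof (cases "cr_phi (word_C n) i x > tensor_eps (word_C n) i w")
      case T: True
      then have "marked n i (act_C n i x)" using act_C_marked[OF i, of x] by (auto simp: marked_def split: if_splits)
      then show ?thesis using Cons.prems True T tensor_filter_marked[of n i w] by (auto split: if_splits)
    next
      case False
      then show ?thesis using Cons True tensor_filter_marked[of n i w] by (auto split: if_splits)
    qed
  next
    case False
    then have "cr_phi (word_C n) i x = 0" by (simp add: marked_def)
    then show ?thesis using Cons False by auto
  qed
qed simp

lemma filter_marked_col:
  assumes S: "S \<subseteq> letters_C n" and i: "i \<in> {1..n}"
  shows "filter (marked n i) (col_of_set S) = filter (\<lambda>x. x \<in> S) (mark_list n i)"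
proof -
  have fin: "finite S" "0 \<notin> S" using S finite_letters_C finite_subset by (blast, auto simp: letters_C_def)
  have m: "marked n i x \<longleftrightarrow> x \<in> set (mark_list n i)" for x
    using i by (auto simp: marked_def mark_list_def mark_C_def)
  have "sorted_wrt letter_less (mark_list n i)"
    using i by (auto simp: mark_list_def letter_less_def)
  then show ?thesis
    using fin by (intro sorted_letters_unique sorted_wrt_filter sorted_col_of_set) (auto simp: set_col_of_set m)
qed

lemma col_eps_phi:
  assumes "S \<subseteq> letters_C n" "i \<in> {1..n}"
  shows "tensor_eps (word_C n) i (col_of_set S) = tensor_eps (word_C n) i (filter (\<lambda>x. x \<in> S) (mark_list n i))"
    and "tensor_phi (word_C n) i (col_of_set S) = tensor_phi (word_C n) i (filter (\<lambda>x. x \<in> S) (mark_list n i))"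
  using tensor_filter_marked[of n i "col_of_set S"] filter_marked_col[OF assms] by simp_all

lemma f_sorted_C:
  assumes i: "i \<in> {1..n}" and w: "sorted_wrt letter_less w" "set w \<subseteq> letters_C n"
    and f: "tensor_f (word_C n) i w = Some w'"
  shows "sorted_wrt letter_less w'"
proof -
  have "sorted_wrt letter_less w' \<and> (\<forall>y\<in>set w'. \<exists>x\<in>set w. y = x \<or> letter_less x y)"
  proof (rule tensor_f_sorted[OF letter_less_trans _ _ f[unfolded word_C_def] w])
    show "letter_less x (act_C n i x) \<and> mark_C n i (act_C n i x) = Some Minus" if "mark_C n i x = Some Plus" for x
      using that i by (auto simp: mark_C_def act_C_def letter_less_def split: if_splits)
    show "y = act_C n i x \<or> letter_less (act_C n i x) y"
      if "mark_C n i x = Some Plus" "letter_less x y" "y \<in> letters_C n" for x y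
      using that i by (auto simp: mark_C_def act_C_def letter_less_def letters_C_def split: if_splits)
  qed
  then show ?thesis by simp
qed

text \<open>At most four letters of a column carry a mark for a given index, and these decide the
  step; strictness then recovers the resulting column from its set.\<close>

lemma col_f:
  assumes S: "S \<subseteq> letters_C n" and S': "S' \<subseteq> letters_C n" and i: "i \<in> {1..n}"
    and f: "tensor_f (word_C n) i (filter (\<lambda>x. x \<in> S') (mark_list n i)) = Some (filter (\<lambda>x. x \<in> S) (mark_list n i))"
    and agree: "\<And>x. x \<notin> set (mark_list n i) \<Longrightarrow> x \<in> S \<longleftrightarrow> x \<in> S'"
  shows "tensor_f (word_C n) i (col_of_set S') = Some (col_of_set S)"
proof -
  have fin: "finite S" "0 \<notin> S" "finite S'" "0 \<notin> S'"
    using S S' finite_letters_C finite_subset by (blast, auto simp: letters_C_def, blast)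
  have m: "marked n i x \<longleftrightarrow> x \<in> set (mark_list n i)" for x
    using i by (auto simp: marked_def mark_list_def mark_C_def)
  obtain w where w: "tensor_f (word_C n) i (col_of_set S') = Some w"
    "filter (marked n i) w = filter (\<lambda>x. x \<in> S) (mark_list n i)"
    "filter (\<lambda>x. \<not> marked n i x) w = filter (\<lambda>x. \<not> marked n i x) (col_of_set S')"
    using tensor_f_filter_marked[OF i, of "col_of_set S'"] f filter_marked_col[OF S' i] by auto
  have "set w = set (filter (marked n i) w) \<union> set (filter (\<lambda>x. \<not> marked n i x) w)" by auto
  also have "\<dots> = S" unfolding w(2,3) using fin agree m by (auto simp: set_col_of_set)
  finally have "set w = S" .
  moreover have "sorted_wrt letter_less w"
    by (rule f_sorted_C[OF i sorted_col_of_set _ w(1)]) (use fin S' in \<open>auto simp: set_col_of_set\<close>)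
  ultimately have "w = col_of_set S" using fin col_of_set_set[of w] by simp
  then show ?thesis using w(1) by simp
qed

lemma letters_set_eqI:
  assumes "A \<subseteq> letters_C n" "B \<subseteq> letters_C n"
    "\<And>j. 1 \<le> j \<Longrightarrow> j \<le> int n \<Longrightarrow> (j \<in> A \<longleftrightarrow> j \<in> B) \<and> (- j \<in> A \<longleftrightarrow> - j \<in> B)"
  shows "A = B"
proof (rule set_eqI)
  fix x show "x \<in> A \<longleftrightarrow> x \<in> B"
  proof (cases "x \<in> letters_C n")
    case True
    then have "1 \<le> \<bar>x\<bar>" "\<bar>x\<bar> \<le> int n" by (auto simp: letters_C_def)
    from assms(3)[OF this] show ?thesis by (auto simp: abs_if split: if_splits)
  qed (use assms in blast)
qed

lemma reflect_image_iff:
  assumes "1 \<le> i"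
  shows "x \<in> reflect n i ` X \<longleftrightarrow> reflect n i x \<in> X"
proof
  assume "x \<in> reflect n i ` X"
  then show "reflect n i x \<in> X" using assms by (auto simp: reflect_involution)
next
  assume "reflect n i x \<in> X"
  then have "reflect n i (reflect n i x) \<in> reflect n i ` X" by (rule imageI)
  then show "x \<in> reflect n i ` X" using assms by (simp add: reflect_involution)
qed

text \<open>The effect of raising a column on its split columns: a set without any plus is reflected
  as a whole, so that all its minuses move down at once.\<close>

definition raise_rel :: "nat \<Rightarrow> nat \<Rightarrow> int set \<Rightarrow> int set \<Rightarrow> bool" where
  "raise_rel n i X X' \<longleftrightarrow> X' = reflect n i ` X \<and> (\<forall>x\<in>X. mark_C n i x \<noteq> Some Plus)"

text \<open>The alternatives in \<open>cases\<close> are the two ways of raising for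
  \<open>i < n\<close>: \<open>i + 1\<close> to \<open>i\<close>, or \<open>-i\<close> to
  \<open>-(i + 1)\<close>. Bracket counts can change only between these two positions, so the split
  columns differ at most at the four marked letters; there the outcome depends on the letters
  present and on whether a bracket is pending above \<open>i + 1\<close>. The vanishing of
  \<open>tensor_phi\<close> when the left split column changes is what later protects the left
  neighbour.\<close>

lemma column_raise_less:
  assumes S: "S \<subseteq> letters_C n" and i: "1 \<le> i" "i < n" and p: "pending n S 1 = 0"
    and S': "S' \<subseteq> letters_C n"
    and agree: "\<And>x. x \<notin> set (mark_list n i) \<Longrightarrow> x \<in> S' \<longleftrightarrow> x \<in> S"
    and cases: "int i \<notin> S \<and> int i + 1 \<in> S \<and> \<not> (- int i \<in> S \<and> - (int i + 1) \<notin> S) \<and>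
          int i \<in> S' \<and> int i + 1 \<notin> S' \<and> (- int i \<in> S' \<longleftrightarrow> - int i \<in> S) \<and> (- (int i + 1) \<in> S' \<longleftrightarrow> - (int i + 1) \<in> S) \<or>
        - int i \<in> S \<and> - (int i + 1) \<notin> S \<and> \<not> (int i \<in> S \<and> int i + 1 \<notin> S) \<and>
          - int i \<notin> S' \<and> - (int i + 1) \<in> S' \<and> (int i \<in> S' \<longleftrightarrow> int i \<in> S) \<and> (int i + 1 \<in> S' \<longleftrightarrow> int i + 1 \<in> S)"
  shows "pending n S' 1 = 0"
    and "tensor_f (word_C n) i (col_of_set S') = Some (col_of_set S)"
    and "l_set n S' = l_set n S \<or> raise_rel n i (l_set n S) (l_set n S') \<and> tensor_phi (word_C n) i (col_of_set S) = 0"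
    and "r_set n S' = r_set n S \<or> raise_rel n i (r_set n S) (r_set n S')"
proof -
  let ?a = "int i"
  have i': "i \<in> {1..n}" using i by simp
  have ml: "mark_list n i = [?a, ?a + 1, - (?a + 1), - ?a]" using i by (simp add: mark_list_def)
  have ag: "x \<in> S' \<longleftrightarrow> x \<in> S" if "\<bar>x\<bar> \<noteq> ?a" "\<bar>x\<bar> \<noteq> ?a + 1" for x
    using that by (intro agree) (auto simp: ml)
  define q where "q = pending n S (?a + 2)"
  have q': "pending n S' (?a + 2) = q"
    unfolding q_def by (rule pending_cong) (auto simp: ag)
  have a2: "?a + 1 + 1 = ?a + 2" by simp
  have an: "?a + 1 \<le> int n" "?a \<le> int n" using i by auto
  note rec = pending_rec[OF an(1), unfolded a2] pending_rec[OF an(2)]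
  \<comment> \<open>Once \<open>i + 1\<close> and \<open>i\<close> are both scanned, the two
    configurations have the same net effect on any number \<open>q\<close> of open brackets.\<close>
  have pa: "pending n S' ?a = pending n S ?a"
    using cases unfolding rec q' q_def[symmetric] by (cases q) auto
  have below: "pending n S' j = pending n S j" if "1 \<le> j" "j \<le> ?a" for j
    by (rule pending_cong_below[OF _ pa _ that]) (use i in \<open>auto simp: ag\<close>)
  have above: "pending n S' j = pending n S j" if "?a + 2 \<le> j" for j
    by (rule pending_cong) (use that i in \<open>auto simp: ag\<close>)
  show p': "pending n S' 1 = 0" using below[of 1] p i by simp
  show "tensor_f (word_C n) i (col_of_set S') = Some (col_of_set S)"
  proof (rule col_f[OF S S' i'])
    show "tensor_f (word_C n) i (filter (\<lambda>x. x \<in> S') (mark_list n i)) = Some (filter (\<lambda>x. x \<in> S) (mark_list n i))"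
      unfolding ml using cases i
      by (cases "- (?a + 1) \<in> S"; cases "- ?a \<in> S"; cases "?a \<in> S"; cases "?a + 1 \<in> S")
        (simp_all add: mark_C_def act_C_def)
  qed (use agree in blast)
  have phi: "tensor_phi (word_C n) i (col_of_set S) =
      tensor_phi (word_C n) i (filter (\<lambda>x. x \<in> S) [?a, ?a + 1, - (?a + 1), - ?a])"
    using col_eps_phi(2)[OF S i'] ml by simp
  have other: "(j \<in> l_set n S' \<longleftrightarrow> j \<in> l_set n S) \<and> (- j \<in> l_set n S' \<longleftrightarrow> - j \<in> l_set n S) \<and>
     (j \<in> r_set n S' \<longleftrightarrow> j \<in> r_set n S) \<and> (- j \<in> r_set n S' \<longleftrightarrow> - j \<in> r_set n S)"
    if j: "1 \<le> j" "j \<le> int n" "j \<noteq> ?a" "j \<noteq> ?a + 1" for j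
  proof -
    have "pending n S' (j + 1) = pending n S (j + 1)" using j below[of "j + 1"] above[of "j + 1"] by linarith
    moreover have "j \<in> S' \<longleftrightarrow> j \<in> S" "- j \<in> S' \<longleftrightarrow> - j \<in> S" using j ag[of j] ag[of "- j"] by auto
    ultimately show ?thesis using lr_set_iff[OF S j(1,2)] lr_set_iff[OF S' j(1,2)] by simp
  qed
  have a1: "1 \<le> ?a" "1 \<le> ?a + 1" using i by auto
  note M = lr_set_iff[OF S a1(1) an(2)] lr_set_iff[OF S a1(2) an(1), unfolded a2]
  note M' = lr_set_iff[OF S' a1(1) an(2)] lr_set_iff[OF S' a1(2) an(1), unfolded a2]
  have same: "X' = X" if X: "X \<subseteq> letters_C n" "X' \<subseteq> letters_C n"
    and o: "\<And>j. 1 \<le> j \<Longrightarrow> j \<le> int n \<Longrightarrow> j \<noteq> ?a \<Longrightarrow> j \<noteq> ?a + 1 \<Longrightarrow> (j \<in> X' \<longleftrightarrow> j \<in> X) \<and> (- j \<in> X' \<longleftrightarrow> - j \<in> X)"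
    and eq: "?a \<in> X' \<longleftrightarrow> ?a \<in> X" "?a + 1 \<in> X' \<longleftrightarrow> ?a + 1 \<in> X" "- ?a \<in> X' \<longleftrightarrow> - ?a \<in> X" "- (?a + 1) \<in> X' \<longleftrightarrow> - (?a + 1) \<in> X"
    for X X'
  proof (rule letters_set_eqI[OF X(2,1)])
    fix j assume "1 \<le> j" "j \<le> int n"
    then show "(j \<in> X' \<longleftrightarrow> j \<in> X) \<and> (- j \<in> X' \<longleftrightarrow> - j \<in> X)"
      using o[of j] eq by (cases "j = ?a"; cases "j = ?a + 1") auto
  qed
  have swap: "raise_rel n i X X'" if X: "X \<subseteq> letters_C n" "X' \<subseteq> letters_C n"
    and o: "\<And>j. 1 \<le> j \<Longrightarrow> j \<le> int n \<Longrightarrow> j \<noteq> ?a \<Longrightarrow> j \<noteq> ?a + 1 \<Longrightarrow> (j \<in> X' \<longleftrightarrow> j \<in> X) \<and> (- j \<in> X' \<longleftrightarrow> - j \<in> X)"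
    and eq: "?a \<in> X' \<longleftrightarrow> ?a + 1 \<in> X" "?a + 1 \<in> X' \<longleftrightarrow> ?a \<in> X" "- ?a \<in> X' \<longleftrightarrow> - (?a + 1) \<in> X" "- (?a + 1) \<in> X' \<longleftrightarrow> - ?a \<in> X"
    and np: "?a \<notin> X" "- (?a + 1) \<notin> X"
    for X X'
    unfolding raise_rel_def
  proof
    have "reflect n i ` X \<subseteq> letters_C n" using X(1) reflect_letters i by auto
    then show "X' = reflect n i ` X"
    proof (rule letters_set_eqI[OF X(2)])
      fix j assume j: "1 \<le> j" "j \<le> int n"
      have rj: "reflect n i j = (if j = ?a then ?a + 1 else if j = ?a + 1 then ?a else j)"
        "reflect n i (- j) = (if j = ?a then - (?a + 1) else if j = ?a + 1 then - ?a else - j)"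
        using i j by (auto simp: reflect_def)
      show "(j \<in> X' \<longleftrightarrow> j \<in> reflect n i ` X) \<and> (- j \<in> X' \<longleftrightarrow> - j \<in> reflect n i ` X)"
        unfolding reflect_image_iff[OF i(1)] rj using o[OF j] eq by simp
    qed
    show "\<forall>x\<in>X. mark_C n i x \<noteq> Some Plus" using np i by (auto simp: mark_C_def)
  qed
  note sub = l_r_set_sub[OF S] l_r_set_sub[OF S']
  note rec1 = rec(1,2)[of S, folded q_def] rec(1)[of S', unfolded q']
  have ol: "(j \<in> l_set n S' \<longleftrightarrow> j \<in> l_set n S) \<and> (- j \<in> l_set n S' \<longleftrightarrow> - j \<in> l_set n S)"
    and or: "(j \<in> r_set n S' \<longleftrightarrow> j \<in> r_set n S) \<and> (- j \<in> r_set n S' \<longleftrightarrow> - j \<in> r_set n S)"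
    if "1 \<le> j" "j \<le> int n" "j \<noteq> ?a" "j \<noteq> ?a + 1" for j using other[OF that] by auto
  show "l_set n S' = l_set n S \<or> raise_rel n i (l_set n S) (l_set n S') \<and> tensor_phi (word_C n) i (col_of_set S) = 0"
  proof (cases "(?a \<in> l_set n S' \<longleftrightarrow> ?a \<in> l_set n S) \<and> (?a + 1 \<in> l_set n S' \<longleftrightarrow> ?a + 1 \<in> l_set n S) \<and>
      (- ?a \<in> l_set n S' \<longleftrightarrow> - ?a \<in> l_set n S) \<and> (- (?a + 1) \<in> l_set n S' \<longleftrightarrow> - (?a + 1) \<in> l_set n S)")
    case True
    then show ?thesis using same[OF sub(1,3) ol] by blast
  next
    case False
    have "tensor_phi (word_C n) i (col_of_set S) = 0 \<and>
      (?a \<in> l_set n S' \<longleftrightarrow> ?a + 1 \<in> l_set n S) \<and> (?a + 1 \<in> l_set n S' \<longleftrightarrow> ?a \<in> l_set n S) \<and>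
      (- ?a \<in> l_set n S' \<longleftrightarrow> - (?a + 1) \<in> l_set n S) \<and> (- (?a + 1) \<in> l_set n S' \<longleftrightarrow> - ?a \<in> l_set n S) \<and>
      ?a \<notin> l_set n S \<and> - (?a + 1) \<notin> l_set n S"
      using False cases i unfolding phi M M' rec1 q_def[symmetric] q'
      by (cases q; cases "- (?a + 1) \<in> S"; cases "- ?a \<in> S"; cases "?a \<in> S"; cases "?a + 1 \<in> S")
        (simp_all add: mark_C_def)
    then show ?thesis using swap[OF sub(1,3) ol] by blast
  qed
  show "r_set n S' = r_set n S \<or> raise_rel n i (r_set n S) (r_set n S')"
  proof (cases "(?a \<in> r_set n S' \<longleftrightarrow> ?a \<in> r_set n S) \<and> (?a + 1 \<in> r_set n S' \<longleftrightarrow> ?a + 1 \<in> r_set n S) \<and>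
      (- ?a \<in> r_set n S' \<longleftrightarrow> - ?a \<in> r_set n S) \<and> (- (?a + 1) \<in> r_set n S' \<longleftrightarrow> - (?a + 1) \<in> r_set n S)")
    case True
    then show ?thesis using same[OF sub(2,4) or] by blast
  next
    case False
    have "(?a \<in> r_set n S' \<longleftrightarrow> ?a + 1 \<in> r_set n S) \<and> (?a + 1 \<in> r_set n S' \<longleftrightarrow> ?a \<in> r_set n S) \<and>
      (- ?a \<in> r_set n S' \<longleftrightarrow> - (?a + 1) \<in> r_set n S) \<and> (- (?a + 1) \<in> r_set n S' \<longleftrightarrow> - ?a \<in> r_set n S) \<and>
      ?a \<notin> r_set n S \<and> - (?a + 1) \<notin> r_set n S"
      using False cases i unfolding M M' rec1 q_def[symmetric] q'
      by (cases q; cases "- (?a + 1) \<in> S"; cases "- ?a \<in> S"; cases "?a \<in> S"; cases "?a + 1 \<in> S")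
        simp_all
    then show ?thesis using swap[OF sub(2,4) or] by blast
  qed
qed

text \<open>Exactly one of \<open>n\<close> and \<open>-n\<close> is present before and after, so no
  bracket is opened or closed at \<open>n\<close>, and both split columns change in the same way as
  the column.\<close>

lemma column_raise_last:
  assumes S: "S \<subseteq> letters_C n" and n: "1 \<le> n" and p: "pending n S 1 = 0"
    and c: "int n \<notin> S" "- int n \<in> S"
  defines "S' \<equiv> insert (int n) (S - {- int n})"
  shows "pending n S' 1 = 0"
    and "tensor_f (word_C n) n (col_of_set S') = Some (col_of_set S)"
    and "raise_rel n n (l_set n S) (l_set n S')" "tensor_phi (word_C n) n (col_of_set S) = 0"
    and "raise_rel n n (r_set n S) (r_set n S')"
proof -
  have n': "n \<in> {1..n}" using n by simp
  have S': "S' \<subseteq> letters_C n" using S n by (auto simp: S'_def letters_C_def)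
  have ml: "mark_list n n = [int n, - int n]" by (simp add: mark_list_def)
  have nn: "int n \<noteq> - int n" using n by simp
  have ag: "x \<in> S' \<longleftrightarrow> x \<in> S" if "\<bar>x\<bar> \<noteq> int n" for x using that by (auto simp: S'_def)
  have s': "int n \<in> S'" "- int n \<notin> S'" using nn by (auto simp: S'_def)
  have "pending n S' (int n) = pending n S (int n)"
    using c s' pending_rec[of "int n" n S] pending_rec[of "int n" n S'] by (simp add: pending_beyond)
  then have pend: "pending n S' j = pending n S j" if "1 \<le> j" "j \<le> int n" for j
    by (intro pending_cong_below[OF _ _ _ that]) (use n in \<open>auto simp: ag\<close>)
  show "pending n S' 1 = 0" using pend[of 1] p n by simp
  show "tensor_f (word_C n) n (col_of_set S') = Some (col_of_set S)"
  proof (rule col_f[OF S S' n'])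
    show "tensor_f (word_C n) n (filter (\<lambda>x. x \<in> S') (mark_list n n)) = Some (filter (\<lambda>x. x \<in> S) (mark_list n n))"
      using c s' by (simp add: ml mark_C_def act_C_def)
    show "x \<in> S \<longleftrightarrow> x \<in> S'" if "x \<notin> set (mark_list n n)" for x using that by (auto simp: ml S'_def)
  qed
  show "tensor_phi (word_C n) n (col_of_set S) = 0"
    using col_eps_phi(2)[OF S n'] c n by (simp add: ml mark_C_def)
  have swap: "raise_rel n n X X'" if X: "X \<subseteq> letters_C n" "X' \<subseteq> letters_C n"
    and o: "\<And>j. 1 \<le> j \<Longrightarrow> j < int n \<Longrightarrow> (j \<in> X' \<longleftrightarrow> j \<in> X) \<and> (- j \<in> X' \<longleftrightarrow> - j \<in> X)"
    and eq: "int n \<in> X'" "- int n \<notin> X'" "int n \<notin> X" "- int n \<in> X"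
    for X X'
    unfolding raise_rel_def
  proof
    have "reflect n n ` X \<subseteq> letters_C n" using X(1) reflect_letters n by auto
    then show "X' = reflect n n ` X"
    proof (rule letters_set_eqI[OF X(2)])
      fix j assume j: "1 \<le> j" "j \<le> int n"
      have rj: "reflect n n j = (if j = int n then - j else j)" "reflect n n (- j) = (if j = int n then j else - j)"
        using n j by (auto simp: reflect_def)
      show "(j \<in> X' \<longleftrightarrow> j \<in> reflect n n ` X) \<and> (- j \<in> X' \<longleftrightarrow> - j \<in> reflect n n ` X)"
        unfolding reflect_image_iff[OF n] rj using o[OF j(1)] j eq n by simp
    qed
    show "\<forall>x\<in>X. mark_C n n x \<noteq> Some Plus" using eq n by (auto simp: mark_C_def)
  qed
  have other: "(j \<in> l_set n S' \<longleftrightarrow> j \<in> l_set n S) \<and> (- j \<in> l_set n S' \<longleftrightarrow> - j \<in> l_set n S) \<and>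
     (j \<in> r_set n S' \<longleftrightarrow> j \<in> r_set n S) \<and> (- j \<in> r_set n S' \<longleftrightarrow> - j \<in> r_set n S)"
    if j: "1 \<le> j" "j < int n" for j
    using lr_set_iff[OF S j(1)] lr_set_iff[OF S' j(1)] j pend[of "j + 1"] ag[of j] ag[of "- j"] by simp
  have n1: "1 \<le> int n" using n by simp
  note M = lr_set_iff[OF S n1 order_refl] lr_set_iff[OF S' n1 order_refl]
  note sub = l_r_set_sub[OF S] l_r_set_sub[OF S']
  show "raise_rel n n (l_set n S) (l_set n S')"
    by (rule swap[OF sub(1,3)]) (use other c s' M pending_beyond[of n "int n + 1"] in auto)
  show "raise_rel n n (r_set n S) (r_set n S')"
    by (rule swap[OF sub(2,4)]) (use other c s' M pending_beyond[of n "int n + 1"] in auto)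
qed

lemma column_raise:
  assumes S: "S \<subseteq> letters_C n" and i: "i \<in> {1..n}" and p: "pending n S 1 = 0"
    and e: "0 < tensor_eps (word_C n) i (col_of_set S)"
  obtains S' where "S' \<subseteq> letters_C n" "pending n S' 1 = 0"
    "tensor_f (word_C n) i (col_of_set S') = Some (col_of_set S)"
    "l_set n S' = l_set n S \<or> raise_rel n i (l_set n S) (l_set n S') \<and> tensor_phi (word_C n) i (col_of_set S) = 0"
    "r_set n S' = r_set n S \<or> raise_rel n i (r_set n S) (r_set n S')"
proof (cases "i < n")
  case True
  let ?a = "int i"
  have i': "1 \<le> i" using i by simp
  have ml: "mark_list n i = [?a, ?a + 1, - (?a + 1), - ?a]" using True by (simp add: mark_list_def)
  have "0 < tensor_eps (word_C n) i (filter (\<lambda>x. x \<in> S) [?a, ?a + 1, - (?a + 1), - ?a])"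
    using e col_eps_phi(1)[OF S i] ml by simp
  then consider "?a \<notin> S \<and> ?a + 1 \<in> S \<and> \<not> (- ?a \<in> S \<and> - (?a + 1) \<notin> S)"
    | "- ?a \<in> S \<and> - (?a + 1) \<notin> S \<and> \<not> (?a \<in> S \<and> ?a + 1 \<notin> S)"
    using True i'
    by (cases "- (?a + 1) \<in> S"; cases "- ?a \<in> S"; cases "?a \<in> S"; cases "?a + 1 \<in> S")
      (simp_all add: mark_C_def)
  then show ?thesis
  proof cases
    case 1
    let ?S' = "insert ?a (S - {?a + 1})"
    have S': "?S' \<subseteq> letters_C n" using S True i' by (auto simp: letters_C_def)
    have "x \<in> ?S' \<longleftrightarrow> x \<in> S" if "x \<notin> set (mark_list n i)" for x using that by (auto simp: ml)
    note R = column_raise_less[OF S i' True p S' this]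
    show ?thesis by (rule that[OF S']; rule R) (use 1 i' in auto)
  next
    case 2
    let ?S' = "insert (- (?a + 1)) (S - {- ?a})"
    have S': "?S' \<subseteq> letters_C n" using S True i' by (auto simp: letters_C_def)
    have "x \<in> ?S' \<longleftrightarrow> x \<in> S" if "x \<notin> set (mark_list n i)" for x using that by (auto simp: ml)
    note R = column_raise_less[OF S i' True p S' this]
    show ?thesis by (rule that[OF S']; rule R) (use 2 i' in auto)
  qed
next
  case False
  then have [simp]: "i = n" using i by simp
  have n: "1 \<le> n" using i by simp
  have "0 < tensor_eps (word_C n) n (filter (\<lambda>x. x \<in> S) [int n, - int n])"
    using e col_eps_phi(1)[OF S i] by (simp add: mark_list_def)
  then have c: "int n \<notin> S" "- int n \<in> S"
    using n by (cases "- int n \<in> S"; cases "int n \<in> S"; simp add: mark_C_def)+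
  have "insert (int n) (S - {- int n}) \<subseteq> letters_C n" using S n by (auto simp: letters_C_def)
  note R = this column_raise_last[OF S n p c]
  show ?thesis
    by (rule that[OF R(1,2)]) (use R(3-6) in \<open>simp_all only: \<open>i = n\<close> simp_thms\<close>)
qed

text \<open>Reflecting a set without pluses only replaces letters by smaller ones.\<close>

lemma rank_raise:
  assumes X: "X \<subseteq> letters_C n" and i: "i \<in> {1..n}" and r: "raise_rel n i X X'"
  shows "rank_le n X x \<le> rank_le n X' x" "card X' = card X" "X' \<subseteq> letters_C n"
proof -
  have inj: "inj (reflect n i)" using reflect_involution i by (metis atLeastAtMost_iff injI)
  have fin: "finite X" using X finite_letters_C finite_subset by blast
  have X': "X' = reflect n i ` X" using r by (simp add: raise_rel_def)
  have low: "hat n (reflect n i y) \<le> hat n y" if y: "y \<in> X" for y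
  proof -
    have "mark_C n i y \<noteq> Some Plus" "y \<in> letters_C n" using r y X by (auto simp: raise_rel_def)
    then show ?thesis using i by (auto simp: reflect_def hat_def mark_C_def letters_C_def split: if_splits)
  qed
  have "reflect n i ` {y \<in> X. hat n y \<le> x} \<subseteq> {y \<in> X'. hat n y \<le> x}"
    unfolding X' using low by (auto intro: order_trans)
  then have "card (reflect n i ` {y \<in> X. hat n y \<le> x}) \<le> card {y \<in> X'. hat n y \<le> x}"
    using fin X' by (intro card_mono) auto
  then show "rank_le n X x \<le> rank_le n X' x"
    unfolding rank_le_def using inj by (simp add: card_image inj_on_subset)
  show "card X' = card X" unfolding X' using inj by (simp add: card_image inj_on_subset)
  show "X' \<subseteq> letters_C n" unfolding X' using X i reflect_letters by auto
qed

lemma rank_step: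
  assumes "finite X" "u \<in> letters_C n" "X \<subseteq> letters_C n"
  shows "rank_le n X (hat n u) = rank_le n X (hat n u - 1) + (if u \<in> X then 1 else 0)"
proof -
  have "hat n y \<le> hat n u \<longleftrightarrow> y = u \<or> hat n y \<le> hat n u - 1" if "y \<in> X" for y
    using hat_inj[THEN inj_onD, of n y u] that assms by (auto simp: order_le_less)
  then have eq: "{y \<in> X. hat n y \<le> hat n u} = (if u \<in> X then {u} else {}) \<union> {y \<in> X. hat n y \<le> hat n u - 1}"
    by auto
  show ?thesis unfolding rank_le_def eq using assms(1) by auto
qed

text \<open>The rank of \<open>X'\<close> can exceed that of \<open>X\<close> only just below a
  moved letter \<open>y\<close>, at \<open>x\<close> with \<open>hat n y = x + 1\<close>. If
  \<open>R\<close> omits \<open>y\<close>, its ranks at \<open>x\<close> and \<open>x + 1\<close>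
  agree and the bound at \<open>x + 1\<close> suffices. If \<open>R\<close> contains
  \<open>y\<close>, it also contains the letter just below, so its rank grows by one at
  \<open>x\<close> and the bound at \<open>x - 1\<close> suffices.\<close>

lemma rank_raise_neighbour:
  assumes X: "X \<subseteq> letters_C n" and i: "i \<in> {1..n}" and r: "raise_rel n i X X'"
    and R: "R \<subseteq> letters_C n" and le: "\<And>x. rank_le n X x \<le> rank_le n R x"
    and closed: "\<And>y. y \<in> R \<Longrightarrow> mark_C n i y = Some Minus \<Longrightarrow> reflect n i y \<in> R"
  shows "rank_le n X' x \<le> rank_le n R x"
proof -
  have i1: "1 \<le> i" using i by simp
  have X': "X' = reflect n i ` X" and np: "\<And>x. x \<in> X \<Longrightarrow> mark_C n i x \<noteq> Some Plus"
    using r by (auto simp: raise_rel_def)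
  have fin: "finite X" "finite R" using X R finite_letters_C finite_subset by blast+
  have hat_reflect: "hat n y = hat n (reflect n i y) + 1" "mark_C n i (reflect n i y) = Some Plus"
    if "mark_C n i y = Some Minus" "y \<in> letters_C n" for y
    using that i by (auto simp: mark_C_def reflect_def hat_def letters_C_def split: if_splits)
  have fixed: "reflect n i y = y" if "y \<in> X" "mark_C n i y \<noteq> Some Minus" for y
    using that np[of y] i by (auto simp: mark_C_def reflect_def split: if_splits)
  show ?thesis
  proof (cases "\<exists>y\<in>X. mark_C n i y = Some Minus \<and> hat n y = x + 1")
    case False
    have "{z \<in> X'. hat n z \<le> x} \<subseteq> reflect n i ` {y \<in> X. hat n y \<le> x}"
    proof
      fix z assume z: "z \<in> {z \<in> X'. hat n z \<le> x}"
      then obtain y where y: "y \<in> X" "z = reflect n i y" using X' by auto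
      have "hat n y \<le> x"
      proof (cases "mark_C n i y = Some Minus")
        case True
        then have "hat n y = hat n z + 1" using hat_reflect(1)[of y] y X by auto
        moreover have "hat n y \<noteq> x + 1" using False True y(1) by blast
        ultimately show ?thesis using z by simp
      next
        case F: False
        then show ?thesis using fixed[OF y(1)] z y(2) by simp
      qed
      then show "z \<in> reflect n i ` {y \<in> X. hat n y \<le> x}" using y by blast
    qed
    then have "rank_le n X' x \<le> card (reflect n i ` {y \<in> X. hat n y \<le> x})"
      unfolding rank_le_def using fin by (intro card_mono) auto
    also have "\<dots> \<le> rank_le n X x" unfolding rank_le_def using fin by (intro card_image_le) auto
    also have "\<dots> \<le> rank_le n R x" by (rule le)
    finally show ?thesis .
  next
    case True
    then obtain y where y: "y \<in> X" "mark_C n i y = Some Minus" "hat n y = x + 1" by blast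
    have yl: "y \<in> letters_C n" using y X by blast
    let ?z = "reflect n i y"
    have zl: "?z \<in> letters_C n" using yl reflect_letters i by auto
    have hz: "hat n ?z = x" using hat_reflect(1)[OF y(2) yl] y(3) by simp
    have zX: "?z \<notin> X" using np hat_reflect(2)[OF y(2) yl] by blast
    have hx: "hat n y - 1 = x" using y(3) by simp
    have "rank_le n X' x \<le> rank_le n X' (x + 1)"
      unfolding rank_le_def using fin X' by (intro card_mono) auto
    note stepX = rank_step[OF fin(1) yl X, unfolded hx y(3)] rank_step[OF fin(1) zl X, unfolded hz]
    note stepR = rank_step[OF fin(2) yl R, unfolded hx y(3)] rank_step[OF fin(2) zl R, unfolded hz]
    have "{z \<in> X'. hat n z \<le> x} \<subseteq> reflect n i ` {y \<in> X. hat n y \<le> x + 1}"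
    proof
      fix z assume z: "z \<in> {z \<in> X'. hat n z \<le> x}"
      then obtain w where w: "w \<in> X" "z = reflect n i w" using X' by auto
      have "hat n w \<le> x + 1"
      proof (cases "mark_C n i w = Some Minus")
        case True
        then show ?thesis using hat_reflect(1)[of w] w X z by auto
      next
        case F: False
        then show ?thesis using fixed[OF w(1)] z w(2) by simp
      qed
      then show "z \<in> reflect n i ` {y \<in> X. hat n y \<le> x + 1}" using w by blast
    qed
    then have "rank_le n X' x \<le> card (reflect n i ` {y \<in> X. hat n y \<le> x + 1})"
      unfolding rank_le_def using fin by (intro card_mono) auto
    also have "\<dots> \<le> rank_le n X (x + 1)" unfolding rank_le_def using fin by (intro card_image_le) auto
    finally have b: "rank_le n X' x \<le> rank_le n X (x + 1)" .
    show ?thesis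
    proof (cases "y \<in> R")
      case True
      then have "?z \<in> R" using closed y(2) by blast
      then have "rank_le n R x = rank_le n R (x - 1) + 1" using stepR(2) by simp
      moreover have "rank_le n X x = rank_le n X (x - 1)" using stepX(2) zX by simp
      moreover have "rank_le n X (x + 1) = rank_le n X x + 1" using stepX(1) y(1) by simp
      ultimately show ?thesis using b le[of "x - 1"] by simp
    next
      case False
      then have "rank_le n R (x + 1) = rank_le n R x" using stepR(1) by simp
      then show ?thesis using b le[of "x + 1"] by simp
    qed
  qed
qed

text \<open>When the column cannot be raised, each minus of its right split column is accompanied by
  the matching plus; this is the closure condition on \<open>R\<close> in
  \<open>rank_raise_neighbour\<close>.\<close>

lemma r_set_closed:
  assumes S: "S \<subseteq> letters_C n" and i: "i \<in> {1..n}"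
    and e: "tensor_eps (word_C n) i (col_of_set S) = 0"
    and y: "y \<in> r_set n S" "mark_C n i y = Some Minus"
  shows "reflect n i y \<in> r_set n S"
proof (cases "i < n")
  case True
  let ?a = "int i"
  have i': "1 \<le> i" using i by simp
  have ml: "mark_list n i = [?a, ?a + 1, - (?a + 1), - ?a]" using True by (simp add: mark_list_def)
  have e': "tensor_eps (word_C n) i (filter (\<lambda>x. x \<in> S) [?a, ?a + 1, - (?a + 1), - ?a]) = 0"
    using e col_eps_phi(1)[OF S i] ml by simp
  have a2: "?a + 1 + 1 = ?a + 2" by simp
  have an: "?a + 1 \<le> int n" "?a \<le> int n" using True by auto
  have a1: "1 \<le> ?a" "1 \<le> ?a + 1" using i' by auto
  note M = lr_set_iff(3,4)[OF S a1(1) an(2)] lr_set_iff(3,4)[OF S a1(2) an(1), unfolded a2]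
  note rec = pending_rec[OF an(1), of S, unfolded a2]
  have "(?a + 1 \<in> r_set n S \<longrightarrow> ?a \<in> r_set n S) \<and> (- ?a \<in> r_set n S \<longrightarrow> - (?a + 1) \<in> r_set n S)"
    using e' True i' unfolding M rec
    by (cases "- (?a + 1) \<in> S"; cases "- ?a \<in> S"; cases "?a \<in> S"; cases "?a + 1 \<in> S")
      (simp_all add: mark_C_def)
  moreover have "y = ?a + 1 \<or> y = - ?a" using y(2) True by (auto simp: mark_C_def split: if_splits)
  ultimately show ?thesis using y(1) True i' by (auto simp: reflect_def)
next
  case False
  then have [simp]: "i = n" using i by simp
  have n: "1 \<le> int n" using i by simp
  have y': "y = - int n" using y(2) by (auto simp: mark_C_def split: if_splits)
  have "tensor_eps (word_C n) n (filter (\<lambda>x. x \<in> S) [int n, - int n]) = 0"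
    using e col_eps_phi(1)[OF S i] by (simp add: mark_list_def)
  then have "- int n \<in> S \<longrightarrow> int n \<in> S"
    using n by (cases "- int n \<in> S"; cases "int n \<in> S"; simp add: mark_C_def)
  then show ?thesis
    using y(1) y' lr_set_iff(4)[OF S n order_refl] pending_beyond[of n "int n + 1" S] by auto
qed

section \<open>Connectedness of the crystal of Kashiwara--Nakashima tableaux\<close>

definition good_col :: "nat \<Rightarrow> column \<Rightarrow> bool" where
  "good_col n C \<longleftrightarrow> set C \<subseteq> letters_C n \<and> sorted_wrt letter_less C \<and> admissible C"

lemma col_le_trans: "col_le letter_less A B \<Longrightarrow> col_le letter_less B C \<Longrightarrow> col_le letter_less A C"
  using transpD[OF letter_less_trans] unfolding col_le_def
  by (metis (no_types, lifting) le_trans order_less_le_trans)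

lemma successively_concat_pairs:
  "successively P (concat (map (\<lambda>C. [f C, g C]) T)) \<longleftrightarrow>
     (\<forall>C\<in>set T. P (f C) (g C)) \<and> successively (\<lambda>C D. P (g C) (f D)) T"
proof (induction T)
  case (Cons C T)
  then show ?case by (cases T) auto
qed simp

context
  fixes n :: nat and C :: column
  assumes C: "good_col n C"
begin

lemma good_col_facts:
  shows "set C \<subseteq> letters_C n" "sorted_wrt letter_less C" "pending n (set C) 1 = 0"
    and "set (l_col C) = l_set n (set C)" "set (r_col C) = r_set n (set C)"
    and "sorted_wrt letter_less (l_col C)" "sorted_wrt letter_less (r_col C)"
    and "length (l_col C) = length C" "length (r_col C) = length C"
    and "l_set n (set C) \<subseteq> letters_C n" "r_set n (set C) \<subseteq> letters_C n"
    and "col_of_set (set C) = C"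
proof -
  show S: "set C \<subseteq> letters_C n" and s: "sorted_wrt letter_less C" using C by (auto simp: good_col_def)
  have a: "admissible C" using C by (simp add: good_col_def)
  show p: "pending n (set C) 1 = 0" using a admissible_iff[OF S] by simp
  note L = l_r_col[OF S a]
  show "set (l_col C) = l_set n (set C)" "set (r_col C) = r_set n (set C)"
    "sorted_wrt letter_less (l_col C)" "sorted_wrt letter_less (r_col C)" by (rule L)+
  have len: "length D = card (set D)" if "sorted_wrt letter_less D" for D
    using distinct_card[OF distinct_sorted_letters[OF that]] by simp
  show "length (l_col C) = length C" "length (r_col C) = length C"
    using len[OF s] len[OF L(3)] len[OF L(4)] rank_l_r(3,4)[OF S p] L(1,2) by simp_all
  show "l_set n (set C) \<subseteq> letters_C n" "r_set n (set C) \<subseteq> letters_C n" by (rule l_r_set_sub[OF S])+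
  have "0 \<notin> set C" using S by (auto simp: letters_C_def)
  then show "col_of_set (set C) = C" using s col_of_set_set by simp
qed

lemma col_le_l_r:
  shows "col_le letter_less (l_col C) C" "col_le letter_less C (r_col C)"
    "col_le letter_less (l_col C) (r_col C)"
proof -
  note G = good_col_facts
  show 1: "col_le letter_less (l_col C) C"
    using col_le_letter_iff[OF G(6) G(2), of n] G rank_l_r(1)[OF G(1,3)] by simp
  show 2: "col_le letter_less C (r_col C)"
    using col_le_letter_iff[OF G(2) G(7), of n] G rank_l_r(2)[OF G(1,3)] by simp
  show "col_le letter_less (l_col C) (r_col C)" by (rule col_le_trans[OF 1 2])
qed

end

lemma col_le_r_l_iff:
  assumes C: "good_col n C" and D: "good_col n D"
  shows "col_le letter_less (r_col C) (l_col D) \<longleftrightarrow> length D \<le> length C \<and>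
     (\<forall>x. rank_le n (l_set n (set D)) x \<le> rank_le n (r_set n (set C)) x)"
  using col_le_letter_iff[of "r_col C" "l_col D" n] good_col_facts[OF C] good_col_facts[OF D] by simp

text \<open>Every admissible column lies between \<open>l_col\<close> and \<open>r_col\<close>, so
  the two semistandardness conditions collapse to comparing \<open>r_col\<close> of a column with
  \<open>l_col\<close> of its right neighbour.\<close>

lemma KN_iff:
  "T \<in> KN n \<mu> \<longleftrightarrow> map length T = col_heights \<mu> \<and> (\<forall>C\<in>set T. good_col n C) \<and>
     successively (\<lambda>C D. col_le letter_less (r_col C) (l_col D)) T"
proof
  assume T: "T \<in> KN n \<mu>"
  then have "\<forall>C\<in>set T. good_col n C"
    by (auto simp: KN_def good_col_def semistandard_iff)
  with T show "map length T = col_heights \<mu> \<and> (\<forall>C\<in>set T. good_col n C) \<and>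
     successively (\<lambda>C D. col_le letter_less (r_col C) (l_col D)) T"
    by (auto simp: KN_def semistandard_iff successively_concat_pairs)
next
  assume T: "map length T = col_heights \<mu> \<and> (\<forall>C\<in>set T. good_col n C) \<and>
     successively (\<lambda>C D. col_le letter_less (r_col C) (l_col D)) T"
  then have g: "good_col n C" if "C \<in> set T" for C using that by blast
  have "col_le letter_less C D"
    if "C \<in> set T" "D \<in> set T" "col_le letter_less (r_col C) (l_col D)" for C D
    by (rule col_le_trans[OF col_le_l_r(2)[OF g[OF that(1)]] col_le_trans[OF that(3) col_le_l_r(1)[OF g[OF that(2)]]]])
  with conjunct2[OF conjunct2[OF T]] have "successively (col_le letter_less) T"
    by (rule successively_mono)
  moreover have "\<forall>C\<in>set (concat (map (\<lambda>C. [l_col C, r_col C]) T)). sorted_wrt letter_less C"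
    using good_col_facts(6,7)[OF g] by auto
  moreover have "successively (col_le letter_less) (concat (map (\<lambda>C. [l_col C, r_col C]) T))"
    unfolding successively_concat_pairs using T g col_le_l_r(3) by blast
  moreover have "set (concat T) \<subseteq> letters_C n" using g by (auto simp: good_col_def)
  moreover have "\<forall>C\<in>set T. sorted_wrt letter_less C" "\<forall>C\<in>set T. admissible C"
    using g by (auto simp: good_col_def)
  ultimately show "T \<in> KN n \<mu>" using T by (simp add: KN_def semistandard_iff)
qed

text \<open>\<open>D\<close> is the factor on which a raising operator would act: its minuses are
  not all absorbed by pluses on its left, and its own pluses absorb all minuses on its
  right.\<close>

lemma tensor_eps_split:
  assumes "0 < tensor_eps B i (concat Cs)"
  shows "\<exists>Xs D Ys. Cs = Xs @ [D] @ Ys \<and> tensor_phi B i (concat Xs) < tensor_eps B i D \<and>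
     tensor_eps B i (concat Ys) \<le> tensor_phi B i D"
  using assms
proof (induction Cs)
  case (Cons C Cs)
  show ?case
  proof (cases "tensor_eps B i (concat Cs) \<le> tensor_phi B i C")
    case True
    then have "0 < tensor_eps B i C" using Cons.prems by (simp add: tensor_eps_append)
    then show ?thesis
      using True by - (rule exI[of _ "[]"], rule exI[of _ C], rule exI[of _ Cs], simp)
  next
    case False
    then obtain Xs D Ys where *: "Cs = Xs @ [D] @ Ys" "tensor_phi B i (concat Xs) < tensor_eps B i D"
      "tensor_eps B i (concat Ys) \<le> tensor_phi B i D" using Cons.IH by fastforce
    have "tensor_phi B i (concat (C # Xs)) < tensor_eps B i D"
      using False *(2,3) unfolding *(1) by (auto simp: tensor_eps_append tensor_phi_append)
    then show ?thesis using * by (metis append_Cons)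
  qed
qed simp

lemma tensor_f_middle:
  assumes sn: "seminormal B" and i: "i \<in> cr_index B" and f: "tensor_f B i D' = Some D"
    and "tensor_phi B i u < tensor_eps B i D" "tensor_eps B i v \<le> tensor_phi B i D"
  shows "tensor_f B i (u @ D' @ v) = Some (u @ D @ v)"
proof -
  note S = seminormalD(2,3)[OF seminormal_tensor[OF sn], simplified, OF i f]
  have "tensor_f B i (D' @ v) = Some (D @ v)" using S assms(5) f by (simp add: tensor_f_append)
  moreover have "tensor_phi B i u \<le> tensor_eps B i (D' @ v)" using S assms(4) by (simp add: tensor_eps_append)
  ultimately show ?thesis by (simp add: tensor_f_append)
qed

lemma KN_raise:
  assumes T: "T \<in> KN n \<mu>" and i: "i \<in> {1..n}" and e: "0 < tensor_eps (word_C n) i (reading T)"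
  shows "\<exists>T'\<in>KN n \<mu>. map length T' = map length T \<and> tensor_f (word_C n) i (reading T') = Some (reading T)"
proof -
  note K = T[unfolded KN_iff]
  let ?P = "\<lambda>C D. col_le letter_less (r_col C) (l_col D)"
  \<comment> \<open>In the reading \<open>Xs\<close> comes first; it consists of the columns to the
    right of \<open>D\<close>.\<close>
  obtain Xs D Ys where split: "rev T = Xs @ [D] @ Ys"
    and D1: "tensor_phi (word_C n) i (concat Xs) < tensor_eps (word_C n) i D"
    and D2: "tensor_eps (word_C n) i (concat Ys) \<le> tensor_phi (word_C n) i D"
    using tensor_eps_split[of "word_C n" i "rev T"] e by (auto simp: reading_def)
  have Teq: "T = rev Ys @ [D] @ rev Xs" using arg_cong[OF split, of rev] by simp
  have gD: "good_col n D" using K Teq by auto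
  note GD = good_col_facts[OF gD]
  have eD: "0 < tensor_eps (word_C n) i (col_of_set (set D))" using D1 GD(12) by simp
  obtain S' where S': "S' \<subseteq> letters_C n" "pending n S' 1 = 0"
    "tensor_f (word_C n) i (col_of_set S') = Some (col_of_set (set D))"
    "l_set n S' = l_set n (set D) \<or> raise_rel n i (l_set n (set D)) (l_set n S') \<and> tensor_phi (word_C n) i (col_of_set (set D)) = 0"
    "r_set n S' = r_set n (set D) \<or> raise_rel n i (r_set n (set D)) (r_set n S')"
    using column_raise[OF GD(1) i GD(3) eD] by blast
  define D' where "D' = col_of_set S'"
  have fin: "finite S'" "0 \<notin> S'" using S'(1) finite_letters_C finite_subset by (blast, auto simp: letters_C_def)
  have sD': "set D' = S'" using fin by (simp add: D'_def set_col_of_set)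
  have gD': "good_col n D'"
    unfolding good_col_def using sD' S'(1,2) admissible_iff[of D' n] fin by (simp add: D'_def sorted_col_of_set)
  have fD': "tensor_f (word_C n) i D' = Some D" using S'(3) GD(12) by (simp add: D'_def)
  have len: "length D' = length D" using tensor_f_length[OF fD'[unfolded word_C_def]] by simp
  let ?T' = "rev Ys @ [D'] @ rev Xs"
  have rd: "reading ?T' = concat Xs @ D' @ concat Ys" "reading T = concat Xs @ D @ concat Ys"
    by (simp_all add: reading_def Teq)
  have "tensor_f (word_C n) i (reading ?T') = Some (reading T)"
    unfolding rd by (rule tensor_f_middle[OF seminormal_C _ fD' D1 D2]) (use i in simp)
  moreover have shape: "map length ?T' = map length T" using len by (simp add: Teq)
  moreover have "?T' \<in> KN n \<mu>"
    unfolding KN_iff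
  proof (intro conjI)
    show "map length ?T' = col_heights \<mu>" using shape K by simp
    show "\<forall>C\<in>set ?T'. good_col n C" using K gD' by (auto simp: Teq)
    \<comment> \<open>Raising can only enlarge the ranks of the right split column, which is the
      larger side of this comparison.\<close>
    have right: "?P D' E" if PE: "?P D E" and gE: "good_col n E" for E
    proof -
      have "rank_le n (r_set n (set D)) x \<le> rank_le n (r_set n S') x" for x
        using S'(5) rank_raise(1)[OF GD(11) i] by auto
      then show ?thesis
        using PE col_le_r_l_iff[OF gD gE] col_le_r_l_iff[OF gD' gE] len sD' by (auto intro: order_trans)
    qed
    \<comment> \<open>Here the smaller side may grow. It does so only if \<open>tensor_phi\<close>
      of \<open>D\<close> is zero; then \<open>C\<close>, all of whose surviving minuses are
      absorbed by \<open>D\<close>, has none, and its right split column is closed as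
      required.\<close>
    have left: "?P C D'" if PC: "?P C D" and gC: "good_col n C" and eC: "tensor_eps (word_C n) i C \<le> tensor_phi (word_C n) i D" for C
    proof -
      note GC = good_col_facts[OF gC]
      have le: "rank_le n (l_set n (set D)) x \<le> rank_le n (r_set n (set C)) x" for x
        using PC col_le_r_l_iff[OF gC gD] by simp
      have "rank_le n (l_set n S') x \<le> rank_le n (r_set n (set C)) x" for x
      proof (cases "l_set n S' = l_set n (set D)")
        case False
        then have r: "raise_rel n i (l_set n (set D)) (l_set n S')" and "tensor_phi (word_C n) i D = 0"
          using S'(4) GD(12) by auto
        then have "tensor_eps (word_C n) i (col_of_set (set C)) = 0" using eC GC(12) by simp
        from r_set_closed[OF GC(1) i this] show ?thesis
          by (intro rank_raise_neighbour[OF GD(10) i r GC(11) le]) auto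
      qed (use le in simp)
      then show ?thesis using col_le_r_l_iff[OF gC gD'] col_le_r_l_iff[OF gC gD] PC len sD' by simp
    qed
    have su: "successively ?P (rev Ys)" "successively ?P (rev Xs)"
      "rev Ys = [] \<or> ?P (last (rev Ys)) D" "rev Xs = [] \<or> ?P D (hd (rev Xs))"
      using K unfolding Teq successively_append_iff by (auto simp: successively_Cons)
    have "rev Ys = [] \<or> ?P (last (rev Ys)) D'"
    proof (cases "Ys")
      case (Cons C Ys')
      have "good_col n C" using K Teq Cons by auto
      moreover have "tensor_eps (word_C n) i C \<le> tensor_phi (word_C n) i D"
        using D2 Cons by (simp add: tensor_eps_append)
      ultimately show ?thesis using left[of C] su(3) Cons by simp
    qed simp
    moreover have "rev Xs = [] \<or> ?P D' (hd (rev Xs))"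
    proof (cases "rev Xs")
      case (Cons E Es)
      then have "E \<in> set (rev Xs)" by simp
      then have "good_col n E" using K Teq by auto
      then show ?thesis using right[of E] su(4) Cons by simp
    qed simp
    ultimately show "successively ?P ?T'"
      unfolding successively_append_iff using su by (auto simp: successively_Cons)
  qed
  ultimately show ?thesis by blast
qed

lemma tensor_phi_pos: "0 < tensor_phi (word_C n) i w \<Longrightarrow> \<exists>y\<in>set w. mark_C n i y = Some Plus"
  by (induction w) (auto split: if_splits)

lemma set_initial: "set (map int [1..<Suc p]) = {1..int p}"
proof -
  have "x \<in> int ` {1..<Suc p} \<longleftrightarrow> x \<in> {1..int p}" for x by (auto intro!: image_eqI[of _ _ "nat x"])
  then show ?thesis by (auto simp del: upt_Suc)
qed

text \<open>Columns are treated from right to left and each from the top; the entry with index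
  \<open>p\<close>, counted from 0, has to be \<open>p + 1\<close>. Where the right neighbour
  reaches this row, its entry is an upper bound. Otherwise everything read before lies in
  \<open>1, ..., p\<close>, and any other letter would be an uncancelled minus or contradict
  admissibility.\<close>

lemma KN_highest_columns:
  assumes "\<forall>C\<in>set T. good_col n C" "successively (\<lambda>C D. col_le letter_less (r_col C) (l_col D)) T"
    and "\<And>i. i \<in> {1..n} \<Longrightarrow> tensor_eps (word_C n) i (concat (rev T)) = 0"
  shows "\<forall>C\<in>set T. C = map int [1..<Suc (length C)] \<and> length C \<le> length (hd T)"
  using assms
proof (induction T)
  case (Cons C T)
  have eps: "tensor_eps (word_C n) i (concat (rev T) @ C) = 0" if "i \<in> {1..n}" for i
    using Cons.prems(3)[OF that] by simp
  have IH: "\<forall>D\<in>set T. D = map int [1..<Suc (length D)] \<and> length D \<le> length (hd T)"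
  proof (rule Cons.IH)
    show "successively (\<lambda>C D. col_le letter_less (r_col C) (l_col D)) T"
      using Cons.prems(2) by (auto simp: successively_Cons)
    show "tensor_eps (word_C n) i (concat (rev T)) = 0" if "i \<in> {1..n}" for i
      using eps[OF that] by (simp add: tensor_eps_append)
  qed (use Cons.prems in simp)
  have gC: "good_col n C" using Cons.prems by simp
  note GC = good_col_facts[OF gC]
  have hdT: "col_le letter_less C (hd T)" if "T \<noteq> []"
  proof -
    have "good_col n (hd T)" using Cons.prems(1) that by simp
    moreover have "col_le letter_less (r_col C) (l_col (hd T))"
      using Cons.prems(2) that by (simp add: successively_Cons)
    ultimately show ?thesis using col_le_l_r gC col_le_trans by blast
  qed
  have lenT: "length D \<le> length C" if "D \<in> set T" for D
  proof -
    have "length (hd T) \<le> length C" using hdT that by (cases T) (auto simp: col_le_def)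
    then show ?thesis using IH that by force
  qed
  have "take p C = map int [1..<Suc p]" if "p \<le> length C" for p
    using that
  proof (induction p)
    case (Suc p)
    then have IHp: "take p C = map int [1..<Suc p]" and p: "p < length C" by auto
    let ?x = "C ! p"
    have xC: "?x \<in> set C" using p by simp
    then have xl: "?x \<in> letters_C n" using GC(1) by blast
    have prev: "letter_less y ?x" if "y \<in> {1..int p}" for y
    proof -
      have "y \<in> set (take p C)" using that IHp set_initial[of p] by simp
      then obtain k where "k < p" "y = C ! k" by (auto simp: in_set_conv_nth)
      then show ?thesis using sorted_wrt_nth_less[OF GC(2)] p by simp
    qed
    have x: "?x = int p + 1"
    proof (cases "T \<noteq> [] \<and> p < length (hd T)")
      case True
      then have "hd T \<in> set T" by simp
      then have hd: "hd T = map int [1..<Suc (length (hd T))]" using IH by blast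
      have "hd T ! p = int p + 1" using True by (subst hd) (simp del: upt_Suc)
      then have "letter_less ?x (int p + 1) \<or> ?x = int p + 1"
        using hdT True unfolding col_le_def by metis
      then have "0 < ?x" "?x \<le> int p + 1" by (auto simp: letter_less_def)
      moreover have "?x \<notin> {1..int p}" using prev[of ?x] by (auto simp: letter_less_def)
      ultimately show ?thesis by auto
    next
      case False
      \<comment> \<open>The part of the reading that precedes the entry in question.\<close>
      let ?w = "concat (rev T) @ take p C"
      have w: "set ?w \<subseteq> {1..int p}"
      proof
        fix y assume "y \<in> set ?w"
        then consider D where "D \<in> set T" "y \<in> set D" | "y \<in> set (take p C)" by auto
        then show "y \<in> {1..int p}"
        proof cases
          case 1
          then have "T \<noteq> []" by auto
          then have "length D \<le> p" using False IH 1(1) by force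
          moreover have "y \<in> {1..int (length D)}" using IH 1 set_initial[of "length D"] by metis
          ultimately show ?thesis by auto
        next
          case 2
          then show ?thesis using IHp set_initial[of p] by simp
        qed
      qed
      have plus: "\<exists>y\<in>{1..int p}. mark_C n i y = Some Plus" if "mark_C n i ?x = Some Minus" "i \<in> {1..n}" for i
      proof -
        have "C = take p C @ [?x] @ drop (Suc p) C" using p by (simp add: id_take_nth_drop)
        then have "concat (rev T) @ C = (?w @ [?x]) @ drop (Suc p) C" by (metis append.assoc)
        then have "tensor_eps (word_C n) i (?w @ [?x]) = 0"
          using eps[OF that(2)] tensor_eps_append[of "word_C n" i "?w @ [?x]" "drop (Suc p) C"] by simp
        then have "0 < tensor_phi (word_C n) i ?w"
          using that(1) tensor_eps_append[of "word_C n" i ?w "[?x]"] by simp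
        then show ?thesis using tensor_phi_pos w by blast
      qed
      show ?thesis
      proof (cases "0 < ?x")
        case True
        have "int p < ?x"
          using prev[of ?x] True by (force simp: letter_less_def)
        moreover have "\<not> int p + 1 < ?x"
        proof
          assume g: "int p + 1 < ?x"
          let ?i = "nat (?x - 1)"
          have i: "?i \<in> {1..n}" "?i < n" "int ?i = ?x - 1" using g xl by (auto simp: letters_C_def)
          have "mark_C n ?i ?x = Some Minus" using i g by (simp add: mark_C_def)
          then obtain y where "y \<in> {1..int p}" "mark_C n ?i y = Some Plus" using plus i(1) by blast
          then show False using i g by (auto simp: mark_C_def split: if_splits)
        qed
        ultimately show ?thesis by simp
      next
        \<comment> \<open>A barred letter needs its partner among \<open>1, ..., p\<close> to be
          cancelled. All of \<open>1, ..., p\<close> lie in the column, so the bracket opened by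
          this pair finds no free letter below on which to close.\<close>
        case neg: False
        let ?q = "nat (- ?x)"
        have q: "?q \<in> {1..n}" "int ?q = - ?x" using neg xl by (auto simp: letters_C_def)
        have "mark_C n ?q ?x = Some Minus" using q by (auto simp: mark_C_def)
        then obtain y where y: "y \<in> {1..int p}" "mark_C n ?q y = Some Plus" using plus q(1) by blast
        then have "- ?x \<in> {1..int p}" using q by (auto simp: mark_C_def split: if_splits)
        moreover have sub: "{1..int p} \<subseteq> set C"
          using IHp set_initial[of p] set_take_subset[of p C] by simp
        ultimately have qC: "- ?x \<in> set C" "- ?x \<le> int p" "1 \<le> - ?x" "- ?x \<le> int n" using q by auto
        have "pending n (set C) (- ?x) = Suc (pending n (set C) (- ?x + 1))"
          using pending_rec[OF qC(4), of "set C"] qC(1) xC by simp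
        moreover have "{t \<in> closers n (set C). - ?x \<le> t} = {t \<in> closers n (set C). 1 \<le> t}"
          using sub qC by (auto simp: closers_def) (metis atLeastAtMost_iff linorder_le_cases order_trans subsetD)
        moreover have "card {z \<in> openers (set C). - ?x \<le> z} \<le> card {z \<in> openers (set C). 1 \<le> z}"
          using finite_openers[OF GC(1)] qC(3) by (intro card_mono) auto
        ultimately show ?thesis
          using pending_count[OF GC(1), of "- ?x"] pending_count[OF GC(1), of 1] GC(3) qC by simp
      qed
    qed
    show ?case using p IHp x by (simp add: take_Suc_conv_app_nth)
  qed simp
  from this[of "length C"] have "C = map int [1..<Suc (length C)]" by simp
  then show ?case using IH lenT by auto
qed simp

lemma KN_highest:
  assumes "T \<in> KN n \<mu>" "\<And>i. i \<in> {1..n} \<Longrightarrow> tensor_eps (word_C n) i (reading T) = 0"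
  shows "T = highest \<mu>"
proof -
  note K = assms(1)[unfolded KN_iff]
  have "\<forall>C\<in>set T. C = map int [1..<Suc (length C)]"
    using KN_highest_columns[of T n] K assms(2) by (auto simp: reading_def)
  then have "T = map (\<lambda>C. map int [1..<Suc (length C)]) T" by (intro map_idI[symmetric]) metis
  also have "\<dots> = map (\<lambda>h. map int [1..<Suc h]) (map length T)" by (simp only: map_map comp_def)
  finally show ?thesis using K by (simp only: highest_def)
qed

text \<open>Every operator moves one letter to its successor in the alphabet, including
  \<open>n\<close> to \<open>-n\<close>. The sum is the measure for climbing to the highest weight
  element.\<close>

lemma sum_hat_f:
  assumes "i \<in> {1..n}"
  shows "set w \<subseteq> letters_C n \<Longrightarrow> tensor_f (word_C n) i w = Some w' \<Longrightarrow>
    sum_list (map (hat n) w') = sum_list (map (hat n) w) + 1"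
proof (induction w arbitrary: w')
  case (Cons x w)
  have "hat n (act_C n i x) = hat n x + 1" if "mark_C n i x = Some Plus"
    using that assms by (auto simp: mark_C_def act_C_def hat_def split: if_splits)
  then show ?case using Cons by (auto split: if_splits)
qed simp

context baker_setup
begin

lemma KN_reachable: "T \<in> KN n \<mu> \<Longrightarrow> T \<in> RC"
proof (induction "nat (sum_list (map (hat n) (reading T)))" arbitrary: T rule: less_induct)
  case less
  show ?case
  proof (cases "\<forall>i\<in>{1..n}. tensor_eps (word_C n) i (reading T) = 0")
    case True
    then have "T = hC" using KN_highest[OF less.prems] by blast
    then show ?thesis by (simp add: reachable_refl)
  next
    case False
    then obtain i where i: "i \<in> {1..n}" "0 < tensor_eps (word_C n) i (reading T)" by auto
    then obtain T' where T': "T' \<in> KN n \<mu>" "map length T' = map length T"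
      "tensor_f (word_C n) i (reading T') = Some (reading T)"
      using KN_raise[OF less.prems] by blast
    have l: "set (reading T') \<subseteq> letters_C n" using T'(1) by (auto simp: KN_def reading_def)
    have "0 \<le> sum_list (map (hat n) (reading T'))"
    proof (rule sum_list_nonneg)
      fix y assume "y \<in> set (map (hat n) (reading T'))"
      then show "0 \<le> y" using l by (auto simp: hat_def letters_C_def)
    qed
    then have "nat (sum_list (map (hat n) (reading T'))) < nat (sum_list (map (hat n) (reading T)))"
      using sum_hat_f[OF i(1) l T'(3)] by simp
    then have "T' \<in> RC" using less.hyps T'(1) by blast
    moreover have "cr_f BC i T' = Some T" using T' BC_f by simp
    ultimately show ?thesis using i by (intro reachable_step[of T' BC hC i T]) simp_all
  qed
qed

end

section \<open>Signed permutations\<close>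

text \<open>Letters are arguments of weights, so they are permuted in the opposite order: the
  reflection applied last to a weight is the first to act on a letter.\<close>

definition signed_perm :: "nat \<Rightarrow> nat list \<Rightarrow> int \<Rightarrow> int" where
  "signed_perm n is = foldr (\<lambda>i g. g \<circ> reflect n i) is id"

lemma word_prod_simps [simp]:
  "word_prod s [] = id" "word_prod s (i # is) = s i \<circ> word_prod s is"
  by (simp_all add: word_prod_def)

lemma signed_perm_simps [simp]:
  "signed_perm n [] = id" "signed_perm n (i # is) = signed_perm n is \<circ> reflect n i"
  by (simp_all add: signed_perm_def)

lemma int_cases_abs: obtains k where "x = int k" | k where "x = - int k" "0 < k"
  by (metis int_cases3 of_nat_0)

lemma s_A_apply: "s_A i v k = v (if k = i then Suc i else if k = Suc i then i else k)"
  by (simp add: s_A_def)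

lemma s_tilde_apply:
  assumes "i < n"
  shows "s_tilde n i v k = v (if k = i then Suc i else if k = Suc i then i
    else if k = 2 * n - i then Suc (2 * n - i) else if k = Suc (2 * n - i) then 2 * n - i else k)"
proof -
  have "s_tilde n i v k = s_A (2 * n - i) v (if k = i then Suc i else if k = Suc i then i else k)"
    using assms by (simp add: s_tilde_def s_A_apply)
  also have "\<dots> = v (if k = i then Suc i else if k = Suc i then i
    else if k = 2 * n - i then Suc (2 * n - i) else if k = Suc (2 * n - i) then 2 * n - i else k)"
    unfolding s_A_apply using assms by (intro arg_cong[of _ _ v]) auto
  finally show ?thesis .
qed

lemma hat_pos: "1 \<le> k \<Longrightarrow> nat (hat n (int k)) = k"
  by (simp add: hat_def)

lemma hat_neg: "1 \<le> k \<Longrightarrow> k \<le> n \<Longrightarrow> nat (hat n (- int k)) = 2 * n + 1 - k"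
  by (simp add: hat_def)

lemma reflect_int:
  assumes "1 \<le> i" "i \<le> n" "1 \<le> k"
  shows "reflect n i (int k) = (if i < n then int (if k = i then Suc i else if k = Suc i then i else k)
      else if k = n then - int k else int k)"
    and "reflect n i (- int k) = (if i < n then - int (if k = i then Suc i else if k = Suc i then i else k)
      else if k = n then int k else - int k)"
  using assms by (auto simp: reflect_def)

lemma signed_int: "signed v (int k) = v k"
  and signed_neg: "0 < k \<Longrightarrow> signed v (- int k) = - v k"
  by (simp_all add: signed_def)

lemma signed_s_C:
  assumes i: "i \<in> {1..n}"
  shows "signed (s_C n i v) x = signed v (reflect n i x)"
proof -
  have i': "1 \<le> i" "i \<le> n" using i by auto
  have 0: "reflect n i 0 = 0" using i' by (simp add: reflect_def)
  show ?thesis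
  proof (cases x rule: int_cases_abs)
    case (1 k)
    show ?thesis
    proof (cases "k = 0")
      case True
      then show ?thesis using 1 0 i' signed_int[of _ 0] by (simp add: s_C_def)
    next
      case False
      then have k: "1 \<le> k" by simp
      show ?thesis
        unfolding 1 reflect_int(1)[OF i' k] using i' k by (auto simp: signed_int signed_neg s_C_def simp del: of_nat_Suc)
    qed
  next
    case (2 k)
    then have k: "1 \<le> k" by simp
    show ?thesis
      unfolding 2(1) reflect_int(2)[OF i' k] using i' k by (auto simp: signed_int signed_neg s_C_def simp del: of_nat_Suc)
  qed
qed

lemma signed_word_prod:
  "set is \<subseteq> {1..n} \<Longrightarrow> signed (word_prod (s_C n) is v) x = signed v (signed_perm n is x)"
  by (induction "is" arbitrary: x) (simp_all add: signed_s_C)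

text \<open>The weight \<open>int\<close> has value \<open>k\<close> in coordinate \<open>k\<close>,
  so \<open>signed int\<close> is the identity on letters, and the permutation can be read off from
  the group element alone.\<close>

lemma signed_perm_eq:
  "set is \<subseteq> {1..n} \<Longrightarrow> signed_perm n is x = signed (word_prod (s_C n) is int) x"
  by (simp add: signed_word_prod) (simp add: signed_def)

lemma s_tilde_hat:
  assumes i: "i \<in> {1..n}" and x: "x \<in> letters_C n"
  shows "s_tilde n i v (nat (hat n x)) = v (nat (hat n (reflect n i x)))"
proof -
  have i': "1 \<le> i" "i \<le> n" using i by auto
  have last: "s_tilde n n v k = v (if k = n then Suc n else if k = Suc n then n else k)" for k
    by (simp add: s_tilde_def s_A_apply)
  show ?thesis
  proof (cases x rule: int_cases_abs)
    case (1 k)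
    then have k: "1 \<le> k" "k \<le> n" using x by (auto simp: letters_C_def)
    show ?thesis
    proof (cases "i < n")
      case True
      then show ?thesis
        unfolding 1 hat_pos[OF k(1)] reflect_int(1)[OF i' k(1)] s_tilde_apply[OF True]
        using k i' True hat_pos by (simp del: of_nat_Suc) (intro impI conjI; linarith)
    next
      case False
      then have "i = n" using i' by simp
      then show ?thesis
        unfolding 1 hat_pos[OF k(1)] reflect_int(1)[OF i' k(1)]
        using k by (simp add: last hat_pos hat_neg)
    qed
  next
    case (2 k)
    then have k: "1 \<le> k" "k \<le> n" using x by (auto simp: letters_C_def)
    show ?thesis
    proof (cases "i < n")
      case True
      let ?k = "if k = i then Suc i else if k = Suc i then i else k"
      have "1 \<le> ?k" "?k \<le> n" using k i' True by auto
      then have "nat (hat n (reflect n i x)) = 2 * n + 1 - ?k"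
        unfolding 2 reflect_int(2)[OF i' k(1)] using True hat_neg by simp
      then show ?thesis
        unfolding 2(1) hat_neg[OF k] s_tilde_apply[OF True] using k i' True
        by (intro arg_cong[of _ _ v]) (auto simp: 2)
    next
      case False
      then have "i = n" using i' by simp
      then show ?thesis
        unfolding 2 hat_neg[OF k] reflect_int(2)[OF i' k(1)]
        using k by (auto simp: last hat_pos hat_neg)
    qed
  qed
qed

lemma s_tilde_outside:
  assumes "i \<in> {1..n}" "k \<notin> {1..2 * n}"
  shows "s_tilde n i v k = v k"
proof (cases "i < n")
  case True
  then have "k \<noteq> i" "k \<noteq> Suc i" "k \<noteq> 2 * n - i" "k \<noteq> Suc (2 * n - i)" using assms by auto
  then show ?thesis by (simp add: s_tilde_apply[OF True])
next
  case False
  then have "k \<noteq> n" "k \<noteq> Suc n" using assms by auto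
  then show ?thesis using False by (simp add: s_tilde_def s_A_apply)
qed

lemma signed_perm_letters:
  "set is \<subseteq> {1..n} \<Longrightarrow> x \<in> letters_C n \<Longrightarrow> signed_perm n is x \<in> letters_C n"
  by (induction "is" arbitrary: x) (simp_all add: reflect_letters)

lemma word_prod_tilde:
  assumes "set is \<subseteq> {1..n}"
  shows "x \<in> letters_C n \<Longrightarrow> word_prod (s_tilde n) is v (nat (hat n x)) = v (nat (hat n (signed_perm n is x)))"
    and "k \<notin> {1..2 * n} \<Longrightarrow> word_prod (s_tilde n) is v k = v k"
  using assms
  by (induction "is" arbitrary: x) (simp_all add: s_tilde_hat reflect_letters s_tilde_outside)

text \<open>Two words for the same group element induce the same permutation of letters, and on the
  coordinates \<open>1, ..., 2n\<close> the lifted product depends only on this permutation; all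
  other coordinates are fixed.\<close>

lemma tilde_word_prod:
  assumes "set is \<subseteq> {1..n}"
  shows "tilde n (word_prod (s_C n) is) = word_prod (s_tilde n) is"
  unfolding tilde_def
proof (rule the_equality)
  show "\<exists>js. set js \<subseteq> {1..n} \<and> word_prod (s_C n) is = word_prod (s_C n) js \<and>
      word_prod (s_tilde n) is = word_prod (s_tilde n) js" using assms by blast
  fix \<tau> assume "\<exists>js. set js \<subseteq> {1..n} \<and> word_prod (s_C n) is = word_prod (s_C n) js \<and> \<tau> = word_prod (s_tilde n) js"
  then obtain js where js: "set js \<subseteq> {1..n}" "word_prod (s_C n) is = word_prod (s_C n) js"
    "\<tau> = word_prod (s_tilde n) js" by blast
  have P: "signed_perm n js x = signed_perm n is x" for x
    using signed_perm_eq[OF js(1)] signed_perm_eq[OF assms] js(2) by simp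
  have "word_prod (s_tilde n) js v k = word_prod (s_tilde n) is v k" for v k
  proof (cases "k \<in> {1..2 * n}")
    case True
    then have "int k \<in> {1..2 * int n}" by auto
    then obtain x where x: "x \<in> letters_C n" "int k = hat n x" by (rule hat_surj)
    then have "k = nat (hat n x)" by simp
    then show ?thesis using word_prod_tilde(1)[OF js(1) x(1)] word_prod_tilde(1)[OF assms x(1)] P by simp
  qed (use word_prod_tilde(2) js(1) assms in simp)
  then show "\<tau> = word_prod (s_tilde n) is" using js(3) by (simp add: fun_eq_iff)
qed

section \<open>Weights in the orbit of a partition\<close>

lemma rearranges_refl:
  assumes "is_partition N \<mu>"
  shows "rearranges N \<mu> \<mu>"
proof -
  have "\<bar>\<mu> i\<bar> = \<mu> i" for i using partition_nonneg[OF assms] by simp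
  then show ?thesis
    using partition_outside[OF assms] by (simp add: rearranges_def col_height_def)
qed

lemma rearranges_s_A:
  assumes "rearranges N \<mu> v" "1 \<le> i" "i < N"
  shows "rearranges N \<mu> (s_A i v)"
proof -
  let ?t = "\<lambda>k. if k = i then Suc i else if k = Suc i then i else k"
  have v0: "v k = 0" if "k \<notin> {1..N}" for k using assms(1) that unfolding rearranges_def by blast
  have "s_A i v k = 0" if k: "k \<notin> {1..N}" for k
    using assms(2,3) k v0[of k] by (auto simp: s_A_apply)
  moreover have "card {k. int c \<le> \<bar>s_A i v k\<bar>} = card {k. int c \<le> \<bar>v k\<bar>}" for c
  proof (rule bij_betw_same_card[of ?t])
    show "bij_betw ?t {k. int c \<le> \<bar>s_A i v k\<bar>} {k. int c \<le> \<bar>v k\<bar>}"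
      by (rule bij_betw_byWitness[of _ ?t]) (auto simp: s_A_apply)
  qed
  ultimately show ?thesis using assms(1) unfolding rearranges_def by simp
qed

lemma rearranges_s_C:
  assumes "rearranges n \<mu> v" "i \<in> {1..n}"
  shows "rearranges n \<mu> (s_C n i v)"
proof (cases "i < n")
  case True
  then have "s_C n i v = s_A i v" by (simp add: s_C_def s_A_def)
  then show ?thesis using rearranges_s_A[OF assms(1)] assms(2) True by simp
next
  case False
  have "\<bar>s_C n i v k\<bar> = \<bar>v k\<bar>" for k using False by (simp add: s_C_def)
  moreover have "v k = 0 \<Longrightarrow> s_C n i v k = 0" for k using False by (auto simp: s_C_def)
  ultimately show ?thesis using assms(1) unfolding rearranges_def by simp
qed

lemma rearranges_word_C:
  "is_partition n \<mu> \<Longrightarrow> set is \<subseteq> {1..n} \<Longrightarrow> rearranges n \<mu> (word_prod (s_C n) is \<mu>)"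
  by (induction "is") (simp_all add: rearranges_refl rearranges_s_C)

lemma rearranges_word_A:
  "is_partition N \<mu> \<Longrightarrow> set is \<subseteq> {1..N - 1} \<Longrightarrow>
   rearranges N \<mu> (word_prod s_A is \<mu>) \<and> (\<forall>k. 0 \<le> word_prod s_A is \<mu> k)"
proof (induction "is")
  case (Cons i "is")
  then have "1 \<le> i" "i < N" by auto
  moreover have "0 \<le> s_A i v k" if "\<forall>k. 0 \<le> v k" for v k using that by (simp add: s_A_def)
  ultimately show ?case using Cons rearranges_s_A[of N \<mu> _ i] by simp
qed (simp add: rearranges_refl partition_nonneg)

lemma word_prod_tilde_A:
  assumes "set is \<subseteq> {1..n}"
  shows "\<exists>js. set js \<subseteq> {1..2 * n - 1} \<and> word_prod (s_tilde n) is = word_prod s_A js"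
  using assms
proof (induction "is")
  case Nil
  then show ?case by (intro exI[of _ "[]"]) simp
next
  case (Cons i "is")
  then obtain js where js: "set js \<subseteq> {1..2 * n - 1}" "word_prod (s_tilde n) is = word_prod s_A js" by auto
  let ?i = "if i < n then [i, 2 * n - i] else [n]"
  have "word_prod (s_tilde n) (i # is) = word_prod s_A (?i @ js)"
    using js(2) by (simp add: s_tilde_def comp_assoc)
  moreover have "set (?i @ js) \<subseteq> {1..2 * n - 1}" using js(1) Cons.prems by auto
  ultimately show ?case by blast
qed

section \<open>Key tableaux\<close>

lemma wt_C_net: "wt_C n T = (\<lambda>i. if i \<in> {1..n} then net_count (concat T) (int i) else 0)"
  unfolding wt_C_def net_count_def ..

lemma net_count_minus: "net_count w (- x) = - net_count w x"
  by (simp add: net_count_def)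

lemma net_count_determined:
  assumes l: "set w \<subseteq> letters_C n" and u: "\<And>i. i \<notin> {1..n} \<Longrightarrow> u i = 0"
    and w: "\<And>i. i \<in> {1..n} \<Longrightarrow> net_count w (int i) = u i"
  shows "net_count w x = signed u x"
proof -
  have *: "net_count w (int k) = u k" for k
  proof (cases "k \<in> {1..n}")
    case False
    then have "int k \<notin> letters_C n" "- int k \<notin> letters_C n" by (auto simp: letters_C_def)
    then have "int k \<notin> set w" "- int k \<notin> set w" using l by blast+
    then show ?thesis using u[OF False] by (simp add: net_count_def)
  qed (rule w)
  show ?thesis
    by (cases x rule: int_cases_abs) (use * in \<open>auto simp: net_count_minus signed_def\<close>)
qed

text \<open>A key column has no opposite pair, so no bracket opens and both split columns equal the
  column itself; nestedness gives the rest. Uniqueness among tableaux of this weight is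
  extremality.\<close>

lemma key_C_eq:
  assumes part: "is_partition n \<mu>" and u: "rearranges n \<mu> u"
  shows "key_tab \<mu> u \<in> KN n \<mu>" "key_C n \<mu> u = key_tab \<mu> u"
proof -
  let ?K = "key_tab \<mu> u"
  have u0: "u i = 0" if "i \<notin> {1..n}" for i using u that unfolding rearranges_def by blast
  have col: "good_col n C \<and> l_col C = C \<and> r_col C = C" if C: "C \<in> set ?K" for C
  proof -
    obtain c where c: "1 \<le> c" "C = col_of_set (key_set u c)" using key_tab_col[OF part u C] by blast
    note F = key_col_facts[OF part u c(1), folded c(2)]
    have S: "set C \<subseteq> letters_C n" using key_set_sub[OF part u c(1)] F(1) by simp
    have "openers (set C) = {}"
      using key_set_opposite[OF part u c(1) c(1)] F(1) by (auto simp: openers_def)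
    then have 0: "pending n (set C) j = 0 \<and> {t \<in> closers n (set C). j \<le> t} = {}" if "1 \<le> j" "j \<le> int n + 1" for j
      using pending_count[OF S that] finite_closers[of n "set C"] by simp
    have cl: "closers n (set C) = {}" using 0[of 1] by (auto simp: closers_def)
    have a: "admissible C" using 0[of 1] admissible_iff[OF S] by simp
    have z: "0 \<notin> set C" using S by (auto simp: letters_C_def)
    have lr: "l_set n (set C) = set C" "r_set n (set C) = set C"
      using cl \<open>openers (set C) = {}\<close> by (simp_all add: l_set_def r_set_def)
    have "l_col C = C" "r_col C = C"
      using l_r_col[OF S a] lr F(2) z by (auto intro!: sorted_letters_unique)
    then show ?thesis using S F(2) a by (simp add: good_col_def)
  qed
  have range: "set [1..<Suc (nat (\<mu> 1))] \<subseteq> {1..}" unfolding set_upt by auto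
  have "successively (col_le letter_less) ?K"
    using semistandard_key[OF part u range sorted_upt] unfolding semistandard_iff key_tab_def by blast
  then have "successively (\<lambda>C D. col_le letter_less (r_col C) (l_col D)) ?K"
    by (rule successively_mono) (use col in simp)
  then show K: "?K \<in> KN n \<mu>" using col map_length_key_tab[OF part u] by (simp add: KN_iff)
  show "key_C n \<mu> u = ?K"
    unfolding key_C_def
  proof (rule the_equality)
    have "wt_C n ?K = u"
      using net_count_key_tab[OF part u] u0 by (auto simp: wt_C_net fun_eq_iff signed_def)
    then show "?K \<in> KN n \<mu> \<and> is_key ?K \<and> wt_C n ?K = u" using K is_key_key_tab[OF part u] by simp
    fix T assume T: "T \<in> KN n \<mu> \<and> is_key T \<and> wt_C n T = u"
    show "T = ?K"
    proof (rule extremal_tableau[OF part u])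
      show "map length T = col_heights \<mu>" using T by (simp add: KN_def)
      show "sorted_wrt letter_less C" if "C \<in> set T" for C using T that by (auto simp: KN_def semistandard_def)
      have "set (concat T) \<subseteq> letters_C n" using T by (simp add: KN_def)
      moreover have "net_count (concat T) (int i) = u i" if "i \<in> {1..n}" for i
        using T that unfolding wt_C_net by (metis (mono_tags, lifting))
      ultimately show "net_count (concat T) x = signed u x" for x using u0 by (intro net_count_determined)
    qed
  qed
qed

lemma sorted_positive:
  assumes "set C \<subseteq> {1..}"
  shows "sorted_wrt letter_less C \<longleftrightarrow> sorted_wrt (<) C"
  using assms
proof (induction C)
  case (Cons a C)
  then have "letter_less a x \<longleftrightarrow> a < x" if "x \<in> set C" for x
    using that by (force simp: letter_less_def)
  then show ?case using Cons by simp
qed simp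

text \<open>A nonnegative weight puts only unbarred letters into the key, and on these the type C
  order is the usual one; type A keys are thus covered by the same construction.\<close>

lemma key_A_eq:
  assumes part: "is_partition N \<nu>" and u: "rearranges N \<nu> u" and pos: "\<And>i. 0 \<le> u i"
  shows "key_A N \<nu> u = key_tab \<nu> u"
proof -
  let ?K = "key_tab \<nu> u"
  have u0: "u i = 0" if "i \<notin> {1..N}" for i using u that unfolding rearranges_def by blast
  have Kpos: "set (concat ?K) \<subseteq> {1..int N}"
  proof
    fix x assume "x \<in> set (concat ?K)"
    then obtain C where C: "C \<in> set ?K" "x \<in> set C" by auto
    then obtain c where c: "1 \<le> c" "C = col_of_set (key_set u c)" using key_tab_col[OF part u] by blast
    have "x \<in> key_set u c" using C c key_col_facts(1)[OF part u c(1)] by simp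
    then have "\<not> x < 0" using pos[of "nat (- x)"] c(1) by (auto simp: key_set_def signed_def)
    moreover have "x \<in> letters_C N" using \<open>x \<in> key_set u c\<close> key_set_sub[OF part u c(1)] by blast
    ultimately show "x \<in> {1..int N}" by (auto simp: letters_C_def)
  qed
  have range: "set [1..<Suc (nat (\<nu> 1))] \<subseteq> {1..}" unfolding set_upt by auto
  have "semistandard letter_less ?K"
    using semistandard_key[OF part u range sorted_upt] unfolding key_tab_def by blast
  moreover have p: "0 < x" if "C \<in> set ?K" "x \<in> set C" for C x using Kpos that by force
  ultimately have "semistandard (<) ?K"
    unfolding semistandard_def
  proof (elim conjE, intro conjI ballI allI impI)
    fix C assume "\<forall>C\<in>set ?K. sorted_wrt letter_less C" "C \<in> set ?K"
    then show "sorted_wrt (<) C" using sorted_positive[of C] p by (force simp: subset_iff)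
  next
    fix j assume *: "\<forall>j. Suc j < length ?K \<longrightarrow> length (?K ! Suc j) \<le> length (?K ! j) \<and>
       (\<forall>i<length (?K ! Suc j). letter_less (?K ! j ! i) (?K ! Suc j ! i) \<or> ?K ! j ! i = ?K ! Suc j ! i)"
      and j: "Suc j < length ?K"
    show "length (?K ! Suc j) \<le> length (?K ! j)" using * j by blast
    fix i assume i: "i < length (?K ! Suc j)"
    have "0 < ?K ! Suc j ! i" using p[of "?K ! Suc j" "?K ! Suc j ! i"] i j by simp
    moreover have "letter_less (?K ! j ! i) (?K ! Suc j ! i) \<or> ?K ! j ! i = ?K ! Suc j ! i" using * i j by blast
    ultimately show "?K ! j ! i < ?K ! Suc j ! i \<or> ?K ! j ! i = ?K ! Suc j ! i"
      by (auto simp: letter_less_def)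
  qed
  then have K: "?K \<in> SSYT N \<nu>" using Kpos map_length_key_tab[OF part u] by (simp add: SSYT_def)
  have wt: "wt_A N T = u \<Longrightarrow> net_count (concat T) x = signed u x" if T: "set (concat T) \<subseteq> {1..int N}" for T x
  proof -
    assume w: "wt_A N T = u"
    have neg: "count_list (concat T) (- int i) = 0" for i using T by (force simp: count_list_0_iff)
    show ?thesis
    proof (rule net_count_determined[of _ N])
      show "set (concat T) \<subseteq> letters_C N" using T by (force simp: letters_C_def)
      show "net_count (concat T) (int i) = u i" if "i \<in> {1..N}" for i
        using fun_cong[OF w, of i] that neg by (simp add: wt_A_def net_count_def)
    qed (rule u0)
  qed
  show ?thesis
    unfolding key_A_def
  proof (rule the_equality)
    have neg: "count_list (concat ?K) (- int i) = 0" for i using Kpos by (force simp: count_list_0_iff)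
    have "wt_A N ?K = u"
    proof
      fix i
      show "wt_A N ?K i = u i"
        using net_count_key_tab[OF part u, of "int i"] u0[of i] neg[of i]
        by (simp add: wt_A_def net_count_def signed_def)
    qed
    then show "?K \<in> SSYT N \<nu> \<and> is_key ?K \<and> wt_A N ?K = u" using K is_key_key_tab[OF part u] by simp
    fix T assume T: "T \<in> SSYT N \<nu> \<and> is_key T \<and> wt_A N T = u"
    show "T = ?K"
    proof (rule extremal_tableau[OF part u])
      show "map length T = col_heights \<nu>" using T by (simp add: SSYT_def)
      have sub: "set (concat T) \<subseteq> {1..int N}" using T by (simp add: SSYT_def)
      show "sorted_wrt letter_less C" if "C \<in> set T" for C
      proof -
        have "set C \<subseteq> {1..}" using sub that by force
        then show ?thesis using T that by (auto simp: sorted_positive SSYT_def semistandard_def)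
      qed
      show "net_count (concat T) x = signed u x" for x using wt[OF sub] T by blast
    qed
  qed
qed

section \<open>Strings through key tableaux\<close>

text \<open>The simple root of index \<open>i\<close>, extended to letters with opposite sign on
  barred ones; the last root is the long one, twice a unit vector.\<close>

definition root :: "nat \<Rightarrow> nat \<Rightarrow> int \<Rightarrow> int" where
  "root n i x = (let \<delta> = \<lambda>k. (if x = int k then 1 else 0) - (if x = - int k then 1 else 0)
     in if i < n then \<delta> i - \<delta> (Suc i) else 2 * \<delta> n)"

text \<open>Evaluation on the simple coroot, hence no factor 2 for \<open>i = n\<close>.\<close>

definition pairing :: "nat \<Rightarrow> nat \<Rightarrow> (int \<Rightarrow> int) \<Rightarrow> int" where
  "pairing n i \<nu> = (if i < n then \<nu> (int i) - \<nu> (int i + 1) else \<nu> (int n))"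

lemma net_count_Cons: "net_count (y # w) x = net_count [y] x + net_count w x"
  by (simp add: net_count_def)

lemma net_count_act:
  assumes i: "i \<in> {1..n}" and y: "mark_C n i y = Some Plus"
  shows "net_count [act_C n i y] x = net_count [y] x - root n i x"
proof (cases "i < n")
  case True
  then have "y = int i \<or> y = - (int i + 1)" using y by (auto simp: mark_C_def split: if_splits)
  then show ?thesis
    using True i by (elim disjE) (auto simp: net_count_def act_C_def root_def)
next
  case False
  then have "i = n" "y = int n" using y i by (auto simp: mark_C_def split: if_splits)
  then show ?thesis using i by (auto simp: net_count_def act_C_def root_def)
qed

lemma net_count_f:
  assumes i: "i \<in> {1..n}"
  shows "tensor_f (word_C n) i w = Some w' \<Longrightarrow> net_count w' x = net_count w x - root n i x"
proof (induction w arbitrary: w')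
  case (Cons y w)
  show ?case
  proof (cases "cr_phi (word_C n) i y > tensor_eps (word_C n) i w")
    case True
    then have "mark_C n i y = Some Plus" "w' = act_C n i y # w" using Cons.prems by (auto split: if_splits)
    then show ?thesis using net_count_act[OF i, of y x] by (simp add: net_count_Cons[of _ w])
  next
    case False
    then obtain v where "tensor_f (word_C n) i w = Some v" "w' = y # v" using Cons.prems by auto
    then show ?thesis using Cons.IH by (simp add: net_count_Cons[of y w] net_count_Cons[of y v])
  qed
qed simp

lemma phi_minus_eps_C:
  assumes i: "i \<in> {1..n}"
  shows "int (tensor_phi (word_C n) i w) - int (tensor_eps (word_C n) i w) = pairing n i (net_count w)"
proof (induction w)
  case (Cons y w)
  have "int (cr_phi (word_C n) i y) - int (cr_eps (word_C n) i y) = pairing n i (net_count [y])"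
    using i by (auto simp: pairing_def net_count_def mark_C_def)
  moreover have "pairing n i (net_count (y # w)) = pairing n i (net_count [y]) + pairing n i (net_count w)"
    by (simp add: pairing_def net_count_Cons[of y w])
  ultimately show ?case using Cons by simp
qed (simp add: pairing_def net_count_def)

lemma signed_reflection:
  assumes i: "i \<in> {1..n}" and u0: "u 0 = 0"
  shows "signed (s_C n i u) x = signed u x - pairing n i (signed u) * root n i x"
proof -
  have i': "1 \<le> i" "i \<le> n" using i by auto
  have p: "pairing n i (signed u) = (if i < n then u i - u (Suc i) else u n)"
    using signed_int[of u "Suc i"] by (simp add: pairing_def signed_int add.commute)
  show ?thesis
  proof (cases x rule: int_cases_abs)
    case (1 k)
    show ?thesis
      unfolding p 1 signed_int using i' u0 by (auto simp: s_C_def root_def Let_def)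
  next
    case (2 k)
    show ?thesis
      unfolding p 2(1) signed_neg[OF 2(2)] using i' u0 2(2) by (auto simp: s_C_def root_def Let_def)
  qed
qed

lemma tensor_phi_concat_0:
  "(\<And>w. w \<in> set ws \<Longrightarrow> tensor_phi B i w = 0) \<Longrightarrow> tensor_phi B i (concat ws) = 0"
  by (induction ws) (auto simp: tensor_phi_append)

text \<open>The sign of the pairing decides which of the marked letters enter the nested key columns
  first, so in each column every sign of the unwanted kind is absent or cancelled. A key thus lies
  at an end of each of its strings.\<close>

lemma key_tab_eps_phi:
  assumes part: "is_partition n \<mu>" and u: "rearranges n \<mu> u" and i: "i \<in> {1..n}"
  shows "0 \<le> pairing n i (signed u) \<Longrightarrow> tensor_eps (word_C n) i (reading (key_tab \<mu> u)) = 0"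
    and "pairing n i (signed u) \<le> 0 \<Longrightarrow> tensor_phi (word_C n) i (reading (key_tab \<mu> u)) = 0"
proof -
  have i': "1 \<le> i" using i by simp
  have mem: "int k \<in> key_set u c \<longleftrightarrow> int c \<le> u k" "- int k \<in> key_set u c \<longleftrightarrow> int c \<le> - u k" if "0 < k" for k c
    using that by (simp_all add: key_set_def signed_int signed_neg)
  have col: "(0 \<le> pairing n i (signed u) \<longrightarrow> tensor_eps (word_C n) i (col_of_set (key_set u c)) = 0) \<and>
    (pairing n i (signed u) \<le> 0 \<longrightarrow> tensor_phi (word_C n) i (col_of_set (key_set u c)) = 0)" if c: "1 \<le> c" for c
  proof (cases "i < n")
    case True
    have p: "pairing n i (signed u) = u i - u (Suc i)"
      using True signed_int[of u "Suc i"] by (simp add: pairing_def signed_int add.commute)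
    have m: "int i + 1 \<in> key_set u c \<longleftrightarrow> int c \<le> u (Suc i)" "- (int i + 1) \<in> key_set u c \<longleftrightarrow> int c \<le> - u (Suc i)"
      using mem[of "Suc i" c] by (simp_all add: add.commute)
    have ml: "mark_list n i = [int i, int i + 1, - (int i + 1), - int i]" using True by (simp add: mark_list_def)
    show ?thesis
      unfolding col_eps_phi[OF key_set_sub[OF part u c] i] p ml
      using True i' c mem[of i c]
      by (cases "int c \<le> u i"; cases "int c \<le> u (Suc i)"; cases "int c \<le> - u i"; cases "int c \<le> - u (Suc i)")
        (simp_all add: m mark_C_def del: minus_add_distrib)
  next
    case False
    then have [simp]: "i = n" using i by simp
    have p: "pairing n i (signed u) = u n" by (simp add: pairing_def signed_int)
    have ml: "mark_list n i = [int n, - int n]" by (simp add: mark_list_def)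
    show ?thesis
      unfolding col_eps_phi[OF key_set_sub[OF part u c] i] p ml
      using i' c mem[of n c] by (cases "int c \<le> u n"; cases "int c \<le> - u n") (simp_all add: mark_C_def)
  qed
  show "tensor_eps (word_C n) i (reading (key_tab \<mu> u)) = 0" if "0 \<le> pairing n i (signed u)"
    unfolding reading_def
  proof (rule tensor_eps_concat_0)
    fix w assume "w \<in> set (rev (key_tab \<mu> u))"
    then obtain c where "1 \<le> c" "w = col_of_set (key_set u c)" using key_tab_col[OF part u] by auto
    then show "tensor_eps (word_C n) i w = 0" using col that by simp
  qed
  show "tensor_phi (word_C n) i (reading (key_tab \<mu> u)) = 0" if "pairing n i (signed u) \<le> 0"
    unfolding reading_def
  proof (rule tensor_phi_concat_0)
    fix w assume "w \<in> set (rev (key_tab \<mu> u))"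
    then obtain c where "1 \<le> c" "w = col_of_set (key_set u c)" using key_tab_col[OF part u] by auto
    then show "tensor_phi (word_C n) i w = 0" using col that by simp
  qed
qed

section \<open>Tableaux on lowering paths and the strings of keys\<close>

lemma count_list_reading: "count_list (reading T) x = count_list (concat T) x"
  by (simp add: reading_def count_list_concat sum_list_rev flip: rev_map)

lemma count_list_flat: "count_list (flat Ts) x = count_list (concat (concat Ts)) x"
  by (induction Ts) (simp_all add: count_list_reading)

context baker_setup
begin

text \<open>Shape, strict columns and range of letters are what the recognition of keys by their
  extremal weight asks for.\<close>

lemma RC_invariant:
  assumes "T \<in> RC"
  shows "map length T = col_heights \<mu> \<and> (\<forall>C\<in>set T. sorted_wrt letter_less C) \<and> set (concat T) \<subseteq> letters_C n"
proof -
  obtain "is" where "set is \<subseteq> {1..n}" "f_path (cr_f BC) is hC = Some T"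
    using assms by (auto simp: reachable_def)
  then show ?thesis
  proof (induction "is" arbitrary: T)
    case Nil
    have "sorted_wrt letter_less C" if C: "C \<in> set hC" for C
    proof -
      obtain h where "C = map int [1..<Suc h]" using C unfolding highest_def set_map by blast
      moreover have "set (map int [1..<Suc h]) \<subseteq> {1..}" for h unfolding set_initial by auto
      moreover have "sorted_wrt (<) (map int [1..<Suc h])" for h
        unfolding sorted_wrt_map by (rule sorted_wrt_mono_rel[OF _ sorted_wrt_upt]) simp
      ultimately show ?thesis using sorted_positive by metis
    qed
    then show ?case using Nil map_length_highest hC_letters by (auto simp: reading_def)
  next
    case (Cons i "is")
    then obtain T1 where T1: "f_path (cr_f BC) is hC = Some T1" "cr_f BC i T1 = Some T"
      by (auto simp: bind_eq_Some_conv)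
    have i: "i \<in> {1..n}" using Cons.prems by simp
    have IH: "map length T1 = col_heights \<mu>" "\<forall>C\<in>set T1. sorted_wrt letter_less C" "set (concat T1) \<subseteq> letters_C n"
      using Cons T1 by auto
    obtain Xs C Ys C' where *: "T1 = Xs @ [C] @ Ys" "tensor_f (word_C n) i C = Some C'" "T = Xs @ [C'] @ Ys"
      using tableau_f_column[of "{1..n}" "mark_C n" "act_C n" i T1 T] T1(2)
      unfolding crystal_C_eq word_C_def by blast
    have C: "sorted_wrt letter_less C" "set C \<subseteq> letters_C n" using IH * by auto
    have "sorted_wrt letter_less C'" by (rule f_sorted_C[OF i C *(2)])
    moreover have "set C' \<subseteq> letters_C n" by (rule f_letters_C[OF C(2) i *(2)])
    ultimately show ?case using IH * tensor_f_length[OF *(2)[unfolded word_C_def]] by auto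
  qed
qed

lemma BA_path_invariant:
  assumes "set is \<subseteq> {1..2 * n - 1}" "f_path (cr_f BA) is hA = Some T"
  shows "map length T = col_heights \<mu>A \<and> (\<forall>C\<in>set T. sorted_wrt (<) C)"
  using assms
proof (induction "is" arbitrary: T)
  case Nil
  have "sorted_wrt (<) (map int [1..<Suc h])" for h
    unfolding sorted_wrt_map by (rule sorted_wrt_mono_rel[OF _ sorted_wrt_upt]) simp
  then show ?case using Nil map_length_highest by (auto simp: highest_def simp del: upt_Suc)
next
  case (Cons i "is")
  then obtain T1 where T1: "f_path (cr_f BA) is hA = Some T1" "cr_f BA i T1 = Some T"
    by (auto simp: bind_eq_Some_conv)
  have IH: "map length T1 = col_heights \<mu>A" "\<forall>C\<in>set T1. sorted_wrt (<) C"
    using Cons T1 by auto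
  obtain Xs C Ys C' where *: "T1 = Xs @ [C] @ Ys"
    "tensor_f (letter_crystal {1..2 * n - 1} mark_A (\<lambda>_ x. x + 1)) i C = Some C'" "T = Xs @ [C'] @ Ys"
    using tableau_f_column[of "{1..2 * n - 1}" "mark_A" "\<lambda>_ x. x + 1" i T1 T] T1(2)
    unfolding crystal_A_eq by blast
  have "sorted_wrt (<) C' \<and> (\<forall>y\<in>set C'. \<exists>x\<in>set C. y = x \<or> x < y)"
    by (rule tensor_f_sorted[OF _ _ _ *(2), where A = UNIV])
      (use IH * in \<open>auto simp: transp_def mark_A_def split: if_splits\<close>)
  then show ?case using IH * tensor_f_length[OF *(2)] by auto
qed

lemma RC_extremal:
  assumes "T \<in> RC" "rearranges n \<mu> u" "\<And>x. net_count (reading T) x = signed u x"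
  shows "T = key_tab \<mu> u"
  by (rule extremal_tableau[OF part assms(2)])
    (use RC_invariant[OF assms(1)] assms(3) in \<open>auto simp: net_count_def count_list_reading\<close>)

definition weyl_weights :: "weight set" where
  "weyl_weights = {word_prod (s_C n) is \<mu> | is. set is \<subseteq> {1..n}}"

lemma weyl_weights_rearranges: "u \<in> weyl_weights \<Longrightarrow> rearranges n \<mu> u"
  using rearranges_word_C[OF part] by (auto simp: weyl_weights_def)

lemma weyl_weights_step:
  assumes "u \<in> weyl_weights" "i \<in> {1..n}"
  shows "s_C n i u \<in> weyl_weights"
proof -
  obtain "is" where "set is \<subseteq> {1..n}" "u = word_prod (s_C n) is \<mu>"
    using assms(1) by (auto simp: weyl_weights_def)
  then show ?thesis
    unfolding weyl_weights_def using assms(2) by (intro CollectI exI[of _ "i # is"]) simp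
qed

lemma weyl_weights_iff: "u \<in> weyl_weights \<longleftrightarrow> (\<exists>\<sigma>\<in>weyl_C n. u = \<sigma> \<mu>)"
  by (auto simp: weyl_weights_def weyl_C_def gen_group_def)

lemma keys_C_eq: "keys_C n \<mu> = key_tab \<mu> ` weyl_weights"
  unfolding keys_C_def using weyl_weights_iff weyl_weights_rearranges key_C_eq(2)[OF part]
  by (auto simp: image_iff) metis

lemma key_tab_reachable: "u \<in> weyl_weights \<Longrightarrow> key_tab \<mu> u \<in> RC"
  using KN_reachable key_C_eq(1)[OF part weyl_weights_rearranges] by blast

lemma highest_key: "\<mu> \<in> weyl_weights" "hC = key_tab \<mu> \<mu>"
proof -
  show "\<mu> \<in> weyl_weights" unfolding weyl_weights_def by (intro CollectI exI[of _ "[]"]) simp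
  show "hC = key_tab \<mu> \<mu>"
  proof (rule RC_extremal[OF reachable_refl rearranges_refl[OF part]])
    fix x show "net_count (reading hC) x = signed \<mu> x"
      using partition_outside[OF part, of 0]
      by (auto simp: net_count_def count_list_highest[OF part] signed_def partition_nonneg[OF part])
  qed
qed

lemma net_count_reading_key:
  "u \<in> weyl_weights \<Longrightarrow> net_count (reading (key_tab \<mu> u)) x = signed u x"
  using net_count_key_tab[OF part weyl_weights_rearranges] by (simp add: net_count_def count_list_reading)

text \<open>For a key at the top of its string, \<open>cr_phi\<close> equals the pairing with the
  coroot, so the bottom of the string has the reflected weight. This weight is extremal again and
  identifies a key.\<close>

lemma key_tab_string:
  assumes u: "u \<in> weyl_weights" and i: "i \<in> {1..n}"
  defines "K \<equiv> key_tab \<mu> u"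
  shows "cr_phi BC i K = 0 \<or> cr_eps BC i K = 0"
    and "cr_eps BC i K = 0 \<Longrightarrow>
      f_path (cr_f BC) (replicate (cr_phi BC i K) i) K = Some (key_tab \<mu> (s_C n i u))"
proof -
  note ru = weyl_weights_rearranges[OF u]
  have K: "K \<in> RC" unfolding K_def by (rule key_tab_reachable[OF u])
  have netK: "net_count (reading K) x = signed u x" for x
    unfolding K_def by (rule net_count_reading_key[OF u])
  have pe: "int (cr_phi BC i K) - int (cr_eps BC i K) = pairing n i (signed u)"
    using phi_minus_eps_C[OF i, of "reading K"] netK
    by (simp add: BC_phi BC_eps pairing_def)
  show "cr_phi BC i K = 0 \<or> cr_eps BC i K = 0"
    using key_tab_eps_phi[OF part ru i] unfolding K_def BC_phi BC_eps by linarith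
  assume e: "cr_eps BC i K = 0"
  let ?d = "cr_phi BC i K"
  obtain T where T: "f_path (cr_f BC) (replicate ?d i) K = Some T"
    using string_exists[OF BC_sem, of i ?d K] i by auto
  have TR: "T \<in> RC" by (rule reachable_path[OF K _ T]) (use i in auto)
  have "net_count (reading T') x = net_count (reading K) x - int k * root n i x"
    if "f_path (cr_f BC) (replicate k i) K = Some T'" for k T' x
    using that
  proof (induction k arbitrary: T')
    case (Suc k)
    then obtain T1 where T1: "f_path (cr_f BC) (replicate k i) K = Some T1" "cr_f BC i T1 = Some T'"
      by (auto simp: bind_eq_Some_conv)
    then have "tensor_f (word_C n) i (reading T1) = Some (reading T')" by (simp add: BC_f)
    from net_count_f[OF i this] have "net_count (reading T') x = net_count (reading T1) x - root n i x" .
    also have "\<dots> = net_count (reading K) x - int (Suc k) * root n i x"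
      unfolding Suc.IH[OF T1(1)] by (simp add: algebra_simps)
    finally show ?case .
  qed simp
  from this[OF T] have "net_count (reading T) x = signed (s_C n i u) x" for x
    using signed_reflection[OF i, of u x] ru pe e netK unfolding rearranges_def by simp
  then have "T = key_tab \<mu> (s_C n i u)"
    by (rule RC_extremal[OF TR rearranges_s_C[OF ru i]])
  then show "f_path (cr_f BC) (replicate ?d i) K = Some (key_tab \<mu> (s_C n i u))" using T by simp
qed

section \<open>Dilatations of key tableaux\<close>

lemma net_count_E_word:
  assumes "set v \<subseteq> letters_C n" "set w \<subseteq> letters_C n" "count_list (E_word n v) = count_list (E_word n w)"
  shows "net_count v x = net_count w x"
proof (cases "x \<in> letters_C n")
  case True
  then have x': "- x \<in> letters_C n" by (simp add: letters_C_def)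
  \<comment> \<open>The lengths of the two words are not assumed equal; subtracting the counts for
    \<open>x\<close> and \<open>- x\<close> eliminates them and doubles the net count.\<close>
  note c = count_E_word[OF assms(1) True] count_E_word[OF assms(1) x']
    count_E_word[OF assms(2) True] count_E_word[OF assms(2) x']
  have "2 * net_count v x = 2 * net_count w x"
    using c fun_cong[OF assms(3), of "hat n x"] fun_cong[OF assms(3), of "hat n (- x)"]
    unfolding net_count_def by simp
  then show ?thesis by simp
next
  case False
  then have "- x \<notin> letters_C n" by (simp add: letters_C_def)
  with False have "x \<notin> set v" "x \<notin> set w" "- x \<notin> set v" "- x \<notin> set w" using assms by blast+
  then show ?thesis by (simp add: net_count_def)
qed

lemma theta_C_facts:
  assumes m: "m > 0" and T: "T \<in> RC"
  shows "(T, theta_C n \<mu> m T) \<in> theta_rel m"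
    and "theta_C n \<mu> m T \<in> lists RC" "length (theta_C n \<mu> m T) = m"
proof -
  obtain "is" where is': "set is \<subseteq> {1..n}" "f_path (cr_f BC) is hC = Some T"
    using T by (auto simp: reachable_def)
  show rel: "(T, theta_C n \<mu> m T) \<in> theta_rel m" by (rule theta_C_path(1)[OF m is'])
  show "length (theta_C n \<mu> m T) = m"
    using rel unfolding theta_rel_def by (metis (mono_tags, lifting) case_prodD length_map length_replicate mem_Collect_eq)
  have "bs \<in> lists RC" if "set js \<subseteq> {1..n}" "f_path (tensor_f BC) js (replicate m hC) = Some bs" for js bs
    using that
  proof (induction js arbitrary: bs)
    case Nil
    then show ?case using reachable_refl[of hC BC] by (auto simp: in_lists_conv_set)
  next
    case (Cons j js)
    then obtain cs where "cs \<in> lists RC" "tensor_f BC j cs = Some bs" by (auto simp: bind_eq_Some_conv)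
    then show ?case using alignedD(3)[OF aligned_baker_tensor, of j cs bs] Cons.prems by simp
  qed
  moreover have "set (concat (map (replicate m) is)) \<subseteq> {1..n}" using is'(1) by auto
  ultimately show "theta_C n \<mu> m T \<in> lists RC" using theta_C_path(2)[OF m is'] by blast
qed

text \<open>The factors are column-strict tableaux of the right shape whose total weight is
  \<open>k\<close> times an extremal one, so each of them is the key.\<close>

lemma theta_key:
  assumes k: "k > 0" and u: "u \<in> weyl_weights"
  shows "theta_C n \<mu> k (key_tab \<mu> u) = replicate k (key_tab \<mu> u)"
proof -
  let ?K = "key_tab \<mu> u" let ?cs = "theta_C n \<mu> k (key_tab \<mu> u)"
  note F = theta_C_facts[OF k key_tab_reachable[OF u]]
  have rel: "set (reading ?K) \<subseteq> letters_C n" "set (flat ?cs) \<subseteq> letters_C n"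
    "map (map length) ?cs = replicate k (map length hC)"
    "(E_word n (stretch k (reading ?K)), E_word n (flat ?cs)) \<in> theta_iso k"
    using F(1) by (auto simp: theta_rel_def)
  have sl: "set (stretch k (reading ?K)) \<subseteq> letters_C n" using rel(1) set_stretch[of k "reading ?K"] by blast
  show ?thesis
  proof (rule extremal_tableaux[OF part weyl_weights_rearranges[OF u]])
    show "map (map length) ?cs = replicate k (col_heights \<mu>)" using rel(3) map_length_highest by simp
    show "sorted_wrt letter_less C" if "T \<in> set ?cs" "C \<in> set T" for T C
      using F(2) that RC_invariant by (auto simp: in_lists_conv_set)
    fix x
    have "net_count (concat (concat ?cs)) x = net_count (flat ?cs) x"
      by (simp add: net_count_def count_list_flat)
    also have "\<dots> = net_count (stretch k (reading ?K)) x"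
      using net_count_E_word[OF sl rel(2) word_isoD(1)[OF theta_iso(1) rel(4)]] by simp
    also have "\<dots> = int k * net_count (reading ?K) x"
      by (simp add: net_count_def count_list_stretch algebra_simps)
    finally show "net_count (concat (concat ?cs)) x = int k * signed u x"
      using net_count_reading_key[OF u] by simp
  qed
qed

lemma aligned_theta:
  assumes k: "k > 0"
  shows "aligned BC BC (replicate k) (\<lambda>_. k) RC (theta_C n \<mu> k)"
  unfolding aligned_def
proof (intro ballI conjI allI impI)
  fix i T assume i: "i \<in> cr_index BC" and T: "T \<in> RC"
  then have i': "i \<in> {1..n}" by simp
  fix j assume "j \<in> set (replicate k i)"
  then have j: "j = i" by simp
  let ?cs = "theta_C n \<mu> k T"
  have "tensor_eps (word_C n) i (flat ?cs) = k * tensor_eps (word_C n) i (reading T) \<and>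
     tensor_phi (word_C n) i (flat ?cs) = k * tensor_phi (word_C n) i (reading T)"
    by (rule theta_rel_eps_phi[OF k theta_C_facts(1)[OF k T] i'])
  then show "tensor_eps BC j ?cs = k * cr_eps BC i T" "tensor_phi BC j ?cs = k * cr_phi BC i T"
    unfolding j by (simp_all add: flat_tensor_C BC_eps BC_phi)
next
  fix i T T' assume i: "i \<in> cr_index BC" and T: "T \<in> RC" and f: "cr_f BC i T = Some T'"
  show "T' \<in> RC" by (rule reachable_step[OF T i f])
  obtain "is" where is': "set is \<subseteq> {1..n}" "f_path (cr_f BC) is hC = Some T"
    using T by (auto simp: reachable_def)
  then have is2: "set (i # is) \<subseteq> {1..n}" "f_path (cr_f BC) (i # is) hC = Some T'" using i f by auto
  show "f_path (tensor_f BC) (replicate k i) (theta_C n \<mu> k T) = Some (theta_C n \<mu> k T')"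
    using theta_C_path(2)[OF k is'] theta_C_path(2)[OF k is2] by (simp add: f_path_append)
qed

text \<open>Dilating every factor of the dilatation by \<open>M\<close> once more by
  \<open>k\<close> replaces each original step by \<open>k * M\<close> lowerings and starts from the
  same tensor, so it is the dilatation by \<open>k * M\<close>. On keys the second dilatation is
  mere repetition.\<close>

lemma theta_multiple:
  assumes k: "k > 0" and M: "M > 0" and T: "T \<in> RC"
    and keys: "set (theta_C n \<mu> M T) \<subseteq> key_tab \<mu> ` weyl_weights"
  shows "theta_C n \<mu> (k * M) T = stretch k (theta_C n \<mu> M T)"
proof -
  obtain "is" where is': "set is \<subseteq> {1..n}" "f_path (cr_f BC) is hC = Some T"
    using T by (auto simp: reachable_def)
  have al: "aligned (tensor_crystal BC) BC (replicate k) (\<lambda>_. k) (lists RC) (\<lambda>bs. concat (map (theta_C n \<mu> k) bs))"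
    by (rule aligned_tensor[OF aligned_theta[OF k] BC_sem]) (rule virtual_indices_replicate[OF k])
  have st: "concat (map (theta_C n \<mu> k) ks) = stretch k ks" if "set ks \<subseteq> key_tab \<mu> ` weyl_weights" for ks
    unfolding stretch_def using that theta_key[OF k] by (intro arg_cong[of _ _ concat] map_cong) auto
  have h: "set (replicate M hC) \<subseteq> key_tab \<mu> ` weyl_weights" using highest_key by auto
  have "stretch k (replicate M hC) = replicate (k * M) hC"
    unfolding stretch_def by (induction M) (simp_all add: replicate_add)
  moreover have "replicate M hC \<in> lists RC" using reachable_refl[of hC BC] by (auto simp: in_lists_conv_set)
  moreover have "set (concat (map (replicate M) is)) \<subseteq> {1..n}" using is'(1) by auto
  ultimately have "f_path (tensor_f BC) (concat (map (replicate k) (concat (map (replicate M) is)))) (replicate (k * M) hC) =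
      Some (stretch k (theta_C n \<mu> M T))"
    using aligned_path[OF al, of "replicate M hC" "concat (map (replicate M) is)" "theta_C n \<mu> M T"]
      theta_C_path(2)[OF M is'] st[OF h] st[OF keys] by simp
  moreover have "concat (map (replicate k) (concat (map (replicate M) is))) = concat (map (replicate (k * M)) is)"
  proof (induction "is")
    case (Cons i "is")
    have "concat (map (replicate k) (replicate M i)) = replicate (k * M) i"
      by (induction M) (simp_all add: replicate_add)
    then show ?case using Cons by simp
  qed simp
  ultimately show ?thesis using theta_C_path(2)[OF _ is', of "k * M"] k M by simp
qed

lemma tensor_stretch_keys:
  assumes "set ks \<subseteq> key_tab \<mu> ` weyl_weights" "i \<in> {1..n}"
  shows "tensor_eps BC i (stretch k ks) = k * tensor_eps BC i ks \<and>
    tensor_phi BC i (stretch k ks) = k * tensor_phi BC i ks"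
  using assms(1)
proof (induction ks)
  case (Cons x ks)
  then obtain u where u: "u \<in> weyl_weights" "x = key_tab \<mu> u" by auto
  have "tensor_eps BC i (replicate k x) = k * cr_eps BC i x \<and> tensor_phi BC i (replicate k x) = k * cr_phi BC i x"
    using key_tab_string(1)[OF u(1) assms(2)] tensor_replicate_eps_0[of BC i x k] tensor_replicate_phi_0[of BC i x k]
    unfolding u(2) by auto
  then show ?case
    using Cons by (simp add: stretch_def tensor_eps_append tensor_phi_append algebra_simps diff_mult_distrib2)
qed (simp add: stretch_def)

text \<open>In \<open>f\<^sub>i\<^sup>c\<^sup>k\<close> of a tensor of \<open>k\<close>-fold repeated keys, every block of equal keys is hit a multiple of \<open>k\<close>
  times, starting from its left end. As the string length of the key divides \<open>k\<close>, the operators exhaust complete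
  strings, and these end in keys again.\<close>

lemma string_on_keys:
  assumes i: "i \<in> {1..n}" and k: "k > 0"
  shows "set ks \<subseteq> key_tab \<mu> ` weyl_weights \<Longrightarrow> \<forall>x\<in>set ks. 0 < cr_phi BC i x \<longrightarrow> cr_phi BC i x dvd k \<Longrightarrow>
    f_path (tensor_f BC) (replicate (c * k) i) (stretch k ks) = Some ks' \<Longrightarrow>
    set ks' \<subseteq> key_tab \<mu> ` weyl_weights"
proof (induction ks arbitrary: c ks')
  case Nil
  show ?case
  proof (cases "c * k = 0")
    case True
    then show ?thesis using Nil by (simp only: stretch_def) simp
  next
    case False
    have "f_path (tensor_f BC) (replicate (Suc j) i) [] = None" for j
      by (induction j) simp_all
    then show ?thesis using Nil False by (metis list.map(1) concat.simps(1) not0_implies_Suc option.distinct(1) stretch_def)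
  qed
next
  case (Cons x ks)
  let ?Keys = "key_tab \<mu> ` weyl_weights"
  obtain u where u: "u \<in> weyl_weights" "x = key_tab \<mu> u" using Cons.prems(1) by auto
  note str = key_tab_string[OF u(1) i, folded u(2)]
  let ?d = "cr_phi BC i x" let ?v = "stretch k ks" let ?e = "tensor_eps BC i ks"
  have ksK: "set ks \<subseteq> ?Keys" using Cons.prems(1) by simp
  have ev: "tensor_eps BC i ?v = k * ?e" using tensor_stretch_keys[OF ksK i] by simp
  have split: "stretch k (x # ks) = replicate k x @ ?v" by (simp add: stretch_def)
  have J: "set (replicate q i) \<subseteq> cr_index BC" for q using i by auto
  have ind: "indep BC j j'" if "j \<in> set (replicate q i)" "j' \<in> set (replicate q i)" "j \<noteq> j'" for j j' q
    using that by simp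
  note IH = Cons.IH[OF ksK]
  have div: "\<forall>y\<in>set ks. 0 < cr_phi BC i y \<longrightarrow> cr_phi BC i y dvd k" using Cons.prems(2) by simp
  show ?case
  proof (cases "?d \<le> ?e")
    case True
    have "tensor_phi BC i (replicate k x) \<le> k * ?e"
    proof (cases "?d = 0")
      case True
      then show ?thesis using tensor_replicate_phi_0[of BC i x k] by simp
    next
      case False
      then have "cr_eps BC i x = 0" using str(1) by simp
      then show ?thesis using tensor_replicate_eps_0[of BC i x k] \<open>?d \<le> ?e\<close> by simp
    qed
    then have "f_path (tensor_f BC) (replicate (c * k) i) (replicate k x @ ?v) =
        map_option ((@) (replicate k x)) (f_path (tensor_f BC) (replicate (c * k) i) ?v)"
      by (intro f_path_tensor_append(2)[OF BC_sem J ind]) (simp_all add: ev)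
    then obtain v' where v': "f_path (tensor_f BC) (replicate (c * k) i) ?v = Some v'" "ks' = replicate k x @ v'"
      using Cons.prems(3) split by auto
    have "set v' \<subseteq> ?Keys" by (rule IH[OF div v'(1)])
    then show ?thesis using v'(2) Cons.prems(1) by auto
  next
    case False
    then have d: "0 < ?d" by simp
    then have ex: "cr_eps BC i x = 0" using str(1) by simp
    note full = str(2)[OF ex]
    \<comment> \<open>In units of \<open>k\<close>, the block of copies of \<open>x\<close> offers
      \<open>?d\<close> pluses against \<open>?e\<close> minuses from the right, so it takes at most
      \<open>?d - ?e\<close> units of lowerings before the remaining ones pass to the right.\<close>
    define a where "a = min c (?d - ?e)"
    have ad: "a \<le> ?d" "a \<le> c" by (auto simp: a_def)
    \<comment> \<open>Divisibility converts \<open>a\<close> units of \<open>k\<close> lowerings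
      into \<open>a * r\<close> complete strings of length \<open>?d\<close>.\<close>
    obtain r where r: "k = ?d * r" using Cons.prems(2) d by auto
    let ?x' = "key_tab \<mu> (s_C n i u)" let ?q = "a * r"
    have q: "?q \<le> k" using ad r by simp
    have aq: "?d * ?q = a * k" using r by simp
    let ?u' = "replicate ?q ?x' @ replicate (k - ?q) x"
    have fu: "f_path (tensor_f BC) (replicate (a * k) i) (replicate k x) = Some ?u'"
      using full_string_replicate[OF BC_sem _ ex full q] i aq by simp
    have phiu: "tensor_phi BC i (replicate k x) = k * ?d" using tensor_replicate_eps_0[of BC i x k] ex by simp
    have "k * ?e + a * k \<le> k * ?d"
    proof -
      have "?e + a \<le> ?d" using False by (simp add: a_def)
      then have "k * (?e + a) \<le> k * ?d" by (rule mult_le_mono2)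
      then show ?thesis by (simp add: algebra_simps)
    qed
    then have "f_path (tensor_f BC) (replicate (a * k) i) (replicate k x @ ?v) =
        map_option (\<lambda>w. w @ ?v) (f_path (tensor_f BC) (replicate (a * k) i) (replicate k x))"
      by (intro f_path_tensor_append(1)[OF BC_sem J ind]) (auto simp: ev phiu count_list_replicate)
    then have first: "f_path (tensor_f BC) (replicate (a * k) i) (stretch k (x # ks)) = Some (?u' @ ?v)"
      using fu split by simp
    have "replicate (c * k) i = replicate ((c - a) * k) i @ replicate (a * k) i"
      using ad(2) by (simp add: diff_mult_distrib flip: replicate_add)
    then have rest: "f_path (tensor_f BC) (replicate ((c - a) * k) i) (?u' @ ?v) = Some ks'"
      using Cons.prems(3) first by (simp add: f_path_append)
    have x'K: "?x' \<in> ?Keys" using weyl_weights_step[OF u(1) i] by simp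
    have u'K: "set ?u' \<subseteq> ?Keys" using x'K Cons.prems(1) by auto
    show ?thesis
    proof (cases "c - a = 0")
      case True
      then have "ks' = ?u' @ ?v" using rest by simp
      moreover have "set ?v \<subseteq> ?Keys" using ksK set_stretch[of k ks] by blast
      ultimately show ?thesis using u'K by simp
    next
      case F: False
      then have a: "a = ?d - ?e" by (auto simp: a_def)
      have "tensor_phi BC i ?u' \<le> k * ?e"
      proof (cases "a * k = 0")
        case True
        then show ?thesis using a False k by simp
      next
        case nz: False
        have sub: "set (replicate (a * k) i) \<subseteq> cr_index (tensor_crystal BC)" using i by auto
        have "tensor_phi BC i (replicate k x) = tensor_phi BC i ?u' + a * k"
          using f_path_eps_phi[OF seminormal_tensor[OF BC_sem] sub _ , of "replicate k x" ?u' i] fu nz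
          by (simp add: count_list_replicate)
        then show ?thesis using phiu a by (simp add: algebra_simps diff_mult_distrib2)
      qed
      then have "f_path (tensor_f BC) (replicate ((c - a) * k) i) (?u' @ ?v) =
          map_option ((@) ?u') (f_path (tensor_f BC) (replicate ((c - a) * k) i) ?v)"
        by (intro f_path_tensor_append(2)[OF BC_sem J ind]) (simp_all add: ev)
      then obtain v' where v': "f_path (tensor_f BC) (replicate ((c - a) * k) i) ?v = Some v'" "ks' = ?u' @ v'"
        using rest by auto
      have "set v' \<subseteq> ?Keys" by (rule IH[OF div v'(1)])
      then show ?thesis using v'(2) u'K by simp
    qed
  qed
qed

lemma theta_keys_exist:
  assumes "T \<in> RC"
  shows "\<exists>M>0. set (theta_C n \<mu> M T) \<subseteq> key_tab \<mu> ` weyl_weights"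
proof -
  let ?Keys = "key_tab \<mu> ` weyl_weights"
  obtain "is" where "set is \<subseteq> {1..n}" "f_path (cr_f BC) is hC = Some T"
    using assms by (auto simp: reachable_def)
  then show ?thesis
  proof (induction "is" arbitrary: T)
    case Nil
    have "theta_C n \<mu> 1 T = [key_tab \<mu> \<mu>]"
      using theta_key[OF _ highest_key(1), of 1] highest_key(2) Nil by simp
    then have "set (theta_C n \<mu> 1 T) \<subseteq> ?Keys" using highest_key(1) by simp
    then show ?case by (intro exI[of _ 1]) simp
  next
    case (Cons i "is")
    then obtain T1 where T1: "f_path (cr_f BC) is hC = Some T1" "cr_f BC i T1 = Some T"
      by (auto simp: bind_eq_Some_conv)
    have i: "i \<in> {1..n}" and is': "set is \<subseteq> {1..n}" using Cons.prems by auto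
    have T1R: "T1 \<in> RC" using T1(1) is' by (auto simp: reachable_def)
    obtain M where M: "M > 0" "set (theta_C n \<mu> M T1) \<subseteq> ?Keys" using Cons.IH[OF is' T1(1)] by blast
    let ?ks = "theta_C n \<mu> M T1"
    \<comment> \<open>Each step of the path enlarges the dilatation by the string lengths of the
      current keys; a zero length is replaced by 1 to keep the product positive.\<close>
    define k where "k = (\<Prod>x\<in>set ?ks. if cr_phi BC i x = 0 then 1 else cr_phi BC i x)"
    have k: "k > 0" unfolding k_def by (rule prod_pos) auto
    have div: "\<forall>x\<in>set ?ks. 0 < cr_phi BC i x \<longrightarrow> cr_phi BC i x dvd k"
    proof (intro ballI impI)
      fix x assume x: "x \<in> set ?ks" "0 < cr_phi BC i x"
      have "(if cr_phi BC i x = 0 then 1 else cr_phi BC i x) dvd k"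
        unfolding k_def by (rule dvd_prodI) (use x in auto)
      then show "cr_phi BC i x dvd k" using x by simp
    qed
    have kM: "k * M > 0" using k M by simp
    have "f_path (tensor_f BC) (replicate (k * M) i) (theta_C n \<mu> (k * M) T1) = Some (theta_C n \<mu> (k * M) T)"
      using alignedD(4)[OF aligned_theta[OF kM] _ T1R T1(2)] i by simp
    then have "f_path (tensor_f BC) (replicate (M * k) i) (stretch k ?ks) = Some (theta_C n \<mu> (k * M) T)"
      unfolding theta_multiple[OF k M(1) T1R M(2)] by (simp add: mult.commute)
    from string_on_keys[OF i k M(2) div this] show ?case using kM by blast
  qed
qed

section \<open>Images of key tableaux\<close>

lemma lift_hat:
  assumes "y \<in> letters_C n"
  shows "\<mu>A (nat (hat n y)) = \<mu> 1 + signed \<mu> y"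
proof (cases y rule: int_cases_abs)
  case (1 k)
  then have k: "1 \<le> k" "k \<le> n" using assms by (auto simp: letters_C_def)
  then show ?thesis unfolding 1 hat_pos[OF k(1)] signed_int using lift_A_eq(1)[OF part, of k] by simp
next
  case (2 k)
  then have k: "1 \<le> k" "k \<le> n" using assms by (auto simp: letters_C_def)
  have "2 * n + 1 - k \<in> {n + 1..2 * n}" "2 * n + 1 - (2 * n + 1 - k) = k" using k by auto
  then show ?thesis
    unfolding 2(1) hat_neg[OF k] signed_neg[OF 2(2)] using lift_A_eq(2)[OF part, of "2 * n + 1 - k"] by simp
qed

text \<open>The relation defining the embedding preserves content, so the weight of the image can be
  computed: it is the lifted weight moved by the same signed permutation. This weight is extremal
  and leaves only one tableau with strict columns.\<close>

lemma baker_key: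
  assumes is': "set is \<subseteq> {1..n}"
  defines "u \<equiv> word_prod (s_C n) is \<mu>" and "w \<equiv> word_prod (s_tilde n) is \<mu>A"
  shows "baker n \<mu> (key_tab \<mu> u) = key_tab \<mu>A w"
    and "key_A (2 * n) \<mu>A w = key_tab \<mu>A w" "key_tab \<mu>A w \<in> keys_A (2 * n) \<mu>A"
proof -
  have u: "u \<in> weyl_weights" unfolding u_def weyl_weights_def using is' by blast
  obtain js where js: "set js \<subseteq> {1..2 * n - 1}" "word_prod (s_tilde n) is = word_prod s_A js"
    using word_prod_tilde_A[OF is'] by blast
  have rw: "rearranges (2 * n) \<mu>A w" "0 \<le> w k" for k
    using rearranges_word_A[OF partA js(1)] unfolding w_def js(2) by auto
  show keyA: "key_A (2 * n) \<mu>A w = key_tab \<mu>A w" by (rule key_A_eq[OF partA rw])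
  have "word_prod s_A js \<in> weyl_A (2 * n)" unfolding weyl_A_def gen_group_def using js(1) by blast
  then show "key_tab \<mu>A w \<in> keys_A (2 * n) \<mu>A"
    unfolding keys_A_def keyA[symmetric] unfolding w_def js(2) by blast
  let ?K = "key_tab \<mu> u" let ?T = "baker n \<mu> ?K"
  have K: "?K \<in> RC" by (rule key_tab_reachable[OF u])
  obtain ls where ls: "set ls \<subseteq> {1..n}" "f_path (cr_f BC) ls hC = Some ?K" using K by (auto simp: reachable_def)
  have "f_path (cr_f BA) (concat (map (E_index n) ls)) hA = Some ?T"
    using baker_path(2)[OF ls] by (simp add: f_path_concat f_E_path[abs_def])
  moreover have "set (concat (map (E_index n) ls)) \<subseteq> {1..2 * n - 1}"
    using subsetD[OF ls(1)] subsetD[OF E_index_range] unfolding set_concat set_map by blast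
  ultimately have inv: "map length ?T = col_heights \<mu>A" "\<And>C. C \<in> set ?T \<Longrightarrow> sorted_wrt (<) C"
    using BA_path_invariant by blast+
  have rel: "set (reading ?K) \<subseteq> letters_C n"
    "(E_word n (reading ?K) @ pad (2 * n) (nat (\<mu> 1)), reading ?T @ pad (2 * n) (length (reading hC))) \<in> baker_iso"
    using baker_reachable[OF K] by (auto simp: baker_rel_def)
  have cnt: "count_list (E_word n (reading ?K)) y + count_list (pad (2 * n) (nat (\<mu> 1))) y =
      count_list (reading ?T) y + count_list (pad (2 * n) (length (reading hC))) y" for y
    using fun_cong[OF word_isoD(1)[OF baker_iso(1) rel(2)], of y] by simp
  have lenK: "length (reading ?K) = length (reading hC)"
    using map_length_key_tab[OF part weyl_weights_rearranges[OF u]] map_length_highest[of \<mu>]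
    by (simp add: length_reading)
  have out: "count_list (reading ?T) y = 0" if "y \<notin> {1..2 * int n}" for y
  proof -
    have "y \<notin> set (E_word n (reading ?K))" using E_word_range[OF rel(1)] that by blast
    then have "count_list (E_word n (reading ?K)) y = 0" by (simp add: count_list_0_iff)
    then show ?thesis using cnt[of y] that by (simp add: count_list_pad split: if_splits)
  qed
  \<comment> \<open>The two paddings shift the contents by \<open>\<mu> 1\<close> and by the length
    of the reading; the length also appears in \<open>count_E_word\<close> and cancels.\<close>
  have inside: "int (count_list (reading ?T) (int k)) = w k" if "k \<in> {1..2 * n}" for k
  proof -
    have ik: "int k \<in> {1..2 * int n}" using that by auto
    then obtain x where x: "x \<in> letters_C n" "int k = hat n x" by (rule hat_surj)
    have kx: "k = nat (hat n x)" using x(2) by simp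
    have "w k = \<mu> 1 + signed \<mu> (signed_perm n is x)"
      unfolding w_def kx word_prod_tilde(1)[OF is' x(1)] by (rule lift_hat[OF signed_perm_letters[OF is' x(1)]])
    also have "\<dots> = \<mu> 1 + signed u x" unfolding u_def signed_word_prod[OF is'] ..
    also have "\<dots> = \<mu> 1 + net_count (reading ?K) x" using net_count_reading_key[OF u] by simp
    finally show ?thesis
      using cnt[of "int k"] count_E_word[OF rel(1) x(1)] lenK ik partition_nonneg[OF part, of 1]
      unfolding x(2)[symmetric] by (simp add: count_list_pad net_count_def)
  qed
  have pos: "y \<in> {1..2 * int n}" if "y \<in> set (concat ?T)" for y
    using out[of y] that by (auto simp: count_list_0_iff reading_def)
  show "?T = key_tab \<mu>A w"
  proof (rule extremal_tableau[OF partA rw(1) inv(1)])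
    show "sorted_wrt letter_less C" if C: "C \<in> set ?T" for C
    proof -
      have "set C \<subseteq> {1..}" using pos C by force
      then show ?thesis using inv(2)[OF C] by (simp add: sorted_positive)
    qed
    fix x
    show "net_count (concat ?T) x = signed w x"
    proof (rule net_count_determined[of _ "2 * n"])
      show "set (concat ?T) \<subseteq> letters_C (2 * n)" using pos by (force simp: letters_C_def)
      show "w i = 0" if "i \<notin> {1..2 * n}" for i using rw(1) that unfolding rearranges_def by blast
      show "net_count (concat ?T) (int i) = w i" if "i \<in> {1..2 * n}" for i
        using inside[OF that] out[of "- int i"] by (simp add: net_count_def count_list_reading)
    qed
  qed
qed

lemma baker_key_weyl:
  assumes \<sigma>: "\<sigma> \<in> weyl_C n"
  shows "baker n \<mu> (key_C n \<mu> (\<sigma> \<mu>)) = key_A (2 * n) \<mu>A (tilde n \<sigma> \<mu>A)"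
    and "baker n \<mu> (key_C n \<mu> (\<sigma> \<mu>)) \<in> orbit_CA n \<mu>"
proof -
  obtain "is" where is': "set is \<subseteq> {1..n}" "\<sigma> = word_prod (s_C n) is"
    using \<sigma> by (auto simp: weyl_C_def gen_group_def)
  have t: "tilde n \<sigma> = word_prod (s_tilde n) is" using tilde_word_prod is' by simp
  have "key_C n \<mu> (\<sigma> \<mu>) = key_tab \<mu> (\<sigma> \<mu>)"
    using key_C_eq(2)[OF part rearranges_word_C[OF part is'(1)]] is'(2) by simp
  then show 1: "baker n \<mu> (key_C n \<mu> (\<sigma> \<mu>)) = key_A (2 * n) \<mu>A (tilde n \<sigma> \<mu>A)"
    using baker_key[OF is'(1)] t is'(2) by simp
  have "tilde n \<sigma> \<in> weyl_CA n" unfolding t weyl_CA_def gen_group_def using is'(1) by blast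
  then show "baker n \<mu> (key_C n \<mu> (\<sigma> \<mu>)) \<in> orbit_CA n \<mu>"
    unfolding 1 orbit_CA_def by blast
qed

lemma baker_keys: "baker n \<mu> ` (key_tab \<mu> ` weyl_weights) \<subseteq> keys_A (2 * n) \<mu>A"
proof (intro subsetI)
  fix T assume "T \<in> baker n \<mu> ` (key_tab \<mu> ` weyl_weights)"
  then obtain "is" where "set is \<subseteq> {1..n}" "T = baker n \<mu> (key_tab \<mu> (word_prod (s_C n) is \<mu>))"
    by (auto simp: weyl_weights_def)
  then show "T \<in> keys_A (2 * n) \<mu>A" using baker_key(1,3) by simp
qed

lemma dilates_to_baker:
  assumes m: "m > 0" and T: "T \<in> KN n \<mu>" and d: "dilates_to n \<mu> m T \<sigma>s"
  shows "theta_A (2 * n) \<mu>A m (baker n \<mu> T) = baker_tensor n \<mu> m (theta_C n \<mu> m T)"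
    and "baker_tensor n \<mu> m (theta_C n \<mu> m T) = map (\<lambda>\<sigma>. baker n \<mu> (key_C n \<mu> (\<sigma> \<mu>))) \<sigma>s"
    and "\<sigma> \<in> set \<sigma>s \<Longrightarrow> baker n \<mu> (key_C n \<mu> (\<sigma> \<mu>)) = key_A (2 * n) \<mu>A (tilde n \<sigma> \<mu>A)"
    and "\<sigma> \<in> set \<sigma>s \<Longrightarrow> baker n \<mu> (key_C n \<mu> (\<sigma> \<mu>)) \<in> orbit_CA n \<mu>"
proof -
  note tb = theta_A_baker[OF m KN_reachable[OF T]]
  show "theta_A (2 * n) \<mu>A m (baker n \<mu> T) = baker_tensor n \<mu> m (theta_C n \<mu> m T)" using tb by simp
  show "baker_tensor n \<mu> m (theta_C n \<mu> m T) = map (\<lambda>\<sigma>. baker n \<mu> (key_C n \<mu> (\<sigma> \<mu>))) \<sigma>s"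
    using tb(2) d by (simp add: dilates_to_def)
  assume "\<sigma> \<in> set \<sigma>s"
  then have "\<sigma> \<in> weyl_C n" using d by (auto simp: dilates_to_def min_reps_def)
  then show "baker n \<mu> (key_C n \<mu> (\<sigma> \<mu>)) = key_A (2 * n) \<mu>A (tilde n \<sigma> \<mu>A)"
    "baker n \<mu> (key_C n \<mu> (\<sigma> \<mu>)) \<in> orbit_CA n \<mu>" by (rule baker_key_weyl)+
qed

section \<open>Right and left keys\<close>

lemma key_eqI:
  assumes "M > 0" "\<And>m. m > 0 \<Longrightarrow> M dvd m \<Longrightarrow> length (\<theta> m b) = m \<and> set (\<theta> m b) \<subseteq> keys \<and> g (\<theta> m b) = k"
  shows "(THE k. \<exists>M>0. \<forall>m>0. M dvd m \<longrightarrow> length (\<theta> m b) = m \<and> set (\<theta> m b) \<subseteq> keys \<and> g (\<theta> m b) = k) = k"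
proof (rule the_equality)
  show "\<exists>M>0. \<forall>m>0. M dvd m \<longrightarrow> length (\<theta> m b) = m \<and> set (\<theta> m b) \<subseteq> keys \<and> g (\<theta> m b) = k"
    using assms by blast
  fix k' assume "\<exists>M>0. \<forall>m>0. M dvd m \<longrightarrow> length (\<theta> m b) = m \<and> set (\<theta> m b) \<subseteq> keys \<and> g (\<theta> m b) = k'"
  then obtain M' where M': "M' > 0" "\<And>m. m > 0 \<Longrightarrow> M' dvd m \<Longrightarrow> g (\<theta> m b) = k'" by blast
  \<comment> \<open>Two candidates with different thresholds are compared at the common multiple
    \<open>M * M'\<close>.\<close>
  have "g (\<theta> (M * M') b) = k'" "g (\<theta> (M * M') b) = k"
    using M'(2)[of "M * M'"] assms(2)[of "M * M'"] M'(1) assms(1) by auto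
  then show "k' = k" by simp
qed

text \<open>At all multiples of a suitable \<open>M\<close> the type C dilatation is a stretched
  list of keys with constant ends. The type A dilatation of the image is its factorwise image, so
  the same \<open>M\<close> serves in both types.\<close>

lemma keys_baker:
  assumes T: "T \<in> KN n \<mu>"
  shows "baker n \<mu> (right_key_C n \<mu> T) = right_key_A (2 * n) \<mu>A (baker n \<mu> T)"
    and "baker n \<mu> (left_key_C n \<mu> T) = left_key_A (2 * n) \<mu>A (baker n \<mu> T)"
proof -
  have TR: "T \<in> RC" by (rule KN_reachable[OF T])
  obtain M where M: "M > 0" "set (theta_C n \<mu> M T) \<subseteq> key_tab \<mu> ` weyl_weights"
    using theta_keys_exist[OF TR] by blast
  let ?ks = "theta_C n \<mu> M T"
  have ne: "?ks \<noteq> []" using theta_C_facts(3)[OF M(1) TR] M(1) by auto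
  have stretch_ends: "stretch k ks \<noteq> [] \<and> hd (stretch k ks) = hd ks \<and> last (stretch k ks) = last ks"
    if "k > 0" "ks \<noteq> []" for k and ks :: "tableau list"
    using that(2)
  proof (induction ks)
    case (Cons x ks)
    have "replicate k x \<noteq> []" "hd (replicate k x) = x" "last (replicate k x) = x"
      using that(1) by (auto simp: hd_replicate last_replicate)
    then show ?case using Cons by (cases "ks = []") (auto simp: stretch_def)
  qed simp
  have C: "length (theta_C n \<mu> m T) = m \<and> set (theta_C n \<mu> m T) \<subseteq> keys_C n \<mu> \<and>
      theta_C n \<mu> m T \<noteq> [] \<and> hd (theta_C n \<mu> m T) = hd ?ks \<and> last (theta_C n \<mu> m T) = last ?ks"
    if m: "m > 0" "M dvd m" for m
  proof -
    obtain k where k: "m = k * M" using m(2) by (metis dvd_def mult.commute)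
    then have "k > 0" using m(1) by simp
    then have "theta_C n \<mu> m T = stretch k ?ks" unfolding k by (rule theta_multiple[OF _ M(1) TR M(2)])
    then show ?thesis
      using theta_C_facts(3)[OF m(1) TR] stretch_ends[OF \<open>k > 0\<close> ne] set_stretch[of k ?ks] M(2) keys_C_eq by auto
  qed
  have A: "length (theta_A (2 * n) \<mu>A m (baker n \<mu> T)) = m \<and>
      set (theta_A (2 * n) \<mu>A m (baker n \<mu> T)) \<subseteq> keys_A (2 * n) \<mu>A \<and>
      hd (theta_A (2 * n) \<mu>A m (baker n \<mu> T)) = baker n \<mu> (hd ?ks) \<and>
      last (theta_A (2 * n) \<mu>A m (baker n \<mu> T)) = baker n \<mu> (last ?ks)"
    if m: "m > 0" "M dvd m" for m
  proof -
    note Cm = C[OF m]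
    have "set (map (baker n \<mu>) (theta_C n \<mu> m T)) \<subseteq> baker n \<mu> ` (key_tab \<mu> ` weyl_weights)"
      using Cm keys_C_eq unfolding set_map by (intro image_mono) simp
    then have "set (map (baker n \<mu>) (theta_C n \<mu> m T)) \<subseteq> keys_A (2 * n) \<mu>A"
      using baker_keys by (rule subset_trans)
    then show ?thesis unfolding theta_A_baker(1)[OF m(1) TR] using Cm by (simp add: hd_map last_map)
  qed
  have "right_key_C n \<mu> T = hd ?ks" "left_key_C n \<mu> T = last ?ks"
    unfolding right_key_C_def right_key_def left_key_C_def left_key_def
    by (rule key_eqI[OF M(1)], use C in blast)+
  moreover have "right_key_A (2 * n) \<mu>A (baker n \<mu> T) = baker n \<mu> (hd ?ks)"
    "left_key_A (2 * n) \<mu>A (baker n \<mu> T) = baker n \<mu> (last ?ks)"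
    unfolding right_key_A_def right_key_def left_key_A_def left_key_def
    by (rule key_eqI[OF M(1)], use A in blast)+
  ultimately show "baker n \<mu> (right_key_C n \<mu> T) = right_key_A (2 * n) \<mu>A (baker n \<mu> T)"
    "baker n \<mu> (left_key_C n \<mu> T) = left_key_A (2 * n) \<mu>A (baker n \<mu> T)" by simp_all
qed

end

theorem theorem7p10:
  fixes n :: nat and \<mu> :: weight
  assumes "1 \<le> n" and "is_partition n \<mu>"
  shows
    "(\<forall>m > 0. (\<forall>T \<in> KN n \<mu>. \<exists>\<sigma>s. dilates_to n \<mu> m T \<sigma>s) \<longrightarrow>
        (\<forall>T \<in> KN n \<mu>. \<forall>\<sigma>s. dilates_to n \<mu> m T \<sigma>s \<longrightarrow>
           theta_A (2 * n) (lift_A n \<mu>) m (baker n \<mu> T) = baker_tensor n \<mu> m (theta_C n \<mu> m T) \<and>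
           baker_tensor n \<mu> m (theta_C n \<mu> m T)
             = map (\<lambda>\<sigma>. baker n \<mu> (key_C n \<mu> (\<sigma> \<mu>))) \<sigma>s \<and>
           map (\<lambda>\<sigma>. baker n \<mu> (key_C n \<mu> (\<sigma> \<mu>))) \<sigma>s
             = map (\<lambda>\<sigma>. key_A (2 * n) (lift_A n \<mu>) (tilde n \<sigma> (lift_A n \<mu>))) \<sigma>s \<and>
           (\<forall>\<sigma> \<in> set \<sigma>s.
              baker n \<mu> (key_C n \<mu> (\<sigma> \<mu>)) = key_A (2 * n) (lift_A n \<mu>) (tilde n \<sigma> (lift_A n \<mu>)) \<and>
              baker n \<mu> (key_C n \<mu> (\<sigma> \<mu>)) \<in> orbit_CA n \<mu>)))
     \<and>
     (\<forall>T \<in> KN n \<mu>.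
        baker n \<mu> (right_key_C n \<mu> T) = right_key_A (2 * n) (lift_A n \<mu>) (baker n \<mu> T) \<and>
        baker n \<mu> (left_key_C n \<mu> T) = left_key_A (2 * n) (lift_A n \<mu>) (baker n \<mu> T))"
proof -
  interpret baker_setup n \<mu> by unfold_locales (use assms in auto)
  show ?thesis
    using dilates_to_baker keys_baker by (intro conjI allI impI ballI map_cong refl)
qed

end
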